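(* Let $N\ge2$ and let $\{X_t\}_{t\ge0}$ be a Markov jump process with finite state space $\mathbb X=\{1,\dots,N\}$ and generator $G$. Assume that $G$ and all the sub-generators $G_{i^ci^c}:=(G(k,\ell))_{k,\ell\in\mathbb X\setminus\{i\}}$, $i=1,\dots,N$, are irreducible. Let $\pi$ be the invariant probability measure of $\{X_t\}$, let $L_t=(L_t(1),\dots,L_t(N))$ with $L_t(i)=\int_0^t1_{\{X_s=i\}}ds$, let $m=\mathbb E_\pi[L_1]$, $Y_t=L_t-tm$ and $Y'_t=(Y_t(1),\dots,Y_t(N-1))\in\mathbb R^{N-1}$. Then the MAP $\{(X_t,Y'_t)\}_{t\ge0}$ satisfies the following three properties, with $d:=N-1$: (i) $\max_{k\in\mathbb X}\sup_{v\in(0,1]}\mathbb E_k[\|Y'_v\|^3]<\infty$. (ii) There exist $c>0$ and $\rho\in(0,1)$ such that $\|\mathcal M_t(1_{\mathbb R^d})\|_0\le c\rho^t$ for all $t>0$, and there exists $t_0>0$ such that $\rho^{t_0}\max(2,cN)\le1/4$ and $\sup_{w\in[t_0,2t_0)}\|\widehat{\mathbf G}_w(\zeta)\|_0\to0$ when $\|\zeta\|\to+\infty$. (iii) For every $t>0$ there exists an open convex subset $\mathcal D_t$ of $\mathbb R^{d}$, with closure $\overline{\mathcal D}_t$ and $\partial\mathcal D_t:=\overline{\mathcal D}_t\setminus\mathcal D_t$, such that $\mathbf G_t$ vanishes on $\mathbb R^d\setminus\overline{\mathcal D}_t$, is continuous on $\overline{\mathcal D}_t$ and differentiable on $\mathcal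 D_t$, with $$\sup_{t>0}\sup_{y\in\overline{\mathcal D}_t}\|\mathbf G_t(y)\|_0<\infty,\qquad\sup_{y\in\partial\mathcal D_t}\|\mathbf G_t(y)\|_0=O\big(t^{-(d+1)/2}\big)\ (t\to+\infty),\qquad\sup_{t>0}\sup_{y\in\mathcal D_t}\Big\|\frac{\partial\mathbf G_t}{\partial y_j}(y)\Big\|_0<\infty\ (j=1,\dots,d).$$
   Context: $\mathbb P_k,\mathbb E_k$ denote probability and expectation given $X_0=k$; $\mathbb E_\pi=\sum_k\pi(k)\mathbb E_k$. The transition semigroup of $\{X_t\}$ is $P_t=e^{tG}$. A square matrix is irreducible if the directed graph of its nonzero off-diagonal entries is strongly connected ($1\times1$ matrices are irreducible). For $(k,\ell)\in\mathbb X^2$ and $t>0$, the measure $B\mapsto\mathbb P_k\{X_t=\ell,Y'_t\in B\}$ on $\mathbb R^{N-1}$ has Lebesgue decomposition $\int_Bg_{k,\ell,t}(y)\,dy+\mu_{k,\ell,t}(B)$ with $\mu_{k,\ell,t}$ singular with respect to Lebesgue measure. Set $\mathbf G_t(y)=(g_{k,\ell,t}(y))_{(k,\ell)\in\mathbb X^2}$ (densities are defined up to null sets; the properties are those of a suitable version), $\mathcal M_t(1_B)=(\mu_{k,\ell,t}(B))_{(k,\ell)\in\mathbb X^2}$, and $\widehat{\mathbf G}_t(\zeta)=\int_{\mathbb R^{N-1}}e^{i\langle\zeta,y\rangle}\mathbf G_t(y)\,dy$ (entrywise). For a matrix $A$, $\|A\|_0=\max_{k,\ell}|A_{k,\ell}|$.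 A Markov additive process (MAP) with state space $\mathbb X\times\mathbb R^{d}$ is a Markov process $\{(X_t,Y_t)\}$ whose transition semigroup satisfies $Q_t(k,y;\{\ell\}\times B)=Q_t(k,0;\{\ell\}\times(B-y))$. *)

theory Defs
  imports
    "HOL-Probability.Probability"
    "HOL-Library.Landau_Symbols"
    "Graph_Theory.Digraph_Component"
begin

section \<open>Matrices indexed by the states 1, ..., N\<close>

text \<open>A square matrix indexed by a finite set \<open>S\<close> of naturals is a function \<open>nat \<Rightarrow> nat \<Rightarrow> 'a\<close>
  of which only the entries in \<open>S \<times> S\<close> matter.\<close>

text \<open>\<open>with_proj\<close> turns the vertex set and the set of ordered pairs into a digraph whose arcs are
  the pairs themselves.\<close>

definition irreducible_matrix_on :: "nat set \<Rightarrow> (nat \<Rightarrow> nat \<Rightarrow> real) \<Rightarrow> bool" where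
  "irreducible_matrix_on S A \<longleftrightarrow>
     strongly_connected (with_proj
       \<lparr>pverts = S, parcs = {(k, l). k \<in> S \<and> l \<in> S \<and> k \<noteq> l \<and> A k l \<noteq> 0}\<rparr>)"

fun matrix_power :: "nat \<Rightarrow> (nat \<Rightarrow> nat \<Rightarrow> real) \<Rightarrow> nat \<Rightarrow> nat \<Rightarrow> nat \<Rightarrow> real" where
  "matrix_power N A 0 = (\<lambda>k l. if k = l then 1 else 0)"
| "matrix_power N A (Suc n) = (\<lambda>k l. \<Sum>j=1..N. matrix_power N A n k j * A j l)"

definition matrix_exp :: "nat \<Rightarrow> (nat \<Rightarrow> nat \<Rightarrow> real) \<Rightarrow> real \<Rightarrow> nat \<Rightarrow> nat \<Rightarrow> real" where
  "matrix_exp N A t k l = (\<Sum>n. t ^ n / fact n * matrix_power N A n k l)"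

definition norm0 :: "nat \<Rightarrow> (nat \<Rightarrow> nat \<Rightarrow> 'a::real_normed_vector) \<Rightarrow> real" where
  "norm0 N A = Max ((\<lambda>(k, l). norm (A k l)) ` ({1..N} \<times> {1..N}))"


section \<open>Markov processes\<close>

definition natural_filtration ::
    "'w measure \<Rightarrow> 's measure \<Rightarrow> (real \<Rightarrow> 'w \<Rightarrow> 's) \<Rightarrow> real \<Rightarrow> 'w measure" where
  "natural_filtration M S Z s =
     sigma (space M) {Z u -` A \<inter> space M | u A. 0 \<le> u \<and> u \<le> s \<and> A \<in> sets S}"

definition markov_process ::
    "'s measure \<Rightarrow> (real \<Rightarrow> 's \<Rightarrow> 's measure) \<Rightarrow> 'w measure \<Rightarrow> (real \<Rightarrow> 'w \<Rightarrow> 's) \<Rightarrow> bool" where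
  "markov_process S Q M Z \<longleftrightarrow>
     prob_space M \<and>
     (\<forall>t\<ge>0. Z t \<in> M \<rightarrow>\<^sub>M S) \<and>
     (\<forall>s\<ge>0. \<forall>t\<ge>0. \<forall>A\<in>sets S. AE \<omega> in M.
        real_cond_exp M (natural_filtration M S Z s) (indicator (Z (s + t) -` A \<inter> space M)) \<omega>
          = measure (Q t (Z s \<omega>)) A)"

definition transition_semigroup :: "'s measure \<Rightarrow> (real \<Rightarrow> 's \<Rightarrow> 's measure) \<Rightarrow> bool" where
  "transition_semigroup S Q \<longleftrightarrow>
     (\<forall>t\<ge>0. Q t \<in> S \<rightarrow>\<^sub>M prob_algebra S) \<and>
     (\<forall>x\<in>space S. Q 0 x = return S x) \<and>
     (\<forall>s\<ge>0. \<forall>t\<ge>0. \<forall>x\<in>space S. Q (s + t) x = Q s x \<bind> Q t)"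

definition is_generator :: "nat \<Rightarrow> (nat \<Rightarrow> nat \<Rightarrow> real) \<Rightarrow> bool" where
  "is_generator N G \<longleftrightarrow>
     (\<forall>k\<in>{1..N}. \<forall>l\<in>{1..N}. k \<noteq> l \<longrightarrow> 0 \<le> G k l) \<and>
     (\<forall>k\<in>{1..N}. (\<Sum>l=1..N. G k l) = 0)"

text \<open>\<open>M k\<close> is the law \<open>\<P>\<^sub>k\<close> of the process started from \<open>k\<close>; all the \<open>M k\<close> live on one
  measurable space. The last clause says that the paths are right-continuous step functions with
  left limits for the discrete topology, that is, with finitely many jumps in bounded intervals.\<close>

definition markov_jump_process ::
    "nat \<Rightarrow> (nat \<Rightarrow> nat \<Rightarrow> real) \<Rightarrow> (nat \<Rightarrow> 'w measure) \<Rightarrow> (real \<Rightarrow> 'w \<Rightarrow> nat) \<Rightarrow> bool" where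
  "markov_jump_process N G M X \<longleftrightarrow>
     is_generator N G \<and>
     (\<forall>k\<in>{1..N}. \<forall>l\<in>{1..N}. sets (M k) = sets (M l)) \<and>
     (\<forall>k\<in>{1..N}.
        markov_process (count_space {1..N})
          (\<lambda>t i. point_measure {1..N} (\<lambda>l. ennreal (matrix_exp N G t i l))) (M k) X \<and>
        (AE \<omega> in M k. X 0 \<omega> = k) \<and>
        (\<forall>\<omega>\<in>space (M k).
           (\<forall>t\<ge>0. eventually (\<lambda>s. X s \<omega> = X t \<omega>) (at_right t)) \<and>
           (\<forall>t>0. \<exists>i. eventually (\<lambda>s. X s \<omega> = i) (at_left t))))"

definition invariant_probability :: "nat \<Rightarrow> (nat \<Rightarrow> nat \<Rightarrow> real) \<Rightarrow> (nat \<Rightarrow> real) \<Rightarrow> bool" where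
  "invariant_probability N G \<pi> \<longleftrightarrow>
     (\<forall>k\<in>{1..N}. 0 \<le> \<pi> k) \<and> (\<Sum>k=1..N. \<pi> k) = 1 \<and>
     (\<forall>t\<ge>0. \<forall>l\<in>{1..N}. (\<Sum>k=1..N. \<pi> k * matrix_exp N G t k l) = \<pi> l)"

text \<open>Markov additive process with state space \<open>{1..N} \<times> 'e\<close>, under each of the laws \<open>M k\<close>.
  The set \<open>B - y\<close> is the image of \<open>B\<close> under \<open>b \<mapsto> b - y\<close>.\<close>

definition markov_additive_process ::
    "nat \<Rightarrow> (nat \<Rightarrow> 'w measure) \<Rightarrow> (real \<Rightarrow> 'w \<Rightarrow> nat) \<Rightarrow> (real \<Rightarrow> 'w \<Rightarrow> 'e::euclidean_space) \<Rightarrow> bool"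
where
  "markov_additive_process N M X Y \<longleftrightarrow>
     (\<exists>Q. transition_semigroup (count_space {1..N} \<Otimes>\<^sub>M borel) Q \<and>
        (\<forall>k\<in>{1..N}. markov_process (count_space {1..N} \<Otimes>\<^sub>M borel) Q (M k)
           (\<lambda>t \<omega>. (X t \<omega>, Y t \<omega>))) \<and>
        (\<forall>t\<ge>0. \<forall>k\<in>{1..N}. \<forall>l\<in>{1..N}. \<forall>y. \<forall>B\<in>sets borel.
           measure (Q t (k, y)) ({l} \<times> B) = measure (Q t (k, 0)) ({l} \<times> ((\<lambda>b. b - y) ` B))))"


section \<open>Occupation times\<close>

definition occupation_time :: "(real \<Rightarrow> 'w \<Rightarrow> nat) \<Rightarrow> real \<Rightarrow> nat \<Rightarrow> 'w \<Rightarrow> real" where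
  "occupation_time X t i \<omega> = (\<integral>s\<in>{0..t}. indicator {i} (X s \<omega>) \<partial>lborel)"

definition mean_occupation ::
    "nat \<Rightarrow> (nat \<Rightarrow> 'w measure) \<Rightarrow> (nat \<Rightarrow> real) \<Rightarrow> (real \<Rightarrow> 'w \<Rightarrow> nat) \<Rightarrow> nat \<Rightarrow> real" where
  "mean_occupation N M \<pi> X i = (\<Sum>k=1..N. \<pi> k * (\<integral>\<omega>. occupation_time X 1 i \<omega> \<partial>M k))"

definition centred_occupation_time ::
    "nat \<Rightarrow> (nat \<Rightarrow> 'w measure) \<Rightarrow> (nat \<Rightarrow> real) \<Rightarrow> (real \<Rightarrow> 'w \<Rightarrow> nat) \<Rightarrow> real \<Rightarrow> nat \<Rightarrow> 'w \<Rightarrow> real" where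
  "centred_occupation_time N M \<pi> X t i \<omega> =
     occupation_time X t i \<omega> - t * mean_occupation N M \<pi> X i"


section \<open>Lebesgue decomposition, Fourier transform, partial derivatives\<close>

text \<open>\<open>g\<close> is a version of the density and \<open>\<mu>\<close> the singular part of the measure \<open>\<nu>\<close>.\<close>

definition lebesgue_decomposition ::
    "('e::euclidean_space set \<Rightarrow> ennreal) \<Rightarrow> ('e \<Rightarrow> real) \<Rightarrow> 'e measure \<Rightarrow> bool" where
  "lebesgue_decomposition \<nu> g \<mu> \<longleftrightarrow>
     g \<in> borel_measurable borel \<and> (\<forall>y. 0 \<le> g y) \<and>
     sets \<mu> = sets borel \<and>
     (\<exists>S\<in>sets borel. emeasure lborel S = 0 \<and> emeasure \<mu> (- S) = 0) \<and>
     (\<forall>B\<in>sets borel. \<nu> B = (\<integral>\<^sup>+y\<in>B. ennreal (g y) \<partial>lborel) + emeasure \<mu> B)"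

definition fourier :: "('e::euclidean_space \<Rightarrow> real) \<Rightarrow> 'e \<Rightarrow> complex" where
  "fourier g \<zeta> = (\<integral>y. exp (\<i> * complex_of_real (\<zeta> \<bullet> y)) * complex_of_real (g y) \<partial>lborel)"

definition partial_deriv :: "'d::finite \<Rightarrow> (real ^ 'd \<Rightarrow> real) \<Rightarrow> real ^ 'd \<Rightarrow> real" where
  "partial_deriv j f y = deriv (\<lambda>h. f (y + h *\<^sub>R axis j 1)) 0"

end

theory Submission
  imports Defs "HOL-Real_Asymp.Real_Asymp"
begin

text \<open>Let \<open>\<Lambda>\<close> exceed the jump rates, \<open>P = 1 + G / \<Lambda>\<close>, and let \<open>q(n)\<close> be the total \<open>P\<close>-weight of the
  paths from \<open>k\<close> to \<open>l\<close> that visit each state \<open>i\<close> exactly \<open>n(i) + 1\<close> times; in particular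
  \<open>0 \<le> q \<le> 1\<close>. By uniformization, on the open simplex the occupation times have the density
  \<open>\<Lambda> ^ (N - 1)\<close> times the expectation of \<open>q\<close> at independent Poisson variables with means \<open>\<Lambda> * x(i)\<close>.
  A partial derivative of a Poisson expectation is the Poisson expectation of a difference, so the density
  and its gradient are bounded uniformly in time. On the boundary some state is visited exactly
  once, and a Lyapunov function for avoiding a state gives exponential decay there, as well as for the
  singular part, on which some state is not visited at all.

  To identify the density, the resolvent equation shows that the time Laplace transform of
  \<open>E_k[exp (- \<langle>a, L_t\<rangle>); X_t = l]\<close> is a generating function of path weights. Inserting the factor
  \<open>\<Prod>i. 1 - exp (- L_t(i))\<close>, which vanishes exactly when some state has not been visited, amounts to
  inclusion-exclusion in \<open>a\<close> and removes the singular part; uniqueness of Laplace transforms in time and a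
  Stone-Weierstrass argument in space then give equality of the laws. The MAP property holds
  since the increments of \<open>Y'\<close> are functionals of the shifted path.\<close>

section \<open>Poisson expectations over several coordinates\<close>

text \<open>Given its sequence of states, the uniformized chain has independent exponential holding
  times of rate \<Lambda>. The total time in a state visited n + 1 times is then a Gamma variable,
  and its density is \<Lambda> times a Poisson weight in n; summing over paths produces the Poisson
  expectation. The virtue of this form is that a bounded coefficient has a bounded expectation
  whatever the means are, so uniformity in time needs no local limit theorem. The obstacle is to
  justify the formula without conditioning on the path, and in the presence of mass on the
  lower-dimensional faces, one for each set of visited states. Comparing Laplace transforms avoids
  conditioning: the resolvent equation and the recursion of paths on their first letter are the same
  linear system, which has one solution. The factor that kills the faces is applied to both sides,
  is positive on the open simplex and can be divided out at the end. The transform in time needs no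
  variable of its own: as the occupation times sum to t, adding n to every a(i) multiplies the
  expectation by exp (- n t).\<close>

definition psum :: "'i set \<Rightarrow> ('i \<Rightarrow> nat \<Rightarrow> real) \<Rightarrow> (('i \<Rightarrow> nat) \<Rightarrow> real) \<Rightarrow> real" where
  "psum A w a = (\<Sum>\<^sub>\<infinity>m\<in>PiE A (\<lambda>_. UNIV). (\<Prod>i\<in>A. w i (m i)) * a m)"

lemma prod_summable_on_PiE:
  fixes w :: "'i \<Rightarrow> nat \<Rightarrow> real"
  assumes "finite A" "\<And>i. i \<in> A \<Longrightarrow> w i summable_on UNIV" "\<And>i n. i \<in> A \<Longrightarrow> 0 \<le> w i n"
  shows "(\<lambda>m. \<Prod>i\<in>A. w i (m i)) summable_on PiE A (\<lambda>_. UNIV)"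
  using assms
proof (induction A)
  case empty
  then show ?case by simp
next
  case (insert x F)
  have pi: "PiE (insert x F) (\<lambda>_. UNIV :: nat set) = (\<lambda>(g,y). g(x:=y)) ` (PiE F (\<lambda>_. UNIV) \<times> UNIV)"
    unfolding PiE_insert_eq by (subst swap_product [symmetric]) (simp add: image_image case_prod_unfold)
  have inj: "inj_on (\<lambda>(g, y). g(x := y)) (PiE F (\<lambda>_. UNIV :: nat set) \<times> UNIV)"
    using inj_combinator'[OF insert.hyps(2), of "\<lambda>_. UNIV"] by simp
  have p: "(\<Prod>z\<in>F. w z (if z = x then y else g z)) = (\<Prod>z\<in>F. w z (g z))" for g y
    by (rule prod.cong) (use insert.hyps in auto)
  have 1: "(\<lambda>m. \<Prod>i\<in>F. w i (m i)) summable_on PiE F (\<lambda>_. UNIV)"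
    using insert by auto
  have "(\<lambda>(g,y). (\<Prod>i\<in>F. w i (g i)) * w x y) summable_on (PiE F (\<lambda>_. UNIV) \<times> UNIV)"
  proof (rule summable_on_SigmaI)
    show "((\<lambda>y. case (g, y) of (g, y) \<Rightarrow> (\<Prod>i\<in>F. w i (g i)) * w x y) has_sum
        (\<Prod>i\<in>F. w i (g i)) * infsum (w x) UNIV) UNIV" for g
      using insert.prems by (auto intro!: has_sum_cmult_right has_sum_infsum)
    show "(\<lambda>g. (\<Prod>i\<in>F. w i (g i)) * infsum (w x) UNIV) summable_on PiE F (\<lambda>_. UNIV)"
      by (rule summable_on_cmult_left[OF 1])
  qed (use insert.prems in \<open>auto intro!: mult_nonneg_nonneg prod_nonneg\<close>)
  then show ?case
    unfolding pi by (subst summable_on_reindex[OF inj])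
      (use insert.hyps in \<open>simp add: o_def case_prod_unfold p mult.commute\<close>)
qed

lemma psum_cmult: "psum A w (\<lambda>m. c * a m) = c * psum A w a"
  unfolding psum_def by (subst infsum_cmult_right'[symmetric]) (simp add: mult_ac)

text \<open>The weights are not normalised, so that one set of lemmas serves Poisson weights, the
  geometric weights of generating functions and differences of geometric weights.\<close>

locale weights =
  fixes A :: "'i set" and w :: "'i \<Rightarrow> nat \<Rightarrow> real"
  assumes finA: "finite A" and wpos: "\<And>i n. i \<in> A \<Longrightarrow> 0 \<le> w i n"
    and wsum: "\<And>i. i \<in> A \<Longrightarrow> w i summable_on UNIV"
begin

lemma wprod_summable: "(\<lambda>m. \<Prod>i\<in>A. w i (m i)) summable_on PiE A (\<lambda>_. UNIV)"
  by (rule prod_summable_on_PiE[OF finA wsum wpos])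

lemma summable_psum:
  assumes "\<And>m. \<bar>a m\<bar> \<le> B"
  shows "(\<lambda>m. (\<Prod>i\<in>A. w i (m i)) * a m) summable_on PiE A (\<lambda>_. UNIV)"
proof -
  have "(\<lambda>m. norm ((\<Prod>i\<in>A. w i (m i)) * a m)) summable_on PiE A (\<lambda>_. UNIV)"
  proof (rule Infinite_Sum.abs_summable_on_comparison_test')
    show "(\<lambda>m. (\<Prod>i\<in>A. w i (m i)) * B) summable_on PiE A (\<lambda>_. UNIV)"
      using wprod_summable by (rule summable_on_cmult_left)
    show "norm ((\<Prod>i\<in>A. w i (m i)) * a m) \<le> (\<Prod>i\<in>A. w i (m i)) * B"
      if "m \<in> PiE A (\<lambda>_. UNIV)" for m
      using assms[of m] by (auto simp: abs_mult abs_prod wpos intro!: mult_mono prod_nonneg)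
  qed
  then show ?thesis by (rule Infinite_Sum.abs_summable_summable)
qed

lemma psum_const: "psum A w (\<lambda>_. c) = c * (\<Prod>i\<in>A. infsum (w i) UNIV)"
  unfolding psum_def
  by (subst infsum_cmult_left', subst infsum_prod_PiE)
     (use finA wsum wprod_summable in auto)

text \<open>Comparison is demanded only where no weight vanishes. For a Poisson weight of mean 0
  this leaves the index 0 alone, which is how a vanishing coordinate becomes information about
  paths.\<close>

lemma psum_mono:
  assumes "\<And>m. \<bar>a m\<bar> \<le> B" "\<And>m. \<bar>b m\<bar> \<le> B'" "\<And>m. m \<in> PiE A (\<lambda>_. UNIV) \<Longrightarrow> (\<forall>i\<in>A. w i (m i) \<noteq> 0) \<Longrightarrow> a m \<le> b m"
  shows "psum A w a \<le> psum A w b"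
  unfolding psum_def
proof (rule infsum_mono[OF summable_psum[OF assms(1)] summable_psum[OF assms(2)]])
  fix m :: "'i \<Rightarrow> nat" assume m: "m \<in> PiE A (\<lambda>_. UNIV)"
  show "(\<Prod>i\<in>A. w i (m i)) * a m \<le> (\<Prod>i\<in>A. w i (m i)) * b m"
  proof (cases "\<forall>i\<in>A. w i (m i) \<noteq> 0")
    case True
    then show ?thesis using assms(3)[OF m] by (intro mult_left_mono prod_nonneg) (auto simp: wpos)
  next
    case False
    then have "(\<Prod>i\<in>A. w i (m i)) = 0" using finA by auto
    then show ?thesis by simp
  qed
qed

lemma psum_bound:
  assumes "\<And>m. \<bar>a m\<bar> \<le> B"
  shows "\<bar>psum A w a\<bar> \<le> B * (\<Prod>i\<in>A. infsum (w i) UNIV)"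
proof -
  have B: "\<bar>B\<bar> \<le> \<bar>B\<bar>" "\<bar>-B\<bar> \<le> \<bar>B\<bar>" by auto
  have "psum A w a \<le> psum A w (\<lambda>_. B)"
    by (rule psum_mono[OF assms B(1)]) (use assms in \<open>simp add: abs_le_iff\<close>)
  moreover have "psum A w (\<lambda>_. -B) \<le> psum A w a"
    by (rule psum_mono[OF B(2) assms]) (metis assms abs_le_iff minus_le_iff)
  ultimately show ?thesis by (auto simp: psum_const)
qed

lemma psum_add:
  assumes "\<And>m. \<bar>a m\<bar> \<le> B" "\<And>m. \<bar>b m\<bar> \<le> B'"
  shows "psum A w (\<lambda>m. a m + b m) = psum A w a + psum A w b"
  unfolding psum_def distrib_left
  by (rule infsum_add) (use summable_psum[OF assms(1)] summable_psum[OF assms(2)] in auto)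

lemma psum_diff:
  assumes "\<And>m. \<bar>a m\<bar> \<le> B" "\<And>m. \<bar>b m\<bar> \<le> B'"
  shows "psum A w (\<lambda>m. a m - b m) = psum A w a - psum A w b"
  using psum_add[OF assms(1), of "\<lambda>m. (-1) * b m" B'] assms(2) psum_cmult[of A w "-1" b] by simp

lemma psum_sum:
  assumes "finite J" "\<And>j m. j \<in> J \<Longrightarrow> \<bar>a j m\<bar> \<le> B j"
  shows "psum A w (\<lambda>m. \<Sum>j\<in>J. a j m) = (\<Sum>j\<in>J. psum A w (a j))"
  using assms
proof (induction J)
  case empty
  then show ?case using psum_const[of 0] by simp
next
  case (insert j J)
  have "\<bar>\<Sum>j\<in>J. a j m\<bar> \<le> (\<Sum>j\<in>J. B j)" for m
    by (rule order_trans[OF sum_abs]) (use insert.prems in \<open>auto intro!: sum_mono\<close>)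
  then show ?case using insert by (simp add: psum_add[of "a j" "B j" "\<lambda>m. \<Sum>j\<in>J. a j m" "\<Sum>j\<in>J. B j"])
qed

end

lemma psum_empty [simp]: "psum {} w a = a (\<lambda>_. undefined)"
  by (simp add: psum_def)

text \<open>Fubini for a single coordinate. It reduces estimates in several coordinates to one
  variable by induction on the index set.\<close>

lemma psum_insert:
  assumes W: "weights (insert x A) w" and x: "x \<notin> A" and B: "\<And>m. \<bar>a m\<bar> \<le> B"
  shows "psum (insert x A) w a = (\<Sum>\<^sub>\<infinity>n. w x n * psum A w (\<lambda>m. a (m(x := n))))"
proof -
  interpret W: weights "insert x A" w by fact
  let ?P = "PiE A (\<lambda>_. UNIV :: nat set)"
  have pi: "PiE (insert x A) (\<lambda>_. UNIV :: nat set) = (\<lambda>(y,g). g(x:=y)) ` (UNIV \<times> ?P)"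
    unfolding PiE_insert_eq by simp
  have inj: "inj_on (\<lambda>(y,g). g(x := y)) (UNIV \<times> ?P)"
    using inj_combinator[OF x, of "\<lambda>_. UNIV"] by simp
  have p: "(\<Prod>z\<in>A. w z (if z = x then y else g z)) = (\<Prod>z\<in>A. w z (g z))" for g y
    by (rule prod.cong) (use x in auto)
  have fin: "finite A" using W.finA by simp
  have s: "(\<lambda>(n,g). w x n * ((\<Prod>z\<in>A. w z (g z)) * a (g(x := n)))) summable_on (UNIV \<times> ?P)"
    using W.summable_psum[OF B] unfolding pi
    by (subst (asm) summable_on_reindex[OF inj])
       (use x fin in \<open>simp add: o_def case_prod_unfold p mult.assoc\<close>)
  have "psum (insert x A) w a = (\<Sum>\<^sub>\<infinity>(n,g)\<in>UNIV \<times> ?P. w x n * ((\<Prod>z\<in>A. w z (g z)) * a (g(x := n))))"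
    unfolding psum_def pi
    by (subst infsum_reindex[OF inj])
       (use x fin in \<open>simp add: o_def case_prod_unfold p mult.assoc\<close>)
  also have "\<dots> = (\<Sum>\<^sub>\<infinity>n. \<Sum>\<^sub>\<infinity>g\<in>?P. w x n * ((\<Prod>z\<in>A. w z (g z)) * a (g(x := n))))"
    using infsum_Sigma'_banach[OF s] by simp
  also have "\<dots> = (\<Sum>\<^sub>\<infinity>n. w x n * psum A w (\<lambda>m. a (m(x := n))))"
    unfolding psum_def by (subst infsum_cmult_right') simp
  finally show ?thesis .
qed

section \<open>Poisson means in one variable\<close>

definition poisw :: "real \<Rightarrow> nat \<Rightarrow> real" where
  "poisw r n = exp (- r) * r ^ n / fact n"

lemma poisw_nonneg: "0 \<le> r \<Longrightarrow> 0 \<le> poisw r n"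
  by (simp add: poisw_def)

lemma poisw_sums: "poisw r sums 1"
  using sums_mult[OF exp_converges[of r], of "exp (-r)"]
  by (simp add: poisw_def[abs_def] scaleR_conv_of_real field_simps exp_minus)

lemma poisw_has_sum: "0 \<le> r \<Longrightarrow> (poisw r has_sum 1) UNIV"
  by (rule norm_summable_imp_has_sum) (use poisw_sums in \<open>auto simp: poisw_nonneg sums_iff\<close>)

lemma weights_poisw:
  assumes "finite A" "\<And>i. i \<in> A \<Longrightarrow> 0 \<le> y i"
  shows "weights A (\<lambda>i. poisw (y i))"
  by standard (use assms poisw_has_sum poisw_nonneg in \<open>auto simp: summable_on_def\<close>)

lemma infsum_poisw: "0 \<le> r \<Longrightarrow> infsum (poisw r) UNIV = 1"
  using poisw_has_sum infsumI by blast

text \<open>Written as a power series rather than as a sum against \<open>poisw\<close>, so that it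
  can be differentiated term by term at every real r.\<close>

definition pois_mean :: "real \<Rightarrow> (nat \<Rightarrow> real) \<Rightarrow> real" where
  "pois_mean r b = exp (-r) * (\<Sum>n. b n / fact n * r ^ n)"

lemma pois_mean_summable:
  fixes r :: real
  assumes "\<And>n. \<bar>b n\<bar> \<le> B"
  shows "summable (\<lambda>n. \<bar>b n / fact n * r ^ n\<bar>)" "summable (\<lambda>n. b n / fact n * r ^ n)"
proof -
  have "summable (\<lambda>n. B * (\<bar>r\<bar> ^ n / fact n))"
    using summable_exp[of "\<bar>r\<bar>"] by (intro summable_mult) (simp add: field_simps)
  then show 1: "summable (\<lambda>n. \<bar>b n / fact n * r ^ n\<bar>)"
    by (rule summable_comparison_test[rotated])
       (use assms in \<open>auto simp: abs_mult power_abs divide_right_mono mult_right_mono intro!: exI[of _ 0]\<close>)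
  then show "summable (\<lambda>n. b n / fact n * r ^ n)" by (rule summable_rabs_cancel)
qed

lemma pois_mean_infsum:
  assumes B: "\<And>n. \<bar>b n\<bar> \<le> B"
  shows "pois_mean r b = (\<Sum>\<^sub>\<infinity>n. poisw r n * b n)"
proof -
  note s = pois_mean_summable[OF B, where r = r]
  have "((\<lambda>n. b n / fact n * r ^ n) has_sum (\<Sum>n. b n / fact n * r ^ n)) UNIV"
    by (rule norm_summable_imp_has_sum) (use s in \<open>auto intro: summable_sums\<close>)
  from has_sum_cmult_right[OF this, of "exp (-r)"]
  show ?thesis unfolding pois_mean_def poisw_def
    by (intro infsumI[symmetric]) (simp add: field_simps)
qed

lemma pois_mean_deriv:
  assumes B: "\<And>n. \<bar>b n\<bar> \<le> B"
  shows "((\<lambda>r. pois_mean r b) has_real_derivative pois_mean r (\<lambda>n. b (Suc n) - b n)) (at r)"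
proof -
  let ?c = "\<lambda>n. b n / fact n"
  \<comment> \<open>\<open>diffs\<close> multiplies the next coefficient by its index; the factorial
    absorbs that factor and the sequence b is merely shifted.\<close>
  have d: "diffs ?c = (\<lambda>n. b (Suc n) / fact n)"
    by (rule ext) (simp add: diffs_def del: of_nat_Suc)
  have "DERIV (\<lambda>x. \<Sum>n. ?c n * x ^ n) r :> (\<Sum>n. diffs ?c n * r ^ n)"
    by (rule termdiffs_strong_converges_everywhere) (rule pois_mean_summable(2)[OF B])
  then have 1: "DERIV (\<lambda>x. \<Sum>n. ?c n * x ^ n) r :> (\<Sum>n. b (Suc n) / fact n * r ^ n)"
    by (simp add: d)
  have s: "(\<Sum>n. (b (Suc n) - b n) / fact n * r ^ n)
      = (\<Sum>n. b (Suc n) / fact n * r ^ n) - (\<Sum>n. b n / fact n * r ^ n)"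
    by (subst suminf_diff)
       (use pois_mean_summable(2)[of b B, OF B] pois_mean_summable(2)[of "\<lambda>n. b (Suc n)" B, OF B] in
         \<open>auto simp: diff_divide_distrib left_diff_distrib\<close>)
  show ?thesis unfolding pois_mean_def s
    by (rule derivative_eq_intros 1 refl | simp)+ (simp add: algebra_simps)
qed

lemma pois_mean_bound:
  assumes B: "\<And>n. \<bar>b n\<bar> \<le> B" and r: "0 \<le> r"
  shows "\<bar>pois_mean r b\<bar> \<le> B"
proof -
  \<comment> \<open>The one-variable mean is the sum over a one-element index set, so the general
    bound applies.\<close>
  have W: "weights {()} (\<lambda>_. poisw r)" by (rule weights_poisw) (use r in auto)
  then interpret weights "{()}" "\<lambda>_. poisw r" .
  have "psum {()} (\<lambda>_. poisw r) (\<lambda>m. b (m ())) = (\<Sum>\<^sub>\<infinity>n. poisw r n * b n)"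
    using psum_insert[OF W, of "\<lambda>m. b (m ())" B] B by simp
  then show ?thesis
    using psum_bound[of "\<lambda>m. b (m ())" B] B r by (simp add: pois_mean_infsum[OF B] infsum_poisw)
qed

lemma pois_mean_lipschitz:
  assumes B: "\<And>n. \<bar>b n\<bar> \<le> B" and r: "0 \<le> r" "0 \<le> r'"
  shows "\<bar>pois_mean r' b - pois_mean r b\<bar> \<le> 2 * B * \<bar>r' - r\<bar>"
proof -
  have B': "\<bar>b (Suc n) - b n\<bar> \<le> 2 * B" for n using B[of n] B[of "Suc n"] by linarith
  have "norm (pois_mean r' b - pois_mean r b) \<le> 2 * B * norm (r' - r)"
    by (rule field_differentiable_bound[of "{0..}" _ "\<lambda>x. pois_mean x (\<lambda>n. b (Suc n) - b n)"])
       (use r B pois_mean_bound[OF B'] in \<open>auto intro!: has_field_derivative_at_within[OF pois_mean_deriv]\<close>)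
  then show ?thesis by simp
qed

text \<open>The mean value theorem is applied to the mean minus its tangent line. Its derivative is
  an increment of the mean of the difference sequence, which is bounded by 2 B and therefore
  Lipschitz with constant 4 B.\<close>

lemma pois_mean_taylor:
  assumes B: "\<And>n. \<bar>b n\<bar> \<le> B" and r: "0 \<le> r" "0 \<le> r'"
  shows "\<bar>pois_mean r' b - pois_mean r b - (r' - r) * pois_mean r (\<lambda>n. b (Suc n) - b n)\<bar> \<le> 4 * B * \<bar>r' - r\<bar>\<^sup>2"
proof -
  let ?D = "\<lambda>n. b (Suc n) - b n"
  have B': "\<bar>?D n\<bar> \<le> 2 * B" for n using B[of n] B[of "Suc n"] by linarith
  have B0: "0 \<le> B" using B[of 0] by linarith
  let ?S = "{min r r'..max r r'}"
  have f1: "norm ((pois_mean r' b - r' * pois_mean r ?D) - (pois_mean r b - r * pois_mean r ?D)) \<le> (4 * B * \<bar>r' - r\<bar>) * norm (r' - r)"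
  proof (rule field_differentiable_bound[of ?S _ "\<lambda>x. pois_mean x ?D - pois_mean r ?D"])
    show "((\<lambda>x. pois_mean x b - x * pois_mean r ?D) has_field_derivative pois_mean z ?D - pois_mean r ?D) (at z within ?S)" for z
      by (rule derivative_eq_intros has_field_derivative_at_within[OF pois_mean_deriv[OF B]] refl | simp)+
    show "norm (pois_mean z ?D - pois_mean r ?D) \<le> 4 * B * \<bar>r' - r\<bar>" if "z \<in> ?S" for z
    proof -
      have "\<bar>pois_mean z ?D - pois_mean r ?D\<bar> \<le> 2 * (2 * B) * \<bar>z - r\<bar>"
        by (rule pois_mean_lipschitz[OF B']) (use that r in auto)
      also have "\<dots> \<le> 2 * (2 * B) * \<bar>r' - r\<bar>"
        by (rule mult_left_mono) (use that B0 in auto)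
      finally show ?thesis by simp
    qed
  qed auto
  have f2: "(4 * B * \<bar>r' - r\<bar>) * norm (r' - r) = 4 * B * \<bar>r' - r\<bar>\<^sup>2"
    by (simp add: power2_eq_square)
  have f3: "(pois_mean r' b - r' * pois_mean r ?D) - (pois_mean r b - r * pois_mean r ?D)
      = pois_mean r' b - pois_mean r b - (r' - r) * pois_mean r ?D"
    by (simp add: algebra_simps)
  show ?thesis using f1 unfolding f2 f3 by simp
qed

section \<open>Expectations over independent Poisson variables\<close>

definition pois_exp :: "'i set \<Rightarrow> ('i \<Rightarrow> real) \<Rightarrow> (('i \<Rightarrow> nat) \<Rightarrow> real) \<Rightarrow> real" where
  "pois_exp A y a = psum A (\<lambda>i. poisw (y i)) a"

lemma pois_exp_empty [simp]: "pois_exp {} y a = a (\<lambda>_. undefined)"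
  by (simp add: pois_exp_def)

lemma pois_exp_bound:
  assumes "finite A" "\<And>i. i \<in> A \<Longrightarrow> 0 \<le> y i" "\<And>m. \<bar>a m\<bar> \<le> B"
  shows "\<bar>pois_exp A y a\<bar> \<le> B"
proof -
  interpret weights A "\<lambda>i. poisw (y i)" by (rule weights_poisw) fact+
  show ?thesis using psum_bound[of a B, OF assms(3)] assms(2) by (simp add: pois_exp_def infsum_poisw)
qed

lemma pois_exp_insert:
  assumes "finite A" "x \<notin> A" "\<And>i. i \<in> insert x A \<Longrightarrow> 0 \<le> y i" "\<And>m. \<bar>a m\<bar> \<le> B"
  shows "pois_exp (insert x A) y a = pois_mean (y x) (\<lambda>n. pois_exp A y (\<lambda>m. a (m(x := n))))"
proof -
  have W: "weights (insert x A) (\<lambda>i. poisw (y i))" by (rule weights_poisw) (use assms in auto)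
  show ?thesis unfolding pois_exp_def
    by (subst psum_insert[OF W], fact, fact, subst pois_mean_infsum[where B = B])
       (use pois_exp_bound[OF assms(1)] assms in \<open>auto simp: pois_exp_def\<close>)
qed

lemma pois_exp_diff:
  assumes "finite A" "\<And>i. i \<in> A \<Longrightarrow> 0 \<le> y i" "\<And>m. \<bar>a m\<bar> \<le> B" "\<And>m. \<bar>b m\<bar> \<le> B'"
  shows "pois_exp A y (\<lambda>m. a m - b m) = pois_exp A y a - pois_exp A y b"
proof -
  interpret weights A "\<lambda>i. poisw (y i)" by (rule weights_poisw) fact+
  show ?thesis unfolding pois_exp_def by (rule psum_diff) fact+
qed

lemma pois_mean_linear:
  assumes "\<And>n. \<bar>b n\<bar> \<le> B" "\<And>n. \<bar>b' n\<bar> \<le> B'"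
  shows "pois_mean r (\<lambda>n. b n - b' n) = pois_mean r b - pois_mean r b'"
  using suminf_diff[OF pois_mean_summable(2)[of b B r, OF assms(1)] pois_mean_summable(2)[of b' B' r, OF assms(2)]]
  by (simp add: pois_mean_def algebra_simps diff_divide_distrib)

lemma pois_mean_uminus:
  assumes "\<And>n. \<bar>b n\<bar> \<le> B"
  shows "pois_mean r (\<lambda>n. - b n) = - pois_mean r b"
  using pois_mean_linear[of "\<lambda>_. 0" 0 b B r] assms by (simp add: pois_mean_def)

abbreviation shift_diff :: "'i \<Rightarrow> (('i \<Rightarrow> nat) \<Rightarrow> real) \<Rightarrow> ('i \<Rightarrow> nat) \<Rightarrow> real" where
  "shift_diff i a \<equiv> (\<lambda>m. a (m(i := Suc (m i))) - a m)"

lemma pois_mean_sum: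
  assumes "finite J" "\<And>j n. j \<in> J \<Longrightarrow> \<bar>b j n\<bar> \<le> B j"
  shows "pois_mean r (\<lambda>n. \<Sum>j\<in>J. c j * b j n) = (\<Sum>j\<in>J. c j * pois_mean r (b j))"
  using assms
proof (induction J)
  case empty
  then show ?case by (simp add: pois_mean_def)
next
  case (insert j J)
  have b1: "\<bar>c j * b j n\<bar> \<le> \<bar>c j\<bar> * B j" for n
    using insert.prems by (auto simp: abs_mult intro!: mult_left_mono)
  have b2: "\<bar>- (\<Sum>j\<in>J. c j * b j n)\<bar> \<le> (\<Sum>j\<in>J. \<bar>c j\<bar> * B j)" for n
    unfolding abs_minus_cancel
    by (rule order_trans[OF sum_abs]) (use insert.prems in \<open>auto simp: abs_mult intro!: sum_mono mult_left_mono\<close>)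
  have s: "pois_mean r (\<lambda>n. c * b n) = c * pois_mean r b" if "\<And>n. \<bar>b n\<bar> \<le> B" for c b B
    using suminf_mult[OF pois_mean_summable(2)[of b B r, OF that], of c] by (simp add: pois_mean_def mult_ac)
  have n: "pois_mean r (\<lambda>n. - b n) = - pois_mean r b" if "\<And>n. \<bar>b n\<bar> \<le> B" for b B
    using s[of b B "-1", OF that] by simp
  have "pois_mean r (\<lambda>n. \<Sum>j\<in>insert j J. c j * b j n)
      = pois_mean r (\<lambda>n. c j * b j n - (- (\<Sum>j\<in>J. c j * b j n)))"
    using insert.hyps by simp
  also have "\<dots> = pois_mean r (\<lambda>n. c j * b j n) - pois_mean r (\<lambda>n. - (\<Sum>j\<in>J. c j * b j n))"
    by (rule pois_mean_linear[OF b1 b2])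
  also have "\<dots> = c j * pois_mean r (b j) + (\<Sum>j\<in>J. c j * pois_mean r (b j))"
    using insert s[of "b j" "B j" "c j"] n[OF b2[unfolded abs_minus_cancel]] by simp
  finally show ?case using insert.hyps by simp
qed

text \<open>Coordinates are added one at a time. The new coordinate is expanded by the one-variable
  bound, the old ones by the induction hypothesis with the new count frozen; the linear term then
  appears averaged at the wrong point, and correcting this costs a cross term, which the square of
  the sum accommodates.\<close>

lemma pois_exp_taylor:
  assumes "finite A" "\<And>i. i \<in> A \<Longrightarrow> 0 \<le> y i" "\<And>i. i \<in> A \<Longrightarrow> 0 \<le> z i" "\<And>m. \<bar>a m\<bar> \<le> B"
  shows "\<bar>pois_exp A z a - pois_exp A y a - (\<Sum>i\<in>A. (z i - y i) * pois_exp A y (shift_diff i a))\<bar>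
           \<le> 4 * B * (\<Sum>i\<in>A. \<bar>z i - y i\<bar>)\<^sup>2"
  using assms
proof (induction A arbitrary: a rule: finite_induct)
  case empty
  then show ?case by simp
next
  case (insert x A)
  let ?dA = "\<Sum>i\<in>A. \<bar>z i - y i\<bar>" and ?dx = "\<bar>z x - y x\<bar>"
  have B0: "0 \<le> B" using insert.prems(3)[of "\<lambda>_. 0"] by linarith
  define by' where "by' n = pois_exp A y (\<lambda>m. a (m(x := n)))" for n
  define bz where "bz n = pois_exp A z (\<lambda>m. a (m(x := n)))" for n
  define g where "g i n = pois_exp A y (shift_diff i (\<lambda>m. a (m(x := n))))" for i n
  have y0: "i \<in> insert x A \<Longrightarrow> 0 \<le> y i" and z0: "i \<in> insert x A \<Longrightarrow> 0 \<le> z i" for i using insert.prems by auto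
  have by_b: "\<bar>by' n\<bar> \<le> B" and bz_b: "\<bar>bz n\<bar> \<le> B" for n
    unfolding by'_def bz_def by (rule pois_exp_bound; use insert in auto)+
  have db: "\<bar>shift_diff i a m\<bar> \<le> 2 * B" for i m
    using insert.prems(3)[of m] insert.prems(3)[of "m(i := Suc (m i))"] by linarith
  have db': "\<bar>shift_diff i (\<lambda>m. a (m(x := n))) m\<bar> \<le> 2 * B" for i m n
    using insert.prems(3)[of "m(x := n)"] insert.prems(3)[of "(m(i := Suc (m i)))(x := n)"] by linarith
  have g_b: "\<bar>g i n\<bar> \<le> 2 * B" for i n
    unfolding g_def by (rule pois_exp_bound[OF insert.hyps(1)]) (use y0 db' in auto)
  have Ey: "pois_exp (insert x A) y a = pois_mean (y x) by'"
    unfolding by'_def by (rule pois_exp_insert) (use insert y0 in auto)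
  have Ez: "pois_exp (insert x A) z a = pois_mean (z x) bz"
    unfolding bz_def by (rule pois_exp_insert) (use insert z0 in auto)
  have Ex: "pois_exp (insert x A) y (shift_diff x a) = pois_mean (y x) (\<lambda>n. by' (Suc n) - by' n)"
    unfolding by'_def
    by (subst pois_exp_insert[OF insert.hyps y0 db], assumption,
        subst pois_exp_diff[symmetric, where B = B and B' = B]) (use insert in auto)
  have Ei: "pois_exp (insert x A) y (shift_diff i a) = pois_mean (y x) (g i)" if "i \<in> A" for i
  proof -
    have "i \<noteq> x" using that insert.hyps by auto
    then have e: "(m(x := n))(i := Suc ((m(x := n)) i)) = (m(i := Suc (m i)))(x := n)" for m :: "_ \<Rightarrow> nat" and n
      by auto
    show ?thesis unfolding g_def
      by (subst pois_exp_insert[OF insert.hyps y0 db], assumption) (simp only: e)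
  qed
  define L where "L n = (\<Sum>i\<in>A. (z i - y i) * g i n)" for n
  \<comment> \<open>Linear term and remainder with the count of x frozen at n; both are bounded
    uniformly in n, so they may be averaged over n.\<close>
  define R where "R n = bz n - by' n - L n" for n
  have R_b: "\<bar>R n\<bar> \<le> 4 * B * ?dA\<^sup>2" for n
    unfolding R_def bz_def by'_def L_def g_def by (rule insert.IH) (use insert.prems in auto)
  have L_b: "\<bar>L n\<bar> \<le> 2 * B * ?dA" for n
  proof -
    have "\<bar>L n\<bar> \<le> (\<Sum>i\<in>A. \<bar>z i - y i\<bar> * (2 * B))"
      unfolding L_def by (rule order_trans[OF sum_abs]) (auto simp: abs_mult g_b intro!: sum_mono mult_left_mono)
    then show ?thesis by (simp add: sum_distrib_left mult_ac)
  qed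
  have eL: "pois_mean (y x) L = (\<Sum>i\<in>A. (z i - y i) * pois_mean (y x) (g i))"
    unfolding L_def by (rule pois_mean_sum[OF insert.hyps(1) g_b])
  have RL: "\<bar>R n - (- L n)\<bar> \<le> 4 * B * ?dA\<^sup>2 + 2 * B * ?dA" for n
    using R_b[of n] L_b[of n] by linarith
  \<comment> \<open>The double negations only serve to write sums as differences, the form of
    \<open>pois_mean_linear\<close>.\<close>
  have "pois_mean (z x) bz = pois_mean (z x) (\<lambda>n. (R n - (- L n)) - (- by' n))"
    by (simp add: R_def)
  also have "\<dots> = pois_mean (z x) (\<lambda>n. R n - (- L n)) - pois_mean (z x) (\<lambda>n. - by' n)"
    by (rule pois_mean_linear[OF RL, of _ B]) (simp add: by_b)
  also have "pois_mean (z x) (\<lambda>n. R n - (- L n)) = pois_mean (z x) R - pois_mean (z x) (\<lambda>n. - L n)"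
    by (rule pois_mean_linear[OF R_b, of _ "2 * B * ?dA"]) (simp add: L_b)
  finally have e: "pois_mean (z x) bz = pois_mean (z x) R + pois_mean (z x) L + pois_mean (z x) by'"
    by (simp add: pois_mean_uminus[OF L_b] pois_mean_uminus[OF by_b])
  have t1: "\<bar>pois_mean (z x) by' - pois_mean (y x) by' - (z x - y x) * pois_mean (y x) (\<lambda>n. by' (Suc n) - by' n)\<bar> \<le> 4 * B * ?dx\<^sup>2"
    by (rule pois_mean_taylor[OF by_b]) (use y0 z0 in auto)
  have t2: "\<bar>pois_mean (z x) R\<bar> \<le> 4 * B * ?dA\<^sup>2"
    by (rule pois_mean_bound[OF R_b]) (use z0 in auto)
  \<comment> \<open>The linear term is averaged at \<open>z x\<close>, while the claim wants it at
    \<open>y x\<close>.\<close>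
  have t3: "\<bar>pois_mean (z x) L - pois_mean (y x) L\<bar> \<le> 2 * (2 * B * ?dA) * ?dx"
    by (rule pois_mean_lipschitz[OF L_b]) (use y0 z0 in auto)
  have BAx: "0 \<le> B * ?dA * ?dx" using B0 by (intro mult_nonneg_nonneg sum_nonneg) auto
  have sq: "4 * B * (?dx + ?dA)\<^sup>2 = 4 * B * ?dx\<^sup>2 + 4 * B * ?dA\<^sup>2 + 8 * (B * ?dA * ?dx)"
    by (simp add: power2_sum algebra_simps)
  have t3': "2 * (2 * B * ?dA) * ?dx = 4 * (B * ?dA * ?dx)" by simp
  have S: "(\<Sum>i\<in>insert x A. (z i - y i) * pois_exp (insert x A) y (shift_diff i a))
     = (z x - y x) * pois_mean (y x) (\<lambda>n. by' (Suc n) - by' n) + pois_mean (y x) L"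
    using insert.hyps by (simp add: Ex Ei eL)
  have S': "(\<Sum>i\<in>insert x A. \<bar>z i - y i\<bar>) = ?dx + ?dA" using insert.hyps by simp
  show ?case unfolding Ey Ez e S S' sq using t1 t2 t3[unfolded t3'] BAx by linarith
qed

lemma pois_exp_lipschitz:
  assumes "finite A" "\<And>i. i \<in> A \<Longrightarrow> 0 \<le> y i" "\<And>i. i \<in> A \<Longrightarrow> 0 \<le> z i" "\<And>m. \<bar>a m\<bar> \<le> B"
  shows "\<bar>pois_exp A z a - pois_exp A y a\<bar> \<le> 2 * B * (\<Sum>i\<in>A. \<bar>z i - y i\<bar>)"
  using assms
proof (induction A arbitrary: a rule: finite_induct)
  case empty
  then show ?case by simp
next
  case (insert x A)
  let ?dA = "\<Sum>i\<in>A. \<bar>z i - y i\<bar>"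
  define by' where "by' n = pois_exp A y (\<lambda>m. a (m(x := n)))" for n
  define bz where "bz n = pois_exp A z (\<lambda>m. a (m(x := n)))" for n
  have by_b: "\<bar>by' n\<bar> \<le> B" and bz_b: "\<bar>bz n\<bar> \<le> B" for n
    unfolding by'_def bz_def by (rule pois_exp_bound; use insert in auto)+
  have d: "\<bar>bz n - by' n\<bar> \<le> 2 * B * ?dA" for n
    unfolding by'_def bz_def by (rule insert.IH) (use insert.prems in auto)
  have Ey: "pois_exp (insert x A) y a = pois_mean (y x) by'"
    unfolding by'_def by (rule pois_exp_insert) (use insert in auto)
  have Ez: "pois_exp (insert x A) z a = pois_mean (z x) bz"
    unfolding bz_def by (rule pois_exp_insert) (use insert in auto)
  have "\<bar>pois_mean (z x) by' - pois_mean (y x) by'\<bar> \<le> 2 * B * \<bar>z x - y x\<bar>"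
    by (rule pois_mean_lipschitz[OF by_b]) (use insert.prems in auto)
  moreover have "\<bar>pois_mean (z x) bz - pois_mean (z x) by'\<bar> \<le> 2 * B * ?dA"
    using pois_mean_bound[OF d, of "z x"] pois_mean_linear[OF bz_b by_b, of "z x"] insert.prems by simp
  ultimately show ?case using insert.hyps unfolding Ey Ez by (simp add: algebra_simps)
qed

section \<open>Weights of paths with prescribed occupation counts\<close>

text \<open>\<open>pathw N P n m k l\<close> sums the weights of the sequences of \<open>n\<close> states from \<open>k\<close> to \<open>l\<close> that contain each
  state \<open>i\<close> exactly \<open>m i\<close> times, by recursion on the first letter.\<close>

fun pathw :: "nat \<Rightarrow> (nat \<Rightarrow> nat \<Rightarrow> real) \<Rightarrow> nat \<Rightarrow> (nat \<Rightarrow> nat) \<Rightarrow> nat \<Rightarrow> nat \<Rightarrow> real" where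
  "pathw N P 0 m k l = 0"
| "pathw N P (Suc n) m k l = (if m k = 0 then 0 else (if n = 0 \<and> k = l then 1 else 0)
     + (\<Sum>j=1..N. P k j * pathw N P n (m(k := m k - 1)) j l))"

text \<open>For an arbitrary length the recursion only prevents a state from occurring more than
  \<open>m i\<close> times. With the length equal to the sum of the counts there is no slack, and
  the counts are attained exactly.\<close>

definition path_weight :: "nat \<Rightarrow> (nat \<Rightarrow> nat \<Rightarrow> real) \<Rightarrow> (nat \<Rightarrow> nat) \<Rightarrow> nat \<Rightarrow> nat \<Rightarrow> real" where
  "path_weight N P m k l = pathw N P (\<Sum>i=1..N. m i) m k l"

locale stochastic_matrix =
  fixes N :: nat and P :: "nat \<Rightarrow> nat \<Rightarrow> real"
  assumes P_nonneg: "\<And>k l. k \<in> {1..N} \<Longrightarrow> l \<in> {1..N} \<Longrightarrow> 0 \<le> P k l"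
    and P_sum: "\<And>k. k \<in> {1..N} \<Longrightarrow> (\<Sum>l=1..N. P k l) = 1"
begin

lemma pathw_nonneg: "k \<in> {1..N} \<Longrightarrow> 0 \<le> pathw N P n m k l"
  by (induction n arbitrary: m k) (auto intro!: sum_nonneg mult_nonneg_nonneg add_nonneg_nonneg P_nonneg simp del: atLeastAtMost_iff)

lemma pathw_le_1: "k \<in> {1..N} \<Longrightarrow> pathw N P n m k l \<le> 1"
proof (induction n arbitrary: m k)
  case (Suc n)
  have "(\<Sum>j=1..N. P k j * pathw N P n (m(k := m k - 1)) j l) \<le> (\<Sum>j=1..N. P k j * 1)"
    by (intro sum_mono mult_left_mono P_nonneg Suc) (use Suc.prems in auto)
  then show ?case using P_sum[OF Suc.prems] by (cases n) auto
qed simp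

lemma path_weight_bounds:
  assumes "k \<in> {1..N}"
  shows "0 \<le> path_weight N P m k l" "path_weight N P m k l \<le> 1" "\<bar>path_weight N P m k l\<bar> \<le> 1"
  unfolding path_weight_def using pathw_nonneg[OF assms] pathw_le_1[OF assms] by (auto simp: abs_le_iff)

lemma sum_upd_Suc:
  assumes "k \<in> {1..N}"
  shows "(\<Sum>i=1..N. (m(k := Suc (m k))) i) = Suc (\<Sum>i=1..N. m i)"
proof -
  have "(\<Sum>i\<in>{1..N}-{k}. (m(k := Suc (m k))) i) = (\<Sum>i\<in>{1..N}-{k}. m i)" by (rule sum.cong) auto
  then show ?thesis
    using assms sum.remove[of "{1..N}" k "m(k := Suc (m k))"] sum.remove[of "{1..N}" k m] by auto
qed

lemma path_weight_Suc:
  assumes "k \<in> {1..N}"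
  shows "path_weight N P (m(k := Suc (m k))) k l
    = (if (\<forall>i\<in>{1..N}. m i = 0) \<and> k = l then 1 else 0) + (\<Sum>j=1..N. P k j * path_weight N P m j l)"
  unfolding path_weight_def sum_upd_Suc[OF assms] by auto

lemma path_weight_0: "k \<in> {1..N} \<Longrightarrow> m k = 0 \<Longrightarrow> path_weight N P m k l = 0"
  unfolding path_weight_def by (cases "\<Sum>i=1..N. m i") auto

section \<open>Generating functions of path weights\<close>

definition path_gf :: "(nat \<Rightarrow> real) \<Rightarrow> nat \<Rightarrow> nat \<Rightarrow> real" where
  "path_gf x k l = psum {1..N} (\<lambda>i n. x i ^ n) (\<lambda>m. if \<exists>i\<in>{1..N}. m i \<noteq> 0 then path_weight N P m k l else 0)"

lemma path_gf_alt: "k \<in> {1..N} \<Longrightarrow> path_gf x k l = psum {1..N} (\<lambda>i n. x i ^ n) (\<lambda>m. path_weight N P m k l)"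
  unfolding path_gf_def by (intro arg_cong[of _ _ "psum _ _"] ext) (auto simp: path_weight_0)

lemma weights_geometric:
  assumes "\<And>i. i \<in> {1..N} \<Longrightarrow> 0 \<le> x i \<and> x i < (1::real)"
  shows "weights {1..N} (\<lambda>i n. x i ^ n)"
  by standard (use assms in \<open>auto intro!: norm_summable_imp_summable_on summable_geometric simp del: atLeastAtMost_iff simp: power_abs\<close>)

text \<open>Removing the first letter k lowers one count by 1 and costs one factor
  \<open>x k\<close>. This is a bijection from the indices with \<open>m k \<noteq> 0\<close> onto
  all indices, and on the remaining ones the weight vanishes.\<close>

lemma path_gf_eq:
  assumes x: "\<And>i. i \<in> {1..N} \<Longrightarrow> 0 \<le> x i \<and> x i < 1" and k: "k \<in> {1..N}"
  shows "path_gf x k l = x k * ((if k = l then 1 else 0) + (\<Sum>j=1..N. P k j * path_gf x j l))"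
proof -
  interpret weights "{1..N}" "\<lambda>i n. x i ^ n" by (rule weights_geometric[OF x])
  let ?I = "{1..N}" and ?E = "PiE {1..N} (\<lambda>_. UNIV :: nat set)"
  let ?\<phi> = "\<lambda>m :: nat \<Rightarrow> nat. m(k := Suc (m k))"
  let ?W = "\<lambda>m. \<Prod>i\<in>?I. x i ^ (m i)"
  let ?\<delta> = "\<lambda>m :: nat \<Rightarrow> nat. if (\<forall>i\<in>?I. m i = 0) \<and> k = l then 1 else 0 :: real"
  have inj: "inj_on ?\<phi> ?E"
    by (rule inj_onI) (metis Suc_inject fun_upd_apply fun_upd_triv fun_upd_upd)
  have img: "?\<phi> ` ?E = {m \<in> ?E. m k \<noteq> 0}"
  proof (intro equalityI subsetI)
    fix m assume m: "m \<in> {m \<in> ?E. m k \<noteq> 0}"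
    then have "m = ?\<phi> (m(k := m k - 1))" "m(k := m k - 1) \<in> ?E"
      using k by (auto simp: PiE_def extensional_def)
    then show "m \<in> ?\<phi> ` ?E" by blast
  qed (use k in \<open>auto simp: PiE_def extensional_def\<close>)
  have W\<phi>: "?W (?\<phi> m) = x k * ?W m" for m
  proof -
    have "(\<Prod>i\<in>?I-{k}. x i ^ (?\<phi> m) i) = (\<Prod>i\<in>?I-{k}. x i ^ m i)" by (rule prod.cong) auto
    then show ?thesis
      using k prod.remove[of ?I k "\<lambda>i. x i ^ (?\<phi> m) i"] prod.remove[of ?I k "\<lambda>i. x i ^ m i"] by auto
  qed
  have b1: "\<bar>?\<delta> m\<bar> \<le> 1" for m by auto
  have b2: "j \<in> ?I \<Longrightarrow> \<bar>P k j * path_weight N P m j l\<bar> \<le> P k j" for j m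
    using path_weight_bounds(3)[of j m l] P_nonneg[OF k, of j] by (auto simp: abs_mult mult_left_le)
  have b3: "\<bar>\<Sum>j=1..N. P k j * path_weight N P m j l\<bar> \<le> (\<Sum>j=1..N. P k j)" for m
    by (rule order_trans[OF sum_abs]) (intro sum_mono b2)
  have "path_gf x k l = (\<Sum>\<^sub>\<infinity>m\<in>?E. ?W m * path_weight N P m k l)"
    by (simp add: path_gf_alt[OF k] psum_def)
  also have "\<dots> = (\<Sum>\<^sub>\<infinity>m\<in>?\<phi> ` ?E. ?W m * path_weight N P m k l)"
    unfolding img by (rule infsum_cong_neutral) (use path_weight_0[OF k] in auto)
  also have "\<dots> = (\<Sum>\<^sub>\<infinity>m\<in>?E. ?W (?\<phi> m) * path_weight N P (?\<phi> m) k l)"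
    by (subst infsum_reindex[OF inj]) (simp add: o_def)
  also have "\<dots> = (\<Sum>\<^sub>\<infinity>m\<in>?E. x k * (?W m * (?\<delta> m + (\<Sum>j=1..N. P k j * path_weight N P m j l))))"
    by (rule infsum_cong) (simp only: W\<phi> path_weight_Suc[OF k] mult.assoc)
  also have "\<dots> = x k * psum ?I (\<lambda>i n. x i ^ n) (\<lambda>m. ?\<delta> m + (\<Sum>j=1..N. P k j * path_weight N P m j l))"
    unfolding psum_def by (rule infsum_cmult_right')
  also have "psum ?I (\<lambda>i n. x i ^ n) (\<lambda>m. ?\<delta> m + (\<Sum>j=1..N. P k j * path_weight N P m j l))
      = psum ?I (\<lambda>i n. x i ^ n) ?\<delta> + (\<Sum>j=1..N. P k j * path_gf x j l)"
    by (subst psum_add[OF b1 b3], subst psum_sum[OF _ b2])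
       (auto simp: psum_cmult path_gf_alt intro!: sum.cong)
  \<comment> \<open>Among the extensional indices only one has all counts 0, so the sum has a single
    term.\<close>
  also have "psum ?I (\<lambda>i n. x i ^ n) ?\<delta> = (\<Sum>\<^sub>\<infinity>m\<in>{\<lambda>i\<in>?I. 0 :: nat}. if k = l then 1 else 0)"
    unfolding psum_def
  proof (rule infsum_cong_neutral[where S = ?E and T = "{\<lambda>i\<in>?I. 0 :: nat}"])
    fix m assume "m \<in> ?E - {\<lambda>i\<in>?I. 0 :: nat}"
    then have m: "m \<in> ?E" "m \<noteq> (\<lambda>i\<in>?I. 0)" by auto
    have "m = (\<lambda>i\<in>?I. 0)" if "\<forall>i\<in>?I. m i = 0"
      by (rule PiE_ext[OF m(1)]) (use that in auto)
    then have "\<not> (\<forall>i\<in>?I. m i = 0)" using m by blast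
    then show "?W m * ?\<delta> m = 0" by auto
  next
    fix m assume "m \<in> ?E \<inter> {\<lambda>i\<in>?I. 0 :: nat}"
    then show "?W m * ?\<delta> m = (if k = l then 1 else 0)" by auto
  qed auto
  finally show ?thesis by simp
qed

text \<open>Maximum principle: the difference d of two solutions satisfies \<open>d = x P d\<close>.
  Where the absolute value of d is largest, a stochastic row and a factor x < 1 can reproduce it
  only if it is 0.\<close>

lemma path_gf_unique:
  assumes x: "\<And>i. i \<in> {1..N} \<Longrightarrow> 0 \<le> x i \<and> x i < 1"
    and R: "\<And>k. k \<in> {1..N} \<Longrightarrow> R k = x k * ((if k = l then 1 else 0) + (\<Sum>j=1..N. P k j * R j))"
    and k: "k \<in> {1..N}"
  shows "R k = path_gf x k l"
proof -
  define d where "d k = R k - path_gf x k l" for k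
  have d: "d k = x k * (\<Sum>j=1..N. P k j * d j)" if "k \<in> {1..N}" for k
    using R[OF that] path_gf_eq[OF x that, where l = l] unfolding d_def
    by (simp add: algebra_simps sum_subtractf)
  let ?M = "Max ((\<lambda>k. \<bar>d k\<bar>) ` {1..N})"
  have "?M \<in> (\<lambda>k. \<bar>d k\<bar>) ` {1..N}" by (rule Max_in) (use k in auto)
  then obtain j0 where j0: "j0 \<in> {1..N}" "?M = \<bar>d j0\<bar>" by blast
  have le: "\<bar>d j\<bar> \<le> \<bar>d j0\<bar>" if "j \<in> {1..N}" for j
    unfolding j0(2)[symmetric] using that by (intro Max_ge) auto
  have "\<bar>\<Sum>j=1..N. P j0 j * d j\<bar> \<le> (\<Sum>j=1..N. P j0 j * \<bar>d j0\<bar>)"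
    by (rule order_trans[OF sum_abs])
       (use j0 P_nonneg le in \<open>auto simp: abs_mult intro!: sum_mono mult_left_mono\<close>)
  also have "\<dots> = \<bar>d j0\<bar>" using P_sum[OF j0(1)] by (simp add: sum_distrib_right[symmetric])
  finally have "x j0 * \<bar>\<Sum>j=1..N. P j0 j * d j\<bar> \<le> x j0 * \<bar>d j0\<bar>"
    using x[OF j0(1)] by (intro mult_left_mono) auto
  moreover have "\<bar>d j0\<bar> = x j0 * \<bar>\<Sum>j=1..N. P j0 j * d j\<bar>"
    using d[OF j0(1)] x[OF j0(1)] by (simp add: abs_mult)
  ultimately have "(1 - x j0) * \<bar>d j0\<bar> \<le> 0" by (simp add: algebra_simps)
  then have "d j0 = 0" using x[OF j0(1)] by (simp add: mult_le_0_iff)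
  then show ?thesis using le[OF k] by (simp add: d_def)
qed

section \<open>Exponential decay for paths visiting a state exactly once\<close>

definition arcs_on :: "(nat \<times> nat) set" where
  "arcs_on = {(a, b). a \<in> {1..N} \<and> b \<in> {1..N} \<and> 0 < P a b}"

text \<open>\<open>f j = 1 - \<gamma> ^ d j\<close>, where \<open>d j\<close> is the distance from \<open>j\<close> to \<open>i\<close>: the step along a shortest
  path to \<open>i\<close> outweighs all others as soon as \<open>\<gamma>\<close> is half the least positive entry.\<close>

lemma lyapunov:
  assumes i: "i \<in> {1..N}" and conn: "\<And>j. j \<in> {1..N} \<Longrightarrow> (j, i) \<in> arcs_on\<^sup>*"
  shows "\<exists>(f :: nat \<Rightarrow> real) \<theta>. 0 < \<theta> \<and> \<theta> < 1 \<and>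
    (\<forall>j\<in>{1..N} - {i}. 1 / 2 \<le> f j \<and> f j \<le> 1) \<and>
    (\<forall>j\<in>{1..N} - {i}. (\<Sum>j'\<in>{1..N}-{i}. P j j' * f j') \<le> \<theta> * f j)"
proof -
  let ?I = "{1..N}"
  define p where "p = Min (insert 1 {x \<in> (\<lambda>(a,b). P a b) ` (?I \<times> ?I). 0 < x})"
  have fin: "finite (insert 1 {x \<in> (\<lambda>(a,b). P a b) ` (?I \<times> ?I). 0 < x})" by simp
  have p0: "0 < p" unfolding p_def by (subst Min_gr_iff[OF fin]) auto
  have p1: "p \<le> 1" unfolding p_def by (rule Min_le[OF fin]) auto
  have pP: "p \<le> P a b" if "(a, b) \<in> arcs_on" for a b
    unfolding p_def by (rule Min_le[OF fin]) (use that in \<open>auto simp: arcs_on_def\<close>)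
  define \<gamma> where "\<gamma> = p / 2"
  have \<gamma>: "0 < \<gamma>" "\<gamma> \<le> 1 / 2" using p0 p1 by (auto simp: \<gamma>_def)
  define d where "d j = (LEAST n. (j, i) \<in> arcs_on ^^ n)" for j
  have dj: "(j, i) \<in> arcs_on ^^ d j" if "j \<in> ?I" for j
    using conn[OF that] unfolding d_def rtrancl_power by (rule LeastI_ex)
  have dle: "d j \<le> n" if "(j, i) \<in> arcs_on ^^ n" for j n
    unfolding d_def using that by (rule Least_le)
  have di: "d i = 0" using dle[of i 0] by auto
  have dpos: "d j \<noteq> 0" if "j \<in> ?I" "j \<noteq> i" for j using dj[OF that(1)] that by (cases "d j") auto
  define D where "D = Max (d ` ?I)"
  have D: "d j \<le> D" if "j \<in> ?I" for j unfolding D_def by (rule Max_ge) (use that in auto)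
  define f where "f j = 1 - \<gamma> ^ d j" for j
  \<comment> \<open>The exponent \<open>Suc D\<close> instead of D keeps \<theta> at least 1/2 even
    if D = 0.\<close>
  define \<theta> where "\<theta> = 1 - \<gamma> ^ Suc D"
  have g: "\<gamma> ^ Suc D \<le> 1 / 2"
    using power_decreasing[of 1 "Suc D" \<gamma>] \<gamma> by (simp del: power_Suc)
  have g0: "0 < \<gamma> ^ Suc D" using \<gamma> by simp
  show ?thesis
  proof (intro exI[of _ f] exI[of _ \<theta>] conjI ballI)
    show "0 < \<theta>" "\<theta> < 1" using g g0 by (auto simp: \<theta>_def simp del: power_Suc)
    fix j assume j: "j \<in> ?I - {i}"
    then obtain n where n: "d j = Suc n" using dpos[of j] by (cases "d j") auto
    have "\<gamma> ^ d j \<le> 1 / 2" using power_decreasing[of 1 "d j" \<gamma>] \<gamma> n by (simp del: power_Suc)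
    then show "1 / 2 \<le> f j" "f j \<le> 1" using \<gamma> by (auto simp: f_def)
    obtain y where y: "(j, y) \<in> arcs_on" "(y, i) \<in> arcs_on ^^ n"
      using dj[of j] j n relpow_Suc_D2 by (metis DiffD1)
    have yI: "y \<in> ?I" using y by (auto simp: arcs_on_def)
    have jI: "j \<in> ?I" using j by auto
    \<comment> \<open>The neighbour y on a shortest path is at distance at most n and has
      probability at least p = 2 \<gamma>, so one step at least doubles the mean of
      \<open>\<gamma> ^ d\<close>.\<close>
    have "2 * \<gamma> ^ d j = p * \<gamma> ^ n" by (simp add: n \<gamma>_def)
    also have "\<dots> \<le> P j y * \<gamma> ^ d y"
      by (intro mult_mono pP y power_decreasing dle) (use \<gamma> P_nonneg[OF jI yI] in auto)
    also have "\<dots> \<le> (\<Sum>j'\<in>?I. P j j' * \<gamma> ^ d j')"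
      by (rule member_le_sum[of y ?I "\<lambda>j'. P j j' * \<gamma> ^ d j'"])
         (use yI \<gamma> P_nonneg[OF jI] in auto)
    finally have 1: "2 * \<gamma> ^ d j \<le> (\<Sum>j'\<in>?I. P j j' * \<gamma> ^ d j')" .
    have "(\<Sum>j'\<in>?I-{i}. P j j' * f j') = (\<Sum>j'\<in>?I. P j j' * f j')"
      by (rule sum.mono_neutral_left) (auto simp: f_def di)
    also have "\<dots> = 1 - (\<Sum>j'\<in>?I. P j j' * \<gamma> ^ d j')"
      using P_sum[OF jI] by (simp add: f_def algebra_simps sum_subtractf)
    also have "\<dots> \<le> f j - \<gamma> ^ d j" using 1 by (simp add: f_def)
    also have "\<dots> \<le> f j - \<gamma> ^ Suc D * 1"
      using power_decreasing[of "d j" "Suc D" \<gamma>] D[OF jI] \<gamma> by simp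
    also have "\<dots> \<le> f j - \<gamma> ^ Suc D * f j"
      using g0 \<gamma> by (intro diff_left_mono mult_left_mono) (auto simp: f_def)
    finally show "(\<Sum>j'\<in>?I-{i}. P j j' * f j') \<le> \<theta> * f j" by (simp add: \<theta>_def algebra_simps)
  qed
qed

text \<open>A path with one visit to i is a stretch avoiding i, the visit, and another stretch
  avoiding i; along each stretch the Lyapunov function yields a factor \<theta> per step. Convolving
  two geometric sequences of equal ratio would produce an extra factor n, so the first stretch is
  estimated with the larger ratio \<theta>' halfway between \<theta> and 1.\<close>

lemma path_weight_decay1:
  assumes i: "i \<in> {1..N}" and conn: "\<And>j. j \<in> {1..N} \<Longrightarrow> (j, i) \<in> arcs_on\<^sup>*"
  shows "\<exists>A r. 0 \<le> A \<and> 0 < r \<and> r < 1 \<and> (\<forall>m. \<forall>k\<in>{1..N}. \<forall>l. m i = 1 \<longrightarrow> path_weight N P m k l \<le> A * r ^ (\<Sum>j=1..N. m j))"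
proof -
  obtain f \<theta> where f\<theta>: "0 < \<theta> \<and> \<theta> < 1 \<and>
    (\<forall>j\<in>{1..N} - {i}. 1 / 2 \<le> f j \<and> f j \<le> 1) \<and>
    (\<forall>j\<in>{1..N} - {i}. (\<Sum>j'\<in>{1..N}-{i}. P j j' * f j') \<le> \<theta> * f j)"
    using lyapunov[OF i conn] by blast
  then have \<theta>: "0 < \<theta>" "\<theta> < 1"
    and f: "\<And>j. j \<in> {1..N} - {i} \<Longrightarrow> 1 / 2 \<le> f j \<and> f j \<le> 1"
    and Pf: "\<And>j. j \<in> {1..N} - {i} \<Longrightarrow> (\<Sum>j'\<in>{1..N}-{i}. P j j' * f j') \<le> \<theta> * f j"
    by (auto simp only:)
  \<comment> \<open>Chosen so that K \<theta> f \<ge> 1 for f \<ge> 1/2, which is the claim for a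
    single letter.\<close>
  define K where "K = 2 / \<theta>"
  have K: "0 < K" "2 = K * \<theta>" "1 \<le> K" using \<theta> by (auto simp: K_def)
  have split: "(\<Sum>j=1..N. F j) = F i + (\<Sum>j\<in>{1..N}-{i}. F j)" for F :: "nat \<Rightarrow> real"
    using i by (simp add: sum.remove)
  have c0: "pathw N P n m i l = 0" if "m i = 0" for n m l using that by (cases n) auto
  have claim0: "k \<in> {1..N} - {i} \<Longrightarrow> m i = 0 \<Longrightarrow> pathw N P n m k l \<le> K * \<theta> ^ n * f k" for n m k l
  proof (induction n arbitrary: m k)
    case 0
    then show ?case using K f[of k] by auto
  next
    case (Suc n)
    show ?case
    proof (cases "n = 0")
      case True
      have "pathw N P (Suc n) m k l \<le> 1" by (rule pathw_le_1) (use Suc in auto)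
      also have "\<dots> \<le> K * \<theta> * f k" using f[OF Suc.prems(1)] K(2) by simp
      finally show ?thesis using True by simp
    next
      case False
      let ?m = "m(k := m k - 1)"
      have m0: "?m i = 0" using Suc.prems by auto
      have "(\<Sum>j=1..N. P k j * pathw N P n ?m j l) = (\<Sum>j\<in>{1..N}-{i}. P k j * pathw N P n ?m j l)"
        unfolding split c0[of ?m, OF m0] by simp
      also have "\<dots> \<le> (\<Sum>j\<in>{1..N}-{i}. P k j * (K * \<theta> ^ n * f j))"
        by (intro sum_mono mult_left_mono Suc.IH m0 P_nonneg) (use Suc.prems in auto)
      also have "\<dots> = K * \<theta> ^ n * (\<Sum>j\<in>{1..N}-{i}. P k j * f j)"
        by (simp add: sum_distrib_left mult_ac)
      also have "\<dots> \<le> K * \<theta> ^ n * (\<theta> * f k)"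
        by (intro mult_left_mono Pf Suc.prems) (use K \<theta> in auto)
      finally have 1: "(\<Sum>j=1..N. P k j * pathw N P n ?m j l) \<le> K * \<theta> ^ Suc n * f k" by (simp add: mult_ac)
      have "0 \<le> K * \<theta> ^ Suc n * f k" using K \<theta> f[OF Suc.prems(1)] by simp
      moreover have "pathw N P (Suc n) m k l \<le> max 0 (\<Sum>j=1..N. P k j * pathw N P n ?m j l)"
        using False by auto
      ultimately show ?thesis using 1 by linarith
    qed
  qed
  define \<theta>' where "\<theta>' = (1 + \<theta>) / 2"
  have \<theta>': "\<theta> < \<theta>'" "\<theta>' < 1" "0 < \<theta>'" using \<theta> by (auto simp: \<theta>'_def)
  \<comment> \<open>As \<theta>' - \<theta> = (1 - \<theta>) / 2, this makes B (\<theta>' -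
    \<theta>) f \<ge> 1. That surplus pays for the step into i in the induction of
    \<open>claim1\<close>.\<close>
  define B where "B = 4 / (1 - \<theta>)"
  have B: "2 \<le> B" "1 \<le> B * (\<theta>' - \<theta>) / 2" using \<theta> by (auto simp: B_def \<theta>'_def field_simps)
  \<comment> \<open>Dividing by \<theta>' accounts for the letter i itself.\<close>
  define K1 where "K1 = K / \<theta>'"
  have K1: "0 < K1" "K = K1 * \<theta>'" using K \<theta>' by (auto simp: K1_def)
  have ki: "pathw N P n m i l \<le> K1 * \<theta>' ^ n" if m: "m i = 1" for n m l
  proof (cases n)
    case 0
    then show ?thesis using K1 by simp
  next
    case (Suc n')
    show ?thesis
    proof (cases "n' = 0")
      case True
      have "pathw N P n m i l \<le> 1" by (rule pathw_le_1[OF i])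
      then show ?thesis using True Suc K K1 by simp
    next
      case False
      let ?m = "m(i := m i - 1)"
      have m0: "?m i = 0" using m by auto
      have "(\<Sum>j=1..N. P i j * pathw N P n' ?m j l) \<le> (\<Sum>j=1..N. P i j * (K * \<theta> ^ n'))"
      proof (intro sum_mono mult_left_mono P_nonneg i)
        fix j assume j: "j \<in> {1..N}"
        show "pathw N P n' ?m j l \<le> K * \<theta> ^ n'"
        proof (cases "j = i")
          case True
          then show ?thesis using c0[of ?m, OF m0] K \<theta> by simp
        next
          case False
          then have "pathw N P n' ?m j l \<le> K * \<theta> ^ n' * f j" by (intro claim0 m0) (use j in auto)
          also have "\<dots> \<le> K * \<theta> ^ n' * 1" by (intro mult_left_mono) (use f[of j] j False K \<theta> in auto)
          finally show ?thesis by simp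
        qed
      qed auto
      also have "\<dots> = K * \<theta> ^ n'" using P_sum[OF i] by (simp add: sum_distrib_right[symmetric])
      also have "\<dots> \<le> K * \<theta>' ^ n'" by (intro mult_left_mono power_mono) (use K \<theta> \<theta>' in auto)
      also have "\<dots> = K1 * \<theta>' ^ n" by (simp add: Suc K1(2) mult_ac)
      finally show ?thesis using False m Suc by simp
    qed
  qed
  have claim1: "k \<in> {1..N} - {i} \<Longrightarrow> m i = 1 \<Longrightarrow> pathw N P n m k l \<le> K1 * \<theta>' ^ n * (B * f k)" for n m k l
  proof (induction n arbitrary: m k)
    case 0
    then show ?case using K1 B f[of k] by auto
  next
    case (Suc n)
    have Bf: "1 \<le> B * f k" using mult_mono[of 2 B "1/2" "f k"] B f[OF Suc.prems(1)] by simp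
    show ?case
    proof (cases "n = 0")
      case True
      have "pathw N P (Suc n) m k l \<le> 1" by (rule pathw_le_1) (use Suc in auto)
      also have "1 \<le> K1 * \<theta>' * (B * f k)"
        using mult_mono[of 1 K 1 "B * f k"] Bf K K1 by simp
      finally show ?thesis using True by simp
    next
      case False
      let ?m = "m(k := m k - 1)"
      have m1: "?m i = 1" using Suc.prems by auto
      have kI: "k \<in> {1..N}" using Suc.prems by auto
      have Pki: "P k i \<le> 1"
        using member_le_sum[of i "{1..N}" "P k"] P_sum[OF kI] P_nonneg[OF kI] i by auto
      have "(\<Sum>j=1..N. P k j * pathw N P n ?m j l)
          = P k i * pathw N P n ?m i l + (\<Sum>j\<in>{1..N}-{i}. P k j * pathw N P n ?m j l)"
        unfolding split ..
      also have "\<dots> \<le> 1 * (K1 * \<theta>' ^ n) + (\<Sum>j\<in>{1..N}-{i}. P k j * (K1 * \<theta>' ^ n * (B * f j)))"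
        by (intro add_mono sum_mono mult_left_mono mult_mono Suc.IH m1 ki P_nonneg Pki)
           (use Suc.prems i pathw_nonneg in auto)
      also have "(\<Sum>j\<in>{1..N}-{i}. P k j * (K1 * \<theta>' ^ n * (B * f j))) = K1 * \<theta>' ^ n * B * (\<Sum>j\<in>{1..N}-{i}. P k j * f j)"
        by (simp add: sum_distrib_left mult_ac)
      also have "\<dots> \<le> K1 * \<theta>' ^ n * B * (\<theta> * f k)"
        by (intro mult_left_mono Pf Suc.prems) (use K1 \<theta>' B in auto)
      also have "1 * (K1 * \<theta>' ^ n) + K1 * \<theta>' ^ n * B * (\<theta> * f k) = K1 * \<theta>' ^ n * (1 + B * \<theta> * f k)"
        by (simp add: algebra_simps)
      also have "\<dots> \<le> K1 * \<theta>' ^ n * (\<theta>' * (B * f k))"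
      proof (intro mult_left_mono)
        have "1 \<le> (B * (\<theta>' - \<theta>)) * (1 / 2)" using B by simp
        also have "\<dots> \<le> (B * (\<theta>' - \<theta>)) * f k"
          by (intro mult_left_mono) (use f[OF Suc.prems(1)] B \<theta>' in auto)
        finally show "1 + B * \<theta> * f k \<le> \<theta>' * (B * f k)" by (simp add: algebra_simps)
      qed (use K1 \<theta>' in auto)
      finally have 1: "(\<Sum>j=1..N. P k j * pathw N P n ?m j l) \<le> K1 * \<theta>' ^ Suc n * (B * f k)"
        by (simp add: mult_ac fun_upd_def)
      have "0 \<le> K1 * \<theta>' ^ Suc n * (B * f k)" using K1 \<theta>' Bf by simp
      moreover have "pathw N P (Suc n) m k l \<le> max 0 (\<Sum>j=1..N. P k j * pathw N P n ?m j l)"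
        using False by auto
      ultimately show ?thesis using 1 by linarith
    qed
  qed
  have "pathw N P n m k l \<le> K1 * B * \<theta>' ^ n" if "m i = 1" "k \<in> {1..N}" for n m k l
  proof (cases "k = i")
    case True
    have "K1 * 1 * \<theta>' ^ n \<le> K1 * B * \<theta>' ^ n"
      by (intro mult_right_mono mult_left_mono) (use K1 B \<theta>' in auto)
    then show ?thesis using ki[of m n l, OF that(1)] True by simp
  next
    case False
    have "K1 * \<theta>' ^ n * (B * f k) \<le> K1 * \<theta>' ^ n * (B * 1)"
      by (intro mult_left_mono) (use f[of k] that False K1 B \<theta>' in auto)
    then show ?thesis using claim1[of k m n l] that False by (simp add: mult_ac)
  qed
  then show ?thesis
    using K1 B \<theta>' unfolding path_weight_def by (intro exI[of _ "K1 * B"] exI[of _ \<theta>']) auto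
qed

definition dens_coeff :: "nat \<Rightarrow> nat \<Rightarrow> (nat \<Rightarrow> nat) \<Rightarrow> real" where
  "dens_coeff k l m = path_weight N P (\<lambda>i. Suc (m i)) k l"

lemma dens_coeff_bounds:
  assumes "k \<in> {1..N}"
  shows "0 \<le> dens_coeff k l m" "dens_coeff k l m \<le> 1" "\<bar>dens_coeff k l m\<bar> \<le> 1"
  unfolding dens_coeff_def using path_weight_bounds[OF assms] by auto

text \<open>The probability generating function of Poisson variables. It converts geometric decay in
  the length of a path into exponential decay in the total Poisson mean, which will be proportional
  to time.\<close>

lemma pois_exp_geometric:
  assumes "finite A" "\<And>i. i \<in> A \<Longrightarrow> 0 \<le> y i" "0 < r" "r < 1"
  shows "pois_exp A y (\<lambda>m. c * (\<Prod>i\<in>A. r ^ m i)) = c * exp (- (1 - r) * (\<Sum>i\<in>A. y i))"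
proof -
  interpret W: weights A "\<lambda>i. poisw (y i)" by (rule weights_poisw) fact+
  have e: "((\<lambda>n. poisw z n * r ^ n) has_sum exp (- (1 - r) * z)) UNIV" if z: "0 \<le> z" for z
  proof (rule norm_summable_imp_has_sum)
    have "(\<lambda>n. exp (-z) * ((z * r) ^ n / fact n)) sums (exp (-z) * exp (z * r))"
      using exp_converges[of "z * r"] by (intro sums_mult) (simp add: field_simps)
    then have s: "(\<lambda>n. poisw z n * r ^ n) sums exp (- (1 - r) * z)"
      by (simp add: poisw_def power_mult_distrib exp_add[symmetric] algebra_simps)
    then show "(\<lambda>n. poisw z n * r ^ n) sums exp (- (1 - r) * z)" .
    show "summable (\<lambda>n. norm (poisw z n * r ^ n))"
      using s z assms by (simp add: abs_mult poisw_nonneg sums_iff)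
  qed
  interpret W': weights A "\<lambda>i n. poisw (y i) n * r ^ n"
    by standard (use assms e poisw_nonneg in \<open>auto simp: summable_on_def\<close>)
  have "pois_exp A y (\<lambda>m. c * (\<Prod>i\<in>A. r ^ m i)) = psum A (\<lambda>i n. poisw (y i) n * r ^ n) (\<lambda>_. c)"
    unfolding pois_exp_def psum_def by (intro infsum_cong) (simp add: prod.distrib mult_ac)
  also have "\<dots> = c * (\<Prod>i\<in>A. exp (- (1 - r) * y i))"
    unfolding W'.psum_const using e assms(2) by (intro arg_cong[of _ _ "\<lambda>x. c * x"] prod.cong) (auto intro!: infsumI)
  also have "(\<Prod>i\<in>A. exp (- (1 - r) * y i)) = exp (- (1 - r) * (\<Sum>i\<in>A. y i))"
    by (simp add: exp_sum[OF assms(1)] sum_distrib_left)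
  finally show ?thesis .
qed

lemma pois_exp_boundary_decay:
  assumes conn: "\<And>i j. i \<in> {1..N} \<Longrightarrow> j \<in> {1..N} \<Longrightarrow> (j, i) \<in> arcs_on\<^sup>*"
  shows "\<exists>A b. 0 \<le> A \<and> 0 < b \<and> (\<forall>k\<in>{1..N}. \<forall>l y. (\<forall>i\<in>{1..N}. 0 \<le> y i) \<longrightarrow> (\<exists>i\<in>{1..N}. y i = 0) \<longrightarrow>
      \<bar>pois_exp {1..N} y (dens_coeff k l)\<bar> \<le> A * exp (- b * (\<Sum>i=1..N. y i)))"
proof -
  have "\<forall>i\<in>{1..N}. \<exists>A r. 0 \<le> A \<and> 0 < r \<and> r < 1 \<and> (\<forall>m. \<forall>k\<in>{1..N}. \<forall>l. m i = 1 \<longrightarrow> path_weight N P m k l \<le> A * r ^ (\<Sum>j=1..N. m j))"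
    using path_weight_decay1 conn by blast
  then obtain A r where Ar: "\<And>i. i \<in> {1..N} \<Longrightarrow> 0 \<le> A i \<and> 0 < r i \<and> r i < 1"
    "\<And>i m k l. i \<in> {1..N} \<Longrightarrow> k \<in> {1..N} \<Longrightarrow> m i = 1 \<Longrightarrow> path_weight N P m k l \<le> A i * r i ^ (\<Sum>j=1..N. m j)"
    by metis
  define A' where "A' = Max (insert 0 (A ` {1..N}))"
  define b where "b = Min (insert 1 ((\<lambda>i. 1 - r i) ` {1..N}))"
  have A': "A i \<le> A'" if "i \<in> {1..N}" for i unfolding A'_def by (rule Max_ge) (use that in auto)
  have b': "b \<le> 1 - r i" if "i \<in> {1..N}" for i unfolding b_def by (rule Min_le) (use that in auto)
  have b0: "0 < b" unfolding b_def by (subst Min_gr_iff) (use Ar in auto)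
  have A0: "0 \<le> A'" unfolding A'_def by (rule Max_ge) auto
  have "\<bar>pois_exp {1..N} y (dens_coeff k l)\<bar> \<le> A' * exp (- b * (\<Sum>i=1..N. y i))"
    if k: "k \<in> {1..N}" and y: "\<forall>i\<in>{1..N}. 0 \<le> y i" and i: "i \<in> {1..N}" "y i = 0" for k l y i
  proof -
    interpret W: weights "{1..N}" "\<lambda>i. poisw (y i)" by (rule weights_poisw) (use y in auto)
    note r = Ar(1)[OF i(1)]
    have le1: "\<bar>A i * (\<Prod>j=1..N. r i ^ m j)\<bar> \<le> A i" for m
      using r by (auto simp: abs_mult abs_prod intro!: mult_left_le prod_le_1 power_le_one)
    have "pois_exp {1..N} y (dens_coeff k l) \<le> pois_exp {1..N} y (\<lambda>m. A i * (\<Prod>j=1..N. r i ^ m j))"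
      unfolding pois_exp_def
    proof (rule W.psum_mono[OF dens_coeff_bounds(3)[OF k] le1])
      fix m :: "nat \<Rightarrow> nat" assume "\<forall>i\<in>{1..N}. poisw (y i) (m i) \<noteq> 0"
      \<comment> \<open>A Poisson variable of mean 0 is 0; as \<open>dens_coeff\<close> raises every
        count by 1, the paths behind this coefficient visit i exactly once.\<close>
      then have "m i = 0" using i by (auto simp: poisw_def)
      then have "dens_coeff k l m \<le> A i * r i ^ (\<Sum>j=1..N. Suc (m j))"
        unfolding dens_coeff_def by (intro Ar(2) i k) auto
      also have "\<dots> \<le> A i * r i ^ (\<Sum>j=1..N. m j)"
        by (intro mult_left_mono power_decreasing sum_mono) (use r in auto)
      finally show "dens_coeff k l m \<le> A i * (\<Prod>j=1..N. r i ^ m j)" by (simp add: power_sum)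
    qed
    also have "\<dots> = A i * exp (- (1 - r i) * (\<Sum>i=1..N. y i))"
      by (rule pois_exp_geometric) (use y r in auto)
    also have "\<dots> \<le> A' * exp (- b * (\<Sum>i=1..N. y i))"
      by (intro mult_mono A' i) (use mult_right_mono[OF b'[OF i(1)], of "\<Sum>i=1..N. y i"] A0 y in \<open>auto intro!: sum_nonneg simp: algebra_simps\<close>)
    finally have "pois_exp {1..N} y (dens_coeff k l) \<le> A' * exp (- b * (\<Sum>i=1..N. y i))" .
    moreover have "0 \<le> pois_exp {1..N} y (dens_coeff k l)"
    proof -
      have "psum {1..N} (\<lambda>i. poisw (y i)) (\<lambda>_. 0) \<le> psum {1..N} (\<lambda>i. poisw (y i)) (dens_coeff k l)"
        by (rule W.psum_mono[of _ 0 _ 1]) (use dens_coeff_bounds[OF k] in auto)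
      then show ?thesis by (simp add: pois_exp_def psum_def)
    qed
    ultimately show ?thesis by simp
  qed
  then show ?thesis using A0 b0 by (intro exI[of _ A'] exI[of _ b]) auto
qed

end

section \<open>The simplex of occupation times\<close>

lemma nn_integral_prod_cart:
  fixes u :: "'d::finite \<Rightarrow> real \<Rightarrow> ennreal"
  assumes [measurable]: "\<And>j. u j \<in> borel_measurable borel"
  shows "(\<integral>\<^sup>+x. (\<Prod>j\<in>UNIV. u j (x $ j)) \<partial>(lborel :: (real ^ 'd) measure)) = (\<Prod>j\<in>UNIV. \<integral>\<^sup>+z. u j z \<partial>lborel)"
proof -
  let ?ax = "\<lambda>j. axis j 1 :: real ^ 'd"
  have inj: "inj ?ax" by (auto simp: inj_def axis_eq_axis)
  have B: "Basis = range ?ax" by (auto simp: Basis_vec_def)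
  define v where "v b = u (inv ?ax b)" for b
  have v: "v (?ax j) = u j" for j by (simp add: v_def inv_f_f[OF inj])
  have "(\<integral>\<^sup>+x. (\<Prod>j\<in>UNIV. u j (x $ j)) \<partial>(lborel :: (real ^ 'd) measure)) = (\<integral>\<^sup>+x. (\<Prod>b\<in>Basis. v b (x \<bullet> b)) \<partial>lborel)"
    unfolding B by (subst prod.reindex[OF inj]) (simp add: v cart_eq_inner_axis)
  also have "\<dots> = (\<Prod>b\<in>Basis. \<integral>\<^sup>+z. v b z \<partial>lborel)"
    by (rule nn_integral_lborel_prod) (auto simp: v_def)
  also have "\<dots> = (\<Prod>j\<in>UNIV. \<integral>\<^sup>+z. u j z \<partial>lborel)"
    unfolding B by (subst prod.reindex[OF inj]) (simp add: v)
  finally show ?thesis .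
qed

locale coords =
  fixes N :: nat and idx :: "'d::finite \<Rightarrow> nat"
  assumes N2: "2 \<le> N" and idx: "bij_betw idx UNIV {1..N - 1}"
begin

lemma card_d: "CARD('d) = N - 1"
  using bij_betw_same_card[OF idx] by simp

lemma states: "{1..N} = insert N (range idx)" and N_notin: "N \<notin> range idx"
  using idx N2 by (auto simp: bij_betw_def)

lemma idx_in: "idx j \<in> {1..N}" and N_in: "N \<in> {1..N}"
  using states by auto

lemma inj_idx: "inj idx" using idx by (simp add: bij_betw_def)

lemma state_cases:
  assumes "i \<in> {1..N}" obtains "i = N" | j where "i = idx j"
  using assms states by blast

text \<open>The simplex is parametrised by all coordinates but the one of the state \<open>N\<close>, which is recovered from
  the total time \<open>t\<close>.\<close>

definition crd :: "real \<Rightarrow> real ^ 'd \<Rightarrow> nat \<Rightarrow> real" where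
  "crd t x i = (if i = N then t - (\<Sum>j\<in>UNIV. x $ j) else x $ inv idx i)"

lemma crd_N [simp]: "crd t x N = t - (\<Sum>j\<in>UNIV. x $ j)"
  by (simp add: crd_def)

lemma crd_idx [simp]: "crd t x (idx j) = x $ j"
  using N_notin inj_idx by (auto simp: crd_def)

lemma sum_states: "(\<Sum>i=1..N. F i) = F N + (\<Sum>j\<in>UNIV. F (idx j))" for F :: "nat \<Rightarrow> 'b::comm_monoid_add"
  unfolding states using N_notin by (simp add: sum.reindex[OF inj_idx])

lemma prod_states: "(\<Prod>i=1..N. F i) = F N * (\<Prod>j\<in>UNIV. F (idx j))" for F :: "nat \<Rightarrow> 'b::comm_monoid_mult"
  unfolding states using N_notin by (simp add: prod.reindex[OF inj_idx])

lemma sum_crd: "(\<Sum>i=1..N. crd t x i) = t"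
  unfolding sum_states by simp

lemma continuous_crd [continuous_intros]:
  assumes "continuous_on S f" "continuous_on S g"
  shows "continuous_on S (\<lambda>s. crd (f s) (g s) i)"
  unfolding crd_def using assms by (cases "i = N") (auto intro!: continuous_intros)

lemma measurable_crd [measurable]:
  assumes "f \<in> borel_measurable M" "g \<in> borel_measurable M"
  shows "(\<lambda>s. crd (f s) (g s) i) \<in> borel_measurable M"
proof -
  have "(\<lambda>p. crd (fst p) (snd p) i) \<in> borel_measurable borel"
    by (intro borel_measurable_continuous_onI continuous_intros)
  then have "(\<lambda>p. crd (fst p) (snd p) i) \<in> borel_measurable (borel \<Otimes>\<^sub>M borel)" by (simp add: borel_prod)
  from measurable_compose[OF measurable_Pair[OF assms] this] show ?thesis by simp
qed

lemma crd_affine: "crd t ((1 - e) *\<^sub>R x + e *\<^sub>R y) i = (1 - e) * crd t x i + e * crd t y i"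
proof (cases "i = N")
  case True
  have "(\<Sum>j\<in>UNIV. ((1 - e) *\<^sub>R x + e *\<^sub>R y) $ j) = (1 - e) * (\<Sum>j\<in>UNIV. x $ j) + e * (\<Sum>j\<in>UNIV. y $ j)"
    by (simp add: sum.distrib sum_distrib_left)
  then show ?thesis using True by (simp only: crd_N) (simp add: algebra_simps)
qed (simp add: crd_def)

definition csimplex :: "real \<Rightarrow> (real ^ 'd) set" where
  "csimplex t = {x. \<forall>i\<in>{1..N}. 0 \<le> crd t x i}"

definition osimplex :: "real \<Rightarrow> (real ^ 'd) set" where
  "osimplex t = {x. \<forall>i\<in>{1..N}. 0 < crd t x i}"

lemma csimplexD: "x \<in> csimplex t \<Longrightarrow> i \<in> {1..N} \<Longrightarrow> 0 \<le> crd t x i"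
  unfolding csimplex_def by blast

lemma open_osimplex: "open (osimplex t)"
proof -
  have "osimplex t = (\<Inter>i\<in>{1..N}. {x. 0 < crd t x i})" by (auto simp: osimplex_def)
  also have "open \<dots>" by (auto intro!: open_INT open_Collect_less continuous_intros)
  finally show ?thesis .
qed

lemma closed_simplex: "closed (csimplex t)"
proof -
  have "csimplex t = (\<Inter>i\<in>{1..N}. {x. 0 \<le> crd t x i})" by (auto simp: csimplex_def)
  also have "closed \<dots>" by (auto intro!: closed_INT closed_Collect_le continuous_intros)
  finally show ?thesis .
qed

lemma convex_osimplex: "convex (osimplex t)"
  unfolding convex_alt osimplex_def
proof (intro ballI allI impI CollectI)
  fix x y e i assume A: "x \<in> {x. \<forall>i\<in>{1..N}. 0 < crd t x i}" "y \<in> {x. \<forall>i\<in>{1..N}. 0 < crd t x i}"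
    "0 \<le> (e::real) \<and> e \<le> 1" "i \<in> {1..N}"
  show "0 < crd t ((1 - e) *\<^sub>R x + e *\<^sub>R y) i"
  proof (cases "e = 0")
    case True then show ?thesis using A by (simp add: crd_affine)
  next
    case False
    then show ?thesis unfolding crd_affine using A by (intro add_nonneg_pos mult_nonneg_nonneg mult_pos_pos) (auto intro: less_imp_le)
  qed
qed

lemma osimplex_subset: "osimplex t \<subseteq> csimplex t"
  by (auto simp: osimplex_def csimplex_def intro: less_imp_le)

lemma closure_osimplex:
  assumes t: "0 < t" shows "closure (osimplex t) = csimplex t"
proof (rule antisym)
  show "closure (osimplex t) \<subseteq> csimplex t"
    by (rule closure_minimal[OF osimplex_subset closed_simplex])
  show "csimplex t \<subseteq> closure (osimplex t)"
  proof
    fix x assume x: "x \<in> csimplex t"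
    \<comment> \<open>The barycentre: its coordinate for the state N is \<open>t / N\<close> as
      well. Points of the closed simplex are approached along the segment towards it.\<close>
    define b :: "real ^ 'd" where "b = (\<chi> j. t / real N)"
    have b: "crd t b i = t / real N" if "i \<in> {1..N}" for i
      using that by (cases rule: state_cases) (use N2 in \<open>simp_all add: b_def card_d field_simps of_nat_diff\<close>)
    define X where "X n = (1 - 1 / real (Suc n)) *\<^sub>R x + (1 / real (Suc n)) *\<^sub>R b" for n
    have "X n \<in> osimplex t" for n
      unfolding osimplex_def
    proof (intro CollectI ballI)
      fix i assume i: "i \<in> {1..N}"
      have "0 \<le> (1 - 1 / real (Suc n)) * crd t x i" using x i by (intro mult_nonneg_nonneg) (auto simp: csimplex_def)
      moreover have "0 < 1 / real (Suc n) * crd t b i" using t N2 by (simp add: b[OF i])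
      ultimately show "0 < crd t (X n) i" by (simp add: X_def crd_affine)
    qed
    moreover have "X \<longlonglongrightarrow> (1 - 0) *\<^sub>R x + 0 *\<^sub>R b"
      unfolding X_def by (intro tendsto_intros LIMSEQ_Suc[OF lim_1_over_n] LIMSEQ_Suc[OF lim_1_over_n] | simp)+
    ultimately show "x \<in> closure (osimplex t)" unfolding closure_sequential by auto
  qed
qed

lemma simplex_bound: "x \<in> csimplex t \<Longrightarrow> 0 \<le> x $ j \<and> x $ j \<le> t"
proof -
  assume x: "x \<in> csimplex t"
  then have 0: "0 \<le> x $ j" for j using idx_in[of j] unfolding csimplex_def by (metis (mono_tags) crd_idx mem_Collect_eq)
  have "x $ j \<le> (\<Sum>j\<in>UNIV. x $ j)" by (rule member_le_sum) (use 0 in auto)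
  also have "\<dots> \<le> t" using x N_in unfolding csimplex_def by (metis (mono_tags, lifting) crd_N diff_ge_0_iff_ge mem_Collect_eq)
  finally show ?thesis using 0 by auto
qed

lemma simplex_empty: "t < 0 \<Longrightarrow> csimplex t = {}"
  using simplex_bound by fastforce

lemma compact_simplex: "compact (csimplex t)"
  unfolding compact_eq_bounded_closed
proof
  have "norm x \<le> (\<Sum>j\<in>(UNIV::'d set). t)" if "x \<in> csimplex t" for x
    by (rule order_trans[OF norm_le_l1_cart]) (intro sum_mono, use simplex_bound[OF that] in auto)
  then show "bounded (csimplex t)" unfolding bounded_iff by blast
qed (rule closed_simplex)

lemma crd_hyperplane_null:
  assumes "i \<in> {1..N}" shows "{x. crd t x i = 0} \<in> null_sets lborel"
proof -
  have "closed {x. crd t x i = 0}" by (intro closed_Collect_eq continuous_intros)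
  then have s: "{x. crd t x i = 0} \<in> sets borel" by auto
  have "negligible {x. crd t x i = 0}"
    using assms
  proof (cases rule: state_cases)
    case 1
    have ne: "(\<chi> j. (1 :: real)) \<noteq> (0 :: real ^ 'd)" by (simp add: vec_eq_iff)
    have "{x. crd t x i = 0} = {x. (\<chi> j. 1) \<bullet> x = t}" by (auto simp: 1 inner_vec_def)
    then show ?thesis using negligible_hyperplane[of "(\<chi> j. (1 :: real)) :: real ^ 'd" t] ne by simp
  next
    case (2 j)
    have "{x. crd t x i = 0} = {x. axis j 1 \<bullet> x = 0}"
      by (auto simp: 2 cart_eq_inner_axis inner_commute)
    then show ?thesis using negligible_hyperplane[of "axis j 1 :: real ^ 'd" 0] by simp
  qed
  then show ?thesis using s
    by (simp add: negligible_iff_null_sets null_sets_completion_iff)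
qed

lemma boundary_null: "{x. \<exists>i\<in>{1..N}. crd t x i = 0} \<in> null_sets lborel"
proof -
  have "{x. \<exists>i\<in>{1..N}. crd t x i = 0} = (\<Union>i\<in>{1..N}. {x. crd t x i = 0})" by auto
  also have "\<dots> \<in> null_sets lborel"
    by (rule null_sets_UN') (auto intro: crd_hyperplane_null)
  finally show ?thesis .
qed

lemma layer_sets: "{x \<in> csimplex t. crd t x i < \<sigma>} \<in> sets borel"
proof -
  have "open {x. crd t x i < \<sigma>}" by (intro open_Collect_less continuous_intros)
  then have "csimplex t \<inter> {x. crd t x i < \<sigma>} \<in> sets borel" using closed_simplex[of t] by auto
  also have "csimplex t \<inter> {x. crd t x i < \<sigma>} = {x \<in> csimplex t. crd t x i < \<sigma>}" by auto
  finally show ?thesis .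
qed

lemma lmeasurable_simplex: "csimplex t \<in> lmeasurable"
  using compact_simplex by (rule lmeasurable_compact)

section \<open>Volumes of simplices and of boundary layers\<close>

definition V :: real where "V = measure lebesgue (csimplex 1)"

lemma V_nonneg: "0 \<le> V" by (simp add: V_def)

lemma measure_simplex: "0 < t \<Longrightarrow> measure lebesgue (csimplex t) = t ^ CARD('d) * V"
proof -
  assume t: "0 < t"
  have c: "crd t (t *\<^sub>R x) i = t * crd 1 x i" for x i
    by (auto simp: crd_def sum_distrib_left algebra_simps)
  have "csimplex t = (\<lambda>x. t *\<^sub>R x + 0) ` csimplex 1"
  proof (intro equalityI subsetI)
    fix x assume x: "x \<in> csimplex t"
    have "x = t *\<^sub>R (x /\<^sub>R t)" using t by simp
    moreover have "x /\<^sub>R t \<in> csimplex 1"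
      unfolding csimplex_def
    proof (intro CollectI ballI)
      fix i assume "i \<in> {1..N}"
      then have "0 \<le> crd t x i" using x unfolding csimplex_def by blast
      then have "0 \<le> t * crd 1 (x /\<^sub>R t) i"
        using c[of "x /\<^sub>R t" i] t by simp
      then show "0 \<le> crd 1 (x /\<^sub>R t) i" using t by (simp add: zero_le_mult_iff)
    qed
    ultimately show "x \<in> (\<lambda>x. t *\<^sub>R x + 0) ` csimplex 1" by (intro image_eqI[of _ _ "x /\<^sub>R t"]) simp_all
  qed (use t in \<open>auto simp: csimplex_def c\<close>)
  then show ?thesis using t by (simp add: measure_lebesgue_affine[of t 0, simplified] V_def)
qed

text \<open>What remains of the simplex beyond the layer is a translate of the simplex of size t -
  \<sigma>. The layer thus has volume \<open>V * (t ^ d - (t - \<sigma>) ^ d)\<close>, where d is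
  the dimension, and Bernoulli's inequality makes this linear in \<sigma>. For \<sigma> \<ge> t the
  whole simplex is small enough.\<close>

lemma measure_layer:
  assumes t: "0 < t" and i: "i \<in> {1..N}" and s: "0 \<le> \<sigma>"
  shows "measure lebesgue {x \<in> csimplex t. crd t x i < \<sigma>} \<le> V * real CARD('d) * t ^ (CARD('d) - 1) * \<sigma>"
proof (cases "t \<le> \<sigma>")
  case True
  have "measure lebesgue {x \<in> csimplex t. crd t x i < \<sigma>} \<le> measure lebesgue (csimplex t)"
  proof (rule measure_mono_fmeasurable[OF _ _ lmeasurable_simplex])
    have "{x \<in> csimplex t. crd t x i < \<sigma>} \<in> sets borel"
      by (rule layer_sets)
    then show "{x \<in> csimplex t. crd t x i < \<sigma>} \<in> sets lebesgue" by simp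
  qed auto
  also have "\<dots> = V * 1 * t ^ (CARD('d) - 1) * t"
    using measure_simplex[OF t] by (simp add: power_eq_if[of t "CARD('d)"])
  also have "\<dots> \<le> V * real CARD('d) * t ^ (CARD('d) - 1) * \<sigma>"
    by (intro mult_mono) (use True t V_nonneg in \<open>auto simp: Suc_leI\<close>)
  finally show ?thesis .
next
  case False
  \<comment> \<open>Passing from total time t - \<sigma> to t and translating by v raises the
    coordinate of i by \<sigma> and no other. For i = N the change of total time alone has this
    effect.\<close>
  define v :: "real ^ 'd" where "v = (if i = N then 0 else \<sigma> *\<^sub>R axis (inv idx i) 1)"
  have cv: "crd t (v + y) l = crd (t - \<sigma>) y l + (if l = i then \<sigma> else 0)" if l: "l \<in> {1..N}" for y l
    using i
  proof (cases rule: state_cases)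
    case 1
    from l show ?thesis by (cases rule: state_cases) (use 1 N_notin in \<open>auto simp: v_def\<close>)
  next
    case (2 j)
    have "idx j \<noteq> N" using N_notin by auto
    have ax: "(\<Sum>j'\<in>UNIV. (axis j 1 :: real ^ 'd) $ j') = 1" by (simp add: axis_def)
    show ?thesis using l
      by (cases rule: state_cases)
         (use \<open>idx j \<noteq> N\<close> inj_idx ax in \<open>auto simp: 2 v_def sum.distrib sum_distrib_left[symmetric] axis_def inj_eq\<close>)
  qed
  have img: "csimplex t - {x \<in> csimplex t. crd t x i < \<sigma>} = (+) v ` csimplex (t - \<sigma>)"
  proof (intro equalityI subsetI)
    fix x assume x: "x \<in> csimplex t - {x \<in> csimplex t. crd t x i < \<sigma>}"
    have "x - v \<in> csimplex (t - \<sigma>)"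
      unfolding csimplex_def
    proof (intro CollectI ballI)
      fix l assume l: "l \<in> {1..N}"
      show "0 \<le> crd (t - \<sigma>) (x - v) l"
      proof -
        have "0 \<le> crd t x l" using x l unfolding csimplex_def by blast
        then show ?thesis using cv[OF l, of "x - v"] x by (cases "l = i") auto
      qed
    qed
    then show "x \<in> (+) v ` csimplex (t - \<sigma>)" by (intro image_eqI[of _ _ "x - v"]) auto
  next
    fix x assume "x \<in> (+) v ` csimplex (t - \<sigma>)"
    then obtain y where y: "x = v + y" "y \<in> csimplex (t - \<sigma>)" by auto
    then show "x \<in> csimplex t - {x \<in> csimplex t. crd t x i < \<sigma>}"
    proof -
      have "x \<in> csimplex t"
        unfolding csimplex_def
      proof (intro CollectI ballI)
        fix l assume l: "l \<in> {1..N}"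
        show "0 \<le> crd t x l" using csimplexD[OF y(2) l] cv[OF l, of y] s y(1) by auto
      qed
      moreover have "\<not> crd t x i < \<sigma>" using csimplexD[OF y(2) i] cv[OF i, of y] y(1) by auto
      ultimately show ?thesis by blast
    qed
  qed
  have L: "{x \<in> csimplex t. crd t x i < \<sigma>} \<in> lmeasurable"
  proof (rule fmeasurableI2[OF lmeasurable_simplex[of t]])
    have "{x \<in> csimplex t. crd t x i < \<sigma>} \<in> sets borel"
      by (rule layer_sets)
    then show "{x \<in> csimplex t. crd t x i < \<sigma>} \<in> sets lebesgue" by simp
  qed auto
  have "measure lebesgue (csimplex t - {x \<in> csimplex t. crd t x i < \<sigma>})
      = measure lebesgue (csimplex t) - measure lebesgue {x \<in> csimplex t. crd t x i < \<sigma>}"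
    by (rule measurable_measure_Diff) (use L lmeasurable_simplex in auto)
  then have "measure lebesgue {x \<in> csimplex t. crd t x i < \<sigma>} = t ^ CARD('d) * V - (t - \<sigma>) ^ CARD('d) * V"
    unfolding img measure_translation using measure_simplex[OF t] measure_simplex[of "t - \<sigma>"] False by simp
  also have "\<dots> = V * (t ^ CARD('d) - t ^ CARD('d) * (1 + (- \<sigma> / t)) ^ CARD('d))"
    using t by (simp add: power_mult_distrib[symmetric] algebra_simps)
  also have "\<dots> \<le> V * (t ^ CARD('d) - t ^ CARD('d) * (1 + real CARD('d) * (- \<sigma> / t)))"
    by (intro mult_left_mono diff_left_mono Bernoulli_inequality) (use V_nonneg t False s in \<open>auto simp: field_simps\<close>)
  also have "\<dots> = V * real CARD('d) * t ^ (CARD('d) - 1) * \<sigma>"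
    using t by (simp add: power_eq_if[of t "CARD('d)"] field_simps)
  finally show ?thesis .
qed

text \<open>Shifting by half a period \<open>\<pi> / \<zeta> $ j\<close> in the direction \<open>j\<close> flips the sign of the exponential,
  so the transform is an average of increments of \<open>f\<close>.\<close>

lemma fourier_decay:
  fixes f :: "real ^ 'd \<Rightarrow> real"
  assumes t: "0 < t" and tT: "t \<le> T" and fm: "f \<in> borel_measurable borel"
    and B: "\<And>x. \<bar>f x\<bar> \<le> B" and L: "0 \<le> L"
    and lip: "\<And>x y. x \<in> csimplex t \<Longrightarrow> y \<in> csimplex t \<Longrightarrow> \<bar>f x - f y\<bar> \<le> L * (\<Sum>i=1..N. \<bar>crd t x i - crd t y i\<bar>)"
    and out: "\<And>x. x \<notin> csimplex t \<Longrightarrow> f x = 0" and \<zeta>: "\<zeta> \<noteq> 0"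
  shows "norm (fourier f \<zeta>) \<le> (2 * L * T ^ CARD('d) * V + 4 * B * V * real CARD('d) * T ^ (CARD('d) - 1)) * (pi * real CARD('d)) / norm \<zeta>"
proof -
  let ?D = "real CARD('d)"
  have D0: "0 < ?D" by simp
  have B0: "0 \<le> B" using B[of 0] by linarith
  \<comment> \<open>The largest component of \<zeta> makes the shift shortest, of order 1 / norm
    \<zeta>.\<close>
  obtain j where j: "norm \<zeta> \<le> ?D * \<bar>\<zeta> $ j\<bar>"
  proof -
    have "Max (range (\<lambda>i. \<bar>\<zeta> $ i\<bar>)) \<in> range (\<lambda>i. \<bar>\<zeta> $ i\<bar>)" by (rule Max_in) auto
    then obtain j where j: "\<bar>\<zeta> $ j\<bar> = Max (range (\<lambda>i. \<bar>\<zeta> $ i\<bar>))" by force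
    have "norm \<zeta> \<le> (\<Sum>i\<in>UNIV. \<bar>\<zeta> $ i\<bar>)" by (rule norm_le_l1_cart)
    also have "\<dots> \<le> (\<Sum>i\<in>(UNIV::'d set). \<bar>\<zeta> $ j\<bar>)" unfolding j by (rule sum_mono) (auto intro!: Max_ge)
    finally show ?thesis using that[of j] by simp
  qed
  then have \<zeta>j: "\<zeta> $ j \<noteq> 0" using \<zeta> by auto
  define s where "s = pi / \<zeta> $ j"
  have sb: "\<bar>s\<bar> \<le> pi * ?D / norm \<zeta>"
  proof -
    have "\<bar>s\<bar> = pi / \<bar>\<zeta> $ j\<bar>" by (simp add: s_def)
    also have "\<dots> \<le> pi * ?D / norm \<zeta>" using j \<zeta> \<zeta>j D0 by (simp add: field_simps mult_left_mono)
    finally show ?thesis .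
  qed
  define h :: "real ^ 'd" where "h = s *\<^sub>R axis j 1"
  have \<zeta>h: "\<zeta> \<bullet> h = pi" using \<zeta>j by (simp add: h_def s_def inner_axis)
  define e where "e y = exp (\<i> * complex_of_real (\<zeta> \<bullet> y))" for y :: "real ^ 'd"
  have e_h: "e (h + y) = - e y" for y
    by (simp add: e_def inner_add_right \<zeta>h exp_add distrib_left exp_pi_i')
  have ne: "norm (e y) = 1" for y by (simp add: e_def norm_exp_eq_Re)
  have em[measurable]: "e \<in> borel_measurable borel"
    unfolding e_def by (intro borel_measurable_continuous_onI continuous_intros)
  note fm[measurable]
  have simplex_m[measurable]: "csimplex t \<in> sets borel" by (intro borel_closed closed_simplex)
  have fin: "emeasure lborel (csimplex t) < \<infinity>"
    using emeasure_bounded_finite[OF compact_imp_bounded[OF compact_simplex]] .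
  have iF: "integrable lborel (\<lambda>y. e y * complex_of_real (f y))"
  proof (rule Bochner_Integration.integrable_bound)
    show "integrable lborel (\<lambda>y. B * indicator (csimplex t) y)" using fin by auto
    show "AE y in lborel. norm (e y * complex_of_real (f y)) \<le> norm (B * indicator (csimplex t) y)"
      by (rule AE_I2) (use B B0 out in \<open>auto simp: norm_mult ne indicator_def\<close>)
  qed auto
  have tr: "(\<integral>y. e y * complex_of_real (f y) \<partial>lborel) = (\<integral>y. e (h + y) * complex_of_real (f (h + y)) \<partial>lborel)"
    by (subst (1) lborel_distr_plus[of h, symmetric], subst integral_distr) auto
  have iF': "integrable lborel (\<lambda>y. e (h + y) * complex_of_real (f (h + y)))"
    using iF by (subst (asm) lborel_distr_plus[of h, symmetric], subst (asm) integrable_distr_eq) auto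
  have "2 * fourier f \<zeta> = (\<integral>y. e y * complex_of_real (f y) \<partial>lborel) + (\<integral>y. e (h + y) * complex_of_real (f (h + y)) \<partial>lborel)"
    using tr by (simp add: fourier_def e_def)
  also have "\<dots> = (\<integral>y. e y * complex_of_real (f y) + e (h + y) * complex_of_real (f (h + y)) \<partial>lborel)"
    by (rule Bochner_Integration.integral_add[symmetric, OF iF iF'])
  also have "\<dots> = (\<integral>y. e y * complex_of_real (f y - f (h + y)) \<partial>lborel)"
    by (rule Bochner_Integration.integral_cong) (simp_all add: e_h right_diff_distrib)
  finally have eq: "2 * fourier f \<zeta> = (\<integral>y. e y * complex_of_real (f y - f (h + y)) \<partial>lborel)" .
  \<comment> \<open>If just one of y and h + y lies in the simplex, then that one is within |s| of
    the face of N or of the face of \<open>idx j\<close>, the only coordinates that the shift moves.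
    On these thin layers the bound B replaces the Lipschitz estimate.\<close>
  define E where "E i = {x \<in> csimplex t. crd t x i < \<bar>s\<bar>}" for i
  have Em[measurable]: "E i \<in> sets borel" for i
    unfolding E_def by (rule layer_sets)
  have El: "measure lborel (E i) \<le> V * ?D * T ^ (CARD('d) - 1) * \<bar>s\<bar>" if "i \<in> {1..N}" for i
  proof -
    have "measure lborel (E i) \<le> V * ?D * t ^ (CARD('d) - 1) * \<bar>s\<bar>"
      using measure_layer[OF t that, of "\<bar>s\<bar>"] Em[of i] by (simp add: E_def measure_completion)
    also have "\<dots> \<le> V * ?D * T ^ (CARD('d) - 1) * \<bar>s\<bar>"
      by (intro mult_right_mono mult_left_mono power_mono) (use t tT V_nonneg in auto)
    finally show ?thesis .
  qed
  have Ef: "emeasure lborel (E i) < \<infinity>" for i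
    by (rule le_less_trans[OF emeasure_mono fin]) (auto simp: E_def)
  let ?S = "{N, idx j}"
  have "N \<noteq> idx j" using N_notin by auto
  then have cardS: "card ?S = 2" by simp
  have sub: "{1..N} \<inter> ?S = ?S" using idx_in[of j] N_in by auto
  have crd_h: "crd t (h + y) i = crd t y i + (if i = N then - s else if i = idx j then s else 0)" if "i \<in> {1..N}" for i y
  proof -
    have "idx j \<noteq> N" using N_notin by auto
    have ax: "(\<Sum>j'\<in>UNIV. (axis j 1 :: real ^ 'd) $ j') = 1" by (simp add: axis_def)
    show ?thesis using that
      by (cases rule: state_cases)
         (use \<open>idx j \<noteq> N\<close> inj_idx ax N_notin in \<open>auto simp: h_def sum.distrib sum_distrib_left[symmetric] axis_def inj_eq\<close>)
  qed
  have exit: "\<exists>i\<in>?S. y \<in> E i" if ys: "y \<in> csimplex t" "h + y \<notin> csimplex t" for y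
  proof -
    obtain i where i: "i \<in> {1..N}" "crd t (h + y) i < 0" "0 \<le> crd t y i"
      using ys unfolding csimplex_def mem_Collect_eq not_le[symmetric] by blast
    then have "i \<in> ?S \<and> crd t y i < \<bar>s\<bar>" using crd_h[OF i(1), of y] by (auto split: if_splits)
    then show ?thesis using ys by (auto simp: E_def)
  qed
  have enter: "\<exists>i\<in>?S. h + y \<in> E i" if ys: "y \<notin> csimplex t" "h + y \<in> csimplex t" for y
  proof -
    obtain i where i: "i \<in> {1..N}" "crd t y i < 0" "0 \<le> crd t (h + y) i"
      using ys unfolding csimplex_def mem_Collect_eq not_le[symmetric] by blast
    then have "i \<in> ?S \<and> crd t (h + y) i < \<bar>s\<bar>" using crd_h[OF i(1), of y] by (auto split: if_splits)
    then show ?thesis using ys by (auto simp: E_def)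
  qed
  define W where "W y = 2 * L * \<bar>s\<bar> * indicator (csimplex t) y + B * (\<Sum>i\<in>?S. indicator (E i) y) + B * (\<Sum>i\<in>?S. indicator (E i) (h + y))"
    for y
  have sumge: "1 \<le> (\<Sum>i\<in>?S. indicat_real (E i) y)" if "\<exists>i\<in>?S. y \<in> E i" for y
  proof -
    from that obtain i where "i \<in> ?S" "y \<in> E i" by blast
    then show ?thesis using member_le_sum[of i ?S "\<lambda>i. indicat_real (E i) y"] by simp
  qed
  have sum0: "0 \<le> (\<Sum>i\<in>?S. indicat_real (E i) y)" for y by (rule sum_nonneg) auto
  have W: "\<bar>f y - f (h + y)\<bar> \<le> W y" for y
  proof -
    have nn: "0 \<le> B * (\<Sum>i\<in>?S. indicat_real (E i) y)" "0 \<le> B * (\<Sum>i\<in>?S. indicat_real (E i) (h + y))"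
      "0 \<le> 2 * L * \<bar>s\<bar> * indicat_real (csimplex t) y"
      using B0 L sum0 by (auto intro!: mult_nonneg_nonneg)
    consider "y \<in> csimplex t" "h + y \<in> csimplex t" | "y \<in> csimplex t" "h + y \<notin> csimplex t"
      | "y \<notin> csimplex t" "h + y \<in> csimplex t" | "y \<notin> csimplex t" "h + y \<notin> csimplex t" by blast
    then show ?thesis
    proof cases
      case 1
      have "(\<Sum>i=1..N. \<bar>crd t y i - crd t (h + y) i\<bar>) = (\<Sum>i=1..N. if i \<in> ?S then \<bar>s\<bar> else 0)"
        by (rule sum.cong) (auto simp: crd_h)
      also have "\<dots> \<le> 2 * \<bar>s\<bar>"
        unfolding sum.inter_restrict[symmetric, OF finite_atLeastAtMost] sub by (simp add: cardS)
      finally have "L * (\<Sum>i=1..N. \<bar>crd t y i - crd t (h + y) i\<bar>) \<le> L * (2 * \<bar>s\<bar>)" using L by (rule mult_left_mono)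
      then have "\<bar>f y - f (h + y)\<bar> \<le> 2 * L * \<bar>s\<bar> * indicator (csimplex t) y"
        using lip[OF 1] 1 by simp
      then show ?thesis unfolding W_def using nn by linarith
    next
      case 2
      have "\<bar>f y - f (h + y)\<bar> \<le> B * 1" using out[OF 2(2)] B[of y] by simp
      also have "\<dots> \<le> B * (\<Sum>i\<in>?S. indicat_real (E i) y)" by (rule mult_left_mono[OF sumge[OF exit[OF 2]] B0])
      finally show ?thesis unfolding W_def using nn by linarith
    next
      case 3
      have "\<bar>f y - f (h + y)\<bar> \<le> B * 1" using out[OF 3(1)] B[of "h + y"] by simp
      also have "\<dots> \<le> B * (\<Sum>i\<in>?S. indicat_real (E i) (h + y))" by (rule mult_left_mono[OF sumge[OF enter[OF 3]] B0])
      finally show ?thesis unfolding W_def using nn by linarith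
    next
      case 4
      then show ?thesis unfolding W_def using nn out by simp
    qed
  qed
  have iE: "integrable lborel (indicat_real (E i))" for i using Ef[of i] by auto
  have iE': "integrable lborel (\<lambda>y. indicat_real (E i) (h + y))" for i
    using iE[of i] by (subst (asm) lborel_distr_plus[of h, symmetric], subst (asm) integrable_distr_eq) auto
  have trE: "(\<integral>y. indicat_real (E i) (h + y) \<partial>lborel) = measure lborel (E i)" for i
    using Ef[of i] integral_distr[of "(+) h" lborel borel "indicat_real (E i)"] by (simp add: lborel_distr_plus)
  have iW: "integrable lborel W"
    unfolding W_def using fin iE iE' by auto
  have "norm (2 * fourier f \<zeta>) \<le> (\<integral>y. norm (e y * complex_of_real (f y - f (h + y))) \<partial>lborel)"
    unfolding eq by (rule integral_norm_bound)
  also have "\<dots> = (\<integral>y. \<bar>f y - f (h + y)\<bar> \<partial>lborel)" by (simp only: norm_mult ne norm_of_real mult_1)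
  also have "\<dots> \<le> (\<integral>y. W y \<partial>lborel)"
  proof (rule integral_mono)
    show "integrable lborel (\<lambda>y. \<bar>f y - f (h + y)\<bar>)"
      by (rule Bochner_Integration.integrable_bound[OF iW]) (auto intro!: AE_I2 intro: order_trans[OF W])
  qed (use iW W in auto)
  also have "\<dots> = 2 * L * \<bar>s\<bar> * measure lborel (csimplex t) + B * (\<Sum>i\<in>?S. measure lborel (E i)) + B * (\<Sum>i\<in>?S. measure lborel (E i))"
    unfolding W_def using fin iE iE' trE by (simp del: sum.insert_if sum.insert sum.empty)
  also have "\<dots> \<le> 2 * L * \<bar>s\<bar> * (T ^ CARD('d) * V) + B * (\<Sum>i\<in>?S. V * ?D * T ^ (CARD('d) - 1) * \<bar>s\<bar>) + B * (\<Sum>i\<in>?S. V * ?D * T ^ (CARD('d) - 1) * \<bar>s\<bar>)"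
  proof (intro add_mono mult_left_mono sum_mono El)
    have "measure lborel (csimplex t) = t ^ CARD('d) * V"
      using measure_simplex[OF t] simplex_m by (simp add: measure_completion)
    also have "\<dots> \<le> T ^ CARD('d) * V" by (intro mult_right_mono power_mono) (use t tT V_nonneg in auto)
    finally show "measure lborel (csimplex t) \<le> T ^ CARD('d) * V" .
  qed (use L B0 idx_in N_in in auto)
  also have "(\<Sum>i\<in>?S. V * ?D * T ^ (CARD('d) - 1) * \<bar>s\<bar>) = 2 * (V * ?D * T ^ (CARD('d) - 1) * \<bar>s\<bar>)"
    using N_notin by (subst sum_constant) (auto simp: card_insert_if)
  finally have "norm (fourier f \<zeta>) \<le> (L * T ^ CARD('d) * V + 2 * B * V * ?D * T ^ (CARD('d) - 1)) * \<bar>s\<bar>"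
    by (simp add: norm_mult algebra_simps)
  also have "\<dots> \<le> (2 * L * T ^ CARD('d) * V + 4 * B * V * ?D * T ^ (CARD('d) - 1)) * (pi * ?D / norm \<zeta>)"
    by (intro mult_mono sb add_mono mult_right_mono) (use L B0 V_nonneg t tT in auto)
  finally show ?thesis by simp
qed

end

section \<open>Uniqueness of Laplace transforms\<close>

lemma nn_integral_eq_integral_bounded:
  fixes f :: "'a \<Rightarrow> real"
  assumes "finite_measure M" "f \<in> borel_measurable M" "AE x in M. 0 \<le> f x" "AE x in M. f x \<le> B"
  shows "(\<integral>\<^sup>+x. ennreal (f x) \<partial>M) = ennreal (\<integral>x. f x \<partial>M)" "integrable M f"
proof -
  interpret finite_measure M by fact
  show i: "integrable M f"
    by (rule integrable_const_bound[of _ B]) (use assms in auto)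
  show "(\<integral>\<^sup>+x. ennreal (f x) \<partial>M) = ennreal (\<integral>x. f x \<partial>M)"
    by (rule nn_integral_eq_integral[OF i assms(3)])
qed

text \<open>\<open>1 - min 1 (n * infdist x C)\<close> decreases to the indicator of the closed set \<open>C\<close>.\<close>

lemma measure_eq_if_integrals_eq:
  fixes M1 M2 :: "'a::euclidean_space measure"
  assumes s: "sets M1 = sets borel" "sets M2 = sets borel"
    and f: "finite_measure M1" "finite_measure M2"
    and K: "compact K" "AE x in M1. x \<in> K" "AE x in M2. x \<in> K"
    and R: "function_ring_on R K"
    and eq: "\<And>f. f \<in> R \<Longrightarrow> (\<integral>x. f x \<partial>M1) = (\<integral>x. f x \<partial>M2)"
    and meas: "\<And>f. f \<in> R \<Longrightarrow> f \<in> borel_measurable borel"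
  shows "M1 = M2"
proof -
  interpret M1: finite_measure M1 by fact
  interpret M2: finite_measure M2 by fact
  interpret R: function_ring_on R K by fact
  have int: "integrable M h" if "M = M1 \<or> M = M2" "h \<in> borel_measurable borel" "\<And>x. x \<in> K \<Longrightarrow> \<bar>h x\<bar> \<le> B"
    for M h and B :: real
  proof -
    interpret M: finite_measure M using that(1) f by auto
    show ?thesis
    proof (rule M.integrable_const_bound)
      have "AE x in M. x \<in> K" using that(1) K by auto
      then show "AE x in M. norm (h x) \<le> B" by (rule AE_mp) (use that(3) in auto)
      show "h \<in> borel_measurable M" using that(1,2) s by (auto cong: measurable_cong_sets)
    qed
  qed
  have int_eq: "(\<integral>x. h x \<partial>M1) = (\<integral>x. h x \<partial>M2)" if h: "continuous_on UNIV h" for h :: "'a \<Rightarrow> real"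
  proof (rule ccontr)
    assume ne: "(\<integral>x. h x \<partial>M1) \<noteq> (\<integral>x. h x \<partial>M2)"
    have hm: "h \<in> borel_measurable borel" using h by (rule borel_measurable_continuous_onI)
    define D where "D = \<bar>(\<integral>x. h x \<partial>M1) - (\<integral>x. h x \<partial>M2)\<bar>"
    have D: "0 < D" using ne by (simp add: D_def)
    \<comment> \<open>If h is approximated within D / (2 m), where m exceeds both masses together,
      the integrals move by at most D / 2 in total, although they are D apart.\<close>
    define m where "m = measure M1 (space M1) + measure M2 (space M2) + 1"
    have m: "0 < m" by (simp add: m_def add_nonneg_pos)
    obtain g where g: "g \<in> R" "\<And>x. x \<in> K \<Longrightarrow> \<bar>h x - g x\<bar> < D / m / 2"
    proof -
      have "continuous_on K h" by (rule continuous_on_subset[OF h]) simp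
      from R.Stone_Weierstrass_basic[OF this, of "D / m / 2"] show ?thesis
        using D m that by auto
    qed
    obtain Bh where Bh: "\<And>x. x \<in> K \<Longrightarrow> \<bar>h x\<bar> \<le> Bh"
      using compact_imp_bounded[OF compact_continuous_image[OF continuous_on_subset[OF h, of K] K(1)]]
      by (auto simp: bounded_iff)
    have Bg: "\<bar>g x\<bar> \<le> Bh + D / m / 2" if "x \<in> K" for x using g(2)[OF that] Bh[OF that] by linarith
    have le: "\<bar>(\<integral>x. h x \<partial>M) - (\<integral>x. g x \<partial>M)\<bar> \<le> D / m / 2 * measure M (space M)"
      if M: "M = M1 \<or> M = M2" for M
    proof -
      have i: "integrable M h" "integrable M g"
        by (rule int[OF M hm Bh], assumption, rule int[OF M meas[OF g(1)] Bg], assumption)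
      interpret M: finite_measure M using M f by auto
      have "\<bar>(\<integral>x. h x \<partial>M) - (\<integral>x. g x \<partial>M)\<bar> = \<bar>\<integral>x. h x - g x \<partial>M\<bar>" using i by simp
      also have "\<dots> \<le> (\<integral>x. \<bar>h x - g x\<bar> \<partial>M)" by (rule integral_abs_bound)
      also have "\<dots> \<le> (\<integral>x. D / m / 2 \<partial>M)"
      proof (rule integral_mono_AE)
        have "AE x in M. x \<in> K" using M K by auto
        then show "AE x in M. \<bar>h x - g x\<bar> \<le> D / m / 2"
          by (rule AE_mp) (intro AE_I2 impI less_imp_le g(2))
      qed (use i in auto)
      finally show ?thesis by (simp add: mult.commute)
    qed
    have "D \<le> D / m / 2 * measure M1 (space M1) + D / m / 2 * measure M2 (space M2)"
      using le[of M1] le[of M2] eq[OF g(1)] D_def by auto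
    also have "\<dots> \<le> D / m / 2 * m" unfolding distrib_left[symmetric]
      by (rule mult_left_mono) (use D m in \<open>auto simp: m_def\<close>)
    also have "\<dots> = D / 2" using m by simp
    finally show False using D by simp
  qed
  have "emeasure M1 C = emeasure M2 C" if C: "closed C" for C
  proof (cases "C = {}")
    case False
    define h where "h n x = 1 - min 1 (real n * infdist x C)" for n x
    have hc: "continuous_on UNIV (h n)" for n unfolding h_def by (intro continuous_intros)
    have hm: "h n \<in> borel_measurable borel" for n using hc by (rule borel_measurable_continuous_onI)
    have lim: "(\<lambda>n. h n x) \<longlonglongrightarrow> indicator C x" for x
    proof (cases "x \<in> C")
      case True
      then show ?thesis by (simp add: h_def)
    next
      case x: False
      then have "0 < infdist x C" using C False by (metis in_closed_iff_infdist_zero infdist_nonneg less_eq_real_def)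
      then obtain n0 where n0: "1 \<le> real n0 * infdist x C"
        using reals_Archimedean3[of "infdist x C"] by (meson less_imp_le)
      have "\<forall>n\<ge>n0. h n x = 0"
      proof (intro allI impI)
        fix n assume "n0 \<le> n"
        then have "real n0 * infdist x C \<le> real n * infdist x C" by (intro mult_right_mono infdist_nonneg) auto
        then show "h n x = 0" using n0 by (simp add: h_def)
      qed
      then have "(\<lambda>n. h n x) \<longlonglongrightarrow> 0" by (intro tendsto_eventually eventually_sequentiallyI[of n0]) auto
      then show ?thesis using x by simp
    qed
    have hb: "\<bar>h n x\<bar> \<le> 1" for n x using infdist_nonneg[of x C] by (auto simp: h_def abs_if min_def)
    have L: "(\<lambda>n. \<integral>x. h n x \<partial>M) \<longlonglongrightarrow> (\<integral>x. indicator C x \<partial>M)" if M: "M = M1 \<or> M = M2" for M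
    proof (rule integral_dominated_convergence[where w = "\<lambda>_. 1"])
      interpret M: finite_measure M using M f by auto
      show "integrable M (\<lambda>_. 1 :: real)" by simp
      show "h n \<in> borel_measurable M" for n using M hm s by (auto cong: measurable_cong_sets)
      show "indicat_real C \<in> borel_measurable M" using M C s by (auto intro!: borel_measurable_indicator)
    qed (use lim hb in auto)
    have "(\<integral>x. indicator C x \<partial>M1) = (\<integral>x. indicat_real C x \<partial>M2)"
      by (rule LIMSEQ_unique[OF L[of M1]]) (use L[of M2] int_eq[OF hc] in auto)
    then have "measure M1 C = measure M2 C" using C s by simp
    then show ?thesis by (simp add: M1.emeasure_eq_measure M2.emeasure_eq_measure)
  qed simp
  then show ?thesis
    by (intro measure_eqI_generator_eq[where \<Omega> = UNIV and E = "Collect closed" and A = "\<lambda>_. UNIV"])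
       (auto simp: Int_stable_def s borel_eq_closed M1.emeasure_eq_measure)
qed

text \<open>The linear span. If B is closed under products, this is an algebra, as the
  Stone-Weierstrass theorem demands, and facts about its members follow by induction from those
  about B.\<close>

inductive_set mono_span :: "('a \<Rightarrow> real) set \<Rightarrow> ('a \<Rightarrow> real) set" for B where
  base: "f \<in> B \<Longrightarrow> f \<in> mono_span B"
| scale: "f \<in> mono_span B \<Longrightarrow> (\<lambda>x. c * f x) \<in> mono_span B"
| add: "f \<in> mono_span B \<Longrightarrow> g \<in> mono_span B \<Longrightarrow> (\<lambda>x. f x + g x) \<in> mono_span B"

lemma mono_span_mult:
  assumes B: "\<And>f g. f \<in> B \<Longrightarrow> g \<in> B \<Longrightarrow> (\<lambda>x. f x * g x) \<in> B"
    and fg: "f \<in> mono_span B" "g \<in> mono_span B"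
  shows "(\<lambda>x. f x * g x) \<in> mono_span B"
  using fg(1)
proof induction
  case (base f)
  show ?case using fg(2)
  proof induction
    case (base h)
    then show ?case using \<open>f \<in> B\<close> B by (auto intro: mono_span.base)
  next
    case (scale h c)
    then show ?case using mono_span.scale[OF scale.IH, of c] by (simp add: mult_ac)
  next
    case (add h1 h2)
    then show ?case using mono_span.add[OF add.IH] by (simp add: algebra_simps)
  qed
next
  case (scale h c)
  then show ?case using mono_span.scale[OF scale.IH, of c] by (simp add: mult_ac)
next
  case (add h1 h2)
  then show ?case using mono_span.add[OF add.IH] by (simp add: algebra_simps)
qed

text \<open>Linearity extends the equality of integrals from B to its span, which is a
  point-separating function ring. It is used for the powers on [0, 1] and for exponentials with
  integer exponents on the simplex.\<close>

lemma measure_eq_if_monomials_eq: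
  fixes M1 M2 :: "'a::euclidean_space measure" and B :: "('a \<Rightarrow> real) set"
  assumes s: "sets M1 = sets borel" "sets M2 = sets borel"
    and f: "finite_measure M1" "finite_measure M2"
    and K: "compact K" "AE x in M1. x \<in> K" "AE x in M2. x \<in> K"
    and Bc: "\<And>f. f \<in> B \<Longrightarrow> continuous_on UNIV f"
    and Bm: "\<And>f g. f \<in> B \<Longrightarrow> g \<in> B \<Longrightarrow> (\<lambda>x. f x * g x) \<in> B"
    and B1: "(\<lambda>_. 1) \<in> B"
    and Bsep: "\<And>x y. x \<noteq> y \<Longrightarrow> \<exists>f\<in>B. f x \<noteq> f y"
    and eq: "\<And>f. f \<in> B \<Longrightarrow> (\<integral>x. f x \<partial>M1) = (\<integral>x. f x \<partial>M2)"
  shows "M1 = M2"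
proof (rule measure_eq_if_integrals_eq[OF s f K])
  have c: "continuous_on UNIV f" if "f \<in> mono_span B" for f
    using that by induction (simp add: Bc, (rule continuous_intros | assumption)+)
  show "function_ring_on (mono_span B) K"
  proof
    show "(\<lambda>_. c) \<in> mono_span B" for c
      using mono_span.scale[OF mono_span.base[OF B1], of c] by simp
    show "\<exists>f\<in>mono_span B. f x \<noteq> f y" if "x \<noteq> y" for x y using Bsep[OF that] mono_span.base by blast
  qed (auto intro: mono_span.add mono_span_mult[OF Bm] continuous_on_subset[OF c] K)
  show "f \<in> borel_measurable borel" if "f \<in> mono_span B" for f
    using c[OF that] by (rule borel_measurable_continuous_onI)
  have int: "integrable M h" if M: "M = M1 \<or> M = M2" and h: "continuous_on UNIV h" for M and h :: "'a \<Rightarrow> real"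
  proof -
    obtain b where b: "\<And>x. x \<in> K \<Longrightarrow> \<bar>h x\<bar> \<le> b"
      using compact_imp_bounded[OF compact_continuous_image[OF continuous_on_subset[OF h, of K] K(1)]]
      by (auto simp: bounded_iff)
    interpret M: finite_measure M using M f by auto
    show ?thesis
    proof (rule M.integrable_const_bound)
      have "AE x in M. x \<in> K" using M K by auto
      then show "AE x in M. norm (h x) \<le> b" by (rule AE_mp) (use b in auto)
      show "h \<in> borel_measurable M"
        using M s borel_measurable_continuous_onI[OF h] by (auto cong: measurable_cong_sets)
    qed
  qed
  show "(\<integral>x. f x \<partial>M1) = (\<integral>x. f x \<partial>M2)" if "f \<in> mono_span B" for f
    using that
  proof induction
    case (add f g)
    then show ?case using int[of M1] int[of M2] c by simp
  qed (auto simp: eq)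
qed

text \<open>Under \<open>u = exp (- t)\<close> the Laplace transform at the integers becomes the moment sequence of a
  measure on \<open>[0, 1]\<close>.\<close>

lemma laplace_unique:
  fixes g h :: "real \<Rightarrow> real"
  assumes gc: "continuous_on {0<..} g" and hc: "continuous_on {0<..} h"
    and gb: "\<And>t. 0 < t \<Longrightarrow> 0 \<le> g t \<and> g t \<le> C" and h0: "\<And>t. 0 < t \<Longrightarrow> 0 \<le> h t"
    and eq: "\<And>n::nat. 1 \<le> n \<Longrightarrow> (\<integral>\<^sup>+t\<in>{0<..}. ennreal (exp (- (real n * t)) * g t) \<partial>lborel)
                             = (\<integral>\<^sup>+t\<in>{0<..}. ennreal (exp (- (real n * t)) * h t) \<partial>lborel)"
    and t: "0 < t"
  shows "g t = h t"
proof -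
  have meas: "(\<lambda>t. exp (- (real n * t)) * f t * indicator {0<..} t) \<in> borel_measurable borel"
    if f: "continuous_on {0<..} f" for n :: nat and f :: "real \<Rightarrow> real"
  proof -
    have "(\<lambda>t. indicator {0<..} t *\<^sub>R (exp (- (real n * t)) * f t)) \<in> borel_measurable borel"
      by (rule borel_measurable_continuous_on_indicator) (auto intro!: continuous_intros f)
    then show ?thesis by (simp add: mult.commute)
  qed
  \<comment> \<open>One factor exp (- t) stays in the density and makes the measure finite; the
    moment of order n is therefore the transform at n + 1.\<close>
  define \<mu> where "\<mu> f = distr (density lborel (\<lambda>t. ennreal (exp (- (real 1 * t)) * f t * indicator {0<..} t))) borel (\<lambda>t. exp (-t))"
    for f :: "real \<Rightarrow> real"
  have meas_e: "(\<lambda>t::real. exp (-t)) \<in> borel_measurable borel" by simp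
  have nn: "(\<integral>\<^sup>+u. ennreal (u ^ n) \<partial>\<mu> f) = (\<integral>\<^sup>+t\<in>{0<..}. ennreal (exp (- (real (Suc n) * t)) * f t) \<partial>lborel)"
    if f: "continuous_on {0<..} f" "\<And>t. 0 < t \<Longrightarrow> 0 \<le> f t" for f n
  proof -
    have "(\<integral>\<^sup>+u. ennreal (u ^ n) \<partial>\<mu> f) = (\<integral>\<^sup>+t. ennreal (exp (-t) ^ n) \<partial>density lborel (\<lambda>t. ennreal (exp (- (real 1 * t)) * f t * indicator {0<..} t)))"
      unfolding \<mu>_def by (subst nn_integral_distr) auto
    also have "\<dots> = (\<integral>\<^sup>+t. ennreal (exp (- (real 1 * t)) * f t * indicator {0<..} t) * ennreal (exp (-t) ^ n) \<partial>lborel)"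
      by (subst nn_integral_density) (use meas[OF f(1), of 1] in auto)
    also have "\<dots> = (\<integral>\<^sup>+t\<in>{0<..}. ennreal (exp (- (real (Suc n) * t)) * f t) \<partial>lborel)"
    proof (rule nn_integral_cong)
      fix t :: real
      have "exp (- t) * exp (- t) ^ n = exp (- (real (Suc n) * t))"
        by (simp add: exp_of_nat_mult[symmetric] exp_add[symmetric] algebra_simps)
      then show "ennreal (exp (- (real 1 * t)) * f t * indicator {0<..} t) * ennreal (exp (-t) ^ n)
          = ennreal (exp (- (real (Suc n) * t)) * f t) * indicator {0<..} t"
        using f(2)[of t] by (auto simp: ennreal_mult'[symmetric] indicator_def mult_ac)
    qed
    finally show ?thesis .
  qed
  have sp: "space (\<mu> f) = UNIV" for f by (simp add: \<mu>_def)
  have g0: "\<And>t. 0 < t \<Longrightarrow> 0 \<le> g t" using gb by auto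
  have "(\<integral>\<^sup>+t\<in>{0<..}. ennreal (exp (- (real (Suc 0) * t)) * g t) \<partial>lborel) \<le> (\<integral>\<^sup>+t. ennreal C * (ennreal (t ^ 0 * exp (- t)) * indicator {0..} t) \<partial>lborel)"
  proof (rule nn_integral_mono)
    fix t :: real
    have C: "0 \<le> C" using gb[of 1] by auto
    have "exp (-t) * g t \<le> C * exp (-t)" if "0 < t" using gb[OF that] by (simp add: mult.commute)
    then show "ennreal (exp (- (real (Suc 0) * t)) * g t) * indicator {0<..} t \<le> ennreal C * (ennreal (t ^ 0 * exp (- t)) * indicator {0..} t)"
      using C by (auto simp: indicator_def ennreal_mult'[symmetric] intro!: ennreal_leI)
  qed
  also have "\<dots> = ennreal C * ennreal (real_of_nat (fact 0))"
    by (subst nn_integral_cmult) (simp, simp only: nn_intergal_power_times_exp_Ici)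
  also have "\<dots> < \<infinity>" by (simp add: ennreal_mult_less_top)
  finally have fin: "(\<integral>\<^sup>+t\<in>{0<..}. ennreal (exp (- (real (Suc 0) * t)) * g t) \<partial>lborel) < \<infinity>" .
  have em: "emeasure (\<mu> f) (space (\<mu> f)) = (\<integral>\<^sup>+t\<in>{0<..}. ennreal (exp (- (real (Suc 0) * t)) * f t) \<partial>lborel)"
    if f: "continuous_on {0<..} f" "\<And>t. 0 < t \<Longrightarrow> 0 \<le> f t" for f
    using nn[OF f, of 0] by simp
  have fg: "finite_measure (\<mu> g)" by (rule finite_measureI) (use em[OF gc g0] fin in auto)
  \<comment> \<open>The finiteness for h is inherited from g, because the transforms agree at
    1.\<close>
  have fh: "finite_measure (\<mu> h)" by (rule finite_measureI) (use em[OF hc h0] fin eq[of 1] in auto)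
  have AE1: "AE u in \<mu> f. u \<in> {0..1}" if f: "continuous_on {0<..} f" for f
    unfolding \<mu>_def by (subst AE_distr_iff, simp, simp, subst AE_density) (use meas[OF f, of 1] in \<open>auto simp: indicator_def\<close>)
  have meq: "\<mu> g = \<mu> h"
  proof (rule measure_eq_if_monomials_eq[where K = "{0..1}" and B = "range (\<lambda>n x. x ^ n)"])
    fix f assume "f \<in> range (\<lambda>n (x::real). x ^ n)"
    then obtain n where n: "f = (\<lambda>x. x ^ n)" by auto
    have e: "ennreal (\<integral>u. u ^ n \<partial>\<mu> f) = (\<integral>\<^sup>+u. ennreal (u ^ n) \<partial>\<mu> f)" "0 \<le> (\<integral>u. u ^ n \<partial>\<mu> f)"
      if "finite_measure (\<mu> f)" "continuous_on {0<..} f" for f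
    proof -
      have a: "AE u in \<mu> f. 0 \<le> u ^ n" "AE u in \<mu> f. u ^ n \<le> 1"
        by (rule AE_mp[OF AE1[OF that(2)]], simp add: power_le_one)+
      show "ennreal (\<integral>u. u ^ n \<partial>\<mu> f) = (\<integral>\<^sup>+u. ennreal (u ^ n) \<partial>\<mu> f)"
        by (rule nn_integral_eq_integral_bounded(1)[OF that(1) _ a, symmetric]) (simp add: \<mu>_def)
      show "0 \<le> (\<integral>u. u ^ n \<partial>\<mu> f)" using a(1) by (rule integral_nonneg_AE)
    qed
    have "ennreal (\<integral>u. u ^ n \<partial>\<mu> g) = ennreal (\<integral>u. u ^ n \<partial>\<mu> h)"
      unfolding e(1)[OF fg gc] e(1)[OF fh hc] using nn[of g n, OF gc g0] nn[of h n, OF hc h0] eq[of "Suc n"] by simp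
    then show "(\<integral>x. f x \<partial>\<mu> g) = (\<integral>x. f x \<partial>\<mu> h)"
      unfolding n using e(2)[OF fg gc] e(2)[OF fh hc] by simp
  next
    fix f k assume "f \<in> range (\<lambda>n (x::real). x ^ n)" "k \<in> range (\<lambda>n (x::real). x ^ n)"
    then obtain n m where "f = (\<lambda>x. x ^ n)" "k = (\<lambda>x. x ^ m)" by auto
    then have "(\<lambda>x. f x * k x) = (\<lambda>x. x ^ (n + m))" by (simp add: power_add)
    then show "(\<lambda>x. f x * k x) \<in> range (\<lambda>n (x::real). x ^ n)" by blast
  next
    show "(\<lambda>_. 1) \<in> range (\<lambda>n (x::real). x ^ n)" by (rule range_eqI[of _ _ 0]) simp
    show "\<exists>f\<in>range (\<lambda>n (x::real). x ^ n). f x \<noteq> f y" if "x \<noteq> y" for x y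
      by (rule bexI[of _ "\<lambda>x. x ^ 1"], use that in simp, rule range_eqI[of _ _ 1], simp)
  qed (auto simp: AE1[OF gc, simplified] AE1[OF hc, simplified] fg fh intro!: continuous_intros, auto simp: \<mu>_def)
  \<comment> \<open>Equal measures with continuous densities: if a exceeded b at t, it would do so
    by e on an interval J around t, and the image of J would have larger mass for a. The left end of
    J is kept above t / 2 so that J lies in the positive half-line.\<close>
  have half: False if ab: "continuous_on {0<..} a" "continuous_on {0<..} b" "\<mu> a = \<mu> b"
      "\<And>t. 0 < t \<Longrightarrow> 0 \<le> a t" "\<And>t. 0 < t \<Longrightarrow> 0 \<le> b t" "finite_measure (\<mu> b)" "b t < a t" for a b
  proof -
    define e where "e = (a t - b t) / 2"
    have "continuous_on {0<..} (\<lambda>s. a s - b s)" by (intro continuous_intros ab)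
    then have "isCont (\<lambda>s. a s - b s) t" using t by (simp add: continuous_on_eq_continuous_at)
    then obtain \<delta> where \<delta>: "0 < \<delta>" "\<And>s. dist s t < \<delta> \<Longrightarrow> dist (a s - b s) (a t - b t) < e"
      unfolding continuous_at_eps_delta using ab(7) by (metis e_def diff_gt_0_iff_gt half_gt_zero)
    define J where "J = {max (t/2) (t - \<delta>/2) .. t + \<delta> / 2}"
    have J: "s \<in> J \<Longrightarrow> 0 < s \<and> b s + e \<le> a s" for s
    proof -
      assume s: "s \<in> J"
      then have "dist s t < \<delta>" using \<delta>(1) by (auto simp: J_def dist_real_def)
      from \<delta>(2)[OF this] have "\<bar>(a s - b s) - (a t - b t)\<bar> < e" by (simp add: dist_real_def)
      moreover have "a t - b t = 2 * e" by (simp add: e_def)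
      moreover have "0 < s" using s t by (auto simp: J_def)
      ultimately show ?thesis by linarith
    qed
    have e0: "0 < e" using ab by (simp add: e_def)
    define U where "U = (\<lambda>t. exp (-t)) ` J"
    have U: "U \<in> sets borel" unfolding U_def J_def
      by (intro borel_compact compact_continuous_image continuous_intros) auto
    have emU: "emeasure (\<mu> f) U = (\<integral>\<^sup>+s\<in>J. ennreal (exp (- s) * f s) \<partial>lborel)"
      if f: "continuous_on {0<..} f" for f
    proof -
      have v: "(\<lambda>t. exp (-t)) -` U = J" by (auto simp: U_def)
      have "emeasure (\<mu> f) U = emeasure (density lborel (\<lambda>t. ennreal (exp (- (real 1 * t)) * f t * indicator {0<..} t))) J"
        unfolding \<mu>_def by (subst emeasure_distr) (use U v in auto)
      also have "\<dots> = (\<integral>\<^sup>+s. ennreal (exp (- (real 1 * s)) * f s * indicator {0<..} s) * indicator J s \<partial>lborel)"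
        by (subst emeasure_density) (use meas[OF f, of 1] in \<open>auto simp: J_def\<close>)
      also have "\<dots> = (\<integral>\<^sup>+s\<in>J. ennreal (exp (- s) * f s) \<partial>lborel)"
        by (rule nn_integral_cong) (use J in \<open>auto simp: indicator_def\<close>)
      finally show ?thesis .
    qed
    have mf: "(\<lambda>s. ennreal (exp (- s) * f s) * indicator J s) \<in> borel_measurable borel" if f: "continuous_on {0<..} f" for f
    proof -
      have "(\<lambda>s. indicator J s *\<^sub>R (exp (- s) * f s)) \<in> borel_measurable borel"
        by (rule borel_measurable_continuous_on_indicator)
           (use J in \<open>auto intro!: continuous_intros continuous_on_subset[OF f] simp: J_def\<close>)
      then have "(\<lambda>s. ennreal (indicator J s *\<^sub>R (exp (- s) * f s))) \<in> borel_measurable borel" by simp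
      then show ?thesis by (rule measurable_cong[THEN iffD1, rotated]) (auto simp: indicator_def)
    qed
    have "emeasure (\<mu> b) U + (\<integral>\<^sup>+s. ennreal (exp (- (t + \<delta>)) * e) * indicator J s \<partial>lborel)
        = (\<integral>\<^sup>+s. ennreal (exp (- s) * b s) * indicator J s + ennreal (exp (- (t + \<delta>)) * e) * indicator J s \<partial>lborel)"
      unfolding emU[OF ab(2)] by (rule nn_integral_add[symmetric]) (use mf[OF ab(2)] in \<open>auto simp: J_def\<close>)
    also have "\<dots> \<le> emeasure (\<mu> a) U"
      unfolding emU[OF ab(1)]
    proof (rule nn_integral_mono)
      fix s
      have "exp (-s) * b s + exp (- (t + \<delta>)) * e \<le> exp (-s) * a s" if s: "s \<in> J"
      proof -
        have "exp (- (t + \<delta>)) * e \<le> exp (-s) * e"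
          using s \<delta>(1) e0 by (intro mult_right_mono) (auto simp: J_def)
        also have "exp (-s) * e \<le> exp (-s) * (a s - b s)" using J[OF s] by (intro mult_left_mono) auto
        finally show ?thesis by (simp add: algebra_simps)
      qed
      then show "ennreal (exp (- s) * b s) * indicator J s + ennreal (exp (- (t + \<delta>)) * e) * indicator J s
          \<le> ennreal (exp (- s) * a s) * indicator J s"
        using J[of s] ab(5)[of s] e0 by (auto simp: indicator_def ennreal_plus[symmetric] simp del: ennreal_plus intro!: ennreal_leI)
    qed
    finally have 1: "emeasure (\<mu> b) U + (\<integral>\<^sup>+s. ennreal (exp (- (t + \<delta>)) * e) * indicator J s \<partial>lborel) \<le> emeasure (\<mu> b) U"
      using ab(3) by simp
    have "emeasure (\<mu> b) U < \<infinity>" using finite_measure.emeasure_finite[OF ab(6), of U] by (simp add: top.not_eq_extremum)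
    with 1 have "(\<integral>\<^sup>+s. ennreal (exp (- (t + \<delta>)) * e) * indicator J s \<partial>lborel) = 0"
      using ennreal_add_left_cancel_le[of "emeasure (\<mu> b) U" _ 0] by auto
    moreover have "(\<integral>\<^sup>+s. ennreal (exp (- (t + \<delta>)) * e) * indicator J s \<partial>lborel) = ennreal (exp (- (t + \<delta>)) * e) * emeasure lborel J"
      by (rule nn_integral_cmult_indicator) (simp add: J_def)
    moreover have "emeasure lborel J \<noteq> 0" using \<delta>(1) t by (simp add: J_def max_def)
    ultimately show False using e0 by simp
  qed
  show ?thesis
    using half[OF gc hc meq g0 h0 fh] half[OF hc gc meq[symmetric] h0 g0 fg] by force
qed

section \<open>The Markov property on path space\<close>

declare One_nat_def [simp del]

text \<open>Samples are taken at right endpoints because a path is locally constant to the right of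
  each time: for fixed u the sampled value is eventually \<open>g u\<close> itself. Pointwise
  convergence of these step functions also supplies the measurability of g.\<close>

lemma right_riemann_sums:
  fixes g :: "real \<Rightarrow> real"
  assumes rc: "\<And>u. a \<le> u \<Longrightarrow> \<forall>\<^sub>F s in at_right u. g s = g u"
    and B: "\<And>u. a \<le> u \<Longrightarrow> \<bar>g u\<bar> \<le> B" and t: "0 \<le> t"
  shows "(\<lambda>u. g u * indicator {a<..a+t} u) \<in> borel_measurable borel"
    and "integrable lborel (\<lambda>u. g u * indicator {a<..a+t} u)"
    and "(\<lambda>n. t / real (Suc n) * (\<Sum>j=1..Suc n. g (a + t * real j / real (Suc n))))
       \<longlonglongrightarrow> (\<integral>u. g u * indicator {a<..a+t} u \<partial>lborel)"
proof -
  have B0: "0 \<le> B" using B[of a] by linarith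
  define h where "h n = t / real (Suc n)" for n
  have h0: "0 \<le> h n" for n using t by (simp add: h_def)
  define I where "I n j = {a + h n * (real j - 1) <.. a + h n * real j}" for n j :: nat
  define G where "G n u = (\<Sum>j=1..Suc n. g (a + h n * real j) * indicator (I n j) u)" for n u
  have Im[measurable]: "I n j \<in> sets borel" for n j by (simp add: I_def)
  have Gm: "G n \<in> borel_measurable borel" for n
    unfolding G_def by measurable
  have Isub: "I n j \<subseteq> {a<..a+t}" if "j \<in> {1..Suc n}" for n j
  proof
    fix u assume u: "u \<in> I n j"
    have "0 \<le> h n * (real j - 1)" using that h0[of n] by simp
    moreover have "h n * real j \<le> h n * real (Suc n)" using that h0[of n] by (intro mult_left_mono) auto
    moreover have "h n * real (Suc n) = t" by (simp add: h_def)
    ultimately show "u \<in> {a<..a+t}" using u by (auto simp: I_def)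
  qed
  have Gat: "\<exists>v. a \<le> v \<and> u \<le> v \<and> v < u + h n \<and> G n u = g v" if u: "u \<in> {a<..a+t}" for n u
  proof -
    have hp: "0 < h n" using u by (auto simp: h_def)
    define c where "c = \<lceil>(u - a) / h n\<rceil>"
    have c0: "0 < c" using u hp by (simp add: c_def)
    have c1: "real_of_int c - 1 < (u - a) / h n" "(u - a) / h n \<le> real_of_int c"
      unfolding c_def by linarith+
    have "(u - a) / h n \<le> real (Suc n)"
    proof -
      have "u - a \<le> h n * real (Suc n)" using u by (simp add: h_def)
      then show ?thesis using hp by (simp add: field_simps)
    qed
    then have cn: "c \<le> int (Suc n)" unfolding c_def by (simp add: ceiling_le_iff)
    define j where "j = nat c"
    have j: "j \<in> {1..Suc n}" "real j = real_of_int c" using c0 cn by (auto simp: j_def)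
    have uI: "a + h n * (real j - 1) < u" "u \<le> a + h n * real j"
      using c1 hp unfolding j(2) by (simp_all add: field_simps)
    have "G n u = (\<Sum>i=1..Suc n. if i = j then g (a + h n * real j) else 0)"
      unfolding G_def
    proof (rule sum.cong[OF refl])
      fix i assume i: "i \<in> {1..Suc n}"
      have "i = j" if "u \<in> I n i"
      proof (rule ccontr)
        assume "i \<noteq> j"
        then consider "real i \<le> real j - 1" | "real j \<le> real i - 1" by linarith
        then show False
        proof cases
          case 1
          then have "h n * real i \<le> h n * (real j - 1)" using hp by simp
          then show False using that uI by (auto simp: I_def)
        next
          case 2
          then have "h n * real j \<le> h n * (real i - 1)" using hp by simp
          then show False using that uI by (auto simp: I_def)
        qed
      qed
      moreover have "u \<in> I n j" using uI by (simp add: I_def)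
      ultimately have "u \<in> I n i \<longleftrightarrow> i = j" by blast
      then have "indicat_real (I n i) u = (if i = j then 1 else 0)" by (simp add: indicator_def)
      then show "g (a + h n * real i) * indicator (I n i) u = (if i = j then g (a + h n * real j) else 0)"
        by simp
    qed
    also have "\<dots> = g (a + h n * real j)" using j by simp
    finally have G: "G n u = g (a + h n * real j)" .
    have "a + h n * real j < u + h n" using uI by (simp add: algebra_simps)
    then show ?thesis using uI u G h0[of n] by (intro exI[of _ "a + h n * real j"]) auto
  qed
  have Gout: "G n u = 0" if "u \<notin> {a<..a+t}" for n u
    unfolding G_def
  proof (rule sum.neutral, rule ballI)
    fix j assume "j \<in> {1..Suc n}"
    then have "u \<notin> I n j" using Isub that by blast
    then show "g (a + h n * real j) * indicator (I n j) u = 0" by simp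
  qed
  have lim: "(\<lambda>n. G n u) \<longlonglongrightarrow> g u * indicator {a<..a+t} u" for u
  proof (cases "u \<in> {a<..a+t}")
    case False
    then show ?thesis by (simp add: Gout)
  next
    case True
    have "\<forall>\<^sub>F s in at_right u. g s = g u" using rc[of u] True by auto
    then obtain b where b: "u < b" "\<And>s. u < s \<Longrightarrow> s < b \<Longrightarrow> g s = g u"
      unfolding eventually_at_right_field by auto
    have "h \<longlonglongrightarrow> 0" unfolding h_def by (rule LIMSEQ_Suc) (rule lim_const_over_n)
    then have "\<forall>\<^sub>F n in sequentially. h n < b - u" using b(1) by (intro order_tendstoD) auto
    then have "\<forall>\<^sub>F n in sequentially. G n u = g u"
    proof (rule eventually_mono)
      fix n assume n: "h n < b - u"
      obtain v where v: "u \<le> v" "v < u + h n" "G n u = g v" using Gat[OF True] by blast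
      then show "G n u = g u" using b(2)[of v] n by (cases "v = u") auto
    qed
    then show ?thesis using True by (simp add: tendsto_eventually)
  qed
  show m: "(\<lambda>u. g u * indicator {a<..a+t} u) \<in> borel_measurable borel"
    by (rule borel_measurable_LIMSEQ_real[OF lim Gm])
  have iB: "integrable lborel (\<lambda>u. B * indicator {a<..a+t} u :: real)" using t by auto
  show "integrable lborel (\<lambda>u. g u * indicator {a<..a+t} u)"
    by (rule Bochner_Integration.integrable_bound[OF iB])
       (use m B B0 in \<open>auto simp: indicator_def\<close>)
  have Gb: "\<bar>G n u\<bar> \<le> B * indicator {a<..a+t} u" for n u
  proof (cases "u \<in> {a<..a+t}")
    case True
    then show ?thesis using Gat[OF True, of n] B by auto
  qed (simp add: Gout)
  have L: "(\<lambda>n. \<integral>u. G n u \<partial>lborel) \<longlonglongrightarrow> (\<integral>u. g u * indicator {a<..a+t} u \<partial>lborel)"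
    by (rule integral_dominated_convergence[OF _ _ iB]) (use m Gm lim Gb in auto)
  have "(\<integral>u. G n u \<partial>lborel) = t / real (Suc n) * (\<Sum>j=1..Suc n. g (a + t * real j / real (Suc n)))" for n
  proof -
    have em: "measure lborel (I n j) = h n" for j
      using h0[of n] by (simp add: I_def algebra_simps)
    have ij: "integrable lborel (\<lambda>u. g (a + h n * real j) * indicator (I n j) u)" for j
    proof (intro integrable_mult_right integrable_real_indicator)
      have "a + h n * (real j - 1) \<le> a + h n * real j" using h0[of n] by (intro add_left_mono mult_left_mono) auto
      then show "emeasure lborel (I n j) < \<infinity>" by (simp add: I_def)
    qed (simp add: I_def)
    have "(\<integral>u. G n u \<partial>lborel) = (\<Sum>j=1..Suc n. \<integral>u. g (a + h n * real j) * indicator (I n j) u \<partial>lborel)"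
      unfolding G_def by (rule Bochner_Integration.integral_sum) (rule ij)
    also have "\<dots> = (\<Sum>j=1..Suc n. g (a + h n * real j) * h n)"
      by (simp add: em)
    finally show ?thesis by (simp add: h_def sum_distrib_left mult_ac del: sum.cl_ivl_Suc)
  qed
  with L show "(\<lambda>n. t / real (Suc n) * (\<Sum>j=1..Suc n. g (a + t * real j / real (Suc n))))
       \<longlonglongrightarrow> (\<integral>u. g u * indicator {a<..a+t} u \<partial>lborel)" by simp
qed

locale jump_process =
  fixes N :: nat and G :: "nat \<Rightarrow> nat \<Rightarrow> real" and M :: "nat \<Rightarrow> 'w measure" and X :: "real \<Rightarrow> 'w \<Rightarrow> nat"
  assumes N1: "1 \<le> N" and mjp: "markov_jump_process N G M X"
begin

abbreviation "I \<equiv> {1..N}"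
text \<open>All the laws share one measurable space; \<open>M 1\<close> stands for it wherever only
  measurability matters.\<close>

definition base :: "'w measure" where "base = M 1"
abbreviation "\<Omega> \<equiv> space base"
abbreviation "CS \<equiv> count_space {1..N}"

lemma one_in: "1 \<in> I" using N1 by simp

lemma generator: "is_generator N G" using mjp by (simp add: markov_jump_process_def)

lemma sets_M: "k \<in> I \<Longrightarrow> sets (M k) = sets base"
  using mjp[unfolded markov_jump_process_def, THEN conjunct2, THEN conjunct1] one_in unfolding base_def by (meson bspec)

lemmas mjp3 = mjp[unfolded markov_jump_process_def, THEN conjunct2, THEN conjunct2, THEN bspec]

lemma space_M: "k \<in> I \<Longrightarrow> space (M k) = \<Omega>"
  using sets_M sets_eq_imp_space_eq by blast

lemma markov: "k \<in> I \<Longrightarrow> markov_process CS (\<lambda>t i. point_measure I (\<lambda>l. ennreal (matrix_exp N G t i l))) (M k) X"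
  by (rule mjp3[THEN conjunct1])

lemma prob_M: "k \<in> I \<Longrightarrow> prob_space (M k)"
  using markov[unfolded markov_process_def, THEN conjunct1] .

lemma meas_X: "0 \<le> t \<Longrightarrow> X t \<in> base \<rightarrow>\<^sub>M CS"
  using markov[OF one_in, unfolded markov_process_def, THEN conjunct2, THEN conjunct1] by (simp add: base_def)

lemma meas_X': "k \<in> I \<Longrightarrow> 0 \<le> t \<Longrightarrow> X t \<in> M k \<rightarrow>\<^sub>M CS"
  using markov[unfolded markov_process_def, THEN conjunct2, THEN conjunct1] by simp

lemma X_in: "\<omega> \<in> \<Omega> \<Longrightarrow> 0 \<le> t \<Longrightarrow> X t \<omega> \<in> I"
  using measurable_space[OF meas_X] by fastforce

lemma X_rc: "\<omega> \<in> \<Omega> \<Longrightarrow> 0 \<le> t \<Longrightarrow> \<forall>\<^sub>F s in at_right t. X s \<omega> = X t \<omega>"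
  using mjp3[OF one_in, THEN conjunct2, THEN conjunct2] unfolding base_def by (meson bspec)

lemma X_0: "k \<in> I \<Longrightarrow> AE \<omega> in M k. X 0 \<omega> = k"
  by (rule mjp3[THEN conjunct2, THEN conjunct1])

definition Filt :: "real \<Rightarrow> 'w measure" where
  "Filt s = natural_filtration base CS X s"

lemma Filt_eq: "k \<in> I \<Longrightarrow> natural_filtration (M k) CS X s = Filt s"
  unfolding natural_filtration_def Filt_def by (simp only: space_M)

lemma space_Filt [simp]: "space (Filt s) = \<Omega>"
  by (simp add: Filt_def natural_filtration_def space_measure_of_conv)

lemma sets_Filt: "sets (Filt s) = sigma_sets \<Omega> {X u -` A \<inter> \<Omega> | u A. 0 \<le> u \<and> u \<le> s \<and> A \<in> sets CS}"
  unfolding Filt_def natural_filtration_def by (subst sets_measure_of) auto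

lemma sets_Filt_subset: "sets (Filt s) \<subseteq> sets base"
  unfolding sets_Filt by (rule sets.sigma_sets_subset) (auto intro: measurable_sets[OF meas_X])

lemma Filt_M: "A \<in> sets (Filt s) \<Longrightarrow> k \<in> I \<Longrightarrow> A \<in> sets (M k)"
  using sets_Filt_subset sets_M by blast

lemma Filt_mono: "s \<le> t \<Longrightarrow> sets (Filt s) \<subseteq> sets (Filt t)"
  unfolding sets_Filt by (rule sigma_sets_mono') (blast intro: order_trans)

lemma subalg: "k \<in> I \<Longrightarrow> subalgebra (M k) (Filt s)"
  using sets_Filt_subset sets_M space_M by (auto simp: subalgebra_def)

lemma X_Filt: "0 \<le> u \<Longrightarrow> u \<le> s \<Longrightarrow> X u \<in> Filt s \<rightarrow>\<^sub>M CS"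
proof (rule measurableI)
  fix A assume "0 \<le> u" "u \<le> s" "A \<in> sets CS"
  then show "X u -` A \<inter> space (Filt s) \<in> sets (Filt s)"
    unfolding space_Filt unfolding sets_Filt by (intro sigma_sets.Basic) blast
qed (use X_in in simp)

lemma X_Filt_set: "0 \<le> u \<Longrightarrow> u \<le> s \<Longrightarrow> {\<omega> \<in> \<Omega>. X u \<omega> \<in> B} \<in> sets (Filt s)"
proof -
  assume u: "0 \<le> u" "u \<le> s"
  have "X u -` (B \<inter> I) \<inter> space (Filt s) \<in> sets (Filt s)"
    by (rule measurable_sets[OF X_Filt[OF u]]) auto
  also have "X u -` (B \<inter> I) \<inter> space (Filt s) = {\<omega> \<in> \<Omega>. X u \<omega> \<in> B}" using X_in u by auto
  finally show ?thesis .
qed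

lemma measurable_Filt_M: "f \<in> Filt s \<rightarrow>\<^sub>M K \<Longrightarrow> k \<in> I \<Longrightarrow> f \<in> M k \<rightarrow>\<^sub>M K"
  by (rule measurable_from_subalg[OF subalg])

text \<open>Read off the kernel, where \<open>ennreal\<close> cuts negative values to 0, and not off
  \<open>matrix_exp\<close>: in this way the positivity of the matrix exponential need not be
  established first.\<close>

definition p :: "real \<Rightarrow> nat \<Rightarrow> nat \<Rightarrow> real" where
  "p t i l = measure (point_measure I (\<lambda>l. ennreal (matrix_exp N G t i l))) {l}"

lemma markov_int:
  assumes k: "k \<in> I" and l: "l \<in> I" and s: "0 \<le> s" and t: "0 \<le> t" and A: "A \<in> sets (Filt s)"
  shows "measure (M k) (A \<inter> {\<omega> \<in> \<Omega>. X (s + t) \<omega> = l}) = (\<integral>\<omega>. indicator A \<omega> * p t (X s \<omega>) l \<partial>M k)"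
proof -
  interpret prob_space "M k" by (rule prob_M[OF k])
  interpret S: finite_measure_subalgebra "M k" "Filt s" by standard (rule subalg[OF k])
  let ?E = "X (s + t) -` {l} \<inter> space (M k)"
  have E: "?E \<in> sets (M k)" by (rule measurable_sets[OF meas_X'[OF k]]) (use s t l in auto)
  have A': "A \<in> sets (M k)" using A k by (rule Filt_M)
  have "\<forall>s\<ge>0. \<forall>t\<ge>0. \<forall>A\<in>sets CS. AE \<omega> in M k. real_cond_exp (M k) (Filt s) (indicator (X (s + t) -` A \<inter> space (M k))) \<omega>
      = measure (point_measure I (\<lambda>l. ennreal (matrix_exp N G t (X s \<omega>) l))) A"
    using markov[OF k, unfolded markov_process_def, THEN conjunct2, THEN conjunct2] unfolding Filt_eq[OF k] .
  moreover have "{l} \<in> sets CS" using l by simp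
  ultimately have AE: "AE \<omega> in M k. real_cond_exp (M k) (Filt s) (indicator ?E) \<omega> = p t (X s \<omega>) l"
    unfolding p_def using s t by blast
  have "measure (M k) (A \<inter> ?E) = (\<integral>\<omega>\<in>A. indicator ?E \<omega> \<partial>M k)"
    using A' E by (simp add: set_lebesgue_integral_def indicator_inter_arith[symmetric])
  also have "\<dots> = (\<integral>\<omega>\<in>A. real_cond_exp (M k) (Filt s) (indicator ?E) \<omega> \<partial>M k)"
    by (rule S.real_cond_exp_intA) (use E A in \<open>auto simp: emeasure_eq_measure\<close>)
  also have "\<dots> = (\<integral>\<omega>. indicator A \<omega> * p t (X s \<omega>) l \<partial>M k)"
    unfolding set_lebesgue_integral_def
  proof (rule integral_cong_AE)
    have "(\<lambda>i. p t i l) \<in> CS \<rightarrow>\<^sub>M borel" by simp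
    from measurable_compose[OF meas_X'[OF k s] this]
    show "(\<lambda>\<omega>. indicator A \<omega> * p t (X s \<omega>) l) \<in> borel_measurable (M k)" using A' by auto
  qed (use AE A' in auto)
  also have "A \<inter> ?E = A \<inter> {\<omega> \<in> \<Omega>. X (s + t) \<omega> = l}" using space_M[OF k] by auto
  finally show ?thesis .
qed

lemma markov_step:
  assumes k: "k \<in> I" and i: "i \<in> I" and l: "l \<in> I" and s: "0 \<le> s" and t: "0 \<le> t" and A: "A \<in> sets (Filt s)"
    and Ai: "\<And>\<omega>. \<omega> \<in> A \<Longrightarrow> X s \<omega> = i"
  shows "measure (M k) (A \<inter> {\<omega> \<in> \<Omega>. X (s + t) \<omega> = l}) = measure (M k) A * p t i l"
proof -
  interpret prob_space "M k" by (rule prob_M[OF k])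
  have A': "A \<in> sets (M k)" using A k by (rule Filt_M)
  have "(\<integral>\<omega>. indicator A \<omega> * p t (X s \<omega>) l \<partial>M k) = (\<integral>\<omega>. indicator A \<omega> * p t i l \<partial>M k)"
    by (rule Bochner_Integration.integral_cong) (auto simp: indicator_def Ai)
  also have "\<dots> = measure (M k) A * p t i l" using A' by (simp add: emeasure_eq_measure)
  finally show ?thesis using markov_int[OF k l s t A] by simp
qed

text \<open>The finite-dimensional distributions: the probability that the chain, in i at time r,
  lies in \<open>B r'\<close> at each later time r' of the list.\<close>

primrec cylw :: "(real \<Rightarrow> nat set) \<Rightarrow> real \<Rightarrow> nat \<Rightarrow> real list \<Rightarrow> real" where
  "cylw B r i [] = 1"
| "cylw B r i (r' # rs) = (\<Sum>j\<in>B r' \<inter> I. p (r' - r) i j * cylw B r' j rs)"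

text \<open>The past event A is kept arbitrary so that the induction over the times closes: after
  one step its intersection with {X = j} takes over the role of A.\<close>

lemma cylinder_markov:
  assumes "k \<in> I" "i \<in> I" "0 \<le> s" "0 \<le> r" "sorted (r # rs)" "A \<in> sets (Filt (s + r))"
    "\<And>\<omega>. \<omega> \<in> A \<Longrightarrow> X (s + r) \<omega> = i"
  shows "measure (M k) (A \<inter> {\<omega> \<in> \<Omega>. \<forall>r\<in>set rs. X (s + r) \<omega> \<in> B r}) = measure (M k) A * cylw B r i rs"
  using assms
proof (induction rs arbitrary: r i A)
  case Nil
  then have "A \<subseteq> \<Omega>" using sets.sets_into_space[of A "Filt (s + r)"] by simp
  then have "A \<inter> \<Omega> = A" by auto
  then show ?case by simp
next
  case (Cons r' rs)
  interpret prob_space "M k" by (rule prob_M[OF Cons.prems(1)])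
  have r': "r \<le> r'" "0 \<le> r'" "sorted (r' # rs)" using Cons.prems by auto
  have AM: "A \<in> sets (M k)" using Cons.prems Filt_M by blast
  let ?E = "\<lambda>j. A \<inter> {\<omega> \<in> \<Omega>. X (s + r') \<omega> = j}"
  let ?R = "{\<omega> \<in> \<Omega>. \<forall>r\<in>set rs. X (s + r) \<omega> \<in> B r}"
  have E: "?E j \<in> sets (Filt (s + r'))" for j
  proof (rule sets.Int)
    show "A \<in> sets (Filt (s + r'))" using Cons.prems(6) Filt_mono[of "s + r" "s + r'"] r' by auto
    show "{\<omega> \<in> \<Omega>. X (s + r') \<omega> = j} \<in> sets (Filt (s + r'))"
      using X_Filt_set[of "s + r'" "s + r'" "{j}"] Cons.prems r' by simp
  qed
  have R: "?R \<in> sets (M k)"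
  proof -
    have "?R = (\<Inter>r\<in>set rs. {\<omega> \<in> \<Omega>. X (s + r) \<omega> \<in> B r}) \<inter> \<Omega>" by auto
    moreover have "{\<omega> \<in> \<Omega>. X (s + r) \<omega> \<in> B r} \<in> sets (M k)" if "r \<in> set rs" for r
    proof (rule Filt_M[OF X_Filt_set[OF _ order_refl] Cons.prems(1)])
      show "0 \<le> s + r" using that r' Cons.prems(3) by auto
    qed
    moreover have "\<Omega> \<in> sets (M k)" using space_M[OF Cons.prems(1)] by (metis sets.top)
    ultimately show ?thesis by (cases "rs = []") (simp, auto intro!: sets.Int sets.finite_INT)
  qed
  have EM: "?E j \<in> sets (M k)" for j using E Filt_M Cons.prems(1) by blast
  have U: "A \<inter> {\<omega> \<in> \<Omega>. \<forall>r\<in>set (r' # rs). X (s + r) \<omega> \<in> B r} = (\<Union>j\<in>B r' \<inter> I. ?E j \<inter> ?R)"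
  proof -
    have "X (s + r') \<omega> \<in> I" if "\<omega> \<in> \<Omega>" for \<omega> by (rule X_in[OF that]) (use Cons.prems(3) r' in simp)
    then show ?thesis by (auto simp del: atLeastAtMost_iff)
  qed
  have "measure (M k) (A \<inter> {\<omega> \<in> \<Omega>. \<forall>r\<in>set (r' # rs). X (s + r) \<omega> \<in> B r})
      = (\<Sum>j\<in>B r' \<inter> I. measure (M k) (?E j \<inter> ?R))"
    unfolding U
  proof (rule finite_measure_finite_Union)
    show "disjoint_family_on (\<lambda>j. ?E j \<inter> ?R) (B r' \<inter> I)" by (auto simp: disjoint_family_on_def)
    show "(\<lambda>j. ?E j \<inter> ?R) ` (B r' \<inter> I) \<subseteq> sets (M k)" by (intro image_subsetI sets.Int[OF EM R])
  qed simp
  also have "\<dots> = (\<Sum>j\<in>B r' \<inter> I. measure (M k) A * (p (r' - r) i j * cylw B r' j rs))"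
  proof (rule sum.cong[OF refl])
    fix j assume j: "j \<in> B r' \<inter> I"
    have "measure (M k) (?E j \<inter> ?R) = measure (M k) (?E j) * cylw B r' j rs"
      by (rule Cons.IH[OF Cons.prems(1) _ Cons.prems(3) r'(2,3) E]) (use j in auto)
    also have "measure (M k) (?E j) = measure (M k) A * p (r' - r) i j"
    proof -
      have "s + r + (r' - r) = s + r'" by simp
      moreover have "j \<in> I" "0 \<le> s + r" "0 \<le> r' - r" using j r' Cons.prems(3,4) by auto
      ultimately show ?thesis using markov_step[OF Cons.prems(1,2) _ _ _ Cons.prems(6,7), of j "r' - r"] by metis
    qed
    finally show "measure (M k) (?E j \<inter> ?R) = measure (M k) A * (p (r' - r) i j * cylw B r' j rs)" by simp
  qed
  finally show ?case unfolding cylw.simps sum_distrib_left .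
qed

section \<open>The law of the shifted path\<close>

abbreviation "PS \<equiv> PiM {0..} (\<lambda>_ :: real. CS)"

definition path :: "real \<Rightarrow> 'w \<Rightarrow> real \<Rightarrow> nat" where
  "path s \<omega> = (\<lambda>r\<in>{0..}. X (s + r) \<omega>)"

lemma meas_path: "0 \<le> s \<Longrightarrow> path s \<in> base \<rightarrow>\<^sub>M PS"
  unfolding path_def by (rule measurable_restrict, rule meas_X) auto

lemma meas_path': "k \<in> I \<Longrightarrow> 0 \<le> s \<Longrightarrow> path s \<in> M k \<rightarrow>\<^sub>M PS"
  using meas_path sets_M[of k] by (simp cong: measurable_cong_sets)

text \<open>Both sides are finite measures in \<Gamma>. On cylinders they agree by
  \<open>cylinder_markov\<close>, and cylinders determine a finite measure on the product
  space.\<close>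

lemma path_markov:
  assumes k: "k \<in> I" and i: "i \<in> I" and s: "0 \<le> s" and A: "A \<in> sets (Filt s)"
    and Ai: "\<And>\<omega>. \<omega> \<in> A \<Longrightarrow> X s \<omega> = i" and \<Gamma>: "\<Gamma> \<in> sets PS"
  shows "emeasure (M k) (A \<inter> (path s -` \<Gamma> \<inter> \<Omega>)) = emeasure (M k) A * emeasure (M i) (path 0 -` \<Gamma> \<inter> \<Omega>)"
proof -
  interpret Mk: prob_space "M k" by (rule prob_M[OF k])
  interpret Mi: prob_space "M i" by (rule prob_M[OF i])
  have AM: "A \<in> sets (M k)" using A k by (rule Filt_M)
  define P1 where "P1 = distr (density (M k) (indicator A)) PS (path s)"
  define P2 where "P2 = scale_measure (emeasure (M k) A) (distr (M i) PS (path 0))"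
  have e1: "emeasure P1 \<Gamma> = emeasure (M k) (A \<inter> (path s -` \<Gamma> \<inter> \<Omega>))" if "\<Gamma> \<in> sets PS" for \<Gamma>
  proof -
    have m: "path s -` \<Gamma> \<inter> \<Omega> \<in> sets (M k)" using measurable_sets[OF meas_path'[OF k s] that] space_M[OF k] by simp
    have "emeasure P1 \<Gamma> = emeasure (density (M k) (indicator A)) (path s -` \<Gamma> \<inter> \<Omega>)"
      unfolding P1_def using that meas_path'[OF k s] space_M[OF k]
      by (subst emeasure_distr) (auto cong: measurable_cong_sets)
    then show ?thesis by (simp add: emeasure_restricted[OF AM m])
  qed
  have e2: "emeasure P2 \<Gamma> = emeasure (M k) A * emeasure (M i) (path 0 -` \<Gamma> \<inter> \<Omega>)" if "\<Gamma> \<in> sets PS" for \<Gamma>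
    unfolding P2_def using that i by (simp add: emeasure_distr meas_path' space_M)
  have "P1 = P2"
  proof (rule measure_eqI_PiM_infinite)
    show "sets P1 = sets PS" "sets P2 = sets PS" by (auto simp: P1_def P2_def)
    show "finite_measure P1"
    proof (rule finite_measureI)
      have "emeasure P1 (space P1) = emeasure (M k) (A \<inter> (path s -` space PS \<inter> \<Omega>))"
        using e1[of "space PS"] by (simp add: P1_def)
      then show "emeasure P1 (space P1) \<noteq> \<infinity>" by (simp add: Mk.emeasure_eq_measure)
    qed
  next
    fix B :: "real \<Rightarrow> nat set" and J :: "real set"
    assume J: "finite J" "J \<subseteq> {0..}" and B: "\<And>i. i \<in> J \<Longrightarrow> B i \<in> sets CS"
    let ?\<Gamma> = "prod_emb {0..} (\<lambda>_. CS) J (Pi\<^sub>E J B)"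
    let ?rs = "sorted_list_of_set J"
    have \<Gamma>: "?\<Gamma> \<in> sets PS" using J B by (intro sets_PiM_I) auto
    have v: "path s' -` ?\<Gamma> \<inter> \<Omega> = {\<omega> \<in> \<Omega>. \<forall>r\<in>set ?rs. X (s' + r) \<omega> \<in> B r}" if "0 \<le> s'" for s'
    proof -
      have "path s' \<omega> \<in> ?\<Gamma> \<longleftrightarrow> (\<forall>r\<in>J. X (s' + r) \<omega> \<in> B r)" if "\<omega> \<in> \<Omega>" for \<omega>
      proof -
        have "path s' \<omega> \<in> space PS" using measurable_space[OF meas_path[OF \<open>0 \<le> s'\<close>] that] .
        then have "path s' \<omega> \<in> ?\<Gamma> \<longleftrightarrow> restrict (path s' \<omega>) J \<in> Pi\<^sub>E J B"
          by (auto simp: prod_emb_iff space_PiM PiE_iff)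
        also have "\<dots> \<longleftrightarrow> (\<forall>r\<in>J. X (s' + r) \<omega> \<in> B r)"
          using J by (auto simp: PiE_iff path_def)
        finally show ?thesis .
      qed
      then show ?thesis using J by auto
    qed
    have sorted: "sorted (0 # ?rs)" using J by auto
    have 1: "measure (M k) (A \<inter> (path s -` ?\<Gamma> \<inter> \<Omega>)) = measure (M k) A * cylw B 0 i ?rs"
      unfolding v[OF s] by (rule cylinder_markov[of k i s 0]) (use k i s A Ai sorted in auto)
    \<comment> \<open>Under \<open>M i\<close> the start in i holds only almost surely, so the
      cylinder formula is applied to this event of full measure.\<close>
    define A0 where "A0 = {\<omega> \<in> \<Omega>. X 0 \<omega> = i}"
    have A0: "A0 \<in> sets (Filt 0)" using X_Filt_set[of 0 0 "{i}"] by (simp add: A0_def)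
    have A0M: "A0 \<in> sets (M i)" using A0 i by (rule Filt_M)
    have AE0: "AE \<omega> in M i. \<omega> \<in> A0" using X_0[OF i] AE_space by eventually_elim (use space_M[OF i] in \<open>auto simp: A0_def\<close>)
    have "measure (M i) (A0 \<inter> (path 0 -` ?\<Gamma> \<inter> \<Omega>)) = measure (M i) A0 * cylw B 0 i ?rs"
      unfolding v[OF order_refl] by (rule cylinder_markov[of i i 0 0]) (use i A0 sorted in \<open>auto simp: A0_def\<close>)
    also have "measure (M i) A0 = 1" using AE0 A0M by (simp add: Mi.prob_eq_1)
    also have "measure (M i) (A0 \<inter> (path 0 -` ?\<Gamma> \<inter> \<Omega>)) = measure (M i) (path 0 -` ?\<Gamma> \<inter> \<Omega>)"
    proof (rule Mi.finite_measure_eq_AE)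
      show m: "path 0 -` ?\<Gamma> \<inter> \<Omega> \<in> sets (M i)"
        using measurable_sets[OF meas_path'[OF i order_refl] \<Gamma>] space_M[OF i] by simp
      show "A0 \<inter> (path 0 -` ?\<Gamma> \<inter> \<Omega>) \<in> sets (M i)" using A0M m by auto
    qed (use AE0 in auto)
    finally have 2: "measure (M i) (path 0 -` ?\<Gamma> \<inter> \<Omega>) = cylw B 0 i ?rs" by simp
    show "emeasure P1 ?\<Gamma> = emeasure P2 ?\<Gamma>"
      unfolding e1[OF \<Gamma>] e2[OF \<Gamma>] Mk.emeasure_eq_measure Mi.emeasure_eq_measure 1 2[symmetric]
      by (simp add: ennreal_mult)
  qed
  then show ?thesis using e1[OF \<Gamma>] e2[OF \<Gamma>] by simp
qed

text \<open>A form of the Markov property in which Z collects everything that is remembered from the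
  past and the future enters as a whole path. The space is cut into the finitely many pieces on
  which \<open>X s\<close> is constant.\<close>

lemma markov_nn:
  assumes k: "k \<in> I" and s: "0 \<le> s" and Z: "Z \<in> Filt s \<rightarrow>\<^sub>M Q" and h: "h \<in> borel_measurable (Q \<Otimes>\<^sub>M PS)"
  shows "(\<integral>\<^sup>+\<omega>. h (Z \<omega>, path s \<omega>) \<partial>M k) = (\<integral>\<^sup>+\<omega>. (\<integral>\<^sup>+\<omega>'. h (Z \<omega>, path 0 \<omega>') \<partial>M (X s \<omega>)) \<partial>M k)"
proof -
  interpret Mk: prob_space "M k" by (rule prob_M[OF k])
  have ZM: "Z \<in> M k \<rightarrow>\<^sub>M Q" by (rule measurable_Filt_M[OF Z k])
  let ?A = "\<lambda>i. {\<omega> \<in> \<Omega>. X s \<omega> = i}"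
  have A: "?A i \<in> sets (Filt s)" for i using X_Filt_set[of s s "{i}"] s by simp
  have AM: "?A i \<in> sets (M k)" for i using A k by (rule Filt_M)
  note [measurable] = ZM meas_path'[OF k s] h
  have hP: "(\<lambda>z. \<integral>\<^sup>+\<omega>'. h (z, path 0 \<omega>') \<partial>M i) \<in> borel_measurable Q" if i: "i \<in> I" for i
  proof -
    interpret Mi: prob_space "M i" by (rule prob_M[OF i])
    note [measurable] = meas_path'[OF i order_refl]
    show ?thesis by measurable
  qed
  have piece: "(\<integral>\<^sup>+\<omega>. h (Z \<omega>, path s \<omega>) * indicator (?A i) \<omega> \<partial>M k)
      = (\<integral>\<^sup>+\<omega>. (\<integral>\<^sup>+\<omega>'. h (Z \<omega>, path 0 \<omega>') \<partial>M i) * indicator (?A i) \<omega> \<partial>M k)" if i: "i \<in> I" for i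
  proof -
    interpret Mi: prob_space "M i" by (rule prob_M[OF i])
    note [measurable] = meas_path'[OF i order_refl] AM
    let ?\<mu> = "density (M k) (indicator (?A i))"
    have meas\<mu>: "f \<in> ?\<mu> \<rightarrow>\<^sub>M K \<longleftrightarrow> f \<in> M k \<rightarrow>\<^sub>M K" for f K by (simp cong: measurable_cong_sets)
    have fm: "finite_measure ?\<mu>"
      by (rule finite_measureI) (use AM[of i] in \<open>simp add: emeasure_density Mk.emeasure_eq_measure nn_integral_set_ennreal[symmetric]\<close>)
    interpret D1: finite_measure "distr ?\<mu> Q Z" by (rule finite_measure.finite_measure_distr[OF fm]) simp
    interpret D2: prob_space "distr (M i) PS (path 0)" by (rule Mi.prob_space_distr) simp
    \<comment> \<open>On the piece \<open>X s = i\<close> past and future are independent: their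
      joint law is a product measure, and Fubini finishes the piece.\<close>
    have prod: "distr ?\<mu> Q Z \<Otimes>\<^sub>M distr (M i) PS (path 0) = distr ?\<mu> (Q \<Otimes>\<^sub>M PS) (\<lambda>\<omega>. (Z \<omega>, path s \<omega>))"
    proof (rule pair_measure_eqI)
      fix C \<Gamma> assume C: "C \<in> sets (distr ?\<mu> Q Z)" and \<Gamma>: "\<Gamma> \<in> sets (distr (M i) PS (path 0))"
      have C': "C \<in> sets Q" and \<Gamma>': "\<Gamma> \<in> sets PS" using C \<Gamma> by auto
      let ?B = "?A i \<inter> (Z -` C \<inter> \<Omega>)"
      have ZC: "Z -` C \<inter> \<Omega> \<in> sets (Filt s)" using measurable_sets[OF Z C'] by simp
      have B: "?B \<in> sets (Filt s)" using A ZC by auto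
      have BM: "?B \<in> sets (M k)" using B k by (rule Filt_M)
      have \<Gamma>M: "path s -` \<Gamma> \<inter> \<Omega> \<in> sets (M k)" using measurable_sets[OF meas_path'[OF k s] \<Gamma>'] space_M[OF k] by simp
      have d: "emeasure ?\<mu> E = emeasure (M k) (?A i \<inter> E)" if "E \<in> sets (M k)" for E
        by (rule emeasure_restricted[OF AM that])
      have "emeasure (distr ?\<mu> Q Z) C = emeasure (M k) ?B"
        using ZC C' sets_Filt_subset sets_M[OF k] space_M[OF k] by (subst emeasure_distr) (auto simp: d meas\<mu> subset_iff)
      moreover have "emeasure (distr (M i) PS (path 0)) \<Gamma> = emeasure (M i) (path 0 -` \<Gamma> \<inter> \<Omega>)"
        using \<Gamma>' space_M[OF i] by (subst emeasure_distr) auto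
      moreover have "emeasure (distr ?\<mu> (Q \<Otimes>\<^sub>M PS) (\<lambda>\<omega>. (Z \<omega>, path s \<omega>))) (C \<times> \<Gamma>) = emeasure (M k) (?B \<inter> (path s -` \<Gamma> \<inter> \<Omega>))"
      proof -
        have "(\<lambda>\<omega>. (Z \<omega>, path s \<omega>)) -` (C \<times> \<Gamma>) \<inter> \<Omega> = (Z -` C \<inter> \<Omega>) \<inter> (path s -` \<Gamma> \<inter> \<Omega>)" by auto
        moreover have "(Z -` C \<inter> \<Omega>) \<inter> (path s -` \<Gamma> \<inter> \<Omega>) \<in> sets (M k)"
          using ZC \<Gamma>M sets_Filt_subset sets_M[OF k] by blast
        ultimately show ?thesis
          using C' \<Gamma>' space_M[OF k] by (subst emeasure_distr) (auto simp: d meas\<mu> Int_assoc)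
      qed
      ultimately show "emeasure (distr ?\<mu> Q Z) C * emeasure (distr (M i) PS (path 0)) \<Gamma>
          = emeasure (distr ?\<mu> (Q \<Otimes>\<^sub>M PS) (\<lambda>\<omega>. (Z \<omega>, path s \<omega>))) (C \<times> \<Gamma>)"
        using path_markov[OF k i s B _ \<Gamma>'] by auto
    next
      show "sigma_finite_measure (distr ?\<mu> Q Z)" by standard (rule D1.sigma_finite_countable)
      show "sigma_finite_measure (distr (M i) PS (path 0))" by standard (rule D2.sigma_finite_countable)
    qed simp
    have "(\<integral>\<^sup>+\<omega>. h (Z \<omega>, path s \<omega>) * indicator (?A i) \<omega> \<partial>M k) = (\<integral>\<^sup>+\<omega>. h (Z \<omega>, path s \<omega>) \<partial>?\<mu>)"
      by (subst nn_integral_density) (auto simp: mult.commute)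
    also have "\<dots> = (\<integral>\<^sup>+x. h x \<partial>distr ?\<mu> (Q \<Otimes>\<^sub>M PS) (\<lambda>\<omega>. (Z \<omega>, path s \<omega>)))"
      by (subst nn_integral_distr) (auto simp: meas\<mu>)
    also have "\<dots> = (\<integral>\<^sup>+z. \<integral>\<^sup>+q. h (z, q) \<partial>distr (M i) PS (path 0) \<partial>distr ?\<mu> Q Z)"
      unfolding prod[symmetric] by (rule D2.nn_integral_fst[symmetric]) simp
    also have "\<dots> = (\<integral>\<^sup>+z. \<integral>\<^sup>+\<omega>'. h (z, path 0 \<omega>') \<partial>M i \<partial>distr ?\<mu> Q Z)"
      by (intro nn_integral_cong nn_integral_distr) (auto simp: space_pair_measure)
    also have "\<dots> = (\<integral>\<^sup>+\<omega>. \<integral>\<^sup>+\<omega>'. h (Z \<omega>, path 0 \<omega>') \<partial>M i \<partial>?\<mu>)"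
      by (rule nn_integral_distr) (use hP[OF i] in \<open>auto simp: meas\<mu>\<close>)
    also have "\<dots> = (\<integral>\<^sup>+\<omega>. (\<integral>\<^sup>+\<omega>'. h (Z \<omega>, path 0 \<omega>') \<partial>M i) * indicator (?A i) \<omega> \<partial>M k)"
      using measurable_compose[OF ZM hP[OF i]] by (subst nn_integral_density) (auto simp: mult.commute)
    finally show ?thesis .
  qed
  have one: "(\<Sum>i\<in>I. c i * indicator (?A i) \<omega>) = c (X s \<omega>)" if "\<omega> \<in> \<Omega>" for c :: "nat \<Rightarrow> ennreal" and \<omega>
  proof -
    have "(\<Sum>i\<in>I. c i * indicator (?A i) \<omega>) = (\<Sum>i\<in>I. if i = X s \<omega> then c i else 0)"
      by (rule sum.cong) (use that in \<open>auto simp: indicator_def\<close>)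
    then show ?thesis using X_in[OF that s] by simp
  qed
  have "(\<integral>\<^sup>+\<omega>. h (Z \<omega>, path s \<omega>) \<partial>M k) = (\<integral>\<^sup>+\<omega>. (\<Sum>i\<in>I. h (Z \<omega>, path s \<omega>) * indicator (?A i) \<omega>) \<partial>M k)"
    by (rule nn_integral_cong, rule one[symmetric]) (simp add: space_M[OF k])
  also have "\<dots> = (\<Sum>i\<in>I. \<integral>\<^sup>+\<omega>. h (Z \<omega>, path s \<omega>) * indicator (?A i) \<omega> \<partial>M k)"
    by (rule nn_integral_sum) (use AM in auto)
  also have "\<dots> = (\<Sum>i\<in>I. \<integral>\<^sup>+\<omega>. (\<integral>\<^sup>+\<omega>'. h (Z \<omega>, path 0 \<omega>') \<partial>M i) * indicator (?A i) \<omega> \<partial>M k)"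
    by (intro sum.cong refl piece)
  also have "\<dots> = (\<integral>\<^sup>+\<omega>. (\<Sum>i\<in>I. (\<integral>\<^sup>+\<omega>'. h (Z \<omega>, path 0 \<omega>') \<partial>M i) * indicator (?A i) \<omega>) \<partial>M k)"
    by (rule nn_integral_sum[symmetric]) (use AM measurable_compose[OF ZM hP] in auto)
  also have "\<dots> = (\<integral>\<^sup>+\<omega>. (\<integral>\<^sup>+\<omega>'. h (Z \<omega>, path 0 \<omega>') \<partial>M (X s \<omega>)) \<partial>M k)"
    by (rule nn_integral_cong, rule one) (simp add: space_M[OF k])
  finally show ?thesis .
qed

end

section \<open>Occupation times\<close>

lemma borel_measurable_vec_lambda:
  fixes f :: "'d::finite \<Rightarrow> 'a \<Rightarrow> real"
  assumes "\<And>j. f j \<in> borel_measurable M"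
  shows "(\<lambda>x. \<chi> j. f j x) \<in> borel_measurable M"
proof (subst borel_measurable_euclidean_space, rule ballI)
  fix b :: "real ^ 'd" assume "b \<in> Basis"
  then obtain j where "b = axis j 1" by (auto simp: Basis_vec_def)
  then show "(\<lambda>x. (\<chi> j. f j x) \<bullet> b) \<in> borel_measurable M" using assms[of j] by (simp add: inner_axis)
qed

context jump_process
begin

abbreviation "L \<equiv> occupation_time X"

text \<open>On a path the occupation time is a limit of Riemann sums, which involve countably many coordinates and
  are therefore measurable for the product \<open>\<sigma>\<close>-algebra.\<close>

definition occ :: "real \<Rightarrow> nat \<Rightarrow> (real \<Rightarrow> nat) \<Rightarrow> real" where
  "occ t i q = lim (\<lambda>n. t / real (Suc n) * (\<Sum>j=1..Suc n. indicator {i} (q (t * real j / real (Suc n)))))"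

lemma indicator_rc:
  assumes "\<omega> \<in> \<Omega>" "0 \<le> u"
  shows "\<forall>\<^sub>F s in at_right u. indicat_real {i} (X s \<omega>) = indicator {i} (X u \<omega>)"
  using X_rc[OF assms] by (rule eventually_mono) simp

lemmas riemann_X = right_riemann_sums[of _ "\<lambda>u. indicat_real {i} (X u \<omega>)" 1 for i \<omega>]

lemma occ_int:
  assumes "\<omega> \<in> \<Omega>" "0 \<le> s" "0 \<le> t"
  shows "integrable lborel (\<lambda>u. indicator {i} (X u \<omega>) * indicator {s<..s+t} u :: real)"
    "(\<lambda>n. t / real (Suc n) * (\<Sum>j=1..Suc n. indicator {i} (X (s + t * real j / real (Suc n)) \<omega>)))
       \<longlonglongrightarrow> (\<integral>u. indicator {i} (X u \<omega>) * indicator {s<..s+t} u \<partial>lborel)"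
  by (rule riemann_X; use assms indicator_rc[OF assms(1)] in auto)+

text \<open>The half-open interval fits the right-endpoint Riemann sums and makes increments
  additive; the point 0 that is lost has measure 0.\<close>

lemma L_eq:
  assumes w: "\<omega> \<in> \<Omega>" and t: "0 \<le> t"
  shows "L t i \<omega> = (\<integral>u. indicator {i} (X u \<omega>) * indicator {0<..0+t} u \<partial>lborel)"
proof -
  have "L t i \<omega> = (\<integral>u. indicator {i} (X u \<omega>) * indicator {0<..0+t} u + indicator {i} (X 0 \<omega>) * indicator {0} u \<partial>lborel)"
    unfolding occupation_time_def set_lebesgue_integral_def
    by (rule Bochner_Integration.integral_cong) (use t in \<open>auto simp: indicator_def\<close>)
  also have "\<dots> = (\<integral>u. indicator {i} (X u \<omega>) * indicator {0<..0+t} u \<partial>lborel) + (\<integral>u. indicator {i} (X 0 \<omega>) * indicator {0} u \<partial>(lborel :: real measure))"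
    by (rule Bochner_Integration.integral_add[OF occ_int(1)[OF w order_refl t]]) simp
  finally show ?thesis by simp
qed

lemma L_increment:
  assumes w: "\<omega> \<in> \<Omega>" and s: "0 \<le> s" and t: "0 \<le> t"
  shows "L (s + t) i \<omega> - L s i \<omega> = (\<integral>u. indicator {i} (X u \<omega>) * indicator {s<..s+t} u \<partial>lborel)"
proof -
  have "L (s + t) i \<omega> = (\<integral>u. indicator {i} (X u \<omega>) * indicator {0<..0+s} u + indicator {i} (X u \<omega>) * indicator {s<..s+t} u \<partial>lborel)"
    unfolding L_eq[OF w add_nonneg_nonneg[OF s t]]
    by (rule Bochner_Integration.integral_cong) (use s t in \<open>auto simp: indicator_def\<close>)
  also have "\<dots> = L s i \<omega> + (\<integral>u. indicator {i} (X u \<omega>) * indicator {s<..s+t} u \<partial>lborel)"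
    unfolding L_eq[OF w s]
    by (rule Bochner_Integration.integral_add[OF occ_int(1)[OF w order_refl s] occ_int(1)[OF w s t]])
  finally show ?thesis by simp
qed

lemma occ_path:
  assumes w: "\<omega> \<in> \<Omega>" and s: "0 \<le> s" and t: "0 \<le> t"
  shows "occ t i (path s \<omega>) = L (s + t) i \<omega> - L s i \<omega>"
proof -
  have e: "t * real j / real (Suc n) \<in> {0..}" for j n :: nat using t by simp
  show ?thesis unfolding occ_def L_increment[OF w s t]
    by (rule limI) (use occ_int(2)[OF w s t] e in \<open>simp add: path_def\<close>)
qed

lemma occ_meas: "0 \<le> t \<Longrightarrow> occ t i \<in> borel_measurable PS"
proof -
  assume t: "0 \<le> t"
  have "(\<lambda>q. indicat_real {i} (q r)) \<in> borel_measurable PS" if "0 \<le> r" for r :: real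
    by (rule measurable_compose[OF measurable_component_singleton]) (use that in auto)
  then show ?thesis unfolding occ_def
    by (intro borel_measurable_lim_metric borel_measurable_times borel_measurable_sum borel_measurable_const) (use t in auto)
qed

text \<open>The Riemann sums for time t sample X at times up to t only, so their limit is
  adapted.\<close>

lemma L_Filt:
  assumes t: "0 \<le> t" "t \<le> s"
  shows "L t i \<in> borel_measurable (Filt s)"
proof -
  let ?f = "\<lambda>n \<omega>. t / real (Suc n) * (\<Sum>j=1..Suc n. indicator {i} (X (0 + t * real j / real (Suc n)) \<omega>)) :: real"
  have X: "(\<lambda>\<omega>. indicat_real {i} (X (0 + t * real j / real (Suc n)) \<omega>)) \<in> borel_measurable (Filt s)"
    if "j \<in> {1..Suc n}" for j n
  proof (rule measurable_compose[OF X_Filt])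
    show "0 \<le> 0 + t * real j / real (Suc n)" using t by simp
    have "t * real j \<le> t * real (Suc n)" using t that by (intro mult_left_mono) auto
    then show "0 + t * real j / real (Suc n) \<le> s" using t by (simp add: divide_le_eq) (smt (verit) mult_right_mono of_nat_0_le_iff)
  qed simp
  have m: "?f n \<in> borel_measurable (Filt s)" for n
    by (intro borel_measurable_times borel_measurable_sum borel_measurable_const X)
  show ?thesis
  proof (rule borel_measurable_LIMSEQ_real[OF _ m])
    fix \<omega> assume "\<omega> \<in> space (Filt s)"
    then have w: "\<omega> \<in> \<Omega>" by simp
    show "(\<lambda>n. ?f n \<omega>) \<longlonglongrightarrow> L t i \<omega>" unfolding L_eq[OF w t(1)] by (rule occ_int(2)[OF w order_refl t(1)])
  qed
qed

lemma L_meas: "k \<in> I \<Longrightarrow> 0 \<le> t \<Longrightarrow> L t i \<in> borel_measurable (M k)"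
  by (rule measurable_Filt_M[OF L_Filt[OF _ order_refl]])

lemma L_mono:
  assumes w: "\<omega> \<in> \<Omega>" and s: "0 \<le> s" and t: "0 \<le> t"
  shows "L s i \<omega> \<le> L (s + t) i \<omega>"
proof -
  have "0 \<le> (\<integral>u. indicator {i} (X u \<omega>) * indicator {s<..s+t} u \<partial>(lborel :: real measure) :: real)"
    by (rule Bochner_Integration.integral_nonneg) simp
  then show ?thesis using L_increment[OF w s t, of i] by linarith
qed

lemma L_0: "\<omega> \<in> \<Omega> \<Longrightarrow> L 0 i \<omega> = 0"
  by (simp add: L_eq)

lemma L_nonneg: "\<omega> \<in> \<Omega> \<Longrightarrow> 0 \<le> t \<Longrightarrow> 0 \<le> L t i \<omega>"
  using L_mono[of \<omega> 0 t i] by (simp add: L_0)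

lemma L_sum:
  assumes w: "\<omega> \<in> \<Omega>" and t: "0 \<le> t"
  shows "(\<Sum>i\<in>I. L t i \<omega>) = t"
proof -
  have "(\<Sum>i\<in>I. L t i \<omega>) = (\<integral>u. (\<Sum>i\<in>I. indicator {i} (X u \<omega>) * indicator {0<..0+t} u) \<partial>lborel)"
    unfolding L_eq[OF w t] by (rule Bochner_Integration.integral_sum[symmetric]) (rule occ_int(1)[OF w order_refl t])
  also have "\<dots> = (\<integral>u. indicator {0<..0+t} u \<partial>lborel)"
  proof (rule Bochner_Integration.integral_cong[OF refl])
    fix u
    show "(\<Sum>i\<in>I. indicator {i} (X u \<omega>) * indicator {0<..0+t} u) = indicat_real {0<..0+t} u"
    proof (cases "u \<in> {0<..0+t}")
      case True
      then have "X u \<omega> \<in> I" using X_in[OF w, of u] by auto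
      have "(\<Sum>i\<in>I. indicator {i} (X u \<omega>) * indicator {0<..0+t} u) = (\<Sum>i\<in>I. if i = X u \<omega> then 1 else (0::real))"
        by (rule sum.cong) (use True in \<open>auto simp: indicator_def\<close>)
      also have "\<dots> = 1" using \<open>X u \<omega> \<in> I\<close> by simp
      also have "1 = indicat_real {0<..0+t} u" using True by simp
      finally show ?thesis .
    qed simp
  qed
  also have "\<dots> = t" using t by simp
  finally show ?thesis .
qed

lemma L_le: "\<omega> \<in> \<Omega> \<Longrightarrow> 0 \<le> t \<Longrightarrow> i \<in> I \<Longrightarrow> L t i \<omega> \<le> t"
  using member_le_sum[of i I "\<lambda>i. L t i \<omega>"] L_nonneg L_sum by simp

end

section \<open>The Markov additive property\<close>

locale jump_coords = jump_process N G M X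
  for N :: nat and G :: "nat \<Rightarrow> nat \<Rightarrow> real" and M :: "nat \<Rightarrow> 'w measure" and X :: "real \<Rightarrow> 'w \<Rightarrow> nat" +
  fixes idx :: "'d::finite \<Rightarrow> nat" and c :: "'d \<Rightarrow> real"
begin

text \<open>The drift c is arbitrary at this stage, since a linear centring does not disturb the
  additive structure; the mean occupation times are inserted in the final theorem.\<close>

definition Y :: "real \<Rightarrow> 'w \<Rightarrow> real ^ 'd" where
  "Y t \<omega> = (\<chi> j. L t (idx j) \<omega> - t * c j)"

definition yinc :: "real \<Rightarrow> (real \<Rightarrow> nat) \<Rightarrow> real ^ 'd" where
  "yinc t q = (\<chi> j. occ t (idx j) q - t * c j)"

lemma yinc_path: "\<omega> \<in> \<Omega> \<Longrightarrow> 0 \<le> s \<Longrightarrow> 0 \<le> t \<Longrightarrow> yinc t (path s \<omega>) = Y (s + t) \<omega> - Y s \<omega>"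
  by (simp add: yinc_def Y_def occ_path vec_eq_iff algebra_simps)

lemma Y_0: "\<omega> \<in> \<Omega> \<Longrightarrow> Y 0 \<omega> = 0"
  by (simp add: Y_def L_0 vec_eq_iff)

lemma yinc_meas: "0 \<le> t \<Longrightarrow> yinc t \<in> borel_measurable PS"
  unfolding yinc_def by (intro borel_measurable_vec_lambda borel_measurable_diff occ_meas) auto

lemma Y_Filt: "0 \<le> t \<Longrightarrow> t \<le> s \<Longrightarrow> Y t \<in> borel_measurable (Filt s)"
  unfolding Y_def by (intro borel_measurable_vec_lambda borel_measurable_diff L_Filt) auto

lemma Y_meas: "k \<in> I \<Longrightarrow> 0 \<le> t \<Longrightarrow> Y t \<in> borel_measurable (M k)"
  by (rule measurable_Filt_M[OF Y_Filt[OF _ order_refl]])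

abbreviation "S \<equiv> CS \<Otimes>\<^sub>M (borel :: (real ^ 'd) measure)"

definition kernel :: "real \<Rightarrow> nat \<times> (real ^ 'd) \<Rightarrow> (nat \<times> (real ^ 'd)) measure" where
  "kernel t z = distr (M (fst z)) S (\<lambda>\<omega>. (X t \<omega>, snd z + Y t \<omega>))"

lemma XY_meas: "k \<in> I \<Longrightarrow> 0 \<le> t \<Longrightarrow> (\<lambda>\<omega>. (X t \<omega>, y + Y t \<omega>)) \<in> M k \<rightarrow>\<^sub>M S"
  using meas_X' Y_meas by (intro measurable_Pair borel_measurable_add) auto

lemma emeasure_kernel:
  assumes "k \<in> I" "0 \<le> t" "A \<in> sets S"
  shows "emeasure (kernel t (k, y)) A = (\<integral>\<^sup>+\<omega>. indicator A (X t \<omega>, y + Y t \<omega>) \<partial>M k)"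
proof -
  have "emeasure (kernel t (k, y)) A = (\<integral>\<^sup>+z. indicator A z \<partial>kernel t (k, y))"
    by (rule nn_integral_indicator[symmetric]) (simp add: kernel_def assms)
  also have "\<dots> = (\<integral>\<^sup>+\<omega>. indicator A (X t \<omega>, y + Y t \<omega>) \<partial>M k)"
    unfolding kernel_def fst_conv snd_conv
    by (rule nn_integral_distr[OF XY_meas[OF assms(1,2)]]) (use assms in simp)
  finally show ?thesis .
qed

lemma kernel_meas:
  assumes t: "0 \<le> t" shows "kernel t \<in> S \<rightarrow>\<^sub>M prob_algebra S"
proof (rule measurable_pair_measure_countable1)
  fix k assume k: "k \<in> I"
  have g: "(\<lambda>y. M k) \<in> borel \<rightarrow>\<^sub>M prob_algebra (M k)"
    by (rule measurable_const) (simp add: space_prob_algebra prob_M[OF k])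
  have f: "(\<lambda>(y, \<omega>). (X t \<omega>, y + Y t \<omega>)) \<in> borel \<Otimes>\<^sub>M M k \<rightarrow>\<^sub>M S"
  proof -
    note [measurable] = meas_X'[OF k t] Y_meas[OF k t]
    show ?thesis by measurable
  qed
  show "(\<lambda>y. kernel t (k, y)) \<in> borel \<rightarrow>\<^sub>M prob_algebra S"
    unfolding kernel_def fst_conv snd_conv
    by (rule measurable_distr_prob_space2[OF g f])
qed simp

text \<open>Both W and Z depend on the past, so that the statement serves twice: W = 1 and
  \<open>Z = y + Y s\<close> give the Chapman-Kolmogorov equation, W an indicator and
  \<open>Z = Y s\<close> the conditional expectation.\<close>

lemma kernel_markov:
  assumes k: "k \<in> I" and s: "0 \<le> s" and t: "0 \<le> t"
    and W: "W \<in> borel_measurable (Filt s)" and Z: "Z \<in> borel_measurable (Filt s)" and A: "A \<in> sets S"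
  shows "(\<integral>\<^sup>+\<omega>. W \<omega> * indicator A (X (s + t) \<omega>, Z \<omega> + (Y (s + t) \<omega> - Y s \<omega>)) \<partial>M k)
       = (\<integral>\<^sup>+\<omega>. W \<omega> * emeasure (kernel t (X s \<omega>, Z \<omega>)) A \<partial>M k)"
proof -
  define h where "h = (\<lambda>x. fst (fst x) * indicator A (snd x t, snd (fst x) + yinc t (snd x)) :: ennreal)"
  have WZ: "(\<lambda>\<omega>. (W \<omega>, Z \<omega>)) \<in> Filt s \<rightarrow>\<^sub>M borel \<Otimes>\<^sub>M borel" using W Z by simp
  have qt: "(\<lambda>q. q t) \<in> PS \<rightarrow>\<^sub>M CS" by (rule measurable_component_singleton) (use t in simp)
  have h: "h \<in> borel_measurable ((borel \<Otimes>\<^sub>M borel) \<Otimes>\<^sub>M PS)"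
  proof -
    note [measurable] = qt yinc_meas[OF t] A
    show ?thesis unfolding h_def by measurable
  qed
  have "(\<integral>\<^sup>+\<omega>. W \<omega> * indicator A (X (s + t) \<omega>, Z \<omega> + (Y (s + t) \<omega> - Y s \<omega>)) \<partial>M k) = (\<integral>\<^sup>+\<omega>. h ((W \<omega>, Z \<omega>), path s \<omega>) \<partial>M k)"
    by (rule nn_integral_cong) (use s t in \<open>simp add: h_def yinc_path space_M[OF k], simp add: path_def\<close>)
  also have "\<dots> = (\<integral>\<^sup>+\<omega>. (\<integral>\<^sup>+\<omega>'. h ((W \<omega>, Z \<omega>), path 0 \<omega>') \<partial>M (X s \<omega>)) \<partial>M k)"
    by (rule markov_nn[OF k s WZ h])
  also have "\<dots> = (\<integral>\<^sup>+\<omega>. W \<omega> * emeasure (kernel t (X s \<omega>, Z \<omega>)) A \<partial>M k)"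
  proof (rule nn_integral_cong)
    fix \<omega> assume "\<omega> \<in> space (M k)"
    then have i: "X s \<omega> \<in> I" using X_in[OF _ s] space_M[OF k] by simp
    have m: "(\<lambda>\<omega>'. indicator A (X t \<omega>', Z \<omega> + Y t \<omega>') :: ennreal) \<in> borel_measurable (M (X s \<omega>))"
      by (rule measurable_compose[OF XY_meas[OF i t]]) (use A in simp)
    have "(\<integral>\<^sup>+\<omega>'. h ((W \<omega>, Z \<omega>), path 0 \<omega>') \<partial>M (X s \<omega>)) = (\<integral>\<^sup>+\<omega>'. W \<omega> * indicator A (X t \<omega>', Z \<omega> + Y t \<omega>') \<partial>M (X s \<omega>))"
      by (rule nn_integral_cong) (use t in \<open>simp add: h_def yinc_path Y_0 space_M[OF i], simp add: path_def\<close>)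
    also have "\<dots> = W \<omega> * emeasure (kernel t (X s \<omega>, Z \<omega>)) A"
      by (subst nn_integral_cmult[OF m]) (simp add: emeasure_kernel[OF i t A])
    finally show "(\<integral>\<^sup>+\<omega>'. h ((W \<omega>, Z \<omega>), path 0 \<omega>') \<partial>M (X s \<omega>)) = W \<omega> * emeasure (kernel t (X s \<omega>, Z \<omega>)) A" .
  qed
  finally show ?thesis .
qed

lemma kernel_semigroup: "transition_semigroup S kernel"
  unfolding transition_semigroup_def
proof (intro conjI allI impI ballI)
  show "kernel t \<in> S \<rightarrow>\<^sub>M prob_algebra S" if "0 \<le> t" for t by (rule kernel_meas[OF that])
next
  fix z :: "nat \<times> (real ^ 'd)" assume z: "z \<in> space S"
  obtain k y where zk: "z = (k, y)" by (cases z)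
  have k: "k \<in> I" using z zk by (simp add: space_pair_measure)
  interpret prob_space "M k" by (rule prob_M[OF k])
  have "kernel 0 z = distr (M k) S (\<lambda>_. (k, y))"
    unfolding kernel_def zk fst_conv snd_conv
  proof (rule distr_cong_AE)
    show "AE \<omega> in M k. (X 0 \<omega>, y + Y 0 \<omega>) = (k, y)"
      using X_0[OF k] AE_space by eventually_elim (simp add: Y_0 space_M[OF k])
    show "(\<lambda>_. (k, y)) \<in> M k \<rightarrow>\<^sub>M S" by (rule measurable_const) (use z zk in simp)
  qed (auto intro: XY_meas[OF k])
  also have "\<dots> = return S z" unfolding zk by (rule distr_const) (use z zk in simp)
  finally show "kernel 0 z = return S z" .
next
  fix s t :: real and z :: "nat \<times> (real ^ 'd)" assume s: "0 \<le> s" and t: "0 \<le> t" and z: "z \<in> space S"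
  obtain k y where zk: "z = (k, y)" by (cases z)
  have k: "k \<in> I" using z zk by (simp add: space_pair_measure)
  have st: "0 \<le> s + t" using s t by simp
  have ks: "kernel t \<in> kernel s z \<rightarrow>\<^sub>M subprob_algebra S"
    using measurable_prob_algebraD[OF kernel_meas[OF t]] by (simp add: kernel_def cong: measurable_cong_sets)
  have ne: "space (kernel s z) \<noteq> {}"
    using z by (auto simp: kernel_def)
  show "kernel (s + t) z = kernel s z \<bind> kernel t"
  proof (rule measure_eqI)
    show "sets (kernel (s + t) z) = sets (kernel s z \<bind> kernel t)"
      by (subst sets_bind[of _ _ S]) (use ne in \<open>auto simp: kernel_def\<close>)
    fix A assume "A \<in> sets (kernel (s + t) z)"
    then have A: "A \<in> sets S" by (simp add: kernel_def)
    have Z: "(\<lambda>\<omega>. y + Y s \<omega>) \<in> borel_measurable (Filt s)"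
      using Y_Filt[OF s order_refl] by (intro borel_measurable_add) auto
    have "emeasure (kernel (s + t) z) A = (\<integral>\<^sup>+\<omega>. 1 * indicator A (X (s + t) \<omega>, (y + Y s \<omega>) + (Y (s + t) \<omega> - Y s \<omega>)) \<partial>M k)"
      unfolding zk emeasure_kernel[OF k st A] by simp
    also have "\<dots> = (\<integral>\<^sup>+\<omega>. 1 * emeasure (kernel t (X s \<omega>, y + Y s \<omega>)) A \<partial>M k)"
      by (rule kernel_markov[OF k s t _ Z A]) simp
    also have "\<dots> = (\<integral>\<^sup>+z'. emeasure (kernel t z') A \<partial>kernel s z)"
      unfolding kernel_def[of s] zk fst_conv snd_conv
      by (subst nn_integral_distr[OF XY_meas[OF k s]])
         (use measurable_emeasure_kernel[OF measurable_prob_algebraD[OF kernel_meas[OF t]] A] in auto)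
    also have "\<dots> = emeasure (kernel s z \<bind> kernel t) A"
      by (rule emeasure_bind[symmetric, OF ne ks A])
    finally show "emeasure (kernel (s + t) z) A = emeasure (kernel s z \<bind> kernel t) A" .
  qed
qed

lemma kernel_process:
  assumes k: "k \<in> I"
  shows "markov_process S kernel (M k) (\<lambda>t \<omega>. (X t \<omega>, Y t \<omega>))"
proof -
  interpret prob_space "M k" by (rule prob_M[OF k])
  let ?Z = "\<lambda>t \<omega>. (X t \<omega>, Y t \<omega>)"
  have ZF: "?Z u \<in> Filt s \<rightarrow>\<^sub>M S" if "0 \<le> u" "u \<le> s" for u s
    using X_Filt[OF that] Y_Filt[OF that] by (rule measurable_Pair)
  have ZM: "?Z u \<in> M k \<rightarrow>\<^sub>M S" if "0 \<le> u" for u by (rule measurable_Filt_M[OF ZF[OF that order_refl] k])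
  have main: "AE \<omega> in M k. real_cond_exp (M k) (natural_filtration (M k) S ?Z s) (indicator (?Z (s + t) -` A \<inter> space (M k))) \<omega>
          = measure (kernel t (?Z s \<omega>)) A"
    if s: "0 \<le> s" and t: "0 \<le> t" and A: "A \<in> sets S" for s t A
  proof -
    let ?F = "natural_filtration (M k) S ?Z s"
    let ?E = "?Z (s + t) -` A \<inter> space (M k)"
    have Pow: "{?Z u -` A \<inter> space (M k) |u A. 0 \<le> u \<and> u \<le> s \<and> A \<in> sets S} \<subseteq> Pow (space (M k))" by auto
    have spF: "space ?F = space (M k)" by (simp add: natural_filtration_def space_measure_of_conv)
    have setsF: "sets ?F = sigma_sets (space (M k)) {?Z u -` A \<inter> space (M k) |u A. 0 \<le> u \<and> u \<le> s \<and> A \<in> sets S}"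
      unfolding natural_filtration_def by (rule sets_measure_of[OF Pow])
    \<comment> \<open>Y is a functional of the past of X, so the pair generates no more than X
      alone. The conditional expectation may then be tested on the smaller filtration, provided that
      its value is measurable there (\<open>Zs\<close> and \<open>gm\<close>).\<close>
    have sub: "sets ?F \<subseteq> sets (Filt s)"
    proof -
      have "sigma_sets (space (Filt s)) {?Z u -` A \<inter> space (M k) |u A. 0 \<le> u \<and> u \<le> s \<and> A \<in> sets S} \<subseteq> sets (Filt s)"
      proof (rule sets.sigma_sets_subset, rule subsetI)
        fix B assume "B \<in> {?Z u -` A \<inter> space (M k) |u A. 0 \<le> u \<and> u \<le> s \<and> A \<in> sets S}"
        then obtain u A where B: "B = ?Z u -` A \<inter> space (M k)" "0 \<le> u" "u \<le> s" "A \<in> sets S" by blast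
        show "B \<in> sets (Filt s)" using measurable_sets[OF ZF[OF B(2,3)] B(4)] unfolding B(1) space_M[OF k] by simp
      qed
      then show ?thesis unfolding setsF using space_M[OF k] by simp
    qed
    have subM: "subalgebra (M k) ?F"
      using sub Filt_M[OF _ k] spF by (auto simp: subalgebra_def)
    interpret FF: finite_measure_subalgebra "M k" ?F by standard (rule subM)
    have Zs: "?Z s \<in> ?F \<rightarrow>\<^sub>M S"
    proof (rule measurableI)
      fix C assume "C \<in> sets S"
      then show "?Z s -` C \<inter> space ?F \<in> sets ?F"
        unfolding spF unfolding setsF by (intro sigma_sets.Basic CollectI exI[of _ s] exI[of _ C]) (use s in auto)
    next
      fix \<omega> assume "\<omega> \<in> space ?F"
      then show "?Z s \<omega> \<in> space S" using measurable_space[OF ZM[OF s]] spF by simp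
    qed
    have E: "?E \<in> sets (M k)" by (rule measurable_sets[OF ZM A]) (use s t in simp)
    let ?g = "\<lambda>\<omega>. measure (kernel t (?Z s \<omega>)) A"
    have gm0: "(\<lambda>z. measure (kernel t z) A) \<in> borel_measurable S"
      using kernel_meas[OF t] A by (intro measurable_compose[OF measurable_prob_algebraD[OF kernel_meas[OF t]] measurable_measure_subprob_algebra])
    have gm: "?g \<in> borel_measurable ?F" by (rule measurable_compose[OF Zs gm0])
    have gmM: "?g \<in> borel_measurable (M k)" by (rule measurable_compose[OF ZM[OF s] gm0])
    have pk: "prob_space (kernel t (?Z s \<omega>))" if "\<omega> \<in> space (M k)" for \<omega>
      using measurable_space[OF kernel_meas[OF t] measurable_space[OF ZM[OF s] that]] by (simp add: space_prob_algebra)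
    have g01: "AE \<omega> in M k. ?g \<omega> \<le> 1"
      by (rule AE_I2) (use prob_space.prob_le_1[OF pk] in auto)
    have gi: "integrable (M k) ?g"
      by (rule integrable_const_bound[of _ 1]) (use g01 gmM in auto)
    show ?thesis
    proof (rule FF.real_cond_exp_charact)
      show "integrable (M k) (indicat_real ?E)" using E by (simp add: emeasure_eq_measure)
      fix B assume B: "B \<in> sets ?F"
      have BF: "B \<in> sets (Filt s)" using B sub by blast
      have BM: "B \<in> sets (M k)" using BF k by (rule Filt_M)
      have "ennreal (\<integral>\<omega>\<in>B. indicator ?E \<omega> \<partial>M k) = emeasure (M k) (B \<inter> ?E)"
        using BM E by (simp add: set_lebesgue_integral_def indicator_inter_arith[symmetric] emeasure_eq_measure)
      also have "\<dots> = (\<integral>\<^sup>+\<omega>. indicator (B \<inter> ?E) \<omega> \<partial>M k)"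
        by (rule nn_integral_indicator[symmetric]) (use BM E in auto)
      also have "\<dots> = (\<integral>\<^sup>+\<omega>. indicator B \<omega> * indicator A (X (s + t) \<omega>, Y s \<omega> + (Y (s + t) \<omega> - Y s \<omega>)) \<partial>M k)"
        by (rule nn_integral_cong) (auto simp: indicator_def)
      also have "\<dots> = (\<integral>\<^sup>+\<omega>. indicator B \<omega> * emeasure (kernel t (X s \<omega>, Y s \<omega>)) A \<partial>M k)"
        by (rule kernel_markov[OF k s t _ Y_Filt[OF s order_refl] A]) (use BF in simp)
      also have "\<dots> = (\<integral>\<^sup>+\<omega>. ennreal (indicator B \<omega> * ?g \<omega>) \<partial>M k)"
      proof (rule nn_integral_cong)
        fix \<omega> assume "\<omega> \<in> space (M k)"
        from pk[OF this] interpret K: prob_space "kernel t (?Z s \<omega>)" .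
        show "indicator B \<omega> * emeasure (kernel t (X s \<omega>, Y s \<omega>)) A = ennreal (indicator B \<omega> * ?g \<omega>)"
          by (auto simp: K.emeasure_eq_measure indicator_def)
      qed
      also have "\<dots> = ennreal (\<integral>\<omega>. indicator B \<omega> * ?g \<omega> \<partial>M k)"
        by (rule nn_integral_eq_integral) (use integrable_mult_indicator[OF BM gi] in auto)
      finally have "ennreal (\<integral>\<omega>\<in>B. indicator ?E \<omega> \<partial>M k) = ennreal (\<integral>\<omega>\<in>B. ?g \<omega> \<partial>M k)"
        by (simp add: set_lebesgue_integral_def)
      then show "(\<integral>\<omega>\<in>B. indicator ?E \<omega> \<partial>M k) = (\<integral>\<omega>\<in>B. ?g \<omega> \<partial>M k)"
        by (subst (asm) ennreal_inj) (auto simp: set_lebesgue_integral_def intro!: Bochner_Integration.integral_nonneg)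
    qed (use gi gm in auto)
  qed
  show ?thesis unfolding markov_process_def
    using prob_space_axioms ZM main by auto
qed

lemma map_property: "markov_additive_process N M X Y"
  unfolding markov_additive_process_def
proof (intro exI[of _ kernel] conjI allI impI ballI)
  show "transition_semigroup S kernel" by (rule kernel_semigroup)
  show "markov_process S kernel (M k) (\<lambda>t \<omega>. (X t \<omega>, Y t \<omega>))" if "k \<in> I" for k by (rule kernel_process[OF that])
  fix t :: real and k l :: nat and y :: "real ^ 'd" and B :: "(real ^ 'd) set"
  assume t: "0 \<le> t" and k: "k \<in> I" and l: "l \<in> I" and B: "B \<in> sets borel"
  have B': "(\<lambda>b. b - y) ` B \<in> sets borel"
  proof -
    have "(\<lambda>b. b - y) ` B = (\<lambda>b. b + y) -` B \<inter> space borel"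
      by (auto intro: image_eqI[of x _ "x + y" for x])
    also have "\<dots> \<in> sets borel" by (rule measurable_sets[OF _ B]) simp
    finally show ?thesis .
  qed
  have "(y + Y t \<omega> \<in> B) \<longleftrightarrow> (0 + Y t \<omega> \<in> (\<lambda>b. b - y) ` B)" for \<omega>
    by (auto simp: image_iff intro: bexI[of _ "y + Y t \<omega>"])
  then have "emeasure (kernel t (k, y)) ({l} \<times> B) = emeasure (kernel t (k, 0)) ({l} \<times> (\<lambda>b. b - y) ` B)"
    using l B B' by (subst (1 2) emeasure_kernel[OF k t]) (auto intro!: nn_integral_cong simp: indicator_def)
  then show "measure (kernel t (k, y)) ({l} \<times> B) = measure (kernel t (k, 0)) ({l} \<times> (\<lambda>b. b - y) ` B)"
    by (simp add: measure_def)
qed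

end

section \<open>Laplace transforms of occupation times\<close>

lemma matrix_power_bound:
  assumes "k \<in> {1..N}" "l \<in> {1..N}"
  shows "\<bar>matrix_power N A n k l\<bar> \<le> (\<Sum>i=1..N. \<Sum>j=1..N. \<bar>A i j\<bar>) ^ n"
  using assms
proof (induction n arbitrary: l)
  case (Suc n)
  let ?K = "\<Sum>i=1..N. \<Sum>j=1..N. \<bar>A i j\<bar>"
  have K0: "0 \<le> ?K" by (intro sum_nonneg) auto
  have "\<bar>matrix_power N A (Suc n) k l\<bar> \<le> (\<Sum>j=1..N. ?K ^ n * \<bar>A j l\<bar>)"
    unfolding matrix_power.simps
    by (rule order_trans[OF sum_abs]) (use Suc in \<open>auto simp: abs_mult intro!: sum_mono mult_right_mono\<close>)
  also have "\<dots> \<le> ?K ^ n * ?K"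
    unfolding sum_distrib_left[symmetric]
    by (intro mult_left_mono sum_mono member_le_sum) (use Suc.prems K0 in auto)
  finally show ?case by (simp add: mult.commute)
qed simp

lemma matrix_exp_taylor:
  assumes k: "k \<in> {1..N}" and l: "l \<in> {1..N}"
  shows "\<exists>C\<ge>0. \<forall>t\<in>{0..1}. \<bar>matrix_exp N A t k l - (if k = l then 1 else 0) - t * A k l\<bar> \<le> C * t\<^sup>2"
proof -
  define K where "K = (\<Sum>i=1..N. \<Sum>j=1..N. \<bar>A i j\<bar>)"
  have K0: "0 \<le> K" unfolding K_def by (intro sum_nonneg) auto
  let ?a = "\<lambda>n. matrix_power N A n k l"
  have a: "\<bar>?a n\<bar> \<le> K ^ n" for n using matrix_power_bound[OF k l] by (simp add: K_def)
  have P1: "?a 1 = A k l"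
  proof -
    have "?a 1 = ?a (Suc 0)" by (simp only: One_nat_def)
    also have "\<dots> = (\<Sum>j=1..N. (if k = j then 1 else 0) * A j l)" by (simp only: matrix_power.simps)
    also have "\<dots> = (\<Sum>j=1..N. if j = k then A j l else 0)" by (rule sum.cong) auto
    finally show ?thesis using k by simp
  qed
  let ?C = "K\<^sup>2 * exp K"
  have sK: "(\<lambda>n. K ^ n / fact n) sums exp K" using exp_converges[of K] by (simp add: field_simps)
  have "\<bar>matrix_exp N A t k l - (if k = l then 1 else 0) - t * A k l\<bar> \<le> ?C * t\<^sup>2" if t: "t \<in> {0..1}" for t
  proof -
    let ?f = "\<lambda>n. t ^ n / fact n * ?a n"
    have t1: "t ^ n \<le> 1" for n using t by (simp add: power_le_one)
    have b: "\<bar>?f n\<bar> \<le> K ^ n / fact n" for n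
    proof -
      have "\<bar>?f n\<bar> = t ^ n * (\<bar>?a n\<bar> / fact n)" using t by (simp add: abs_mult)
      also have "\<dots> \<le> 1 * (K ^ n / fact n)"
        by (intro mult_mono t1 divide_right_mono a) (use t in auto)
      finally show ?thesis by simp
    qed
    have sf: "summable ?f"
      by (rule summable_comparison_test[OF _ sums_summable[OF sK]]) (use b in auto)
    have "matrix_exp N A t k l = (\<Sum>n. ?f (n + 2)) + (\<Sum>n<2. ?f n)"
      unfolding matrix_exp_def by (rule suminf_split_initial_segment[OF sf])
    also have "(\<Sum>n<2. ?f n) = (if k = l then 1 else 0) + t * A k l"
      using P1 by (simp add: numeral_2_eq_2 One_nat_def)
    finally have e: "matrix_exp N A t k l - (if k = l then 1 else 0) - t * A k l = (\<Sum>n. ?f (n + 2))" by simp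
    have g: "\<bar>?f (n + 2)\<bar> \<le> t\<^sup>2 * (K\<^sup>2 * (K ^ n / fact n))" for n
    proof -
      have "\<bar>?f (n + 2)\<bar> = t\<^sup>2 * t ^ n * (\<bar>?a (n + 2)\<bar> / fact (n + 2))"
        using t by (simp add: abs_mult power_add mult_ac power2_eq_square del: matrix_power.simps)
      also have "\<dots> \<le> t\<^sup>2 * 1 * (K ^ (n + 2) / fact n)"
        by (intro mult_mono mult_left_mono t1 frac_le a fact_mono) (use t K0 in auto)
      finally show ?thesis by (simp add: power_add mult_ac power2_eq_square)
    qed
    have s2: "(\<lambda>n. t\<^sup>2 * (K\<^sup>2 * (K ^ n / fact n))) sums (t\<^sup>2 * (K\<^sup>2 * exp K))"
      by (intro sums_mult sK)
    have sn: "summable (\<lambda>n. \<bar>?f (n + 2)\<bar>)"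
      by (rule summable_comparison_test[OF _ sums_summable[OF s2]]) (intro exI[of _ 0] allI impI, use g in simp)
    have "\<bar>\<Sum>n. ?f (n + 2)\<bar> \<le> (\<Sum>n. \<bar>?f (n + 2)\<bar>)"
      by (rule summable_rabs[OF sn])
    also have "\<dots> \<le> (\<Sum>n. t\<^sup>2 * (K\<^sup>2 * (K ^ n / fact n)))"
      by (rule suminf_le[OF g sn sums_summable[OF s2]])
    also have "\<dots> = ?C * t\<^sup>2" using sums_unique[OF s2] by (simp add: mult_ac)
    finally show ?thesis unfolding e by simp
  qed
  then show ?thesis by (intro exI[of _ ?C]) auto
qed

lemma abs_exp_minus_diff: "0 \<le> x \<Longrightarrow> 0 \<le> y \<Longrightarrow> \<bar>exp (-x) - exp (-y)\<bar> \<le> \<bar>x - y\<bar>" for x y :: real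
proof (induction x y rule: linorder_wlog)
  case (le x y)
  have "exp (-x) - exp (-y) = exp (-x) * (1 - exp (-(y - x)))" by (simp add: algebra_simps exp_add[symmetric])
  also have "\<dots> \<le> 1 * (y - x)"
  proof (intro mult_mono)
    show "1 - exp (-(y - x)) \<le> y - x" using exp_ge_add_one_self[of "-(y - x)"] by linarith
  qed (use le in auto)
  finally show ?case using le by auto
qed (simp add: abs_minus_commute)

lemma exp_minus_taylor: "0 \<le> x \<Longrightarrow> \<bar>exp (-x) - 1 + x\<bar> \<le> x\<^sup>2" for x :: real
proof -
  assume x: "0 \<le> x"
  have 1: "1 - x \<le> exp (-x)" using exp_ge_add_one_self[of "-x"] by simp
  have "1 + x \<le> exp x" by (rule exp_ge_add_one_self)
  then have "exp (-x) \<le> 1 / (1 + x)" using x by (simp add: exp_minus field_simps)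
  also have "\<dots> \<le> 1 - x + x\<^sup>2" using x by (simp add: field_simps power2_eq_square)
  finally show ?thesis using 1 by auto
qed

context jump_process
begin

abbreviation \<delta> :: "nat \<Rightarrow> nat \<Rightarrow> real" where "\<delta> k l \<equiv> (if k = l then 1 else 0)"

lemma G_nonneg: "k \<in> I \<Longrightarrow> l \<in> I \<Longrightarrow> k \<noteq> l \<Longrightarrow> 0 \<le> G k l"
  using generator unfolding is_generator_def by blast

lemma G_sum: "k \<in> I \<Longrightarrow> (\<Sum>l\<in>I. G k l) = 0"
  using generator unfolding is_generator_def by blast

text \<open>The summand 1 gives 1 / Lam \<le> 1, so [0, 1 / Lam] can serve as the range of small
  times: it lies in [0, 1], and on it 1 + h G has nonnegative entries.\<close>

definition Lam :: real where "Lam = 1 + (\<Sum>k\<in>I. \<Sum>l\<in>I. \<bar>G k l\<bar>)"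

lemma Lam_ge1: "1 \<le> Lam"
  unfolding Lam_def by (simp add: sum_nonneg)

lemma G_le_Lam: "k \<in> I \<Longrightarrow> l \<in> I \<Longrightarrow> \<bar>G k l\<bar> \<le> Lam - 1"
proof -
  assume k: "k \<in> I" and l: "l \<in> I"
  have "\<bar>G k l\<bar> \<le> (\<Sum>l\<in>I. \<bar>G k l\<bar>)" by (rule member_le_sum) (use l in auto)
  also have "\<dots> \<le> (\<Sum>k\<in>I. \<Sum>l\<in>I. \<bar>G k l\<bar>)"
    by (rule member_le_sum[of k I "\<lambda>k. \<Sum>l\<in>I. \<bar>G k l\<bar>"]) (use k in \<open>auto intro!: sum_nonneg\<close>)
  finally show ?thesis by (simp add: Lam_def)
qed

definition P :: "nat \<Rightarrow> nat \<Rightarrow> real" where "P k l = \<delta> k l + G k l / Lam"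

lemma G_P: "G k l = Lam * (P k l - \<delta> k l)"
  using Lam_ge1 by (simp add: P_def)

lemma stochastic_P: "stochastic_matrix N P"
proof
  show "0 \<le> P k l" if "k \<in> I" "l \<in> I" for k l
  proof (cases "k = l")
    case True
    have "- Lam \<le> G k l" using G_le_Lam[OF that] by linarith
    then have "-1 \<le> G k l / Lam" using Lam_ge1 by (simp add: field_simps)
    then show ?thesis using True by (simp add: P_def)
  qed (use G_nonneg[OF that] Lam_ge1 in \<open>simp add: P_def\<close>)
  show "(\<Sum>l\<in>I. P k l) = 1" if "k \<in> I" for k
  proof -
    have "(\<Sum>l\<in>I. P k l) = (\<Sum>l\<in>I. \<delta> k l) + (\<Sum>l\<in>I. G k l) / Lam"
      by (simp add: P_def sum.distrib sum_divide_distrib)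
    then show ?thesis using that G_sum[OF that] by simp
  qed
qed

sublocale stochastic_matrix N P by (rule stochastic_P)

lemma p_eq: "l \<in> I \<Longrightarrow> p t k l = max 0 (matrix_exp N G t k l)"
  unfolding p_def measure_def by (subst emeasure_point_measure_finite) (auto simp: max_def ennreal_neg)

lemma X_dist:
  assumes k: "k \<in> I" and l: "l \<in> I" and t: "0 \<le> t"
  shows "measure (M k) {\<omega> \<in> \<Omega>. X t \<omega> = l} = p t k l"
proof -
  interpret prob_space "M k" by (rule prob_M[OF k])
  let ?A = "{\<omega> \<in> \<Omega>. X 0 \<omega> = k}"
  have A: "?A \<in> sets (Filt 0)" using X_Filt_set[of 0 0 "{k}"] by simp
  have AE: "AE \<omega> in M k. \<omega> \<in> ?A" using X_0[OF k] AE_space by eventually_elim (simp add: space_M[OF k])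
  have AM: "?A \<in> sets (M k)" using A k by (rule Filt_M)
  have Xl: "{\<omega> \<in> \<Omega>. X t \<omega> = l} \<in> sets (M k)" using Filt_M[OF X_Filt_set[OF t order_refl, of "{l}"] k] by simp
  have "measure (M k) (?A \<inter> {\<omega> \<in> \<Omega>. X (0 + t) \<omega> = l}) = measure (M k) ?A * p t k l"
    by (rule markov_step[OF k k l order_refl t A]) simp
  also have "measure (M k) ?A = 1" using AE AM by (simp add: prob_eq_1)
  also have "measure (M k) (?A \<inter> {\<omega> \<in> \<Omega>. X (0 + t) \<omega> = l}) = measure (M k) {\<omega> \<in> \<Omega>. X t \<omega> = l}"
    by (rule finite_measure_eq_AE) (use AE AM Xl in auto)
  finally show ?thesis by simp
qed

section \<open>Expansions at time 0\<close>

lemma p_small: "\<exists>C\<ge>0. \<forall>k\<in>I. \<forall>l\<in>I. \<forall>h\<in>{0..1 / Lam}. \<bar>p h k l - \<delta> k l - h * G k l\<bar> \<le> C * h\<^sup>2"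
proof -
  have "\<forall>k\<in>I. \<forall>l\<in>I. \<exists>C\<ge>0. \<forall>t\<in>{0..1}. \<bar>matrix_exp N G t k l - \<delta> k l - t * G k l\<bar> \<le> C * t\<^sup>2"
    by (intro ballI matrix_exp_taylor)
  then obtain C where C: "\<And>k l. k \<in> I \<Longrightarrow> l \<in> I \<Longrightarrow> 0 \<le> C k l"
    "\<And>k l t. k \<in> I \<Longrightarrow> l \<in> I \<Longrightarrow> t \<in> {0..1} \<Longrightarrow> \<bar>matrix_exp N G t k l - \<delta> k l - t * G k l\<bar> \<le> C k l * t\<^sup>2"
    by metis
  let ?C = "\<Sum>k\<in>I. \<Sum>l\<in>I. C k l"
  have CC: "C k l \<le> ?C" if "k \<in> I" "l \<in> I" for k l
  proof -
    have "C k l \<le> (\<Sum>l\<in>I. C k l)" by (rule member_le_sum) (use that C in auto)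
    also have "\<dots> \<le> ?C" by (rule member_le_sum[of k I "\<lambda>k. \<Sum>l\<in>I. C k l"]) (use that C in \<open>auto intro!: sum_nonneg\<close>)
    finally show ?thesis .
  qed
  have "\<bar>p h k l - \<delta> k l - h * G k l\<bar> \<le> ?C * h\<^sup>2" if k: "k \<in> I" and l: "l \<in> I" and h: "h \<in> {0..1 / Lam}" for k l h
  proof -
    have h1: "h \<in> {0..1}" using h Lam_ge1 by (auto intro: order_trans[of h "1 / Lam" 1])
    \<comment> \<open>The first-order approximation is nonnegative for h \<le> 1 / Lam, so cutting
      the exponential at 0 can only bring it closer.\<close>
    have nn: "0 \<le> \<delta> k l + h * G k l"
    proof (cases "k = l")
      case True
      have "h * \<bar>G k l\<bar> \<le> (1 / Lam) * Lam"
        by (intro mult_mono) (use h Lam_ge1 G_le_Lam[OF k l] in auto)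
      moreover have "h * (- G k l) \<le> h * \<bar>G k l\<bar>" by (rule mult_left_mono) (use h in auto)
      moreover have "(1 / Lam) * Lam = 1" using Lam_ge1 by simp
      ultimately have "0 \<le> 1 + h * G k l" by simp
      then show ?thesis using True by simp
    qed (use G_nonneg[OF k l] h in simp)
    have "\<bar>p h k l - \<delta> k l - h * G k l\<bar> \<le> \<bar>matrix_exp N G h k l - \<delta> k l - h * G k l\<bar>"
      unfolding p_eq[OF l] using nn by linarith
    also have "\<dots> \<le> C k l * h\<^sup>2" by (rule C(2)[OF k l h1])
    also have "\<dots> \<le> ?C * h\<^sup>2" by (rule mult_right_mono[OF CC[OF k l]]) simp
    finally show ?thesis .
  qed
  moreover have "0 \<le> ?C" using C by (auto intro!: sum_nonneg)
  ultimately show ?thesis by blast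
qed

text \<open>Being in i \<noteq> k at a time up to h has probability of order h, and the times in
  question have length h, hence the square. Expectations are taken of the Riemann sums, where only
  the transition probabilities at fixed times enter, and passed to the limit by dominated
  convergence.\<close>

lemma expectation_L_small:
  "\<exists>C\<ge>0. \<forall>k\<in>I. \<forall>i\<in>I - {k}. \<forall>h\<in>{0..1 / Lam}. (\<integral>\<omega>. L h i \<omega> \<partial>M k) \<le> C * h\<^sup>2"
proof -
  obtain C where C: "0 \<le> C" "\<And>k l h. k \<in> I \<Longrightarrow> l \<in> I \<Longrightarrow> h \<in> {0..1 / Lam} \<Longrightarrow> \<bar>p h k l - \<delta> k l - h * G k l\<bar> \<le> C * h\<^sup>2"
    using p_small by blast
  have "(\<integral>\<omega>. L h i \<omega> \<partial>M k) \<le> (Lam + C) * h\<^sup>2"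
    if k: "k \<in> I" and i: "i \<in> I - {k}" and h: "h \<in> {0..1 / Lam}" for k i h
  proof -
    interpret prob_space "M k" by (rule prob_M[OF k])
    have iI: "i \<in> I" and ik: "k \<noteq> i" using i by auto
    have h0: "0 \<le> h" using h by auto
    have h1: "h \<le> 1" using h Lam_ge1 by (auto intro: order_trans[of h "1 / Lam" 1])
    let ?S = "\<lambda>n \<omega>. h / real (Suc n) * (\<Sum>j=1..Suc n. indicator {i} (X (0 + h * real j / real (Suc n)) \<omega>)) :: real"
    have r: "0 \<le> h * real j / real (Suc n)" "h * real j / real (Suc n) \<le> h" if "j \<in> {1..Suc n}" for j n
    proof -
      have "h * real j \<le> h * real (Suc n)" using h0 that by (intro mult_left_mono) auto
      then show "h * real j / real (Suc n) \<le> h" by (subst divide_le_eq) auto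
      show "0 \<le> h * real j / real (Suc n)" using h0 by simp
    qed
    have Xm: "(\<lambda>\<omega>. indicat_real {i} (X r \<omega>)) \<in> borel_measurable (M k)" if "0 \<le> r" for r
      by (rule measurable_compose[OF meas_X'[OF k that]]) simp
    have Sm: "?S n \<in> borel_measurable (M k)" for n
      by (intro borel_measurable_times borel_measurable_sum borel_measurable_const Xm) (use r in auto)
    have Sb: "\<bar>?S n \<omega>\<bar> \<le> h" for n \<omega>
    proof -
      have "(\<Sum>j=1..Suc n. indicat_real {i} (X (0 + h * real j / real (Suc n)) \<omega>)) \<le> (\<Sum>j=1..Suc n. 1)"
        by (rule sum_mono) (simp add: indicator_def)
      then have "?S n \<omega> \<le> h / real (Suc n) * real (Suc n)" using h0 by (intro mult_left_mono) auto
      moreover have "0 \<le> ?S n \<omega>" using h0 by (intro mult_nonneg_nonneg sum_nonneg) auto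
      ultimately show ?thesis by (simp del: of_nat_Suc)
    qed
    have lim: "(\<lambda>n. \<integral>\<omega>. ?S n \<omega> \<partial>M k) \<longlonglongrightarrow> (\<integral>\<omega>. L h i \<omega> \<partial>M k)"
    proof (rule integral_dominated_convergence[where w = "\<lambda>_. h"])
      show "AE \<omega> in M k. (\<lambda>n. ?S n \<omega>) \<longlonglongrightarrow> L h i \<omega>"
      proof (rule AE_I2)
        fix \<omega> assume "\<omega> \<in> space (M k)"
        then have w: "\<omega> \<in> \<Omega>" by (simp add: space_M[OF k])
        show "(\<lambda>n. ?S n \<omega>) \<longlonglongrightarrow> L h i \<omega>" unfolding L_eq[OF w h0] by (rule occ_int(2)[OF w order_refl h0])
      qed
    qed (use L_meas[OF k h0] Sm Sb in auto)
    have "(\<integral>\<omega>. ?S n \<omega> \<partial>M k) \<le> (Lam + C) * h\<^sup>2" for n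
    proof -
      have ind: "(\<integral>\<omega>. indicat_real {i} (X r \<omega>) \<partial>M k) = p r k i" if "0 \<le> r" for r
      proof -
        have "(\<integral>\<omega>. indicat_real {i} (X r \<omega>) \<partial>M k) = (\<integral>\<omega>. indicator {\<omega> \<in> \<Omega>. X r \<omega> = i} \<omega> \<partial>M k)"
          by (rule Bochner_Integration.integral_cong) (auto simp: indicator_def space_M[OF k])
        also have "\<dots> = measure (M k) {\<omega> \<in> \<Omega>. X r \<omega> = i}" using space_M[OF k] by (simp add: Int_absorb2 subset_iff)
        finally show ?thesis using X_dist[OF k iI that] by simp
      qed
      have "(\<integral>\<omega>. ?S n \<omega> \<partial>M k) = h / real (Suc n) * (\<Sum>j=1..Suc n. \<integral>\<omega>. indicator {i} (X (0 + h * real j / real (Suc n)) \<omega>) \<partial>M k)"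
        by (subst integral_mult_right_zero, subst Bochner_Integration.integral_sum)
           (auto intro!: integrable_const_bound[of _ 1] Xm simp del: sum.cl_ivl_Suc simp: r h0)
      also have "\<dots> = h / real (Suc n) * (\<Sum>j=1..Suc n. p (h * real j / real (Suc n)) k i)"
        using r ind by (simp del: sum.cl_ivl_Suc)
      also have "\<dots> \<le> h / real (Suc n) * (\<Sum>j=1..Suc n. (Lam + C) * h)"
      proof (intro mult_left_mono sum_mono)
        fix j assume j: "j \<in> {1..Suc n}"
        let ?r = "h * real j / real (Suc n)"
        have r': "?r \<in> {0..1 / Lam}" using r[OF j] h by auto
        have r1: "?r \<le> 1" using r(2)[OF j] h1 by (rule order_trans)
        have "p ?r k i \<le> ?r * G k i + C * ?r\<^sup>2" using C(2)[OF k iI r'] ik by auto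
        also have "\<dots> \<le> h * Lam + C * (h * 1)"
        proof (intro add_mono mult_mono mult_left_mono)
          show "?r\<^sup>2 \<le> h * 1" unfolding power2_eq_square by (intro mult_mono r r1 j h0)
          show "G k i \<le> Lam" using G_le_Lam[OF k iI] by linarith
        qed (use r[OF j] h0 C G_nonneg[OF k iI ik] in auto)
        finally show "p ?r k i \<le> (Lam + C) * h" by (simp add: algebra_simps)
      qed (use h0 in auto)
      also have "\<dots> = (Lam + C) * h\<^sup>2" by (simp add: power2_eq_square del: of_nat_Suc)
      finally show ?thesis .
    qed
    then show ?thesis by (intro LIMSEQ_le_const2[OF lim]) auto
  qed
  then show ?thesis using C(1) Lam_ge1 by (intro exI[of _ "Lam + C"]) auto
qed

section \<open>The Feynman-Kac semigroup of the occupation times\<close>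

definition wL :: "(nat \<Rightarrow> real) \<Rightarrow> real \<Rightarrow> 'w \<Rightarrow> real" where
  "wL a t \<omega> = (\<Sum>i\<in>I. a i * L t i \<omega>)"

lemma wL_meas: "k \<in> I \<Longrightarrow> 0 \<le> t \<Longrightarrow> wL a t \<in> borel_measurable (M k)"
  unfolding wL_def by (intro borel_measurable_sum borel_measurable_times L_meas) auto

lemma wL_nonneg: "\<forall>i\<in>I. 0 \<le> a i \<Longrightarrow> \<omega> \<in> \<Omega> \<Longrightarrow> 0 \<le> t \<Longrightarrow> 0 \<le> wL a t \<omega>"
  unfolding wL_def by (intro sum_nonneg mult_nonneg_nonneg L_nonneg) auto

text \<open>The transition probabilities of the chain killed at rate \<open>a i\<close> while in i.
  The generator of this semigroup is G minus the diagonal matrix of a.\<close>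

definition \<Phi> :: "(nat \<Rightarrow> real) \<Rightarrow> real \<Rightarrow> nat \<Rightarrow> nat \<Rightarrow> real" where
  "\<Phi> a t k l = (\<integral>\<omega>. exp (- wL a t \<omega>) * indicator {l} (X t \<omega>) \<partial>M k)"

lemma \<Phi>_integrand:
  assumes a: "\<forall>i\<in>I. 0 \<le> a i" and k: "k \<in> I" and t: "0 \<le> t"
  shows "(\<lambda>\<omega>. exp (- wL a t \<omega>) * indicat_real {l} (X t \<omega>)) \<in> borel_measurable (M k)"
    "integrable (M k) (\<lambda>\<omega>. exp (- wL a t \<omega>) * indicat_real {l} (X t \<omega>))"
    "(\<integral>\<^sup>+\<omega>. ennreal (exp (- wL a t \<omega>) * indicat_real {l} (X t \<omega>)) \<partial>M k) = ennreal (\<Phi> a t k l)"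
proof -
  interpret prob_space "M k" by (rule prob_M[OF k])
  have X: "(\<lambda>\<omega>. indicat_real {l} (X t \<omega>)) \<in> borel_measurable (M k)"
    by (rule measurable_compose[OF meas_X'[OF k t]]) simp
  show m: "(\<lambda>\<omega>. exp (- wL a t \<omega>) * indicat_real {l} (X t \<omega>)) \<in> borel_measurable (M k)"
    using wL_meas[OF k t] X by simp
  show i: "integrable (M k) (\<lambda>\<omega>. exp (- wL a t \<omega>) * indicat_real {l} (X t \<omega>))"
    by (rule integrable_const_bound[of _ 1])
       (use m wL_nonneg[OF a _ t] in \<open>auto intro!: AE_I2 simp: indicator_def space_M[OF k]\<close>)
  show "(\<integral>\<^sup>+\<omega>. ennreal (exp (- wL a t \<omega>) * indicat_real {l} (X t \<omega>)) \<partial>M k) = ennreal (\<Phi> a t k l)"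
    unfolding \<Phi>_def by (rule nn_integral_eq_integral[OF i]) auto
qed

lemma \<Phi>_nonneg: "0 \<le> \<Phi> a t k l"
  unfolding \<Phi>_def by (rule Bochner_Integration.integral_nonneg) auto

lemma \<Phi>_sum:
  assumes a: "\<forall>i\<in>I. 0 \<le> a i" and k: "k \<in> I" and t: "0 \<le> t"
  shows "(\<Sum>l\<in>I. f l * \<Phi> a t k l) = (\<integral>\<omega>. exp (- wL a t \<omega>) * f (X t \<omega>) \<partial>M k)"
    "integrable (M k) (\<lambda>\<omega>. exp (- wL a t \<omega>) * f (X t \<omega>))"
proof -
  have e: "(\<Sum>l\<in>I. f l * (exp (- wL a t \<omega>) * indicator {l} (X t \<omega>))) = exp (- wL a t \<omega>) * f (X t \<omega>)"
    if "\<omega> \<in> space (M k)" for \<omega>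
  proof -
    have "X t \<omega> \<in> I" using X_in[OF _ t] that space_M[OF k] by simp
    have "(\<Sum>l\<in>I. f l * (exp (- wL a t \<omega>) * indicator {l} (X t \<omega>))) = (\<Sum>l\<in>I. if l = X t \<omega> then exp (- wL a t \<omega>) * f (X t \<omega>) else 0)"
      by (rule sum.cong) (auto simp: indicator_def)
    also have "\<dots> = exp (- wL a t \<omega>) * f (X t \<omega>)" using \<open>X t \<omega> \<in> I\<close> by simp
    finally show ?thesis .
  qed
  have i: "integrable (M k) (\<lambda>\<omega>. \<Sum>l\<in>I. f l * (exp (- wL a t \<omega>) * indicator {l} (X t \<omega>)))"
    by (intro Bochner_Integration.integrable_sum integrable_mult_right \<Phi>_integrand(2)[OF a k t])
  show "integrable (M k) (\<lambda>\<omega>. exp (- wL a t \<omega>) * f (X t \<omega>))"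
    using i by (rule Bochner_Integration.integrable_cong[THEN iffD1, rotated -1]) (use e in auto)
  have "(\<Sum>l\<in>I. f l * \<Phi> a t k l) = (\<integral>\<omega>. (\<Sum>l\<in>I. f l * (exp (- wL a t \<omega>) * indicator {l} (X t \<omega>))) \<partial>M k)"
    unfolding \<Phi>_def using \<Phi>_integrand(2)[OF a k t]
    by (subst Bochner_Integration.integral_sum) auto
  also have "\<dots> = (\<integral>\<omega>. exp (- wL a t \<omega>) * f (X t \<omega>) \<partial>M k)"
    by (rule Bochner_Integration.integral_cong) (use e in auto)
  finally show "(\<Sum>l\<in>I. f l * \<Phi> a t k l) = (\<integral>\<omega>. exp (- wL a t \<omega>) * f (X t \<omega>) \<partial>M k)" .
qed

lemma \<Phi>_le_exp:
  assumes a: "\<forall>i\<in>I. b \<le> a i" and b: "0 \<le> b" and k: "k \<in> I" and l: "l \<in> I" and t: "0 \<le> t"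
  shows "\<Phi> a t k l \<le> exp (- b * t)"
proof -
  interpret prob_space "M k" by (rule prob_M[OF k])
  have a0: "\<forall>i\<in>I. 0 \<le> a i" using a b by (meson order_trans)
  have "\<Phi> a t k l \<le> (\<integral>\<omega>. exp (- b * t) \<partial>M k)"
    unfolding \<Phi>_def
  proof (rule integral_mono[OF \<Phi>_integrand(2)[OF a0 k t]])
    fix \<omega> assume "\<omega> \<in> space (M k)"
    then have w: "\<omega> \<in> \<Omega>" by (simp add: space_M[OF k])
    have "b * t = (\<Sum>i\<in>I. b * L t i \<omega>)" using L_sum[OF w t] by (simp add: sum_distrib_left[symmetric])
    also have "\<dots> \<le> wL a t \<omega>" unfolding wL_def by (intro sum_mono mult_right_mono L_nonneg[OF w t]) (use a in auto)
    finally show "exp (- wL a t \<omega>) * indicator {l} (X t \<omega>) \<le> exp (- b * t)" by (auto simp: indicator_def)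
  qed simp
  then show ?thesis by (simp add: prob_space)
qed

lemma \<Phi>_le_1: "\<forall>i\<in>I. 0 \<le> a i \<Longrightarrow> k \<in> I \<Longrightarrow> l \<in> I \<Longrightarrow> 0 \<le> t \<Longrightarrow> \<Phi> a t k l \<le> 1"
  using \<Phi>_le_exp[of 0 a k l t] by simp

lemma \<Phi>_semigroup:
  assumes a: "\<forall>i\<in>I. 0 \<le> a i" and k: "k \<in> I" and l: "l \<in> I" and s: "0 \<le> s" and t: "0 \<le> t"
  shows "\<Phi> a (s + t) k l = (\<Sum>j\<in>I. \<Phi> a s k j * \<Phi> a t j l)"
proof -
  have st: "0 \<le> s + t" using s t by simp
  define h where "h = (\<lambda>x. ennreal (fst x * (exp (- (\<Sum>i\<in>I. a i * occ t i (snd x))) * indicator {l} (snd x t))))"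
  have Z: "(\<lambda>\<omega>. exp (- wL a s \<omega>)) \<in> borel_measurable (Filt s)"
  proof -
    have "wL a s \<in> borel_measurable (Filt s)"
      unfolding wL_def by (intro borel_measurable_sum borel_measurable_times L_Filt s) auto
    then show ?thesis by simp
  qed
  have hm: "h \<in> borel_measurable (borel \<Otimes>\<^sub>M PS)"
  proof -
    have q: "(\<lambda>q. indicat_real {l} (q t)) \<in> borel_measurable PS"
      by (rule measurable_compose[OF measurable_component_singleton]) (use t in auto)
    note [measurable] = q occ_meas[OF t]
    show ?thesis unfolding h_def by measurable
  qed
  have "ennreal (\<Phi> a (s + t) k l) = (\<integral>\<^sup>+\<omega>. h (exp (- wL a s \<omega>), path s \<omega>) \<partial>M k)"
    unfolding \<Phi>_integrand(3)[OF a k st, symmetric]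
  proof (rule nn_integral_cong)
    fix \<omega> assume "\<omega> \<in> space (M k)"
    then have w: "\<omega> \<in> \<Omega>" by (simp add: space_M[OF k])
    have "wL a (s + t) \<omega> = wL a s \<omega> + (\<Sum>i\<in>I. a i * occ t i (path s \<omega>))"
      unfolding wL_def occ_path[OF w s t] sum.distrib[symmetric] by (rule sum.cong) (auto simp: algebra_simps)
    then show "ennreal (exp (- wL a (s + t) \<omega>) * indicat_real {l} (X (s + t) \<omega>)) = h (exp (- wL a s \<omega>), path s \<omega>)"
      using t by (simp add: h_def path_def exp_add[symmetric])
  qed
  also have "\<dots> = (\<integral>\<^sup>+\<omega>. (\<integral>\<^sup>+\<omega>'. h (exp (- wL a s \<omega>), path 0 \<omega>') \<partial>M (X s \<omega>)) \<partial>M k)"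
    by (rule markov_nn[OF k s Z hm])
  also have "\<dots> = (\<integral>\<^sup>+\<omega>. ennreal (exp (- wL a s \<omega>) * \<Phi> a t (X s \<omega>) l) \<partial>M k)"
  proof (rule nn_integral_cong)
    fix \<omega> assume "\<omega> \<in> space (M k)"
    then have i: "X s \<omega> \<in> I" using X_in[OF _ s] space_M[OF k] by simp
    have "(\<integral>\<^sup>+\<omega>'. h (exp (- wL a s \<omega>), path 0 \<omega>') \<partial>M (X s \<omega>))
       = (\<integral>\<^sup>+\<omega>'. ennreal (exp (- wL a s \<omega>)) * ennreal (exp (- wL a t \<omega>') * indicat_real {l} (X t \<omega>')) \<partial>M (X s \<omega>))"
    proof (rule nn_integral_cong)
      fix \<omega>' assume "\<omega>' \<in> space (M (X s \<omega>))"
      then have w: "\<omega>' \<in> \<Omega>" by (simp add: space_M[OF i])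
      have "wL a t \<omega>' = (\<Sum>i\<in>I. a i * occ t i (path 0 \<omega>'))"
        unfolding wL_def occ_path[OF w order_refl t] by (simp add: L_0[OF w])
      then show "h (exp (- wL a s \<omega>), path 0 \<omega>') = ennreal (exp (- wL a s \<omega>)) * ennreal (exp (- wL a t \<omega>') * indicat_real {l} (X t \<omega>'))"
        using t by (simp add: h_def path_def ennreal_mult'[symmetric])
    qed
    also have "\<dots> = ennreal (exp (- wL a s \<omega>)) * ennreal (\<Phi> a t (X s \<omega>) l)"
      unfolding \<Phi>_integrand(3)[OF a i t, symmetric]
      by (rule nn_integral_cmult) (use \<Phi>_integrand(1)[OF a i t] in simp)
    finally show "(\<integral>\<^sup>+\<omega>'. h (exp (- wL a s \<omega>), path 0 \<omega>') \<partial>M (X s \<omega>)) = ennreal (exp (- wL a s \<omega>) * \<Phi> a t (X s \<omega>) l)"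
      by (simp add: ennreal_mult')
  qed
  also have "\<dots> = ennreal (\<integral>\<omega>. exp (- wL a s \<omega>) * \<Phi> a t (X s \<omega>) l \<partial>M k)"
    by (rule nn_integral_eq_integral[OF \<Phi>_sum(2)[OF a k s]]) (simp add: \<Phi>_nonneg)
  also have "\<dots> = ennreal (\<Sum>j\<in>I. \<Phi> a t j l * \<Phi> a s k j)"
    by (simp add: \<Phi>_sum(1)[OF a k s])
  finally show ?thesis
    by (subst (asm) ennreal_inj) (auto simp: \<Phi>_nonneg mult.commute intro!: sum_nonneg mult_nonneg_nonneg)
qed

text \<open>On a short interval \<open>wL\<close> differs from \<open>a k * h\<close> only through
  the time spent away from k, whose mean is of order \<open>h\<^sup>2\<close>. What remains is exp
  (- a(k) h) times a transition probability, both known to first order.\<close>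

lemma \<Phi>_small:
  assumes a: "\<forall>i\<in>I. 0 \<le> a i"
  shows "\<exists>C\<ge>0. \<forall>k\<in>I. \<forall>l\<in>I. \<forall>h\<in>{0..1 / Lam}. \<bar>\<Phi> a h k l - \<delta> k l - h * (G k l - \<delta> k l * a k)\<bar> \<le> C * h\<^sup>2"
proof -
  obtain C1 where C1: "0 \<le> C1" "\<And>k l h. k \<in> I \<Longrightarrow> l \<in> I \<Longrightarrow> h \<in> {0..1 / Lam} \<Longrightarrow> \<bar>p h k l - \<delta> k l - h * G k l\<bar> \<le> C1 * h\<^sup>2"
    using p_small by blast
  obtain C2 where C2: "0 \<le> C2" "\<And>k i h. k \<in> I \<Longrightarrow> i \<in> I - {k} \<Longrightarrow> h \<in> {0..1 / Lam} \<Longrightarrow> (\<integral>\<omega>. L h i \<omega> \<partial>M k) \<le> C2 * h\<^sup>2"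
    using expectation_L_small by blast
  define b where "b = (\<Sum>i\<in>I. a i)"
  have b: "a i \<le> b" if "i \<in> I" for i unfolding b_def by (rule member_le_sum) (use that a in auto)
  have b0: "0 \<le> b" unfolding b_def by (rule sum_nonneg) (use a in auto)
  let ?C = "real N * (b * C2) + (C1 + b * Lam + b\<^sup>2 * (1 + Lam))"
  have "\<bar>\<Phi> a h k l - \<delta> k l - h * (G k l - \<delta> k l * a k)\<bar> \<le> ?C * h\<^sup>2"
    if k: "k \<in> I" and l: "l \<in> I" and h: "h \<in> {0..1 / Lam}" for k l h
  proof -
    interpret prob_space "M k" by (rule prob_M[OF k])
    have h0: "0 \<le> h" using h by auto
    have h1: "h \<le> 1" using h Lam_ge1 by (auto intro: order_trans[of h "1 / Lam" 1])
    have ak: "0 \<le> a k" "a k \<le> b" using a k b by auto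
    have Li: "integrable (M k) (L h i)" if "i \<in> I" for i
      by (rule integrable_const_bound[of _ h])
         (use L_meas[OF k h0] L_nonneg[OF _ h0] L_le[OF _ h0 that] space_M[OF k] in auto)
    let ?e = "exp (- (a k * h))"
    have Xm: "(\<lambda>\<omega>. indicat_real {l} (X h \<omega>)) \<in> borel_measurable (M k)"
      by (rule measurable_compose[OF meas_X'[OF k h0]]) simp
    have pe: "(\<integral>\<omega>. ?e * indicat_real {l} (X h \<omega>) \<partial>M k) = ?e * p h k l"
    proof -
      have "(\<integral>\<omega>. indicat_real {l} (X h \<omega>) \<partial>M k) = (\<integral>\<omega>. indicator {\<omega> \<in> \<Omega>. X h \<omega> = l} \<omega> \<partial>M k)"
        by (rule Bochner_Integration.integral_cong) (auto simp: indicator_def space_M[OF k])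
      also have "\<dots> = measure (M k) {\<omega> \<in> \<Omega>. X h \<omega> = l}" using space_M[OF k] by (simp add: Int_absorb2 subset_iff)
      finally show ?thesis using X_dist[OF k l h0] by simp
    qed
    have iX: "integrable (M k) (\<lambda>\<omega>. ?e * indicat_real {l} (X h \<omega>))"
      by (intro integrable_mult_right integrable_const_bound[of _ 1] Xm) auto
    have "\<bar>\<Phi> a h k l - ?e * p h k l\<bar> = \<bar>\<integral>\<omega>. exp (- wL a h \<omega>) * indicat_real {l} (X h \<omega>) - ?e * indicat_real {l} (X h \<omega>) \<partial>M k\<bar>"
      unfolding \<Phi>_def pe[symmetric] using \<Phi>_integrand(2)[OF a k h0] iX by simp
    also have "\<dots> \<le> (\<integral>\<omega>. \<bar>exp (- wL a h \<omega>) * indicat_real {l} (X h \<omega>) - ?e * indicat_real {l} (X h \<omega>)\<bar> \<partial>M k)"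
      by (rule integral_abs_bound)
    also have "\<dots> \<le> (\<integral>\<omega>. (\<Sum>i\<in>I-{k}. b * L h i \<omega>) \<partial>M k)"
    proof (rule integral_mono)
      show "integrable (M k) (\<lambda>\<omega>. \<bar>exp (- wL a h \<omega>) * indicat_real {l} (X h \<omega>) - ?e * indicat_real {l} (X h \<omega>)\<bar>)"
        using \<Phi>_integrand(2)[OF a k h0] iX by (intro integrable_abs Bochner_Integration.integrable_diff)
      show "integrable (M k) (\<lambda>\<omega>. \<Sum>i\<in>I-{k}. b * L h i \<omega>)"
        by (intro Bochner_Integration.integrable_sum integrable_mult_right Li) auto
      fix \<omega> assume "\<omega> \<in> space (M k)"
      then have w: "\<omega> \<in> \<Omega>" by (simp add: space_M[OF k])
      have "\<bar>exp (- wL a h \<omega>) * indicat_real {l} (X h \<omega>) - ?e * indicat_real {l} (X h \<omega>)\<bar> \<le> \<bar>exp (- wL a h \<omega>) - ?e\<bar>"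
        by (auto simp: indicator_def)
      also have "\<dots> \<le> \<bar>wL a h \<omega> - a k * h\<bar>"
        by (rule abs_exp_minus_diff) (use wL_nonneg[OF a w h0] ak h0 in auto)
      \<comment> \<open>Occupation times sum to h, so subtracting \<open>a k * h\<close> removes the
        contribution of k itself.\<close>
      also have "wL a h \<omega> - a k * h = (\<Sum>i\<in>I. (a i - a k) * L h i \<omega>)"
      proof -
        have "a k * h = (\<Sum>i\<in>I. a k * L h i \<omega>)" using L_sum[OF w h0] by (simp add: sum_distrib_left[symmetric])
        then show ?thesis unfolding wL_def by (simp add: sum_subtractf left_diff_distrib)
      qed
      also have "\<dots> = (\<Sum>i\<in>I-{k}. (a i - a k) * L h i \<omega>)"
        using k by (simp add: sum.remove)
      also have "\<bar>\<dots>\<bar> \<le> (\<Sum>i\<in>I-{k}. b * L h i \<omega>)"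
      proof (rule order_trans[OF sum_abs], rule sum_mono)
        fix i assume i: "i \<in> I - {k}"
        have "0 \<le> a i" "a i \<le> b" using a b i by auto
        then have "\<bar>a i - a k\<bar> \<le> b" using ak by linarith
        then show "\<bar>(a i - a k) * L h i \<omega>\<bar> \<le> b * L h i \<omega>"
          using L_nonneg[OF w h0, of i] by (simp add: abs_mult mult_right_mono)
      qed
      finally show "\<bar>exp (- wL a h \<omega>) * indicat_real {l} (X h \<omega>) - ?e * indicat_real {l} (X h \<omega>)\<bar> \<le> (\<Sum>i\<in>I-{k}. b * L h i \<omega>)" .
    qed
    also have "\<dots> = (\<Sum>i\<in>I-{k}. b * (\<integral>\<omega>. L h i \<omega> \<partial>M k))"
      using Li by (subst Bochner_Integration.integral_sum) auto
    also have "\<dots> \<le> (\<Sum>i\<in>I-{k}. b * (C2 * h\<^sup>2))"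
      by (intro sum_mono mult_left_mono C2(2)[OF k _ h] b0)
    also have "\<dots> = real (card (I - {k})) * (b * (C2 * h\<^sup>2))" by simp
    also have "\<dots> \<le> real N * (b * (C2 * h\<^sup>2))"
      by (intro mult_right_mono mult_nonneg_nonneg) (use b0 C2 k in auto)
    finally have t1: "\<bar>\<Phi> a h k l - ?e * p h k l\<bar> \<le> real N * (b * C2) * h\<^sup>2" by (simp add: mult_ac)
    define r where "r = p h k l - \<delta> k l - h * G k l"
    define r' where "r' = ?e - 1 + a k * h"
    have r: "\<bar>r\<bar> \<le> C1 * h\<^sup>2" unfolding r_def by (rule C1(2)[OF k l h])
    have r': "\<bar>r'\<bar> \<le> b\<^sup>2 * h\<^sup>2"
    proof -
      have "\<bar>r'\<bar> \<le> (a k * h)\<^sup>2" unfolding r'_def using exp_minus_taylor[of "a k * h"] ak h0 by simp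
      also have "\<dots> \<le> (b * h)\<^sup>2" by (intro power_mono mult_right_mono) (use ak h0 in auto)
      finally show ?thesis by (simp add: power_mult_distrib)
    qed
    have "?e * p h k l - \<delta> k l - h * (G k l - \<delta> k l * a k) = ?e * r - a k * h\<^sup>2 * G k l + r' * (\<delta> k l + h * G k l)"
      unfolding r_def r'_def by (simp add: algebra_simps power2_eq_square)
    moreover have "\<bar>?e * r\<bar> \<le> 1 * (C1 * h\<^sup>2)"
      unfolding abs_mult by (intro mult_mono r) (use ak h0 in auto)
    moreover have "\<bar>a k * h\<^sup>2 * G k l\<bar> \<le> b * h\<^sup>2 * Lam"
      unfolding abs_mult by (intro mult_mono) (use ak b0 G_le_Lam[OF k l] in auto)
    moreover have "\<bar>r' * (\<delta> k l + h * G k l)\<bar> \<le> (b\<^sup>2 * h\<^sup>2) * (1 + Lam)"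
    proof -
      have "\<bar>h * G k l\<bar> \<le> 1 * Lam" unfolding abs_mult by (intro mult_mono) (use h0 h1 G_le_Lam[OF k l] in auto)
      then have "\<bar>\<delta> k l + h * G k l\<bar> \<le> 1 + Lam" by (auto simp: abs_le_iff)
      then show ?thesis unfolding abs_mult by (intro mult_mono r') auto
    qed
    ultimately have "\<bar>?e * p h k l - \<delta> k l - h * (G k l - \<delta> k l * a k)\<bar> \<le> 1 * (C1 * h\<^sup>2) + b * h\<^sup>2 * Lam + (b\<^sup>2 * h\<^sup>2) * (1 + Lam)"
      by linarith
    also have "\<dots> = (C1 + b * Lam + b\<^sup>2 * (1 + Lam)) * h\<^sup>2" by (simp add: algebra_simps)
    finally show ?thesis using t1 unfolding distrib_right[of "real N * (b * C2)"] by linarith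
  qed
  moreover have "0 \<le> ?C" using b0 C1 C2 Lam_ge1 by (intro add_nonneg_nonneg mult_nonneg_nonneg) auto
  ultimately show ?thesis by blast
qed

text \<open>Putting the short step first in the semigroup law reduces every time t to time 0, which
  makes the constant independent of t.\<close>

lemma \<Phi>_lipschitz:
  assumes a: "\<forall>i\<in>I. 0 \<le> a i"
  shows "\<exists>C\<ge>0. \<forall>k\<in>I. \<forall>l\<in>I. \<forall>t\<ge>0. \<forall>h\<in>{0..1 / Lam}. \<bar>\<Phi> a (t + h) k l - \<Phi> a t k l\<bar> \<le> C * h"
proof -
  obtain C where C: "0 \<le> C" "\<And>k l h. k \<in> I \<Longrightarrow> l \<in> I \<Longrightarrow> h \<in> {0..1 / Lam} \<Longrightarrow> \<bar>\<Phi> a h k l - \<delta> k l - h * (G k l - \<delta> k l * a k)\<bar> \<le> C * h\<^sup>2"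
    using \<Phi>_small[OF a] by blast
  define b where "b = (\<Sum>i\<in>I. a i)"
  have b: "a i \<le> b" if "i \<in> I" for i unfolding b_def by (rule member_le_sum) (use that a in auto)
  have b0: "0 \<le> b" unfolding b_def by (rule sum_nonneg) (use a in auto)
  have d: "\<bar>\<Phi> a h k l - \<delta> k l\<bar> \<le> (C + Lam + b) * h" if k: "k \<in> I" and l: "l \<in> I" and h: "h \<in> {0..1 / Lam}" for k l h
  proof -
    have h0: "0 \<le> h" using h by auto
    have h1: "h \<le> 1" using h Lam_ge1 by (auto intro: order_trans[of h "1 / Lam" 1])
    have ak: "0 \<le> a k" using a k by auto
    have "\<bar>\<delta> k l * a k\<bar> \<le> b" using ak b[OF k] b0 by auto
    then have "\<bar>G k l - \<delta> k l * a k\<bar> \<le> Lam + b" using G_le_Lam[OF k l] by linarith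
    then have "\<bar>h * (G k l - \<delta> k l * a k)\<bar> \<le> h * (Lam + b)" using h0 by (simp add: abs_mult mult_left_mono)
    moreover have "C * h\<^sup>2 \<le> C * (h * 1)" unfolding power2_eq_square by (intro mult_left_mono) (use h0 h1 C in auto)
    moreover have "\<bar>\<Phi> a h k l - \<delta> k l - h * (G k l - \<delta> k l * a k)\<bar> \<le> C * h\<^sup>2" by (rule C(2)[OF k l h])
    ultimately show ?thesis by (simp add: algebra_simps)
  qed
  have "\<bar>\<Phi> a (t + h) k l - \<Phi> a t k l\<bar> \<le> (real N * (C + Lam + b)) * h"
    if k: "k \<in> I" and l: "l \<in> I" and t: "0 \<le> t" and h: "h \<in> {0..1 / Lam}" for k l t h
  proof -
    have h0: "0 \<le> h" using h by auto
    have "\<Phi> a t k l = (\<Sum>j\<in>I. \<delta> k j * \<Phi> a t j l)"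
    proof -
      have "(\<Sum>j\<in>I. \<delta> k j * \<Phi> a t j l) = (\<Sum>j\<in>I. if j = k then \<Phi> a t j l else 0)" by (rule sum.cong) auto
      then show ?thesis using k by simp
    qed
    moreover have "\<Phi> a (t + h) k l = (\<Sum>j\<in>I. \<Phi> a h k j * \<Phi> a t j l)"
      using \<Phi>_semigroup[OF a k l h0 t] by (simp add: add.commute)
    ultimately have "\<Phi> a (t + h) k l - \<Phi> a t k l = (\<Sum>j\<in>I. (\<Phi> a h k j - \<delta> k j) * \<Phi> a t j l)"
      by (simp add: sum_subtractf left_diff_distrib)
    also have "\<bar>\<dots>\<bar> \<le> (\<Sum>j\<in>I. ((C + Lam + b) * h) * 1)"
    proof (rule order_trans[OF sum_abs], rule sum_mono)
      fix j assume j: "j \<in> I"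
      show "\<bar>(\<Phi> a h k j - \<delta> k j) * \<Phi> a t j l\<bar> \<le> ((C + Lam + b) * h) * 1"
        unfolding abs_mult by (intro mult_mono d[OF k j h])
          (use \<Phi>_nonneg[of a t j l] \<Phi>_le_1[OF a j l t] h0 C Lam_ge1 b0 in auto)
    qed
    also have "\<dots> = (real N * (C + Lam + b)) * h" by simp
    finally show ?thesis .
  qed
  moreover have "0 \<le> real N * (C + Lam + b)" using C Lam_ge1 b0 by auto
  ultimately show ?thesis by blast
qed

lemma \<Phi>_continuous:
  assumes a: "\<forall>i\<in>I. 0 \<le> a i" and k: "k \<in> I" and l: "l \<in> I"
  shows "continuous_on {0..} (\<lambda>t. \<Phi> a t k l)"
proof -
  obtain C where C: "0 \<le> C" "\<And>t h. t \<ge> 0 \<Longrightarrow> h \<in> {0..1 / Lam} \<Longrightarrow> \<bar>\<Phi> a (t + h) k l - \<Phi> a t k l\<bar> \<le> C * h"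
    using \<Phi>_lipschitz[OF a] k l by blast
  show ?thesis
    unfolding continuous_on_iff dist_real_def
  proof (intro ballI allI impI)
    fix t e :: real assume t: "t \<in> {0..}" and e: "0 < e"
    let ?d = "min (1 / Lam) (e / (C + 1))"
    have d: "0 < ?d" using e C Lam_ge1 by simp
    have "\<bar>\<Phi> a t' k l - \<Phi> a t k l\<bar> < e" if t': "t' \<in> {0..}" "\<bar>t' - t\<bar> < ?d" for t'
    proof -
      have h: "\<bar>t' - t\<bar> \<in> {0..1 / Lam}" using t' by auto
      have "\<bar>\<Phi> a t' k l - \<Phi> a t k l\<bar> \<le> C * \<bar>t' - t\<bar>"
      proof (cases "t \<le> t'")
        case True
        then show ?thesis using C(2)[of t "\<bar>t' - t\<bar>"] h t by simp
      next
        case False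
        then show ?thesis using C(2)[of t' "\<bar>t' - t\<bar>"] h t' by (simp add: abs_minus_commute)
      qed
      also have "\<dots> \<le> (C + 1) * \<bar>t' - t\<bar>" by (rule mult_right_mono) auto
      also have "\<dots> < (C + 1) * (e / (C + 1))" by (rule mult_strict_left_mono) (use t' C in auto)
      also have "\<dots> = e" using C by simp
      finally show ?thesis .
    qed
    then show "\<exists>d>0. \<forall>x'\<in>{0..}. \<bar>x' - t\<bar> < d \<longrightarrow> \<bar>\<Phi> a x' k l - \<Phi> a t k l\<bar> < e" using d by blast
  qed
qed

lemma \<Phi>_0: "k \<in> I \<Longrightarrow> \<Phi> a 0 k l = \<delta> k l"
proof -
  assume k: "k \<in> I"
  interpret prob_space "M k" by (rule prob_M[OF k])
  have X: "(\<lambda>\<omega>. indicat_real {l} (X 0 \<omega>)) \<in> borel_measurable (M k)"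
    by (rule measurable_compose[OF meas_X'[OF k order_refl]]) simp
  have "\<Phi> a 0 k l = (\<integral>\<omega>. \<delta> k l \<partial>M k)"
    unfolding \<Phi>_def
  proof (rule integral_cong_AE)
    show "AE \<omega> in M k. exp (- wL a 0 \<omega>) * indicator {l} (X 0 \<omega>) = \<delta> k l"
      using X_0[OF k] AE_space by eventually_elim (auto simp: wL_def L_0 space_M[OF k])
    show "(\<lambda>\<omega>. exp (- wL a 0 \<omega>) * indicator {l} (X 0 \<omega>)) \<in> borel_measurable (M k)"
      using wL_meas[OF k order_refl] X by simp
  qed simp
  then show ?thesis by (simp add: prob_space)
qed

text \<open>The resolvent of the killed chain. The Laplace variable of time is hidden in a, which is
  why a is at least 1 in the lemmas on it: this is what makes the integral converge.\<close>

definition R :: "(nat \<Rightarrow> real) \<Rightarrow> nat \<Rightarrow> nat \<Rightarrow> real" where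
  "R a k l = (\<integral>t. indicator {0<..} t * \<Phi> a t k l \<partial>lborel)"

lemma \<Phi>_integrable:
  assumes a: "\<forall>i\<in>I. 1 \<le> a i" and k: "k \<in> I" and l: "l \<in> I"
  shows "integrable lborel (\<lambda>t. indicator {0<..} t * \<Phi> a t k l)"
proof -
  have a0: "\<forall>i\<in>I. 0 \<le> a i" using a by (meson order_trans zero_le_one)
  have "(\<lambda>t. indicator {0<..} t *\<^sub>R \<Phi> a t k l) \<in> borel_measurable borel"
    by (rule borel_measurable_continuous_on_indicator) (auto intro: continuous_on_subset[OF \<Phi>_continuous[OF a0 k l]])
  then have m: "(\<lambda>t. indicator {0<..} t * \<Phi> a t k l) \<in> borel_measurable lborel" by simp
  have "integrable lborel (\<lambda>t::real. t ^ 0 * exp (- t) * indicator {0..} t)"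
  proof (rule integrableI_nonneg)
    have "(\<integral>\<^sup>+t. ennreal (t ^ 0 * exp (- t) * indicator {0..} t) \<partial>(lborel :: real measure)) = (\<integral>\<^sup>+t. ennreal (t ^ 0 * exp (- t)) * indicator {0..} t \<partial>lborel)"
      by (rule nn_integral_cong) (auto simp: indicator_def)
    also have "\<dots> < \<infinity>" unfolding nn_intergal_power_times_exp_Ici by simp
    finally show "(\<integral>\<^sup>+t. ennreal (t ^ 0 * exp (- t) * indicator {0..} t) \<partial>(lborel :: real measure)) < \<infinity>" .
  qed auto
  then show ?thesis
  proof (rule Bochner_Integration.integrable_bound[OF _ m])
    show "AE t in lborel. norm (indicator {0<..} t * \<Phi> a t k l) \<le> norm (t ^ 0 * exp (- t) * indicator {0..} t)"
      by (rule AE_I2) (use \<Phi>_le_exp[OF a _ k l] \<Phi>_nonneg in \<open>auto simp: indicator_def\<close>)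
  qed
qed

text \<open>Translating the time integral by h turns the semigroup law into an identity: \<Phi> at
  time h applied to R equals R minus the integral of \<Phi> over (0, h]. Both sides are known up to
  errors of order \<open>h\<^sup>2\<close>, so the defect E of the resolvent equation satisfies |E|
  \<le> K h for all small h and vanishes, without any derivative in time.\<close>

lemma R_eq:
  assumes a: "\<forall>i\<in>I. 1 \<le> a i" and k: "k \<in> I" and l: "l \<in> I"
  shows "a k * R a k l = \<delta> k l + (\<Sum>j\<in>I. G k j * R a j l)"
proof -
  have a0: "\<forall>i\<in>I. 0 \<le> a i" using a by (meson order_trans zero_le_one)
  obtain C where C: "0 \<le> C" "\<And>k l h. k \<in> I \<Longrightarrow> l \<in> I \<Longrightarrow> h \<in> {0..1 / Lam} \<Longrightarrow> \<bar>\<Phi> a h k l - \<delta> k l - h * (G k l - \<delta> k l * a k)\<bar> \<le> C * h\<^sup>2"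
    using \<Phi>_small[OF a0] by blast
  obtain C' where C': "0 \<le> C'" "\<And>t h. t \<ge> 0 \<Longrightarrow> h \<in> {0..1 / Lam} \<Longrightarrow> \<bar>\<Phi> a (t + h) k l - \<Phi> a t k l\<bar> \<le> C' * h"
    using \<Phi>_lipschitz[OF a0] k l by blast
  define E where "E = (\<Sum>j\<in>I. G k j * R a j l) - a k * R a k l + \<delta> k l"
  define K where "K = C * (\<Sum>j\<in>I. \<bar>R a j l\<bar>) + C'"
  have K0: "0 \<le> K" unfolding K_def using C C' by (intro add_nonneg_nonneg mult_nonneg_nonneg sum_nonneg) auto
  note int = \<Phi>_integrable[OF a]
  have dsum: "(\<Sum>j\<in>I. \<delta> k j * F j) = F k" for F :: "nat \<Rightarrow> real"
  proof -
    have "(\<Sum>j\<in>I. \<delta> k j * F j) = (\<Sum>j\<in>I. if j = k then F j else 0)" by (rule sum.cong) auto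
    then show ?thesis using k by simp
  qed
  have main: "\<bar>E\<bar> \<le> K * h" if h: "0 < h" "h \<le> 1 / Lam" for h
  proof -
    have weighted_dens: "h \<in> {0..1 / Lam}" using h by auto
    have m: "(\<lambda>t. indicator {0<..h} t * \<Phi> a t k l) \<in> borel_measurable borel"
    proof -
      have "(\<lambda>t. indicator {0<..h} t *\<^sub>R \<Phi> a t k l) \<in> borel_measurable borel"
        by (rule borel_measurable_continuous_on_indicator) (auto intro: continuous_on_subset[OF \<Phi>_continuous[OF a0 k l]])
      then show ?thesis by simp
    qed
    have i1: "integrable lborel (\<lambda>t. indicator {0<..h} t * \<Phi> a t k l)"
      by (rule Bochner_Integration.integrable_bound[OF int[OF k l]]) (use m in \<open>auto simp: indicator_def\<close>)
    have i2: "integrable lborel (\<lambda>t. indicator {h<..} t * \<Phi> a t k l)"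
    proof -
      have "(\<lambda>t. indicator {h<..} t * \<Phi> a t k l) = (\<lambda>t. indicator {0<..} t * \<Phi> a t k l - indicator {0<..h} t * \<Phi> a t k l)"
        using h by (auto simp: indicator_def fun_eq_iff)
      then show ?thesis using int[OF k l] i1 by simp
    qed
    have "(\<Sum>j\<in>I. \<Phi> a h k j * R a j l) = (\<integral>t. (\<Sum>j\<in>I. \<Phi> a h k j * (indicator {0<..} t * \<Phi> a t j l)) \<partial>lborel)"
      unfolding R_def using int[OF _ l] by (subst Bochner_Integration.integral_sum) auto
    also have "\<dots> = (\<integral>t. indicator {h<..} (h + 1 * t) * \<Phi> a (h + 1 * t) k l \<partial>lborel)"
      by (rule Bochner_Integration.integral_cong)
         (use h \<Phi>_semigroup[OF a0 k l, of h] in \<open>auto simp: indicator_def mult_ac\<close>)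
    also have "\<dots> = (\<integral>t. indicator {h<..} t * \<Phi> a t k l \<partial>lborel)"
      using lborel_integral_real_affine[of 1 "\<lambda>t. indicator {h<..} t * \<Phi> a t k l" h] by simp
    also have "\<dots> = R a k l - (\<integral>t. indicator {0<..h} t * \<Phi> a t k l \<partial>lborel)"
    proof -
      have "R a k l = (\<integral>t. indicator {h<..} t * \<Phi> a t k l + indicator {0<..h} t * \<Phi> a t k l \<partial>lborel)"
        unfolding R_def by (rule Bochner_Integration.integral_cong) (use h in \<open>auto simp: indicator_def\<close>)
      then show ?thesis using i1 i2 by simp
    qed
    finally have e1: "(\<Sum>j\<in>I. \<Phi> a h k j * R a j l) = R a k l - (\<integral>t. indicator {0<..h} t * \<Phi> a t k l \<partial>lborel)" .
    define J where "J = (\<integral>t. indicator {0<..h} t * \<Phi> a t k l \<partial>lborel)"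
    have f1: "\<bar>J - h * \<delta> k l\<bar> \<le> C' * h * h"
    proof -
      have i3: "integrable lborel (\<lambda>t::real. indicator {0<..h} t * \<delta> k l)" using h by simp
      have hd: "(\<integral>t. indicator {0<..h} t * \<delta> k l \<partial>lborel) = h * \<delta> k l" using h by simp
      have e2: "(\<integral>t. indicator {0<..h} t * \<Phi> a t k l \<partial>lborel) - h * \<delta> k l = (\<integral>t. indicator {0<..h} t * \<Phi> a t k l - indicator {0<..h} t * \<delta> k l \<partial>lborel)"
        unfolding hd[symmetric] by (rule Bochner_Integration.integral_diff[OF i1 i3, symmetric])
      have "\<bar>(\<integral>t. indicator {0<..h} t * \<Phi> a t k l \<partial>lborel) - h * \<delta> k l\<bar> \<le> (\<integral>t. \<bar>indicator {0<..h} t * \<Phi> a t k l - indicator {0<..h} t * \<delta> k l\<bar> \<partial>lborel)"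
        unfolding e2 by (rule integral_abs_bound)
      also have "\<dots> \<le> (\<integral>t. indicator {0<..h} t * (C' * h) \<partial>lborel)"
      proof (rule integral_mono)
        show "integrable lborel (\<lambda>t. \<bar>indicator {0<..h} t * \<Phi> a t k l - indicator {0<..h} t * \<delta> k l\<bar>)"
          by (rule integrable_abs[OF Bochner_Integration.integrable_diff[OF i1 i3]])
        show "integrable lborel (\<lambda>t. indicator {0<..h} t * (C' * h))" using h by auto
        fix t :: real
        show "\<bar>indicator {0<..h} t * \<Phi> a t k l - indicator {0<..h} t * \<delta> k l\<bar> \<le> indicator {0<..h} t * (C' * h)"
        proof (cases "t \<in> {0<..h}")
          case True
          then have "\<bar>\<Phi> a (0 + t) k l - \<Phi> a 0 k l\<bar> \<le> C' * t" using h by (intro C'(2)) auto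
          also have "\<dots> \<le> C' * h" using True C' by (intro mult_left_mono) auto
          finally show ?thesis using True by (simp add: \<Phi>_0[OF k])
        qed simp
      qed
      also have "\<dots> = C' * h * h" using h by simp
      finally show ?thesis unfolding J_def .
    qed
    define W where "W = (\<Sum>j\<in>I. \<Phi> a h k j * R a j l)"
    have f2: "\<bar>W - R a k l - h * ((\<Sum>j\<in>I. G k j * R a j l) - a k * R a k l)\<bar> \<le> C * (\<Sum>j\<in>I. \<bar>R a j l\<bar>) * h * h"
    proof -
      have e3: "(\<Sum>j\<in>I. \<Phi> a h k j * R a j l) - R a k l - h * ((\<Sum>j\<in>I. G k j * R a j l) - a k * R a k l)
          = (\<Sum>j\<in>I. (\<Phi> a h k j - \<delta> k j - h * (G k j - \<delta> k j * a k)) * R a j l)"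
      proof -
      have "(\<Sum>j\<in>I. \<Phi> a h k j * R a j l) - R a k l - h * ((\<Sum>j\<in>I. G k j * R a j l) - a k * R a k l)
          = (\<Sum>j\<in>I. \<Phi> a h k j * R a j l) - (\<Sum>j\<in>I. \<delta> k j * R a j l) - h * ((\<Sum>j\<in>I. G k j * R a j l) - (\<Sum>j\<in>I. \<delta> k j * (a k * R a j l)))"
        by (simp only: dsum)
      also have "\<dots> = (\<Sum>j\<in>I. (\<Phi> a h k j - \<delta> k j - h * (G k j - \<delta> k j * a k)) * R a j l)"
        by (simp only: sum_subtractf[symmetric] sum_distrib_left) (rule sum.cong, auto simp: algebra_simps)
      finally show ?thesis .
      qed
      have "\<bar>(\<Sum>j\<in>I. \<Phi> a h k j * R a j l) - R a k l - h * ((\<Sum>j\<in>I. G k j * R a j l) - a k * R a k l)\<bar> \<le> (\<Sum>j\<in>I. C * h\<^sup>2 * \<bar>R a j l\<bar>)"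
        unfolding e3 by (rule order_trans[OF sum_abs]) (auto simp: abs_mult intro!: sum_mono mult_right_mono C(2)[OF k _ weighted_dens])
      also have "\<dots> = C * (\<Sum>j\<in>I. \<bar>R a j l\<bar>) * h * h"
        by (simp add: sum_distrib_left sum_distrib_right power2_eq_square mult_ac)
      finally show ?thesis unfolding W_def .
    qed
    have WJ: "W = R a k l - J" using e1 by (simp only: W_def J_def)
    have hE: "h * E = - (W - R a k l - h * ((\<Sum>j\<in>I. G k j * R a j l) - a k * R a k l)) - (J - h * \<delta> k l)"
      unfolding E_def WJ by (simp add: algebra_simps)
    have "\<bar>h * E\<bar> \<le> C * (\<Sum>j\<in>I. \<bar>R a j l\<bar>) * h * h + C' * h * h"
      unfolding hE using f1 f2 by linarith
    also have "\<dots> = h * (K * h)" by (simp add: K_def algebra_simps)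
    finally have "h * \<bar>E\<bar> \<le> h * (K * h)" using h by (simp add: abs_mult)
    then show ?thesis using h by (simp only: mult_le_cancel_left_pos)
  qed
  have "\<bar>E\<bar> \<le> 0"
  proof (rule field_le_epsilon)
    fix e :: real assume e: "0 < e"
    let ?h = "min (1 / Lam) (e / (K + 1))"
    have "\<bar>E\<bar> \<le> K * ?h" by (rule main) (use Lam_ge1 e K0 in auto)
    also have "\<dots> \<le> (K + 1) * (e / (K + 1))" by (intro mult_mono) (use K0 e Lam_ge1 in auto)
    also have "\<dots> = e" using K0 by simp
    finally show "\<bar>E\<bar> \<le> 0 + e" by simp
  qed
  then have "E = 0" by simp
  then show ?thesis unfolding E_def by linarith
qed

text \<open>Inserting G = Lam (P - 1) turns the resolvent equation into the first-letter equation of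
  \<open>path_gf\<close>. The ratio Lam / (Lam + a) is the Laplace transform at a of an exponential
  time of rate Lam, one for each letter.\<close>

lemma R_path_gf:
  assumes a: "\<forall>i\<in>I. 1 \<le> a i" and k: "k \<in> I" and l: "l \<in> I"
  shows "Lam * R a k l = path_gf (\<lambda>i. Lam / (Lam + a i)) k l"
proof (rule path_gf_unique[where R = "\<lambda>k. Lam * R a k l" and x = "\<lambda>i. Lam / (Lam + a i)" and l = l, OF _ _ k])
  fix i assume i: "i \<in> I"
  have "1 \<le> a i" using a i by auto
  then show "0 \<le> Lam / (Lam + a i) \<and> Lam / (Lam + a i) < 1" using Lam_ge1 by (simp add: field_simps)
next
  fix k assume k: "k \<in> I"
  have ak: "1 \<le> a k" using a k by auto
  have dsum: "(\<Sum>j\<in>I. \<delta> k j * F j) = F k" for F :: "nat \<Rightarrow> real"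
  proof -
    have "(\<Sum>j\<in>I. \<delta> k j * F j) = (\<Sum>j\<in>I. if j = k then F j else 0)" by (rule sum.cong) auto
    then show ?thesis using k by simp
  qed
  have "(\<Sum>j\<in>I. G k j * R a j l) = (\<Sum>j\<in>I. Lam * (P k j * R a j l) - Lam * (\<delta> k j * R a j l))"
    by (rule sum.cong) (auto simp: G_P algebra_simps)
  also have "\<dots> = (\<Sum>j\<in>I. P k j * (Lam * R a j l)) - Lam * R a k l"
    by (simp only: sum_subtractf sum_distrib_left[symmetric] dsum) (simp add: sum_distrib_left mult_ac)
  finally have "(Lam + a k) * R a k l = \<delta> k l + (\<Sum>j\<in>I. P k j * (Lam * R a j l))"
    using R_eq[OF a k l] by (simp add: algebra_simps)
  then show "Lam * R a k l = Lam / (Lam + a k) * (\<delta> k l + (\<Sum>j\<in>I. P k j * (Lam * R a j l)))"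
    using ak Lam_ge1 by (simp add: field_simps)
qed

text \<open>Let the chain be killed at a high rate s in i. On the event that no time is spent in i
  nothing is killed, so its probability is at most 1 / \<epsilon> times the expectation of any g
  \<ge> \<epsilon> under killing. The function g is the Lyapunov function off i, completed by the
  value \<epsilon> at i; the killed generator maps it below - \<eta> g, and the expectation
  decays.\<close>

lemma unvisited_decay1:
  assumes i: "i \<in> I" and conn: "\<And>j. j \<in> I \<Longrightarrow> (j, i) \<in> arcs_on\<^sup>*"
  shows "\<exists>C \<eta>. 0 \<le> C \<and> 0 < \<eta> \<and> (\<forall>k\<in>I. \<forall>t>0. measure (M k) {\<omega> \<in> \<Omega>. L t i \<omega> = 0} \<le> C * exp (- \<eta> * t))"
proof -
  obtain f \<theta> where f\<theta>: "0 < \<theta> \<and> \<theta> < 1 \<and>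
    (\<forall>j\<in>I - {i}. 1 / 2 \<le> f j \<and> f j \<le> 1) \<and>
    (\<forall>j\<in>I - {i}. (\<Sum>j'\<in>I-{i}. P j j' * f j') \<le> \<theta> * f j)"
    using lyapunov[OF i conn] by blast
  then have \<theta>: "0 < \<theta>" "\<theta> < 1"
    and f: "\<And>j. j \<in> I - {i} \<Longrightarrow> 1 / 2 \<le> f j \<and> f j \<le> 1"
    and Pf: "\<And>j. j \<in> I - {i} \<Longrightarrow> (\<Sum>j'\<in>I-{i}. P j j' * f j') \<le> \<theta> * f j"
    by (auto simp only:)
  \<comment> \<open>Small enough that jumps into i, of rate at most Lam, use up at most half of the
    gain Lam (1 - \<theta>) f, given f \<ge> 1/2. The other half is the rate \<eta>.\<close>
  define \<epsilon> where "\<epsilon> = (1 - \<theta>) / 4"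
  have \<epsilon>: "0 < \<epsilon>" "\<epsilon> \<le> 1 / 4" using \<theta> by (auto simp: \<epsilon>_def)
  define \<eta> where "\<eta> = Lam * (1 - \<theta>) / 2"
  have \<eta>: "0 < \<eta>" using \<theta> Lam_ge1 by (simp add: \<eta>_def)
  define g where "g j = (if j = i then \<epsilon> else f j)" for j
  \<comment> \<open>In i the killing term is s \<epsilon> = Lam + \<eta> \<epsilon>: it offsets the
    flow out of i, at most Lam, and still leaves \<eta> g.\<close>
  define s where "s = Lam / \<epsilon> + \<eta>"
  have s0: "0 \<le> s" using \<epsilon> \<eta> Lam_ge1 by (simp add: s_def)
  define a where "a j = (if j = i then s else 0)" for j
  have a0: "\<forall>j\<in>I. 0 \<le> a j" using s0 by (simp add: a_def)
  have g: "\<epsilon> \<le> g j" "g j \<le> 1" if "j \<in> I" for j using f[of j] that \<epsilon> by (auto simp: g_def)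
  have split: "(\<Sum>j\<in>I. F j) = F i + (\<Sum>j\<in>I-{i}. F j)" for F :: "nat \<Rightarrow> real"
    using i by (simp add: sum.remove)
  have dsum: "(\<Sum>l\<in>I. \<delta> k l * F l) = F k" if "k \<in> I" for k and F :: "nat \<Rightarrow> real"
  proof -
    have "(\<Sum>j\<in>I. \<delta> k j * F j) = (\<Sum>j\<in>I. if j = k then F j else 0)" by (rule sum.cong) auto
    then show ?thesis using that by simp
  qed
  have Gg: "(\<Sum>l\<in>I. G k l * g l) - a k * g k \<le> - \<eta> * g k" if k: "k \<in> I" for k
  proof (cases "k = i")
    case True
    have "(\<Sum>l\<in>I-{i}. G i l * g l) \<le> (\<Sum>l\<in>I-{i}. G i l * 1)"
      by (intro sum_mono mult_left_mono) (use g G_nonneg[OF i] in auto)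
    also have "\<dots> = - G i i" using G_sum[OF i] split[of "G i"] by simp
    also have "\<dots> \<le> Lam" using G_le_Lam[OF i i] by linarith
    finally have "(\<Sum>l\<in>I. G i l * g l) \<le> G i i * \<epsilon> + Lam" unfolding split by (simp add: g_def)
    moreover have "G i i \<le> 0" using G_sum[OF i] split[of "G i"] sum_nonneg[of "I - {i}" "G i"] G_nonneg[OF i] by force
    then have "G i i * \<epsilon> \<le> 0" using \<epsilon> by (simp add: mult_le_0_iff)
    moreover have "a i * g i = Lam + \<eta> * g i" using \<epsilon> by (simp add: a_def g_def s_def field_simps)
    ultimately show ?thesis using True by simp
  next
    case False
    then have ki: "k \<in> I - {i}" using k by auto
    have "(\<Sum>l\<in>I-{i}. G k l * g l) = (\<Sum>l\<in>I-{i}. Lam * (P k l * f l) - Lam * (\<delta> k l * f l))"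
      by (rule sum.cong) (auto simp: G_P g_def algebra_simps)
    also have "\<dots> = Lam * (\<Sum>l\<in>I-{i}. P k l * f l) - Lam * (\<Sum>l\<in>I-{i}. \<delta> k l * f l)"
      by (simp add: sum_subtractf sum_distrib_left)
    also have "(\<Sum>l\<in>I-{i}. \<delta> k l * f l) = (\<Sum>l\<in>I-{i}. if l = k then f l else 0)" by (rule sum.cong) auto
    also have "\<dots> = f k" using ki by simp
    also have "Lam * (\<Sum>l\<in>I-{i}. P k l * f l) - Lam * f k \<le> Lam * (\<theta> * f k) - Lam * f k"
      by (intro diff_right_mono mult_left_mono Pf ki) (use Lam_ge1 in auto)
    also have "\<dots> = - (Lam * (1 - \<theta>)) * f k" by (simp add: algebra_simps)
    finally have 1: "(\<Sum>l\<in>I-{i}. G k l * g l) \<le> - (Lam * (1 - \<theta>)) * f k" .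
    have "G k i * \<epsilon> \<le> Lam * \<epsilon>" using G_le_Lam[OF k i] \<epsilon> by (intro mult_right_mono) auto
    also have "\<dots> = (Lam * (1 - \<theta>) / 2) * (1 / 2)" by (simp add: \<epsilon>_def)
    also have "\<dots> \<le> (Lam * (1 - \<theta>) / 2) * f k" using f[OF ki] Lam_ge1 \<theta> by (intro mult_left_mono) auto
    finally have "G k i * \<epsilon> \<le> (Lam * (1 - \<theta>) / 2) * f k" .
    moreover have "(\<Sum>l\<in>I. G k l * g l) = G k i * \<epsilon> + (\<Sum>l\<in>I-{i}. G k l * g l)" unfolding split by (simp add: g_def)
    moreover define Q where "Q = Lam * (1 - \<theta>) * f k"
    then have q: "(Lam * (1 - \<theta>) / 2) * f k = Q / 2" "- (Lam * (1 - \<theta>)) * f k = - Q" by simp_all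
    ultimately have "(\<Sum>l\<in>I. G k l * g l) \<le> Q / 2 - Q" using 1 unfolding q by linarith
    also have "\<dots> = - \<eta> * g k" using False by (simp add: \<eta>_def g_def Q_def)
    finally show ?thesis using False by (simp add: a_def)
  qed
  obtain C where C: "0 \<le> C" "\<And>k l h. k \<in> I \<Longrightarrow> l \<in> I \<Longrightarrow> h \<in> {0..1 / Lam} \<Longrightarrow> \<bar>\<Phi> a h k l - \<delta> k l - h * (G k l - \<delta> k l * a k)\<bar> \<le> C * h\<^sup>2"
    using \<Phi>_small[OF a0] by blast
  define K where "K = real N * C / \<epsilon>"
  have K0: "0 \<le> K" using C \<epsilon> by (simp add: K_def)
  \<comment> \<open>For steps of this size the second-order error costs at most half of the decay,
    and the rate \<eta> / 2 survives.\<close>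
  define h1 where "h1 = min (1 / Lam) (\<eta> / 2 / (K + 1))"
  have h1: "0 < h1" using \<eta> K0 Lam_ge1 by (simp add: h1_def)
  have step: "(\<Sum>l\<in>I. g l * \<Phi> a h k l) \<le> g k * exp (- (\<eta> / 2 * h))" if k: "k \<in> I" and h: "0 \<le> h" "h \<le> h1" for k h
  proof -
    have weighted_dens: "h \<in> {0..1 / Lam}" using h by (auto simp: h1_def)
    have "(\<Sum>l\<in>I. g l * \<Phi> a h k l) \<le> (\<Sum>l\<in>I. (\<delta> k l * g l) + h * (G k l * g l) - h * (\<delta> k l * (a k * g l)) + C * h\<^sup>2)"
    proof (rule sum_mono)
      fix l assume l: "l \<in> I"
      have "\<Phi> a h k l \<le> \<delta> k l + h * (G k l - \<delta> k l * a k) + C * h\<^sup>2" using C(2)[OF k l weighted_dens] by (simp add: abs_le_iff)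
      then have "g l * \<Phi> a h k l \<le> g l * (\<delta> k l + h * (G k l - \<delta> k l * a k) + C * h\<^sup>2)"
        using g[OF l] \<epsilon> by (intro mult_left_mono) auto
      also have "\<dots> = (\<delta> k l * g l) + h * (G k l * g l) - h * (\<delta> k l * (a k * g l)) + g l * (C * h\<^sup>2)"
        by (simp add: algebra_simps)
      also have "g l * (C * h\<^sup>2) \<le> 1 * (C * h\<^sup>2)" using g[OF l] C by (intro mult_right_mono) auto
      finally show "g l * \<Phi> a h k l \<le> (\<delta> k l * g l) + h * (G k l * g l) - h * (\<delta> k l * (a k * g l)) + C * h\<^sup>2" by simp
    qed
    also have "\<dots> = g k + h * (\<Sum>l\<in>I. G k l * g l) - h * (a k * g k) + real N * (C * h\<^sup>2)"
      by (simp only: sum.distrib sum_subtractf sum_distrib_left[symmetric] dsum[OF k]) simp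
    also have "\<dots> = g k + h * ((\<Sum>l\<in>I. G k l * g l) - a k * g k) + K * \<epsilon> * h\<^sup>2"
      using \<epsilon> by (simp add: K_def algebra_simps)
    also have "\<dots> \<le> g k + h * (- \<eta> * g k) + K * g k * h\<^sup>2"
      by (intro add_mono mult_left_mono mult_right_mono Gg[OF k] g(1)[OF k]) (use h K0 in auto)
    also have "K * g k * h\<^sup>2 \<le> g k * (\<eta> / 2 * h)"
    proof -
      have "K * h \<le> (K + 1) * (\<eta> / 2 / (K + 1))" by (intro mult_mono) (use h K0 \<eta> in \<open>auto simp: h1_def\<close>)
      also have "\<dots> = \<eta> / 2"
        unfolding times_divide_eq_right[of "K + 1" "\<eta> / 2" "K + 1"]
        by (rule nonzero_mult_div_cancel_left) (use K0 in linarith)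
      finally have "(K * h) * (g k * h) \<le> (\<eta> / 2) * (g k * h)"
        using g[OF k] \<epsilon> h by (intro mult_right_mono) auto
      then show ?thesis by (simp add: power2_eq_square mult_ac)
    qed
    finally have "(\<Sum>l\<in>I. g l * \<Phi> a h k l) \<le> g k * (1 + - (\<eta> / 2 * h))" by (simp add: algebra_simps)
    also have "\<dots> \<le> g k * exp (- (\<eta> / 2 * h))"
      using g[OF k] \<epsilon> exp_ge_add_one_self[of "- (\<eta> / 2 * h)"] by (intro mult_left_mono) auto
    finally show ?thesis .
  qed
  have iter: "(\<Sum>l\<in>I. g l * \<Phi> a (real n * h) k l) \<le> g k * exp (- (\<eta> / 2 * (real n * h)))"
    if k: "k \<in> I" and h: "0 \<le> h" "h \<le> h1" for k h n
    using k
  proof (induction n arbitrary: k)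
    case 0
    have "(\<Sum>l\<in>I. g l * \<Phi> a 0 k l) = (\<Sum>l\<in>I. \<delta> k l * g l)" by (rule sum.cong) (auto simp: \<Phi>_0[OF 0])
    then show ?case using dsum[OF 0] by simp
  next
    case (Suc n)
    have nh: "0 \<le> real n * h" using h by simp
    have e: "real (Suc n) * h = h + real n * h" by (simp add: algebra_simps)
    have "(\<Sum>l\<in>I. g l * \<Phi> a (real (Suc n) * h) k l) = (\<Sum>l\<in>I. \<Sum>j\<in>I. g l * (\<Phi> a h k j * \<Phi> a (real n * h) j l))"
      unfolding e by (rule sum.cong) (auto simp: \<Phi>_semigroup[OF a0 Suc.prems _ h(1) nh] sum_distrib_left)
    also have "\<dots> = (\<Sum>j\<in>I. \<Phi> a h k j * (\<Sum>l\<in>I. g l * \<Phi> a (real n * h) j l))"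
      by (subst sum.swap) (simp add: sum_distrib_left mult_ac)
    also have "\<dots> \<le> (\<Sum>j\<in>I. \<Phi> a h k j * (g j * exp (- (\<eta> / 2 * (real n * h)))))"
      by (intro sum_mono mult_left_mono Suc.IH \<Phi>_nonneg)
    also have "\<dots> = (\<Sum>j\<in>I. g j * \<Phi> a h k j) * exp (- (\<eta> / 2 * (real n * h)))"
      unfolding sum_distrib_right by (rule sum.cong) auto
    also have "\<dots> \<le> g k * exp (- (\<eta> / 2 * h)) * exp (- (\<eta> / 2 * (real n * h)))"
      by (intro mult_right_mono step Suc.prems h) auto
    finally show ?case unfolding e by (simp add: exp_add[symmetric] algebra_simps)
  qed
  have "measure (M k) {\<omega> \<in> \<Omega>. L t i \<omega> = 0} \<le> 1 / \<epsilon> * exp (- (\<eta> / 2) * t)" if k: "k \<in> I" and t: "0 < t" for k t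
  proof -
    interpret prob_space "M k" by (rule prob_M[OF k])
    have t0: "0 \<le> t" using t by simp
    \<comment> \<open>The interval is cut into equal steps short enough for the one-step
      bound.\<close>
    define n where "n = nat \<lceil>t / h1\<rceil>"
    have "0 < t / h1" using t h1 by simp
    then have n: "0 < n" "t / h1 \<le> real n" by (simp_all add: n_def)
    have weighted_mass: "0 \<le> t / real n" "t / real n \<le> h1" using n t h1 by (auto simp: field_simps)
    have tn: "real n * (t / real n) = t" using n by simp
    have "(\<Sum>l\<in>I. g l * \<Phi> a t k l) \<le> g k * exp (- (\<eta> / 2 * t))"
      using iter[OF k weighted_mass, of n] unfolding tn .
    also have "\<dots> \<le> 1 * exp (- (\<eta> / 2 * t))" by (intro mult_right_mono g[OF k]) auto
    finally have 1: "(\<integral>\<omega>. exp (- wL a t \<omega>) * g (X t \<omega>) \<partial>M k) \<le> exp (- (\<eta> / 2 * t))"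
      using \<Phi>_sum(1)[OF a0 k t0, of g] by simp
    have Lm: "{\<omega> \<in> \<Omega>. L t i \<omega> = 0} \<in> sets (M k)"
    proof -
      have "L t i -` {0} \<inter> space (M k) \<in> sets (M k)" by (rule measurable_sets[OF L_meas[OF k t0]]) simp
      also have "L t i -` {0} \<inter> space (M k) = {\<omega> \<in> \<Omega>. L t i \<omega> = 0}" by (auto simp: space_M[OF k])
      finally show ?thesis .
    qed
    have "\<epsilon> * measure (M k) {\<omega> \<in> \<Omega>. L t i \<omega> = 0} = (\<integral>\<omega>. \<epsilon> * indicator {\<omega> \<in> \<Omega>. L t i \<omega> = 0} \<omega> \<partial>M k)"
      using Lm by (simp add: emeasure_eq_measure)
    also have "\<dots> \<le> (\<integral>\<omega>. exp (- wL a t \<omega>) * g (X t \<omega>) \<partial>M k)"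
    proof (rule integral_mono[OF _ \<Phi>_sum(2)[OF a0 k t0]])
      show "integrable (M k) (\<lambda>\<omega>. \<epsilon> * indicator {\<omega> \<in> \<Omega>. L t i \<omega> = 0} \<omega>)"
        using Lm by (intro integrable_mult_right) (simp add: emeasure_eq_measure)
      fix \<omega> assume "\<omega> \<in> space (M k)"
      then have w: "\<omega> \<in> \<Omega>" by (simp add: space_M[OF k])
      have gX: "\<epsilon> \<le> g (X t \<omega>)" by (rule g(1)[OF X_in[OF w t0]])
      show "\<epsilon> * indicator {\<omega> \<in> \<Omega>. L t i \<omega> = 0} \<omega> \<le> exp (- wL a t \<omega>) * g (X t \<omega>)"
      proof (cases "L t i \<omega> = 0")
        case True
        have "wL a t \<omega> = 0" unfolding wL_def by (rule sum.neutral) (use True in \<open>auto simp: a_def\<close>)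
        then show ?thesis using True w gX by simp
      next
        case False
        then show ?thesis using gX \<epsilon> by simp
      qed
    qed
    also note 1
    finally show ?thesis using \<epsilon> by (simp add: field_simps)
  qed
  then show ?thesis using \<epsilon> \<eta> by (intro exI[of _ "1 / \<epsilon>"] exI[of _ "\<eta> / 2"]) auto
qed

end

section \<open>The density\<close>

lemma summable_diff':
  fixes f g :: "'a \<Rightarrow> real"
  assumes "f summable_on A" "g summable_on A"
  shows "(\<lambda>x. f x - g x) summable_on A"
  using summable_on_add[OF assms(1), of "\<lambda>x. - g x"] assms(2) by (simp add: summable_on_uminus)

lemma infsum_diff':
  fixes f g :: "'a \<Rightarrow> real"
  assumes "f summable_on A" "g summable_on A"
  shows "infsum (\<lambda>x. f x - g x) A = infsum f A - infsum g A"
  using infsum_add[OF assms(1), of "\<lambda>x. - g x"] assms(2) by (simp add: summable_on_uminus infsum_uminus)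

lemma pois_exp_nonneg:
  assumes "finite A" "\<And>i. i \<in> A \<Longrightarrow> 0 \<le> y i" "\<And>m. 0 \<le> a m" "\<And>m. \<bar>a m\<bar> \<le> B"
  shows "0 \<le> pois_exp A y a"
  unfolding pois_exp_def psum_def
  by (rule infsum_nonneg) (use assms poisw_nonneg in \<open>auto intro!: mult_nonneg_nonneg prod_nonneg\<close>)

context jump_process
begin

lemma upd_ge: "\<forall>i\<in>I. (c::real) \<le> a i \<Longrightarrow> \<forall>i\<in>I. c \<le> (a(j := a j + 1)) i" if "j \<in> I"
proof (intro ballI)
  fix i assume a: "\<forall>i\<in>I. c \<le> a i" and i: "i \<in> I"
  have "c \<le> a i" "c \<le> a j" using a i that by blast+
  then show "c \<le> (a(j := a j + 1)) i" by simp
qed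

section \<open>Inclusion-exclusion over the states\<close>

definition incl_excl :: "nat set \<Rightarrow> (nat \<Rightarrow> real) \<Rightarrow> real \<Rightarrow> nat \<Rightarrow> nat \<Rightarrow> real" where
  "incl_excl J a t k l = (\<integral>\<omega>. (\<Prod>i\<in>J. 1 - exp (- L t i \<omega>)) * (exp (- wL a t \<omega>) * indicator {l} (X t \<omega>)) \<partial>M k)"

lemma incl_excl_integrand:
  assumes a: "\<forall>i\<in>I. 0 \<le> a i" and k: "k \<in> I" and t: "0 \<le> t"
  shows "integrable (M k) (\<lambda>\<omega>. (\<Prod>i\<in>J. 1 - exp (- L t i \<omega>)) * (exp (- wL a t \<omega>) * indicat_real {l} (X t \<omega>)))"
    "(\<lambda>\<omega>. (\<Prod>i\<in>J. 1 - exp (- L t i \<omega>)) * (exp (- wL a t \<omega>) * indicat_real {l} (X t \<omega>))) \<in> borel_measurable (M k)"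
proof -
  have m: "(\<lambda>\<omega>. \<Prod>i\<in>J. 1 - exp (- L t i \<omega>)) \<in> borel_measurable (M k)"
    using L_meas[OF k t] by (intro borel_measurable_prod borel_measurable_diff) auto
  show mm: "(\<lambda>\<omega>. (\<Prod>i\<in>J. 1 - exp (- L t i \<omega>)) * (exp (- wL a t \<omega>) * indicat_real {l} (X t \<omega>))) \<in> borel_measurable (M k)"
    using m \<Phi>_integrand(1)[OF a k t, of l] by (rule borel_measurable_times)
  show "integrable (M k) (\<lambda>\<omega>. (\<Prod>i\<in>J. 1 - exp (- L t i \<omega>)) * (exp (- wL a t \<omega>) * indicat_real {l} (X t \<omega>)))"
  proof (rule Bochner_Integration.integrable_bound[OF \<Phi>_integrand(2)[OF a k t] mm], rule AE_I2)
    fix \<omega> assume "\<omega> \<in> space (M k)"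
    then have w: "\<omega> \<in> \<Omega>" by (simp add: space_M[OF k])
    have "\<bar>\<Prod>i\<in>J. 1 - exp (- L t i \<omega>)\<bar> \<le> 1"
      unfolding abs_prod by (rule prod_le_1) (use L_nonneg[OF w t] in auto)
    then show "norm ((\<Prod>i\<in>J. 1 - exp (- L t i \<omega>)) * (exp (- wL a t \<omega>) * indicat_real {l} (X t \<omega>)))
        \<le> norm (exp (- wL a t \<omega>) * indicat_real {l} (X t \<omega>))"
      unfolding norm_mult by (intro mult_left_le_one_le) auto
  qed
qed

lemma incl_excl_empty: "incl_excl {} a t k l = \<Phi> a t k l"
  by (simp add: incl_excl_def \<Phi>_def)

lemma incl_excl_bounds:
  assumes a: "\<forall>i\<in>I. 0 \<le> a i" and k: "k \<in> I" and l: "l \<in> I" and t: "0 \<le> t"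
  shows "0 \<le> incl_excl J a t k l" "incl_excl J a t k l \<le> 1"
proof -
  have 1: "0 \<le> (\<Prod>i\<in>J. 1 - exp (- L t i \<omega>)) \<and> (\<Prod>i\<in>J. 1 - exp (- L t i \<omega>)) \<le> 1" if "\<omega> \<in> \<Omega>" for \<omega>
    using L_nonneg[OF that t] by (auto intro!: prod_nonneg prod_le_1)
  show "0 \<le> incl_excl J a t k l"
    unfolding incl_excl_def
    by (rule integral_nonneg_AE, rule AE_I2) (use 1 space_M[OF k] in auto)
  have "incl_excl J a t k l \<le> \<Phi> a t k l"
    unfolding incl_excl_def \<Phi>_def
    by (rule integral_mono[OF incl_excl_integrand(1)[OF a k t] \<Phi>_integrand(2)[OF a k t]])
       (use 1 space_M[OF k] in \<open>auto intro!: mult_left_le_one_le\<close>)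
  then show "incl_excl J a t k l \<le> 1" using \<Phi>_le_1[OF a k l t] by simp
qed

text \<open>Multiplication by exp (- L(j)) raises \<open>a j\<close> by 1, so each new factor acts
  as a unit difference in the parameter a.\<close>

lemma incl_excl_insert:
  assumes a: "\<forall>i\<in>I. 0 \<le> a i" and k: "k \<in> I" and t: "0 \<le> t" and J: "finite J" "j \<notin> J" and j: "j \<in> I"
  shows "incl_excl (insert j J) a t k l = incl_excl J a t k l - incl_excl J (a(j := a j + 1)) t k l"
proof -
  have a': "\<forall>i\<in>I. 0 \<le> (a(j := a j + 1)) i" by (rule upd_ge[OF j a])
  have wL': "wL (a(j := a j + 1)) t \<omega> = wL a t \<omega> + L t j \<omega>" for \<omega>
    unfolding wL_def using j by (simp add: sum.remove[of I j] algebra_simps cong: sum.cong_simp)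
  have "incl_excl (insert j J) a t k l = (\<integral>\<omega>. (\<Prod>i\<in>J. 1 - exp (- L t i \<omega>)) * (exp (- wL a t \<omega>) * indicator {l} (X t \<omega>))
      - (\<Prod>i\<in>J. 1 - exp (- L t i \<omega>)) * (exp (- wL (a(j := a j + 1)) t \<omega>) * indicator {l} (X t \<omega>)) \<partial>M k)"
    unfolding incl_excl_def wL'
  proof (rule Bochner_Integration.integral_cong[OF refl])
    fix \<omega>
    have "exp (- (wL a t \<omega> + L t j \<omega>)) = exp (- wL a t \<omega>) * exp (- L t j \<omega>)" by (simp add: exp_add[symmetric])
    then show "(\<Prod>i\<in>insert j J. 1 - exp (- L t i \<omega>)) * (exp (- wL a t \<omega>) * indicator {l} (X t \<omega>))
      = (\<Prod>i\<in>J. 1 - exp (- L t i \<omega>)) * (exp (- wL a t \<omega>) * indicator {l} (X t \<omega>))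
        - (\<Prod>i\<in>J. 1 - exp (- L t i \<omega>)) * (exp (- (wL a t \<omega> + L t j \<omega>)) * indicator {l} (X t \<omega>))"
      using J by (simp only: prod.insert) (simp add: algebra_simps)
  qed
  also have "\<dots> = incl_excl J a t k l - incl_excl J (a(j := a j + 1)) t k l"
    unfolding incl_excl_def
    by (rule Bochner_Integration.integral_diff) (rule incl_excl_integrand(1)[OF a k t] incl_excl_integrand(1)[OF a' k t])+
  finally show ?thesis .
qed

definition geo_ratio :: "real \<Rightarrow> real" where "geo_ratio a = Lam / (Lam + a)"

lemma geo_ratio_bounds: "0 < a \<Longrightarrow> 0 < geo_ratio a \<and> geo_ratio a < 1" "0 < a \<Longrightarrow> geo_ratio (a + 1) \<le> geo_ratio a"
  using Lam_ge1 by (auto simp: geo_ratio_def field_simps)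

text \<open>The trace of these unit differences on the generating function: geometric weights are
  differenced in the coordinates of J. There the weight of the count 0 is 1 - 1 = 0, so paths
  missing a state of J drop out.\<close>

definition ie_weight :: "nat set \<Rightarrow> (nat \<Rightarrow> real) \<Rightarrow> nat \<Rightarrow> nat \<Rightarrow> real" where
  "ie_weight J a i n = geo_ratio (a i) ^ n - (if i \<in> J then geo_ratio (a i + 1) ^ n else 0)"

lemma weights_ie_weight:
  assumes a: "\<forall>i\<in>I. 1 \<le> a i" shows "weights I (ie_weight J a)"
proof
  show "0 \<le> ie_weight J a i n" if "i \<in> I" for i n
  proof -
    have ai: "0 < a i" using a that by force
    show ?thesis using geo_ratio_bounds[OF ai] geo_ratio_bounds(1)[of "a i + 1"] ai by (auto simp: ie_weight_def intro!: power_mono)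
  qed
  show "ie_weight J a i summable_on UNIV" if "i \<in> I" for i
  proof -
    have ai: "0 < a i" using a that by force
    have g: "(\<lambda>n. x ^ n) summable_on UNIV" if "0 < x" "x < 1" for x :: real
      by (rule norm_summable_imp_summable_on) (use that in \<open>simp add: power_abs\<close>)
    have "(\<lambda>n. geo_ratio (a i) ^ n) summable_on UNIV" "(\<lambda>n. geo_ratio (a i + 1) ^ n) summable_on UNIV"
      by (rule g; use geo_ratio_bounds(1)[OF ai] geo_ratio_bounds(1)[of "a i + 1"] ai in auto)+
    then have "(\<lambda>n. geo_ratio (a i) ^ n - geo_ratio (a i + 1) ^ n) summable_on UNIV" "(\<lambda>n. geo_ratio (a i) ^ n - 0) summable_on UNIV"
      by (auto intro: summable_diff')
    then show ?thesis unfolding ie_weight_def[abs_def] by (cases "i \<in> J") auto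
  qed
qed simp

text \<open>Induction over J with a arbitrary: a new state j subtracts the statement at
  \<open>a j + 1\<close>. On the right only the factor of j in the product of weights changes, so
  the difference is taken in that factor.\<close>

lemma incl_excl_laplace:
  assumes "finite J" "J \<subseteq> I" "\<forall>i\<in>I. 1 \<le> a i" and k: "k \<in> I" and l: "l \<in> I"
  shows "integrable lborel (\<lambda>t. indicator {0<..} t * incl_excl J a t k l)
    \<and> Lam * (\<integral>t. indicator {0<..} t * incl_excl J a t k l \<partial>lborel) = psum I (ie_weight J a) (\<lambda>m. path_weight N P m k l)"
  using assms(1-3)
proof (induction J arbitrary: a)
  case empty
  have "Lam * R a k l = psum I (\<lambda>i n. geo_ratio (a i) ^ n) (\<lambda>m. path_weight N P m k l)"
    using R_path_gf[OF empty.prems(2) k l] path_gf_alt[OF k] by (simp add: geo_ratio_def)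
  moreover have "ie_weight {} a = (\<lambda>i n. geo_ratio (a i) ^ n)" by (simp add: ie_weight_def fun_eq_iff)
  ultimately show ?case using \<Phi>_integrable[OF empty.prems(2) k l] by (simp add: incl_excl_empty R_def)
next
  case (insert j J)
  let ?a = "a(j := a j + 1)"
  have j: "j \<in> I" and J: "J \<subseteq> I" using insert.prems by auto
  have a0: "\<forall>i\<in>I. 0 \<le> a i" using insert.prems(2) by (meson order_trans zero_le_one)
  have a': "\<forall>i\<in>I. 1 \<le> ?a i" by (rule upd_ge[OF j insert.prems(2)])
  note IH1 = insert.IH[OF J insert.prems(2)]
  have IH2: "integrable lborel (\<lambda>t. indicator {0<..} t * incl_excl J ?a t k l)
    \<and> Lam * (\<integral>t. indicator {0<..} t * incl_excl J ?a t k l \<partial>lborel) = psum I (ie_weight J ?a) (\<lambda>m. path_weight N P m k l)"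
    using insert.IH[OF J a'] .
  have e: "(\<lambda>t. indicator {0<..} t * incl_excl (insert j J) a t k l)
      = (\<lambda>t. indicator {0<..} t * incl_excl J a t k l - indicator {0<..} t * incl_excl J ?a t k l)"
    by (rule ext) (simp add: indicator_def incl_excl_insert[OF a0 k _ insert.hyps j])
  have b: "\<bar>path_weight N P m k l\<bar> \<le> 1" for m by (rule path_weight_bounds(3)[OF k])
  interpret W1: weights I "ie_weight J a" by (rule weights_ie_weight[OF insert.prems(2)])
  interpret W2: weights I "ie_weight J ?a" by (rule weights_ie_weight[OF a'])
  have pr: "(\<Prod>i\<in>I. ie_weight (insert j J) a i (m i)) = (\<Prod>i\<in>I. ie_weight J a i (m i)) - (\<Prod>i\<in>I. ie_weight J ?a i (m i))" for m
  proof -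
    have r: "(\<Prod>i\<in>I-{j}. ie_weight (insert j J) a i (m i)) = (\<Prod>i\<in>I-{j}. ie_weight J a i (m i))"
      "(\<Prod>i\<in>I-{j}. ie_weight J ?a i (m i)) = (\<Prod>i\<in>I-{j}. ie_weight J a i (m i))"
      by (rule prod.cong; auto simp: ie_weight_def)+
    have "(\<Prod>i\<in>I. F i) = F j * (\<Prod>i\<in>I-{j}. F i)" for F :: "nat \<Rightarrow> real"
      by (rule prod.remove) (use j in auto)
    note this[of "\<lambda>i. ie_weight (insert j J) a i (m i)"] this[of "\<lambda>i. ie_weight J a i (m i)"] this[of "\<lambda>i. ie_weight J ?a i (m i)"]
    moreover have "ie_weight (insert j J) a j (m j) = ie_weight J a j (m j) - ie_weight J ?a j (m j)"
      using insert.hyps by (simp add: ie_weight_def)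
    ultimately show ?thesis using r by (simp add: left_diff_distrib)
  qed
  have "psum I (ie_weight (insert j J) a) (\<lambda>m. path_weight N P m k l)
      = psum I (ie_weight J a) (\<lambda>m. path_weight N P m k l) - psum I (ie_weight J ?a) (\<lambda>m. path_weight N P m k l)"
    unfolding psum_def pr left_diff_distrib
    by (rule infsum_diff'[OF W1.summable_psum[OF b] W2.summable_psum[OF b]])
  then show ?case unfolding e using IH1 IH2 by (simp add: right_diff_distrib del: fun_upd_apply)
qed

text \<open>The event \<open>X t = l\<close> does not vary continuously along a path, but the
  expectation is a finite signed combination of the functions \<Phi>, which are Lipschitz in
  time.\<close>

lemma incl_excl_continuous:
  assumes "finite J" "J \<subseteq> I" "\<forall>i\<in>I. 0 \<le> a i" and k: "k \<in> I" and l: "l \<in> I"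
  shows "continuous_on {0..} (\<lambda>t. incl_excl J a t k l)"
  using assms(1-3)
proof (induction J arbitrary: a)
  case empty
  then show ?case using \<Phi>_continuous[OF empty.prems(2) k l] by (simp add: incl_excl_empty)
next
  case (insert j J)
  let ?a = "a(j := a j + 1)"
  have j: "j \<in> I" and J: "J \<subseteq> I" using insert.prems by auto
  have a': "\<forall>i\<in>I. 0 \<le> ?a i" by (rule upd_ge[OF j insert.prems(2)])
  have "continuous_on {0..} (\<lambda>t. incl_excl J a t k l - incl_excl J ?a t k l)"
    by (intro continuous_on_diff insert.IH J insert.prems(2) a')
  then show ?case
    by (rule continuous_on_cong[THEN iffD1, rotated -1])
       (use incl_excl_insert[OF insert.prems(2) k _ insert.hyps j] in auto)
qed

definition ie_weight_suc :: "(nat \<Rightarrow> real) \<Rightarrow> nat \<Rightarrow> nat \<Rightarrow> real" where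
  "ie_weight_suc a i n = geo_ratio (a i) ^ Suc n - geo_ratio (a i + 1) ^ Suc n"

lemma ie_weight_suc_ie_weight: "i \<in> I \<Longrightarrow> ie_weight_suc a i n = ie_weight I a i (Suc n)" "i \<in> I \<Longrightarrow> ie_weight I a i 0 = 0"
  by (auto simp: ie_weight_suc_def ie_weight_def)

lemma weights_ie_weight_suc:
  assumes a: "\<forall>i\<in>I. 1 \<le> a i" shows "weights I (ie_weight_suc a)"
proof -
  interpret W: weights I "ie_weight I a" by (rule weights_ie_weight[OF a])
  show ?thesis
  proof
    show "0 \<le> ie_weight_suc a i n" if "i \<in> I" for i n using W.wpos[OF that] ie_weight_suc_ie_weight(1)[OF that] by simp
    show "ie_weight_suc a i summable_on UNIV" if "i \<in> I" for i
    proof -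
      have "ie_weight I a i summable_on range Suc" using W.wsum[OF that] by (rule summable_on_subset_banach) simp
      then have "(ie_weight I a i \<circ> Suc) summable_on UNIV" by (subst (asm) summable_on_reindex) auto
      moreover have "ie_weight_suc a i = ie_weight I a i \<circ> Suc" using ie_weight_suc_ie_weight(1)[OF that] by (simp add: fun_eq_iff)
      ultimately show ?thesis by simp
    qed
  qed simp
qed

text \<open>With all states differenced only indices with every count at least 1 survive, and
  lowering each count by 1 makes the sum run over all indices again.\<close>

lemma psum_shift: "k \<in> I \<Longrightarrow> psum I (ie_weight I a) (\<lambda>m. path_weight N P m k l) = psum I (ie_weight_suc a) (dens_coeff k l)"
proof -
  assume k: "k \<in> I"
  let ?E = "PiE I (\<lambda>_. UNIV :: nat set)"
  let ?s = "\<lambda>m. restrict (\<lambda>i. Suc (m i)) I"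
  have inj: "inj_on ?s ?E"
  proof (rule inj_onI)
    fix m m' assume m: "m \<in> ?E" "m' \<in> ?E" "?s m = ?s m'"
    show "m = m'"
    proof (rule PiE_ext[OF m(1,2)])
      fix i assume "i \<in> I"
      then show "m i = m' i" using fun_cong[OF m(3), of i] by simp
    qed
  qed
  have img: "?s ` ?E = {m \<in> ?E. \<forall>i\<in>I. m i \<noteq> 0}"
  proof (intro equalityI subsetI)
    fix m assume m: "m \<in> {m \<in> ?E. \<forall>i\<in>I. m i \<noteq> 0}"
    have "m = ?s (restrict (\<lambda>i. m i - 1) I)"
      by (rule PiE_ext[of m I "\<lambda>_. UNIV"]) (use m in auto)
    then show "m \<in> ?s ` ?E" by (intro image_eqI[where x = "restrict (\<lambda>i. m i - 1) I"]) auto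
  qed auto
  have "psum I (ie_weight I a) (\<lambda>m. path_weight N P m k l) = (\<Sum>\<^sub>\<infinity>m\<in>?s ` ?E. (\<Prod>i\<in>I. ie_weight I a i (m i)) * path_weight N P m k l)"
    unfolding psum_def img
  proof (rule infsum_cong_neutral)
    fix m assume "m \<in> ?E - {m \<in> ?E. \<forall>i\<in>I. m i \<noteq> 0}"
    then obtain i where i: "i \<in> I" "m i = 0" by blast
    have "(\<Prod>i\<in>I. ie_weight I a i (m i)) = 0"
      by (rule prod_zero, simp, rule bexI[of _ i], simp add: i ie_weight_suc_ie_weight(2)[OF i(1)], rule i(1))
    then show "(\<Prod>i\<in>I. ie_weight I a i (m i)) * path_weight N P m k l = 0" by simp
  qed auto
  also have "\<dots> = (\<Sum>\<^sub>\<infinity>m\<in>?E. (\<Prod>i\<in>I. ie_weight I a i (?s m i)) * path_weight N P (?s m) k l)"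
    by (subst infsum_reindex[OF inj]) (simp add: o_def)
  also have "\<dots> = psum I (ie_weight_suc a) (dens_coeff k l)"
    unfolding psum_def
  proof (rule infsum_cong)
    fix m
    have "(\<Prod>i\<in>I. ie_weight I a i (?s m i)) = (\<Prod>i\<in>I. ie_weight_suc a i (m i))" by (rule prod.cong) (auto simp: ie_weight_suc_ie_weight)
    moreover have "path_weight N P (?s m) k l = dens_coeff k l m"
    proof -
      \<comment> \<open>\<open>restrict\<close> leaves undefined values off I where
        \<open>dens_coeff\<close> adds 1; the recursion never reads the counts there.\<close>
      have c: "pathw N P n m1 k l = pathw N P n m2 k l" if "\<And>i. i \<in> I \<Longrightarrow> m1 i = m2 i" "k \<in> I" for n m1 m2 k
        using that
      proof (induction n arbitrary: m1 m2 k)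
        case (Suc n)
        have "pathw N P n (m1(k := m1 k - 1)) j l = pathw N P n (m2(k := m2 k - 1)) j l" if "j \<in> I" for j
          by (rule Suc.IH) (use Suc.prems that in auto)
        then show ?case using Suc.prems by (simp cong: sum.cong_simp)
      qed simp
      have "(\<Sum>i=1..N. ?s m i) = (\<Sum>i=1..N. Suc (m i))" by (rule sum.cong) auto
      then show ?thesis unfolding dens_coeff_def path_weight_def
        using c[of "?s m" "\<lambda>i. Suc (m i)", OF _ k] by simp
    qed
    ultimately show "(\<Prod>i\<in>I. ie_weight I a i (?s m i)) * path_weight N P (?s m) k l = (\<Prod>i\<in>I. ie_weight_suc a i (m i)) * dens_coeff k l m" by simp
  qed
  finally show ?thesis .
qed

end

locale jump_density = jump_process N G M X + coords N idx
  for N :: nat and G :: "nat \<Rightarrow> nat \<Rightarrow> real" and M :: "nat \<Rightarrow> 'w measure" and X :: "real \<Rightarrow> 'w \<Rightarrow> nat"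
    and idx :: "'d::finite \<Rightarrow> nat"
begin

definition Lv :: "real \<Rightarrow> 'w \<Rightarrow> real ^ 'd" where "Lv t \<omega> = (\<chi> j. L t (idx j) \<omega>)"

lemma crd_Lv:
  assumes w: "\<omega> \<in> \<Omega>" and t: "0 \<le> t" and i: "i \<in> I"
  shows "crd t (Lv t \<omega>) i = L t i \<omega>"
  using i
proof (cases rule: state_cases)
  case 1
  then show ?thesis using L_sum[OF w t] unfolding sum_states by (simp add: Lv_def)
qed (simp add: Lv_def)

lemma Lv_simplex: "\<omega> \<in> \<Omega> \<Longrightarrow> 0 \<le> t \<Longrightarrow> Lv t \<omega> \<in> csimplex t"
  unfolding csimplex_def using crd_Lv L_nonneg by simp

lemma Lv_meas: "k \<in> I \<Longrightarrow> 0 \<le> t \<Longrightarrow> Lv t \<in> borel_measurable (M k)"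
  unfolding Lv_def by (intro borel_measurable_vec_lambda L_meas)

text \<open>Truncation makes the Poisson means nonnegative everywhere, so that the density formula is continuous
  on the whole space.\<close>

definition cp :: "real \<Rightarrow> real ^ 'd \<Rightarrow> nat \<Rightarrow> real" where "cp t x i = max 0 (crd t x i)"

lemma cp_nonneg [simp]: "0 \<le> cp t x i" by (simp add: cp_def)

lemma cp_simplex: "x \<in> csimplex t \<Longrightarrow> i \<in> I \<Longrightarrow> cp t x i = crd t x i"
  using csimplexD by (simp add: cp_def)

text \<open>Each of the N total holding times contributes a factor Lam, its Gamma density being Lam
  times a Poisson weight. One factor is taken back because the sojourn in progress at time t is not
  completed; it is the factor Lam in front of the resolvent in \<open>R_path_gf\<close>.\<close>

definition raw_dens :: "nat \<Rightarrow> nat \<Rightarrow> real \<Rightarrow> real ^ 'd \<Rightarrow> real" where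
  "raw_dens k l t x = Lam ^ (N - 1) * pois_exp I (\<lambda>i. Lam * cp t x i) (dens_coeff k l)"

lemma Lam_pos: "0 < Lam" using Lam_ge1 by simp

lemma raw_dens_bounds:
  assumes k: "k \<in> I" shows "0 \<le> raw_dens k l t x" "raw_dens k l t x \<le> Lam ^ (N - 1)"
proof -
  have y: "\<And>i. i \<in> I \<Longrightarrow> 0 \<le> Lam * cp t x i" using Lam_pos by simp
  have "0 \<le> pois_exp I (\<lambda>i. Lam * cp t x i) (dens_coeff k l)"
    by (rule pois_exp_nonneg[OF _ y dens_coeff_bounds(1)[OF k] dens_coeff_bounds(3)[OF k]]) auto
  then show "0 \<le> raw_dens k l t x" using Lam_pos by (simp add: raw_dens_def)
  have "\<bar>pois_exp I (\<lambda>i. Lam * cp t x i) (dens_coeff k l)\<bar> \<le> 1"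
    by (rule pois_exp_bound[OF _ y dens_coeff_bounds(3)[OF k]]) auto
  then show "raw_dens k l t x \<le> Lam ^ (N - 1)" using Lam_pos by (simp add: raw_dens_def mult_left_le)
qed

lemma raw_dens_lipschitz:
  assumes k: "k \<in> I"
  shows "\<bar>raw_dens k l t x - raw_dens k l t' x'\<bar> \<le> 2 * Lam ^ N * (\<Sum>i\<in>I. \<bar>crd t x i - crd t' x' i\<bar>)"
proof -
  have "\<bar>pois_exp I (\<lambda>i. Lam * cp t x i) (dens_coeff k l) - pois_exp I (\<lambda>i. Lam * cp t' x' i) (dens_coeff k l)\<bar>
      \<le> 2 * 1 * (\<Sum>i\<in>I. \<bar>Lam * cp t x i - Lam * cp t' x' i\<bar>)"
    by (rule pois_exp_lipschitz) (use dens_coeff_bounds[OF k] Lam_pos in auto)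
  also have "\<dots> \<le> 2 * 1 * (\<Sum>i\<in>I. Lam * \<bar>crd t x i - crd t' x' i\<bar>)"
  proof (intro mult_left_mono sum_mono)
    fix i
    have "\<bar>cp t x i - cp t' x' i\<bar> \<le> \<bar>crd t x i - crd t' x' i\<bar>" by (simp add: cp_def)
    then show "\<bar>Lam * cp t x i - Lam * cp t' x' i\<bar> \<le> Lam * \<bar>crd t x i - crd t' x' i\<bar>"
      using Lam_pos by (simp add: right_diff_distrib[symmetric] abs_mult)
  qed simp
  finally have 1: "\<bar>pois_exp I (\<lambda>i. Lam * cp t x i) (dens_coeff k l) - pois_exp I (\<lambda>i. Lam * cp t' x' i) (dens_coeff k l)\<bar>
      \<le> 2 * Lam * (\<Sum>i\<in>I. \<bar>crd t x i - crd t' x' i\<bar>)" by (simp add: sum_distrib_left[symmetric])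
  have "\<bar>raw_dens k l t x - raw_dens k l t' x'\<bar> = Lam ^ (N - 1) * \<bar>pois_exp I (\<lambda>i. Lam * cp t x i) (dens_coeff k l) - pois_exp I (\<lambda>i. Lam * cp t' x' i) (dens_coeff k l)\<bar>"
    using Lam_pos by (simp add: raw_dens_def right_diff_distrib[symmetric] abs_mult)
  also have "\<dots> \<le> Lam ^ (N - 1) * (2 * Lam * (\<Sum>i\<in>I. \<bar>crd t x i - crd t' x' i\<bar>))"
    by (rule mult_left_mono[OF 1]) (use Lam_pos in simp)
  also have "\<dots> = 2 * Lam ^ N * (\<Sum>i\<in>I. \<bar>crd t x i - crd t' x' i\<bar>)"
    using N1 by (simp add: power_eq_if[of Lam N])
  finally show ?thesis .
qed

lemma raw_dens_continuous: "k \<in> I \<Longrightarrow> continuous_on UNIV (\<lambda>z. raw_dens k l (fst z) (snd z))"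
proof -
  assume k: "k \<in> I"
  show ?thesis
    unfolding continuous_on_def
  proof (intro ballI)
    fix z :: "real \<times> (real ^ 'd)"
    have "continuous_on UNIV (\<lambda>y. 2 * Lam ^ N * (\<Sum>i\<in>I. \<bar>crd (fst y) (snd y) i - crd (fst z) (snd z) i\<bar>))"
      by (intro continuous_intros)
    then have "((\<lambda>y. 2 * Lam ^ N * (\<Sum>i\<in>I. \<bar>crd (fst y) (snd y) i - crd (fst z) (snd z) i\<bar>))
        \<longlongrightarrow> 2 * Lam ^ N * (\<Sum>i\<in>I. \<bar>crd (fst z) (snd z) i - crd (fst z) (snd z) i\<bar>)) (at z within UNIV)"
      unfolding continuous_on_def by blast
    then have "((\<lambda>y. 2 * Lam ^ N * (\<Sum>i\<in>I. \<bar>crd (fst y) (snd y) i - crd (fst z) (snd z) i\<bar>)) \<longlongrightarrow> 0) (at z within UNIV)"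
      by simp
    then have "((\<lambda>y. raw_dens k l (fst y) (snd y) - raw_dens k l (fst z) (snd z)) \<longlongrightarrow> 0) (at z within UNIV)"
      by (rule Lim_null_comparison[rotated]) (use raw_dens_lipschitz[OF k] in \<open>auto intro!: always_eventually\<close>)
    then show "((\<lambda>y. raw_dens k l (fst y) (snd y)) \<longlongrightarrow> raw_dens k l (fst z) (snd z)) (at z within UNIV)"
      by (simp add: LIM_zero_iff)
  qed
qed

lemma raw_dens_continuous2:
  assumes "k \<in> I" "continuous_on S f" "continuous_on S g"
  shows "continuous_on S (\<lambda>s. raw_dens k l (f s) (g s))"
  using continuous_on_compose2[OF raw_dens_continuous[OF assms(1)] continuous_on_Pair[OF assms(2,3)]] by simp

section \<open>Regularity of the density on the simplex\<close>

definition dens0 :: "real \<Rightarrow> real ^ 'd \<Rightarrow> nat \<Rightarrow> nat \<Rightarrow> real" where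
  "dens0 t x k l = (if x \<in> csimplex t then raw_dens k l t x else 0)"

lemma dens0_bounds: "k \<in> I \<Longrightarrow> 0 \<le> dens0 t x k l" "k \<in> I \<Longrightarrow> \<bar>dens0 t x k l\<bar> \<le> Lam ^ (N - 1)"
  using raw_dens_bounds[of k l t x] Lam_pos by (auto simp: dens0_def)

lemma dens0_continuous: "k \<in> I \<Longrightarrow> continuous_on (csimplex t) (\<lambda>x. dens0 t x k l)"
  by (rule continuous_on_cong[THEN iffD1, OF refl _ raw_dens_continuous2[of k "csimplex t" "\<lambda>_. t" "\<lambda>x. x" l]])
     (auto simp: dens0_def intro: continuous_intros)

lemma dens0_meas: "k \<in> I \<Longrightarrow> (\<lambda>x. dens0 t x k l) \<in> borel_measurable borel"
proof -
  assume k: "k \<in> I"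
  have "(\<lambda>x. indicator (csimplex t) x *\<^sub>R dens0 t x k l) \<in> borel_measurable borel"
    by (rule borel_measurable_continuous_on_indicator[OF _ dens0_continuous[OF k]]) (simp add: borel_closed closed_simplex)
  also have "(\<lambda>x. indicator (csimplex t) x *\<^sub>R dens0 t x k l) = (\<lambda>x. dens0 t x k l)"
    by (auto simp: fun_eq_iff dens0_def indicator_def)
  finally show ?thesis .
qed

lemma crd_diff: "crd t z i - crd t y i = crd 0 (z - y) i"
  by (simp add: crd_def sum_subtractf)

lemma crd0_linear: "linear (\<lambda>h. crd 0 h i)"
  by (rule linearI) (auto simp: crd_def sum.distrib sum_distrib_left)

lemma sum_crd0: "(\<Sum>i\<in>I. \<bar>crd 0 h i\<bar>) \<le> 2 * real CARD('d) * norm h"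
proof -
  have "(\<Sum>j\<in>UNIV. \<bar>h $ j\<bar>) \<le> (\<Sum>j\<in>(UNIV :: 'd set). norm h)" by (intro sum_mono) (rule component_le_norm_cart)
  also have "\<dots> = real CARD('d) * norm h" by simp
  finally have "(\<Sum>j\<in>UNIV. \<bar>h $ j\<bar>) \<le> real CARD('d) * norm h" .
  moreover have "\<bar>\<Sum>j\<in>UNIV. h $ j\<bar> \<le> (\<Sum>j\<in>UNIV. \<bar>h $ j\<bar>)" by (rule sum_abs)
  moreover have "(\<Sum>i\<in>I. \<bar>crd 0 h i\<bar>) = \<bar>\<Sum>j\<in>UNIV. h $ j\<bar> + (\<Sum>j\<in>UNIV. \<bar>h $ j\<bar>)" unfolding sum_states by simp
  ultimately have "(\<Sum>i\<in>I. \<bar>crd 0 h i\<bar>) \<le> real CARD('d) * norm h + real CARD('d) * norm h" by linarith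
  then show ?thesis by (simp add: mult_ac)
qed

text \<open>\<open>crd 0 h\<close> lists the increments of all N coordinates along h. That of the
  state N is minus the sum of the others, since the total time stays fixed.\<close>

definition dens_deriv :: "nat \<Rightarrow> nat \<Rightarrow> real \<Rightarrow> real ^ 'd \<Rightarrow> real ^ 'd \<Rightarrow> real" where
  "dens_deriv k l t y h = (\<Sum>i\<in>I. crd 0 h i * (Lam ^ N * pois_exp I (\<lambda>i. Lam * cp t y i) (shift_diff i (dens_coeff k l))))"

lemma dens0_has_derivative:
  assumes k: "k \<in> I" and y: "y \<in> osimplex t"
  shows "((\<lambda>x. dens0 t x k l) has_derivative dens_deriv k l t y) (at y)"
proof -
  obtain e where e: "0 < e" "ball y e \<subseteq> osimplex t"
    using open_osimplex y unfolding open_contains_ball by blast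
  have lin: "linear (dens_deriv k l t y)"
    unfolding dens_deriv_def
    by (rule linearI) (auto simp: linear_add[OF crd0_linear] linear_scale[OF crd0_linear] sum.distrib sum_distrib_left algebra_simps)
  let ?K = "Lam ^ (N - 1) * 4 * (Lam * (2 * real CARD('d)))\<^sup>2"
  \<comment> \<open>The quadratic Taylor remainder is divided by the distance. In the ball the
    truncation in \<open>cp\<close> is inactive, so the increments of the Poisson means are
    linear.\<close>
  show ?thesis
  proof (rule has_derivativeI_sandwich[OF e(1), where H = "\<lambda>x. ?K * norm (x - y)"])
    show "bounded_linear (dens_deriv k l t y)" using lin linear_conv_bounded_linear by blast
    have "((\<lambda>x. ?K * norm (x - y)) \<longlongrightarrow> ?K * norm (y - y)) (at y)"
      by (intro tendsto_intros)
    then show "((\<lambda>x. ?K * norm (x - y)) \<longlongrightarrow> 0) (at y)" by simp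
    fix z assume z: "z \<in> UNIV" "z \<noteq> y" "dist z y < e"
    have zs: "z \<in> osimplex t" using e z by (auto simp: dist_commute)
    have zc: "z \<in> csimplex t" "y \<in> csimplex t" using zs y osimplex_subset by auto
    let ?pz = "pois_exp I (\<lambda>i. Lam * cp t z i) (dens_coeff k l)" and ?py = "pois_exp I (\<lambda>i. Lam * cp t y i) (dens_coeff k l)"
    let ?pd = "\<lambda>i. pois_exp I (\<lambda>i. Lam * cp t y i) (shift_diff i (dens_coeff k l))"
    have d: "Lam * cp t z i - Lam * cp t y i = Lam * crd 0 (z - y) i" if "i \<in> I" for i
      using that zc by (simp add: cp_simplex crd_diff right_diff_distrib[symmetric])
    have "\<bar>?pz - ?py - (\<Sum>i\<in>I. (Lam * cp t z i - Lam * cp t y i) * ?pd i)\<bar> \<le> 4 * 1 * (\<Sum>i\<in>I. \<bar>Lam * cp t z i - Lam * cp t y i\<bar>)\<^sup>2"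
      by (rule pois_exp_taylor) (use dens_coeff_bounds[OF k] Lam_pos in auto)
    also have "(\<Sum>i\<in>I. \<bar>Lam * cp t z i - Lam * cp t y i\<bar>) = Lam * (\<Sum>i\<in>I. \<bar>crd 0 (z - y) i\<bar>)"
      unfolding sum_distrib_left by (rule sum.cong) (use d Lam_pos in \<open>auto simp: abs_mult\<close>)
    also have "4 * 1 * (Lam * (\<Sum>i\<in>I. \<bar>crd 0 (z - y) i\<bar>))\<^sup>2 \<le> 4 * 1 * (Lam * (2 * real CARD('d) * norm (z - y)))\<^sup>2"
    proof (intro mult_left_mono power_mono)
      show "(\<Sum>i\<in>I. \<bar>crd 0 (z - y) i\<bar>) \<le> 2 * real CARD('d) * norm (z - y)" by (rule sum_crd0)
      show "0 \<le> Lam * (\<Sum>i\<in>I. \<bar>crd 0 (z - y) i\<bar>)" using Lam_pos by (intro mult_nonneg_nonneg sum_nonneg) auto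
    qed (use Lam_pos in auto)
    finally have 1: "\<bar>?pz - ?py - (\<Sum>i\<in>I. (Lam * cp t z i - Lam * cp t y i) * ?pd i)\<bar> \<le> 4 * 1 * (Lam * (2 * real CARD('d) * norm (z - y)))\<^sup>2" .
    have "(\<Sum>i\<in>I. (Lam * cp t z i - Lam * cp t y i) * ?pd i) * Lam ^ (N - 1) = dens_deriv k l t y (z - y)"
      unfolding dens_deriv_def sum_distrib_right
      by (rule sum.cong) (use d N1 in \<open>auto simp: power_eq_if[of Lam N]\<close>)
    then have "dens0 t z k l - dens0 t y k l - dens_deriv k l t y (z - y) = Lam ^ (N - 1) * (?pz - ?py - (\<Sum>i\<in>I. (Lam * cp t z i - Lam * cp t y i) * ?pd i))"
      using zc by (simp add: dens0_def raw_dens_def right_diff_distrib mult.commute)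
    then have "norm (dens0 t z k l - dens0 t y k l - dens_deriv k l t y (z - y)) = Lam ^ (N - 1) * \<bar>?pz - ?py - (\<Sum>i\<in>I. (Lam * cp t z i - Lam * cp t y i) * ?pd i)\<bar>"
      using Lam_pos by (simp add: abs_mult)
    also have "\<dots> \<le> Lam ^ (N - 1) * (4 * 1 * (Lam * (2 * real CARD('d) * norm (z - y)))\<^sup>2)"
      by (rule mult_left_mono[OF 1]) (use Lam_pos in simp)
    also have "\<dots> = ?K * norm (z - y) * norm (z - y)" by (simp add: power2_eq_square mult_ac)
    finally show "norm (dens0 t z k l - dens0 t y k l - dens_deriv k l t y (z - y)) / norm (z - y) \<le> ?K * norm (z - y)"
      using z by (simp add: divide_le_eq)
  qed
qed

lemma dens_deriv_axis_bound:
  assumes k: "k \<in> I" shows "\<bar>dens_deriv k l t y (axis j 1)\<bar> \<le> 4 * real CARD('d) * Lam ^ N"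
proof -
  have "\<bar>shift_diff i (dens_coeff k l) m\<bar> \<le> 2" for i m
    using dens_coeff_bounds[OF k, of l m] dens_coeff_bounds[OF k, of l "m(i := Suc (m i))"] by linarith
  then have b: "\<bar>pois_exp I (\<lambda>i. Lam * cp t y i) (shift_diff i (dens_coeff k l))\<bar> \<le> 2" for i
    by (intro pois_exp_bound) (use Lam_pos in auto)
  have "\<bar>dens_deriv k l t y (axis j 1)\<bar> \<le> (\<Sum>i\<in>I. \<bar>crd 0 (axis j 1) i\<bar> * (Lam ^ N * 2))"
    unfolding dens_deriv_def
    by (rule order_trans[OF sum_abs]) (use b Lam_pos in \<open>auto simp: abs_mult intro!: sum_mono mult_left_mono\<close>)
  also have "\<dots> = (\<Sum>i\<in>I. \<bar>crd 0 (axis j 1) i\<bar>) * (Lam ^ N * 2)" by (simp only: sum_distrib_right)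
  also have "\<dots> \<le> (2 * real CARD('d) * norm (axis j 1 :: real ^ 'd)) * (Lam ^ N * 2)"
    by (rule mult_right_mono[OF sum_crd0]) (use Lam_pos in simp)
  finally show ?thesis by (simp add: mult_ac)
qed

text \<open>The Poisson means sum to Lam t, so decay in the total mean is decay in time.\<close>

lemma dens0_boundary:
  assumes conn: "\<And>i j. i \<in> I \<Longrightarrow> j \<in> I \<Longrightarrow> (j, i) \<in> arcs_on\<^sup>*"
  shows "\<exists>A b. 0 \<le> A \<and> 0 < b \<and> (\<forall>t k l x. k \<in> I \<longrightarrow> x \<in> csimplex t - osimplex t \<longrightarrow> \<bar>dens0 t x k l\<bar> \<le> A * exp (- b * t))"
proof -
  obtain A b where A: "0 \<le> A" "0 < b"
    "\<And>k l y. k \<in> I \<Longrightarrow> (\<forall>i\<in>I. 0 \<le> y i) \<Longrightarrow> (\<exists>i\<in>I. y i = 0) \<Longrightarrow> \<bar>pois_exp I y (dens_coeff k l)\<bar> \<le> A * exp (- b * (\<Sum>i=1..N. y i))"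
    using pois_exp_boundary_decay[OF conn] by blast
  have "\<bar>dens0 t x k l\<bar> \<le> Lam ^ (N - 1) * A * exp (- (b * Lam) * t)" if k: "k \<in> I" and x: "x \<in> csimplex t - osimplex t" for t k l x
  proof -
    obtain i where i: "i \<in> I" "\<not> 0 < crd t x i" using x unfolding osimplex_def by blast
    have z: "Lam * cp t x i = 0" using i by (simp add: cp_def)
    have "\<bar>pois_exp I (\<lambda>i. Lam * cp t x i) (dens_coeff k l)\<bar> \<le> A * exp (- b * (\<Sum>i=1..N. Lam * cp t x i))"
      by (rule A(3)[OF k]) (use Lam_pos z i in auto)
    also have "(\<Sum>i=1..N. Lam * cp t x i) = Lam * (\<Sum>i=1..N. crd t x i)"
      unfolding sum_distrib_left by (rule sum.cong) (use x cp_simplex in auto)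
    finally have "\<bar>pois_exp I (\<lambda>i. Lam * cp t x i) (dens_coeff k l)\<bar> \<le> A * exp (- (b * Lam) * t)"
      by (simp add: sum_crd mult_ac)
    then have "Lam ^ (N - 1) * \<bar>pois_exp I (\<lambda>i. Lam * cp t x i) (dens_coeff k l)\<bar> \<le> Lam ^ (N - 1) * (A * exp (- (b * Lam) * t))"
      using Lam_pos by (intro mult_left_mono) auto
    then show ?thesis using x Lam_pos by (simp add: dens0_def raw_dens_def abs_mult)
  qed
  then show ?thesis using A Lam_pos by (intro exI[of _ "Lam ^ (N - 1) * A"] exI[of _ "b * Lam"]) auto
qed

lemma dens0_fourier:
  assumes k: "k \<in> I" and t: "0 < t" "t \<le> T" and \<zeta>: "\<zeta> \<noteq> 0"
  shows "norm (fourier (\<lambda>x. dens0 t x k l) \<zeta>)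
    \<le> (2 * (2 * Lam ^ N) * T ^ CARD('d) * V + 4 * Lam ^ (N - 1) * V * real CARD('d) * T ^ (CARD('d) - 1)) * (pi * real CARD('d)) / norm \<zeta>"
proof (rule fourier_decay[OF t dens0_meas[OF k] dens0_bounds(2)[OF k] _ _ _ \<zeta>])
  show "0 \<le> 2 * Lam ^ N" using Lam_pos by simp
  show "\<bar>dens0 t x k l - dens0 t y k l\<bar> \<le> 2 * Lam ^ N * (\<Sum>i=1..N. \<bar>crd t x i - crd t y i\<bar>)"
    if "x \<in> csimplex t" "y \<in> csimplex t" for x y
    using raw_dens_lipschitz[OF k, of l t x t y] that by (simp add: dens0_def)
qed (simp add: dens0_def)

end

section \<open>Identification of the law on the open simplex\<close>

lemma ennreal_infsum:
  fixes f :: "'a \<Rightarrow> real"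
  assumes "f summable_on A" "\<And>x. x \<in> A \<Longrightarrow> 0 \<le> f x"
  shows "ennreal (infsum f A) = (\<integral>\<^sup>+x. ennreal (f x) \<partial>count_space A)"
proof -
  have "(\<lambda>x. norm (f x)) summable_on A"
    using assms(1) summable_on_iff_abs_summable_on_real by blast
  then have "Infinite_Set_Sum.abs_summable_on f A"
    by (simp only: abs_summable_equivalent[symmetric])
  then show ?thesis using assms(2) by (simp add: nn_integral_conv_infsetsum infsetsum_infsum)
qed

lemma nn_integral_power_exp_scaled:
  assumes c: "0 < (c::real)"
  shows "(\<integral>\<^sup>+z. ennreal (z ^ n * exp (- (c * z))) * indicator {0..} z \<partial>lborel) = ennreal (fact n / c ^ Suc n)"
proof -
  have "(\<integral>\<^sup>+z. ennreal (z ^ n * exp (- z)) * indicator {0..} z \<partial>lborel)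
      = ennreal \<bar>c\<bar> * (\<integral>\<^sup>+z. ennreal ((0 + c * z) ^ n * exp (- (0 + c * z))) * indicator {0..} (0 + c * z) \<partial>lborel)"
    by (rule nn_integral_real_affine) (use c in auto)
  also have "(\<integral>\<^sup>+z. ennreal ((0 + c * z) ^ n * exp (- (0 + c * z))) * indicator {0..} (0 + c * z) \<partial>lborel)
      = (\<integral>\<^sup>+z. ennreal (c ^ n) * (ennreal (z ^ n * exp (- (c * z))) * indicator {0..} z) \<partial>lborel)"
    by (rule nn_integral_cong)
       (use c in \<open>auto simp: indicator_def power_mult_distrib ennreal_mult'[symmetric] zero_le_mult_iff mult_ac\<close>)
  also have "\<dots> = ennreal (c ^ n) * (\<integral>\<^sup>+z. ennreal (z ^ n * exp (- (c * z))) * indicator {0..} z \<partial>lborel)"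
    by (rule nn_integral_cmult) auto
  finally have e: "ennreal (fact n) = ennreal (c ^ Suc n) * (\<integral>\<^sup>+z. ennreal (z ^ n * exp (- (c * z))) * indicator {0..} z \<partial>lborel)"
    unfolding nn_intergal_power_times_exp_Ici using c by (simp add: mult.assoc[symmetric] ennreal_mult'[symmetric])
  have "ennreal (fact n / c ^ Suc n) = ennreal (1 / c ^ Suc n) * ennreal (fact n)"
    using c by (simp add: ennreal_mult'[symmetric] del: power_Suc)
  also have "\<dots> = (\<integral>\<^sup>+z. ennreal (z ^ n * exp (- (c * z))) * indicator {0..} z \<partial>lborel)"
    unfolding e using c by (simp add: mult.assoc[symmetric] ennreal_mult'[symmetric] del: power_Suc)
  finally show ?thesis by simp
qed

text \<open>The total time and the first N - 1 coordinates are linear coordinates with unit Jacobian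
  on the space of all N coordinates: for fixed x, the coordinate of N is a translate of t.\<close>

lemma (in coords) nn_integral_crd:
  assumes u[measurable]: "\<And>i. u i \<in> borel_measurable borel"
  shows "(\<integral>\<^sup>+t. \<integral>\<^sup>+x. (\<Prod>i=1..N. u i (crd t x i)) \<partial>lborel \<partial>lborel) = (\<Prod>i=1..N. \<integral>\<^sup>+z. u i z \<partial>(lborel :: real measure))"
proof -
  have m: "(\<lambda>(t, x). \<Prod>i=1..N. u i (crd t x i) :: ennreal) \<in> borel_measurable ((lborel :: real measure) \<Otimes>\<^sub>M (lborel :: (real ^ 'd) measure))"
    by measurable
  have "(\<integral>\<^sup>+t. \<integral>\<^sup>+x. (\<Prod>i=1..N. u i (crd t x i)) \<partial>lborel \<partial>lborel) = (\<integral>\<^sup>+x. \<integral>\<^sup>+t. (\<Prod>i=1..N. u i (crd t x i)) \<partial>lborel \<partial>(lborel :: (real ^ 'd) measure))"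
    by (rule lborel_pair.Fubini'[OF m, symmetric])
  also have "\<dots> = (\<integral>\<^sup>+x. (\<Prod>j\<in>UNIV. u (idx j) (x $ j)) * (\<integral>\<^sup>+z. u N z \<partial>lborel) \<partial>lborel)"
  proof (rule nn_integral_cong)
    fix x :: "real ^ 'd"
    have "(\<integral>\<^sup>+t. (\<Prod>i=1..N. u i (crd t x i)) \<partial>lborel) = (\<integral>\<^sup>+t. (\<Prod>j\<in>UNIV. u (idx j) (x $ j)) * u N (- (\<Sum>j\<in>UNIV. x $ j) + 1 * t) \<partial>lborel)"
      unfolding prod_states by (simp add: mult.commute)
    also have "\<dots> = (\<Prod>j\<in>UNIV. u (idx j) (x $ j)) * (\<integral>\<^sup>+t. u N (- (\<Sum>j\<in>UNIV. x $ j) + 1 * t) \<partial>lborel)"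
      by (rule nn_integral_cmult) measurable
    also have "(\<integral>\<^sup>+t. u N (- (\<Sum>j\<in>UNIV. x $ j) + 1 * t) \<partial>lborel) = (\<integral>\<^sup>+z. u N z \<partial>lborel)"
      using nn_integral_real_affine[of "u N" 1 "- (\<Sum>j\<in>UNIV. x $ j)"] by simp
    finally show "(\<integral>\<^sup>+t. (\<Prod>i=1..N. u i (crd t x i)) \<partial>lborel) = (\<Prod>j\<in>UNIV. u (idx j) (x $ j)) * (\<integral>\<^sup>+z. u N z \<partial>lborel)" .
  qed
  also have "\<dots> = (\<integral>\<^sup>+x. (\<Prod>j\<in>UNIV. u (idx j) (x $ j)) \<partial>(lborel :: (real ^ 'd) measure)) * (\<integral>\<^sup>+z. u N z \<partial>lborel)"
    by (rule nn_integral_multc) measurable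
  also have "\<dots> = (\<Prod>i=1..N. \<integral>\<^sup>+z. u i z \<partial>lborel)"
    unfolding prod_states by (subst nn_integral_prod_cart) (auto simp: mult.commute)
  finally show ?thesis .
qed

context jump_density
begin

text \<open>The counterpart on the simplex of the product inserted under the expectation. It
  vanishes off the open simplex, so that \<open>weighted_dens\<close> is continuous everywhere, in
  time as well, without a cut-off.\<close>

definition chi :: "real \<Rightarrow> real ^ 'd \<Rightarrow> real" where "chi t x = (\<Prod>i\<in>I. 1 - exp (- cp t x i))"

definition ex :: "(nat \<Rightarrow> real) \<Rightarrow> real \<Rightarrow> real ^ 'd \<Rightarrow> real" where "ex a t x = exp (- (\<Sum>i\<in>I. a i * cp t x i))"

definition weighted_dens :: "(nat \<Rightarrow> real) \<Rightarrow> nat \<Rightarrow> nat \<Rightarrow> real \<Rightarrow> real ^ 'd \<Rightarrow> real" where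
  "weighted_dens a k l t x = chi t x * ex a t x * raw_dens k l t x"

lemma chi_bounds: "0 \<le> chi t x" "chi t x \<le> 1"
  unfolding chi_def by (auto intro!: prod_nonneg prod_le_1)

lemma chi_out: "x \<notin> osimplex t \<Longrightarrow> chi t x = 0"
proof -
  assume "x \<notin> osimplex t"
  then obtain i where i: "i \<in> I" "\<not> 0 < crd t x i" unfolding osimplex_def by blast
  then have "1 - exp (- cp t x i) = 0" by (simp add: cp_def)
  then show ?thesis unfolding chi_def by (intro prod_zero) (use i in auto)
qed

lemma chi_pos: "x \<in> osimplex t \<Longrightarrow> 0 < chi t x"
  unfolding chi_def by (rule prod_pos) (auto simp: osimplex_def cp_def)

lemma chi_out': "x \<notin> csimplex t \<Longrightarrow> chi t x = 0"
  using chi_out osimplex_subset by blast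

lemma continuous_cp [continuous_intros]:
  "continuous_on S f \<Longrightarrow> continuous_on S g \<Longrightarrow> continuous_on S (\<lambda>s. cp (f s) (g s) i)"
  unfolding cp_def by (intro continuous_intros)

lemma weighted_dens_continuous:
  assumes "k \<in> I" "continuous_on S f" "continuous_on S g"
  shows "continuous_on S (\<lambda>s. weighted_dens a k l (f s) (g s))"
  unfolding weighted_dens_def chi_def ex_def by (intro continuous_intros raw_dens_continuous2 assms)

lemma weighted_dens_meas: "k \<in> I \<Longrightarrow> weighted_dens a k l t \<in> borel_measurable borel"
  using weighted_dens_continuous[of k UNIV "\<lambda>_. t" "\<lambda>x. x" a l] by (intro borel_measurable_continuous_onI) (auto intro: continuous_intros)

lemma weighted_dens_bounds:
  assumes k: "k \<in> I" and a: "\<forall>i\<in>I. 0 \<le> a i"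
  shows "0 \<le> weighted_dens a k l t x" "t \<le> T \<Longrightarrow> \<bar>weighted_dens a k l t x\<bar> \<le> Lam ^ (N - 1) * indicator (csimplex T) x"
proof -
  have ex: "0 \<le> ex a t x" "ex a t x \<le> 1"
    unfolding ex_def using a by (auto intro!: sum_nonneg mult_nonneg_nonneg)
  show 0: "0 \<le> weighted_dens a k l t x" unfolding weighted_dens_def using chi_bounds ex raw_dens_bounds[OF k] by (intro mult_nonneg_nonneg) auto
  have 1: "weighted_dens a k l t x \<le> 1 * 1 * Lam ^ (N - 1)"
    unfolding weighted_dens_def by (intro mult_mono chi_bounds ex raw_dens_bounds[OF k]) (use Lam_pos in auto)
  assume T: "t \<le> T"
  show "\<bar>weighted_dens a k l t x\<bar> \<le> Lam ^ (N - 1) * indicator (csimplex T) x"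
  proof (cases "x \<in> csimplex t")
    case True
    have "crd t x i \<le> crd T x i" for i using T by (simp add: crd_def)
    then have "x \<in> csimplex T" using True unfolding csimplex_def by (blast intro: order_trans)
    then show ?thesis using 0 1 by simp
  next
    case False
    then show ?thesis using Lam_pos by (simp add: weighted_dens_def chi_out')
  qed
qed

lemma simplex_fin: "emeasure lborel (csimplex t) < \<infinity>"
  by (rule emeasure_bounded_finite[OF compact_imp_bounded[OF compact_simplex]])

lemma dom_int: "integrable lborel (\<lambda>x. Lam ^ (N - 1) * indicator (csimplex T) x :: real)"
  using simplex_fin[of T] closed_simplex[of T] by (intro integrable_mult_right integrable_real_indicator) auto

definition weighted_mass :: "(nat \<Rightarrow> real) \<Rightarrow> nat \<Rightarrow> nat \<Rightarrow> real \<Rightarrow> real" where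
  "weighted_mass a k l t = (\<integral>x. weighted_dens a k l t x \<partial>lborel)"

lemma weighted_dens_integrable:
  assumes k: "k \<in> I" and a: "\<forall>i\<in>I. 0 \<le> a i"
  shows "integrable lborel (weighted_dens a k l t)" "ennreal (weighted_mass a k l t) = (\<integral>\<^sup>+x. ennreal (weighted_dens a k l t x) \<partial>lborel)"
proof -
  show i: "integrable lborel (weighted_dens a k l t)"
    by (rule Bochner_Integration.integrable_bound[OF dom_int[of t]])
       (use weighted_dens_meas[OF k] weighted_dens_bounds(2)[OF k a order_refl] Lam_pos in \<open>auto intro!: AE_I2\<close>)
  show "ennreal (weighted_mass a k l t) = (\<integral>\<^sup>+x. ennreal (weighted_dens a k l t x) \<partial>lborel)"
    unfolding weighted_mass_def by (rule nn_integral_eq_integral[symmetric, OF i]) (simp add: weighted_dens_bounds(1)[OF k a])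
qed

lemma weighted_mass_nonneg: "k \<in> I \<Longrightarrow> \<forall>i\<in>I. 0 \<le> a i \<Longrightarrow> 0 \<le> weighted_mass a k l t"
  unfolding weighted_mass_def by (rule Bochner_Integration.integral_nonneg) (rule weighted_dens_bounds(1))

lemma weighted_mass_continuous:
  assumes k: "k \<in> I" and a: "\<forall>i\<in>I. 0 \<le> a i"
  shows "continuous_on UNIV (weighted_mass a k l)"
  unfolding continuous_on_sequentially
proof (intro ballI allI impI)
  fix t :: real and u :: "nat \<Rightarrow> real" assume u: "(\<forall>n. u n \<in> UNIV) \<and> u \<longlonglongrightarrow> t"
  \<comment> \<open>The times of the sequence are bounded by some T, so all integrands live on one
    compact simplex, which supplies the dominating function.\<close>
  then have "Bseq u" using convergentI convergent_imp_Bseq by blast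
  then obtain T where T: "\<And>n. \<bar>u n\<bar> \<le> T" unfolding Bseq_def by (auto simp: real_norm_def)
  show "(weighted_mass a k l \<circ> u) \<longlonglongrightarrow> weighted_mass a k l t"
    unfolding weighted_mass_def o_def
  proof (rule integral_dominated_convergence[OF _ _ dom_int[of T]])
    show "AE x in lborel. (\<lambda>n. weighted_dens a k l (u n) x) \<longlonglongrightarrow> weighted_dens a k l t x"
    proof (rule AE_I2)
      fix x
      have "continuous_on UNIV (\<lambda>s. weighted_dens a k l s x)" by (rule weighted_dens_continuous[OF k]) (auto intro: continuous_intros)
      then show "(\<lambda>n. weighted_dens a k l (u n) x) \<longlonglongrightarrow> weighted_dens a k l t x"
        using u unfolding continuous_on_sequentially o_def by blast
    qed
    show "AE x in lborel. norm (weighted_dens a k l (u n) x) \<le> Lam ^ (N - 1) * indicator (csimplex T) x" for n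
      by (rule AE_I2) (use weighted_dens_bounds(2)[OF k a, of "u n" T l] T[of n] in auto)
  qed (use weighted_dens_meas[OF k] in auto)
qed

text \<open>The share of the coordinate i with count n in the weighted density. The cut at 0 makes
  the product over i vanish outside the closed simplex.\<close>

definition U :: "(nat \<Rightarrow> real) \<Rightarrow> nat \<Rightarrow> nat \<Rightarrow> real \<Rightarrow> ennreal" where
  "U a i n z = ennreal ((1 - exp (- z)) * exp (- (a i * z)) * poisw (Lam * z) n) * indicator {0..} z"

lemma U_meas [measurable]: "U a i n \<in> borel_measurable borel"
  unfolding U_def poisw_def by measurable

text \<open>Expanding 1 - exp (- z) leaves two Gamma integrals, with parameters \<open>a i\<close>
  and \<open>a i + 1\<close>. Each is a power of a geometric ratio divided by Lam, and their
  difference is the weight found on the path side.\<close>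

lemma U_integral:
  assumes a: "0 < a i"
  shows "(\<integral>\<^sup>+z. U a i n z \<partial>lborel) = ennreal (ie_weight_suc a i n / Lam)"
proof -
  let ?f = "\<lambda>c z. ennreal (Lam ^ n / fact n) * (ennreal (z ^ n * exp (- ((Lam + c) * z))) * indicator {0..} z)"
  have If: "(\<integral>\<^sup>+z. ?f c z \<partial>lborel) = ennreal (geo_ratio c ^ Suc n / Lam)" if c: "0 < c" for c
  proof -
    have "(\<integral>\<^sup>+z. ?f c z \<partial>lborel) = ennreal (Lam ^ n / fact n) * ennreal (fact n / (Lam + c) ^ Suc n)"
      using nn_integral_power_exp_scaled[of "Lam + c" n] c Lam_pos by (subst nn_integral_cmult) auto
    also have "\<dots> = ennreal (Lam ^ n / (Lam + c) ^ Suc n)"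
      using c Lam_pos by (subst ennreal_mult'[symmetric]) auto
    also have "Lam ^ n / (Lam + c) ^ Suc n = geo_ratio c ^ Suc n / Lam"
      using Lam_pos by (simp add: geo_ratio_def power_divide)
    finally show ?thesis .
  qed
  have "U a i n z = ?f (a i) z - ?f (a i + 1) z" for z
  proof (cases "0 \<le> z")
    case True
    have e1: "exp (- ((Lam + a i) * z)) = exp (- (a i * z)) * exp (- (Lam * z))"
      "exp (- ((Lam + (a i + 1)) * z)) = exp (- (a i * z)) * exp (- (Lam * z)) * exp (- z)"
      by (simp_all add: exp_add[symmetric] algebra_simps)
    have "U a i n z = ennreal (Lam ^ n / fact n * (z ^ n * exp (- ((Lam + a i) * z))) - Lam ^ n / fact n * (z ^ n * exp (- ((Lam + (a i + 1)) * z))))"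
      unfolding U_def poisw_def e1 using True by (simp add: power_mult_distrib algebra_simps diff_divide_distrib)
    also have "\<dots> = ?f (a i) z - ?f (a i + 1) z"
      using True Lam_pos by (simp add: ennreal_minus[symmetric] ennreal_mult'[symmetric])
    finally show ?thesis .
  qed (simp add: U_def)
  then have "(\<integral>\<^sup>+z. U a i n z \<partial>lborel) = (\<integral>\<^sup>+z. ?f (a i) z - ?f (a i + 1) z \<partial>lborel)" by simp
  also have "\<dots> = (\<integral>\<^sup>+z. ?f (a i) z \<partial>lborel) - (\<integral>\<^sup>+z. ?f (a i + 1) z \<partial>lborel)"
  proof (rule nn_integral_diff)
    show "(\<integral>\<^sup>+z. ?f (a i + 1) z \<partial>lborel) \<noteq> \<infinity>" using If[of "a i + 1"] a by simp
    show "AE z in lborel. ?f (a i + 1) z \<le> ?f (a i) z"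
    proof (rule AE_I2)
      fix z :: real
      show "?f (a i + 1) z \<le> ?f (a i) z"
      proof (cases "0 \<le> z")
        case True
        then have "(Lam + a i) * z \<le> (Lam + (a i + 1)) * z" by (intro mult_right_mono) auto
        then show ?thesis using True by (intro mult_left_mono mult_right_mono ennreal_leI) auto
      qed simp
    qed
  qed auto
  also have "\<dots> = ennreal (ie_weight_suc a i n / Lam)"
    using If[OF a] If[of "a i + 1"] a geo_ratio_bounds(1)[of "a i + 1"] Lam_pos
    by (simp add: ennreal_minus ie_weight_suc_def diff_divide_distrib del: power_Suc)
  finally show ?thesis .
qed

lemma weighted_dens_series:
  assumes k: "k \<in> I" and a: "\<forall>i\<in>I. 0 \<le> a i"
  shows "ennreal (weighted_dens a k l t x) = (\<integral>\<^sup>+m. ennreal (Lam ^ (N - 1) * dens_coeff k l m) * (\<Prod>i\<in>I. U a i (m i) (crd t x i))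
    \<partial>count_space (PiE I (\<lambda>_. UNIV)))"
proof (cases "x \<in> csimplex t")
  case True
  have c0: "0 \<le> crd t x i" if "i \<in> I" for i by (rule csimplexD[OF True that])
  have cc: "cp t x i = crd t x i" if "i \<in> I" for i by (rule cp_simplex[OF True that])
  interpret W: weights I "\<lambda>i. poisw (Lam * cp t x i)" by (rule weights_poisw) (use Lam_pos in auto)
  let ?F = "\<lambda>m. (\<Prod>i\<in>I. poisw (Lam * cp t x i) (m i)) * dens_coeff k l m"
  let ?c = "chi t x * ex a t x * Lam ^ (N - 1)"
  have c: "0 \<le> ?c" using chi_bounds[of t x] Lam_pos by (simp add: ex_def)
  have F0: "0 \<le> ?F m" for m using dens_coeff_bounds[OF k] Lam_pos by (auto intro!: mult_nonneg_nonneg prod_nonneg poisw_nonneg)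
  have "ennreal (weighted_dens a k l t x) = ennreal ?c * ennreal (infsum ?F (PiE I (\<lambda>_. UNIV)))"
    unfolding weighted_dens_def raw_dens_def pois_exp_def psum_def using c by (simp add: ennreal_mult'[symmetric] mult_ac)
  also have "\<dots> = ennreal ?c * (\<integral>\<^sup>+m. ennreal (?F m) \<partial>count_space (PiE I (\<lambda>_. UNIV)))"
    by (subst ennreal_infsum[OF W.summable_psum[OF dens_coeff_bounds(3)[OF k]] F0]) simp
  also have "\<dots> = (\<integral>\<^sup>+m. ennreal ?c * ennreal (?F m) \<partial>count_space (PiE I (\<lambda>_. UNIV)))"
    by (rule nn_integral_cmult[symmetric]) simp
  also have "\<dots> = (\<integral>\<^sup>+m. ennreal (Lam ^ (N - 1) * dens_coeff k l m) * (\<Prod>i\<in>I. U a i (m i) (crd t x i)) \<partial>count_space (PiE I (\<lambda>_. UNIV)))"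
  proof (rule nn_integral_cong)
    fix m :: "nat \<Rightarrow> nat"
    have u0: "0 \<le> (1 - exp (- crd t x i)) * exp (- (a i * crd t x i)) * poisw (Lam * crd t x i) (m i)" if "i \<in> I" for i
      using c0[OF that] Lam_pos by (intro mult_nonneg_nonneg poisw_nonneg) auto
    have "(\<Prod>i\<in>I. U a i (m i) (crd t x i)) = (\<Prod>i\<in>I. ennreal ((1 - exp (- crd t x i)) * exp (- (a i * crd t x i)) * poisw (Lam * crd t x i) (m i)))"
      by (rule prod.cong) (use c0 in \<open>auto simp: U_def\<close>)
    also have "\<dots> = ennreal (\<Prod>i\<in>I. (1 - exp (- crd t x i)) * exp (- (a i * crd t x i)) * poisw (Lam * crd t x i) (m i))"
      by (rule prod_ennreal) (rule u0)
    also have "(\<Prod>i\<in>I. (1 - exp (- crd t x i)) * exp (- (a i * crd t x i)) * poisw (Lam * crd t x i) (m i))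
        = chi t x * ex a t x * (\<Prod>i\<in>I. poisw (Lam * cp t x i) (m i))"
    proof -
      have "ex a t x = (\<Prod>i\<in>I. exp (- (a i * cp t x i)))" unfolding ex_def by (simp add: exp_sum sum_negf[symmetric])
      then show ?thesis unfolding chi_def by (simp only: prod.distrib[symmetric]) (rule prod.cong, auto simp: cc)
    qed
    finally have p: "(\<Prod>i\<in>I. U a i (m i) (crd t x i)) = ennreal (chi t x * ex a t x * (\<Prod>i\<in>I. poisw (Lam * cp t x i) (m i)))" .
    have "0 \<le> Lam ^ (N - 1) * dens_coeff k l m" using dens_coeff_bounds[OF k] Lam_pos by simp
    then show "ennreal ?c * ennreal (?F m) = ennreal (Lam ^ (N - 1) * dens_coeff k l m) * (\<Prod>i\<in>I. U a i (m i) (crd t x i))"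
      unfolding p using c by (simp add: ennreal_mult'[symmetric] mult_ac)
  qed
  finally show ?thesis .
next
  case False
  then obtain i where i: "i \<in> I" "\<not> 0 \<le> crd t x i" unfolding csimplex_def by blast
  have "(\<Prod>i\<in>I. U a i (m i) (crd t x i)) = 0" for m
    by (rule prod_zero, simp, rule bexI[of _ i]) (use i in \<open>auto simp: U_def\<close>)
  then have z: "(\<integral>\<^sup>+m. ennreal (Lam ^ (N - 1) * dens_coeff k l m) * (\<Prod>i\<in>I. U a i (m i) (crd t x i)) \<partial>count_space (PiE I (\<lambda>_. UNIV)))
      = (\<integral>\<^sup>+m. 0 \<partial>count_space (PiE I (\<lambda>_. UNIV :: nat set)))"
    by (intro nn_integral_cong) (simp only: mult_zero_right)
  have "weighted_dens a k l t x = 0" using chi_out'[OF False] by (simp add: weighted_dens_def)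
  then show ?thesis unfolding z by simp
qed

text \<open>All terms are nonnegative, so the sum over counts can be taken outside the integrals
  over time and space; each term is then a product over the states by
  \<open>nn_integral_crd\<close>.\<close>

lemma weighted_mass_laplace:
  assumes k: "k \<in> I" and a: "\<forall>i\<in>I. 1 \<le> a i"
  shows "(\<integral>\<^sup>+t\<in>{0<..}. ennreal (weighted_mass a k l t) \<partial>lborel) = ennreal (psum I (ie_weight_suc a) (dens_coeff k l) / Lam)"
proof -
  have a0: "\<forall>i\<in>I. 0 \<le> a i" using a by (meson order_trans zero_le_one)
  let ?E = "PiE I (\<lambda>_. UNIV :: nat set)"
  have cE: "countable ?E" by (rule countable_PiE) auto
  let ?c = "\<lambda>m. ennreal (Lam ^ (N - 1) * dens_coeff k l m)"
  let ?U = "\<lambda>m t x. \<Prod>i\<in>I. U a i (m i) (crd t x i)"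
  have Um: "(\<lambda>(t, x). ?U m t x) \<in> borel_measurable ((lborel :: real measure) \<Otimes>\<^sub>M (lborel :: (real ^ 'd) measure))" for m
    by measurable
  have Um2: "?U m t \<in> borel_measurable lborel" for m t by measurable
  have "(\<integral>\<^sup>+t\<in>{0<..}. ennreal (weighted_mass a k l t) \<partial>lborel) = (\<integral>\<^sup>+t. (\<integral>\<^sup>+x. ennreal (weighted_dens a k l t x) \<partial>lborel) \<partial>lborel)"
  proof (rule nn_integral_cong_AE)
    have "AE t in lborel. t \<noteq> (0::real)" by (rule AE_lborel_singleton)
    then show "AE t in lborel. ennreal (weighted_mass a k l t) * indicator {0<..} t = (\<integral>\<^sup>+x. ennreal (weighted_dens a k l t x) \<partial>lborel)"
    proof (rule AE_mp, intro AE_I2 impI)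
      fix t :: real assume "t \<noteq> 0"
      show "ennreal (weighted_mass a k l t) * indicator {0<..} t = (\<integral>\<^sup>+x. ennreal (weighted_dens a k l t x) \<partial>lborel)"
      proof (cases "0 < t")
        case True
        then show ?thesis by (simp add: weighted_dens_integrable(2)[OF k a0])
      next
        case False
        then have "t < 0" using \<open>t \<noteq> 0\<close> by simp
        then have "weighted_dens a k l t x = 0" for x using chi_out'[of x t] simplex_empty by (simp add: weighted_dens_def)
        then show ?thesis using False by simp
      qed
    qed
  qed
  also have "\<dots> = (\<integral>\<^sup>+t. (\<integral>\<^sup>+m. ?c m * (\<integral>\<^sup>+x. ?U m t x \<partial>lborel) \<partial>count_space ?E) \<partial>lborel)"
  proof (rule nn_integral_cong)
    fix t :: real
    have "(\<integral>\<^sup>+x. ennreal (weighted_dens a k l t x) \<partial>lborel) = (\<integral>\<^sup>+x. \<integral>\<^sup>+m. ?c m * ?U m t x \<partial>count_space ?E \<partial>lborel)"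
      by (simp only: weighted_dens_series[OF k a0])
    also have "\<dots> = (\<integral>\<^sup>+m. \<integral>\<^sup>+x. ?c m * ?U m t x \<partial>lborel \<partial>count_space ?E)"
      by (rule nn_integral_count_space_nn_integral[OF cE]) (use Um2 in auto)
    also have "\<dots> = (\<integral>\<^sup>+m. ?c m * (\<integral>\<^sup>+x. ?U m t x \<partial>lborel) \<partial>count_space ?E)"
      by (intro nn_integral_cong nn_integral_cmult Um2)
    finally show "(\<integral>\<^sup>+x. ennreal (weighted_dens a k l t x) \<partial>lborel) = (\<integral>\<^sup>+m. ?c m * (\<integral>\<^sup>+x. ?U m t x \<partial>lborel) \<partial>count_space ?E)" .
  qed
  also have "\<dots> = (\<integral>\<^sup>+m. \<integral>\<^sup>+t. ?c m * (\<integral>\<^sup>+x. ?U m t x \<partial>lborel) \<partial>lborel \<partial>count_space ?E)"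
    by (rule nn_integral_count_space_nn_integral[OF cE])
       (use lborel.borel_measurable_nn_integral[OF Um] in auto)
  also have "\<dots> = (\<integral>\<^sup>+m. ?c m * (\<integral>\<^sup>+t. \<integral>\<^sup>+x. ?U m t x \<partial>lborel \<partial>lborel) \<partial>count_space ?E)"
    by (intro nn_integral_cong nn_integral_cmult lborel.borel_measurable_nn_integral[OF Um])
  also have "\<dots> = (\<integral>\<^sup>+m. ennreal (((\<Prod>i\<in>I. ie_weight_suc a i (m i)) * dens_coeff k l m) / Lam) \<partial>count_space ?E)"
  proof (rule nn_integral_cong)
    fix m :: "nat \<Rightarrow> nat"
    interpret W: weights I "ie_weight_suc a" by (rule weights_ie_weight_suc[OF a])
    have "(\<integral>\<^sup>+t. \<integral>\<^sup>+x. ?U m t x \<partial>lborel \<partial>lborel) = (\<Prod>i\<in>I. \<integral>\<^sup>+z. U a i (m i) z \<partial>lborel)"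
      by (rule nn_integral_crd) measurable
    also have "\<dots> = (\<Prod>i\<in>I. ennreal (ie_weight_suc a i (m i) / Lam))"
    proof (rule prod.cong[OF refl])
      fix i assume "i \<in> I"
      then have "1 \<le> a i" using a by blast
      then show "(\<integral>\<^sup>+z. U a i (m i) z \<partial>lborel) = ennreal (ie_weight_suc a i (m i) / Lam)" by (intro U_integral) simp
    qed
    also have "\<dots> = ennreal (\<Prod>i\<in>I. ie_weight_suc a i (m i) / Lam)"
      by (rule prod_ennreal) (use W.wpos Lam_pos in auto)
    also have "(\<Prod>i\<in>I. ie_weight_suc a i (m i) / Lam) = (\<Prod>i\<in>I. ie_weight_suc a i (m i)) / Lam ^ N"
      by (simp add: prod_dividef)
    finally have e: "(\<integral>\<^sup>+t. \<integral>\<^sup>+x. ?U m t x \<partial>lborel \<partial>lborel) = ennreal ((\<Prod>i\<in>I. ie_weight_suc a i (m i)) / Lam ^ N)" .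
    have "Lam ^ (N - 1) * dens_coeff k l m * ((\<Prod>i\<in>I. ie_weight_suc a i (m i)) / Lam ^ N) = ((\<Prod>i\<in>I. ie_weight_suc a i (m i)) * dens_coeff k l m) / Lam"
      using N1 Lam_pos by (simp add: power_eq_if[of Lam N])
    moreover have "0 \<le> Lam ^ (N - 1) * dens_coeff k l m" using dens_coeff_bounds[OF k] Lam_pos by simp
    ultimately show "?c m * (\<integral>\<^sup>+t. \<integral>\<^sup>+x. ?U m t x \<partial>lborel \<partial>lborel) = ennreal (((\<Prod>i\<in>I. ie_weight_suc a i (m i)) * dens_coeff k l m) / Lam)"
      unfolding e by (simp add: ennreal_mult'[symmetric])
  qed
  also have "\<dots> = ennreal (infsum (\<lambda>m. ((\<Prod>i\<in>I. ie_weight_suc a i (m i)) * dens_coeff k l m) / Lam) ?E)"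
  proof (rule ennreal_infsum[symmetric])
    interpret W: weights I "ie_weight_suc a" by (rule weights_ie_weight_suc[OF a])
    have "(\<lambda>m. ((\<Prod>i\<in>I. ie_weight_suc a i (m i)) * dens_coeff k l m) * (1 / Lam)) summable_on ?E"
      by (rule summable_on_cmult_left[OF W.summable_psum[OF dens_coeff_bounds(3)[OF k]]])
    then show "(\<lambda>m. ((\<Prod>i\<in>I. ie_weight_suc a i (m i)) * dens_coeff k l m) / Lam) summable_on ?E" by simp
    show "0 \<le> ((\<Prod>i\<in>I. ie_weight_suc a i (m i)) * dens_coeff k l m) / Lam" for m
      using dens_coeff_bounds[OF k] Lam_pos W.wpos by (auto intro!: divide_nonneg_nonneg mult_nonneg_nonneg prod_nonneg)
  qed
  also have "infsum (\<lambda>m. ((\<Prod>i\<in>I. ie_weight_suc a i (m i)) * dens_coeff k l m) / Lam) ?E = psum I (ie_weight_suc a) (dens_coeff k l) / Lam"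
    unfolding psum_def divide_inverse by (rule infsum_cmult_left')
  finally show ?thesis .
qed

text \<open>Uniqueness of Laplace transforms in time. On both sides the factor exp (- n t) is the
  same as adding n to every \<open>a i\<close>, because occupation times and coordinates of the
  simplex both sum to t; for n \<ge> 1 the shifted parameters are at least 1, where the transforms
  have been computed.\<close>

lemma incl_excl_eq_weighted_mass:
  assumes k: "k \<in> I" and l: "l \<in> I" and a: "\<forall>i\<in>I. 0 \<le> a i" and t: "0 < t"
  shows "incl_excl I a t k l = weighted_mass a k l t"
proof (rule laplace_unique[OF _ _ _ _ _ t])
  show "continuous_on {0<..} (\<lambda>t. incl_excl I a t k l)"
    by (rule continuous_on_subset[OF incl_excl_continuous[OF _ order_refl a k l]]) auto
  show "continuous_on {0<..} (weighted_mass a k l)" by (rule continuous_on_subset[OF weighted_mass_continuous[OF k a]]) simp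
  show "0 \<le> incl_excl I a t k l \<and> incl_excl I a t k l \<le> 1" if "0 < t" for t
    using incl_excl_bounds[OF a k l, of t I] that by simp
  show "0 \<le> weighted_mass a k l t" for t by (rule weighted_mass_nonneg[OF k a])
  fix n :: nat assume n: "1 \<le> n"
  let ?a = "\<lambda>i. a i + real n"
  have a': "\<forall>i\<in>I. 1 \<le> ?a i"
  proof
    fix i assume "i \<in> I" then have "0 \<le> a i" using a by blast
    moreover have "1 \<le> real n" using n by simp
    ultimately show "1 \<le> ?a i" by linarith
  qed
  have a'0: "\<forall>i\<in>I. 0 \<le> ?a i" using a' by (meson order_trans zero_le_one)
  have g: "exp (- (real n * t)) * incl_excl I a t k l = incl_excl I ?a t k l" if t: "0 < t" for t
  proof -
    have "incl_excl I ?a t k l = (\<integral>\<omega>. exp (- (real n * t)) * ((\<Prod>i\<in>I. 1 - exp (- L t i \<omega>)) * (exp (- wL a t \<omega>) * indicator {l} (X t \<omega>))) \<partial>M k)"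
      unfolding incl_excl_def
    proof (rule Bochner_Integration.integral_cong[OF refl])
      fix \<omega> assume "\<omega> \<in> space (M k)"
      then have w: "\<omega> \<in> \<Omega>" by (simp add: space_M[OF k])
      have "(\<Sum>i\<in>I. real n * L t i \<omega>) = real n * t" using L_sum[OF w, of t] t by (simp add: sum_distrib_left[symmetric])
      then have "wL ?a t \<omega> = wL a t \<omega> + real n * t" unfolding wL_def by (simp add: distrib_right sum.distrib)
      then have "exp (- wL ?a t \<omega>) = exp (- (real n * t)) * exp (- wL a t \<omega>)" by (simp add: exp_add[symmetric])
      then show "(\<Prod>i\<in>I. 1 - exp (- L t i \<omega>)) * (exp (- wL ?a t \<omega>) * indicator {l} (X t \<omega>))
        = exp (- (real n * t)) * ((\<Prod>i\<in>I. 1 - exp (- L t i \<omega>)) * (exp (- wL a t \<omega>) * indicator {l} (X t \<omega>)))" by simp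
    qed
    then show ?thesis unfolding incl_excl_def by simp
  qed
  have h: "exp (- (real n * t)) * weighted_mass a k l t = weighted_mass ?a k l t" for t
  proof -
    have "weighted_dens ?a k l t x = exp (- (real n * t)) * weighted_dens a k l t x" for x
    proof (cases "x \<in> csimplex t")
      case True
      have "(\<Sum>i\<in>I. real n * cp t x i) = real n * (\<Sum>i\<in>I. crd t x i)"
        unfolding sum_distrib_left by (rule sum.cong) (auto simp: cp_simplex[OF True])
      then have "(\<Sum>i\<in>I. ?a i * cp t x i) = (\<Sum>i\<in>I. a i * cp t x i) + real n * t"
        by (simp add: distrib_right sum.distrib sum_crd)
      then have "ex ?a t x = exp (- (real n * t)) * ex a t x" unfolding ex_def by (simp add: exp_add[symmetric])
      then show ?thesis by (simp add: weighted_dens_def)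
    qed (simp add: weighted_dens_def chi_out')
    then show ?thesis by (simp add: weighted_mass_def)
  qed
  have "(\<integral>\<^sup>+t\<in>{0<..}. ennreal (exp (- (real n * t)) * incl_excl I a t k l) \<partial>lborel)
      = (\<integral>\<^sup>+t. ennreal (indicator {0<..} t * incl_excl I ?a t k l) \<partial>lborel)"
    by (rule nn_integral_cong) (use g in \<open>auto simp: indicator_def\<close>)
  also have "\<dots> = ennreal (\<integral>t. indicator {0<..} t * incl_excl I ?a t k l \<partial>lborel)"
  proof (rule nn_integral_eq_integral)
    show "integrable lborel (\<lambda>t. indicator {0<..} t * incl_excl I ?a t k l)"
      using incl_excl_laplace[OF _ order_refl a' k l] by auto
    show "AE t in lborel. 0 \<le> indicator {0<..} t * incl_excl I ?a t k l"
      by (rule AE_I2) (use incl_excl_bounds(1)[OF a'0 k l] in \<open>auto simp: indicator_def\<close>)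
  qed
  also have "(\<integral>t. indicator {0<..} t * incl_excl I ?a t k l \<partial>lborel) = psum I (ie_weight_suc ?a) (dens_coeff k l) / Lam"
    using incl_excl_laplace[OF _ order_refl a' k l] psum_shift[OF k, of ?a l] Lam_pos by (simp add: field_simps)
  also have "ennreal (psum I (ie_weight_suc ?a) (dens_coeff k l) / Lam) = (\<integral>\<^sup>+t\<in>{0<..}. ennreal (weighted_mass ?a k l t) \<partial>lborel)"
    by (rule weighted_mass_laplace[OF k a', symmetric])
  finally show "(\<integral>\<^sup>+t\<in>{0<..}. ennreal (exp (- (real n * t)) * incl_excl I a t k l) \<partial>lborel)
      = (\<integral>\<^sup>+t\<in>{0<..}. ennreal (exp (- (real n * t)) * weighted_mass a k l t) \<partial>lborel)"
    unfolding h .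
qed

text \<open>After weighting by \<open>chi\<close>, the law and the density have equal integrals
  against exponentials with integer exponents, which identifies the two weighted measures on the
  compact simplex. Dividing by \<open>chi\<close> on the open simplex recovers the law there; its
  mass on the boundary is invisible to this argument.\<close>

lemma interior_density:
  assumes k: "k \<in> I" and l: "l \<in> I" and t: "0 < t" and B: "B \<in> sets borel"
  shows "emeasure (M k) {\<omega> \<in> space (M k). X t \<omega> = l \<and> Lv t \<omega> \<in> B \<inter> osimplex t} = (\<integral>\<^sup>+x\<in>B. ennreal (dens0 t x k l) \<partial>lborel)"
proof -
  interpret prob_space "M k" by (rule prob_M[OF k])
  have t0: "0 \<le> t" using t by simp
  have LM: "Lv t \<in> borel_measurable (M k)" by (rule Lv_meas[OF k t0])
  have chim: "chi t \<in> borel_measurable borel"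
    unfolding chi_def by (intro borel_measurable_continuous_onI continuous_intros)
  have Dm: "raw_dens k l t \<in> borel_measurable borel"
    by (intro borel_measurable_continuous_onI raw_dens_continuous2[OF k] continuous_intros)
  have Xm: "(\<lambda>\<omega>. indicat_real {l} (X t \<omega>)) \<in> borel_measurable (M k)"
    by (rule measurable_compose[OF meas_X'[OF k t0]]) simp
  note [measurable] = LM chim Dm Xm
  let ?d1 = "\<lambda>\<omega>. chi t (Lv t \<omega>) * indicat_real {l} (X t \<omega>)"
  let ?d2 = "\<lambda>x. chi t x * raw_dens k l t x"
  define \<nu>1 where "\<nu>1 = distr (density (M k) (\<lambda>\<omega>. ennreal (?d1 \<omega>))) borel (Lv t)"
  define \<nu>2 where "\<nu>2 = density lborel (\<lambda>x. ennreal (?d2 x))"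
  have d1: "0 \<le> ?d1 \<omega>" "?d1 \<omega> \<le> 1" for \<omega> using chi_bounds[of t "Lv t \<omega>"] by (auto simp: indicator_def)
  have d2: "0 \<le> ?d2 x" for x using chi_bounds raw_dens_bounds[OF k] by (intro mult_nonneg_nonneg) auto
  have d2h: "?d2 x = weighted_dens (\<lambda>_. 0) k l t x" for x by (simp add: weighted_dens_def ex_def)
  have "\<nu>1 = \<nu>2"
  proof (rule measure_eq_if_monomials_eq[where K = "csimplex t" and B = "range (\<lambda>(b::'d \<Rightarrow> nat) x. exp (- (\<Sum>j\<in>UNIV. real (b j) * x $ j)))"])
    show "sets \<nu>1 = sets borel" "sets \<nu>2 = sets borel" by (simp_all add: \<nu>1_def \<nu>2_def)
    have fd: "finite_measure (density (M k) (\<lambda>\<omega>. ennreal (?d1 \<omega>)))"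
    proof (rule finite_measureI)
      have "emeasure (density (M k) (\<lambda>\<omega>. ennreal (?d1 \<omega>))) (space (M k)) = (\<integral>\<^sup>+\<omega>. ennreal (?d1 \<omega>) \<partial>M k)"
        by (subst emeasure_density) (auto intro!: nn_integral_cong)
      also have "\<dots> \<le> (\<integral>\<^sup>+\<omega>. 1 \<partial>M k)" by (rule nn_integral_mono) (use d1 in \<open>simp add: ennreal_le_1\<close>)
      also have "\<dots> < \<infinity>" by (simp add: emeasure_space_1)
      finally show "emeasure (density (M k) (\<lambda>\<omega>. ennreal (?d1 \<omega>))) (space (density (M k) (\<lambda>\<omega>. ennreal (?d1 \<omega>)))) \<noteq> \<infinity>" by simp
    qed
    show "finite_measure \<nu>1" unfolding \<nu>1_def by (rule finite_measure.finite_measure_distr[OF fd]) simp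
    show "finite_measure \<nu>2"
    proof (rule finite_measureI)
      have "emeasure \<nu>2 (space \<nu>2) = (\<integral>\<^sup>+x. ennreal (weighted_dens (\<lambda>_. 0) k l t x) \<partial>lborel)"
        unfolding \<nu>2_def by (subst emeasure_density) (auto simp: d2h[symmetric])
      also have "\<dots> = ennreal (weighted_mass (\<lambda>_. 0) k l t)" by (rule weighted_dens_integrable(2)[symmetric, OF k]) simp
      finally show "emeasure \<nu>2 (space \<nu>2) \<noteq> \<infinity>" by simp
    qed
    show "compact (csimplex t)" by (rule compact_simplex)
    have cm: "csimplex t \<in> sets borel" by (rule borel_closed[OF closed_simplex])
    show "AE x in \<nu>1. x \<in> csimplex t"
      unfolding \<nu>1_def
      by (subst AE_distr_iff, simp, use cm in simp, subst AE_density, simp, rule AE_I2)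
         (use Lv_simplex[OF _ t0] space_M[OF k] in simp)
    show "AE x in \<nu>2. x \<in> csimplex t"
      unfolding \<nu>2_def by (subst AE_density, simp, rule AE_I2) (use chi_out' in force)
  next
    fix f assume "f \<in> range (\<lambda>(b::'d \<Rightarrow> nat) x. exp (- (\<Sum>j\<in>UNIV. real (b j) * x $ j)))"
    then obtain b :: "'d \<Rightarrow> nat" where f: "f = (\<lambda>x. exp (- (\<Sum>j\<in>UNIV. real (b j) * x $ j)))" by auto
    show fc: "continuous_on UNIV f" unfolding f by (intro continuous_intros)
    have fm[measurable]: "f \<in> borel_measurable borel" by (rule borel_measurable_continuous_onI[OF fc])
    \<comment> \<open>A test function on the simplex depends only on the coordinates other than that
      of N, so the state N gets exponent 0.\<close>
    define a where "a i = (if i = N then 0 else real (b (inv idx i)))" for i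
    have aN: "a N = 0" and aj: "a (idx j) = real (b j)" for j
      using N_notin inj_idx by (auto simp: a_def)
    have a0: "\<forall>i\<in>I. 0 \<le> a i" by (simp add: a_def)
    have suma: "(\<Sum>i\<in>I. a i * c i) = (\<Sum>j\<in>UNIV. real (b j) * c (idx j))" for c :: "nat \<Rightarrow> real"
      unfolding sum_states by (simp add: aN aj)
    have "(\<integral>x. f x \<partial>\<nu>1) = (\<integral>\<omega>. ?d1 \<omega> * f (Lv t \<omega>) \<partial>M k)"
      unfolding \<nu>1_def by (subst integral_distr, simp, simp, subst integral_density) (use d1 in auto)
    also have "\<dots> = incl_excl I a t k l"
      unfolding incl_excl_def
    proof (rule Bochner_Integration.integral_cong[OF refl])
      fix \<omega> assume "\<omega> \<in> space (M k)"
      then have w: "\<omega> \<in> \<Omega>" by (simp add: space_M[OF k])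
      have "chi t (Lv t \<omega>) = (\<Prod>i\<in>I. 1 - exp (- L t i \<omega>))"
        unfolding chi_def by (rule prod.cong) (auto simp: cp_simplex[OF Lv_simplex[OF w t0]] crd_Lv[OF w t0])
      moreover have "f (Lv t \<omega>) = exp (- wL a t \<omega>)" unfolding f wL_def suma by (simp add: Lv_def)
      ultimately show "?d1 \<omega> * f (Lv t \<omega>) = (\<Prod>i\<in>I. 1 - exp (- L t i \<omega>)) * (exp (- wL a t \<omega>) * indicator {l} (X t \<omega>))" by simp
    qed
    also have "\<dots> = weighted_mass a k l t" by (rule incl_excl_eq_weighted_mass[OF k l a0 t])
    also have "\<dots> = (\<integral>x. ?d2 x * f x \<partial>lborel)"
      unfolding weighted_mass_def
    proof (rule Bochner_Integration.integral_cong[OF refl])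
      fix x :: "real ^ 'd"
      show "weighted_dens a k l t x = ?d2 x * f x"
      proof (cases "x \<in> csimplex t")
        case True
        have "ex a t x = f x"
          unfolding ex_def suma f using cp_simplex[OF True idx_in] by simp
        then show ?thesis by (simp add: weighted_dens_def)
      qed (simp add: weighted_dens_def chi_out')
    qed
    also have "\<dots> = (\<integral>x. f x \<partial>\<nu>2)"
      unfolding \<nu>2_def by (subst integral_density) (use d2 in auto)
    finally show "(\<integral>x. f x \<partial>\<nu>1) = (\<integral>x. f x \<partial>\<nu>2)" .
  next
    fix f g assume "f \<in> range (\<lambda>(b::'d \<Rightarrow> nat) x. exp (- (\<Sum>j\<in>UNIV. real (b j) * x $ j)))"
      "g \<in> range (\<lambda>(b::'d \<Rightarrow> nat) x. exp (- (\<Sum>j\<in>UNIV. real (b j) * x $ j)))"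
    then obtain b b' :: "'d \<Rightarrow> nat" where f: "f = (\<lambda>x. exp (- (\<Sum>j\<in>UNIV. real (b j) * x $ j)))"
      and g: "g = (\<lambda>x. exp (- (\<Sum>j\<in>UNIV. real (b' j) * x $ j)))" by auto
    have "(\<lambda>x. f x * g x) = (\<lambda>x. exp (- (\<Sum>j\<in>UNIV. real (b j + b' j) * x $ j)))"
      unfolding f g by (simp add: exp_add[symmetric] sum.distrib distrib_right)
    then show "(\<lambda>x. f x * g x) \<in> range (\<lambda>(b::'d \<Rightarrow> nat) x. exp (- (\<Sum>j\<in>UNIV. real (b j) * x $ j)))"
      by (intro range_eqI[of _ _ "\<lambda>j. b j + b' j"])
  next
    show "(\<lambda>_. 1) \<in> range (\<lambda>(b::'d \<Rightarrow> nat) (x :: real ^ 'd). exp (- (\<Sum>j\<in>UNIV. real (b j) * x $ j)))"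
      by (rule range_eqI[of _ _ "\<lambda>_. 0"]) simp
    fix x y :: "real ^ 'd" assume "x \<noteq> y"
    then obtain j where j: "x $ j \<noteq> y $ j" by (auto simp: vec_eq_iff)
    define b where "b i = (if i = j then 1 else 0 :: nat)" for i
    have s: "(\<Sum>i\<in>UNIV. real (b i) * z $ i) = z $ j" for z :: "real ^ 'd"
    proof -
      have "(\<Sum>i\<in>UNIV. real (b i) * z $ i) = (\<Sum>i\<in>UNIV. if i = j then z $ i else 0)" by (rule sum.cong) (auto simp: b_def)
      then show ?thesis by simp
    qed
    show "\<exists>f\<in>range (\<lambda>(b::'d \<Rightarrow> nat) x. exp (- (\<Sum>j\<in>UNIV. real (b j) * x $ j))). f x \<noteq> f y"
      by (rule bexI[OF _ rangeI[of _ b]]) (use j in \<open>simp add: s\<close>)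
  qed
  moreover have om: "osimplex t \<in> sets borel" by (rule borel_open[OF open_osimplex])
  \<comment> \<open>Integrating this function undoes the weighting on the open simplex and discards
    the boundary.\<close>
  let ?w = "\<lambda>x. ennreal (1 / chi t x) * indicator (B \<inter> osimplex t) x"
  have wm: "?w \<in> borel_measurable borel" using B om by measurable
  have "(\<integral>\<^sup>+x. ?w x \<partial>\<nu>1) = emeasure (M k) {\<omega> \<in> space (M k). X t \<omega> = l \<and> Lv t \<omega> \<in> B \<inter> osimplex t}"
  proof -
    have "(\<integral>\<^sup>+x. ?w x \<partial>\<nu>1) = (\<integral>\<^sup>+\<omega>. ennreal (?d1 \<omega>) * ?w (Lv t \<omega>) \<partial>M k)"
      unfolding \<nu>1_def using wm
      by (subst nn_integral_distr, simp, simp, subst nn_integral_density) (auto intro!: measurable_compose[OF LM])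
    also have "\<dots> = (\<integral>\<^sup>+\<omega>. indicator {\<omega> \<in> space (M k). X t \<omega> = l \<and> Lv t \<omega> \<in> B \<inter> osimplex t} \<omega> \<partial>M k)"
    proof (rule nn_integral_cong)
      fix \<omega> assume w: "\<omega> \<in> space (M k)"
      show "ennreal (?d1 \<omega>) * ?w (Lv t \<omega>) = indicator {\<omega> \<in> space (M k). X t \<omega> = l \<and> Lv t \<omega> \<in> B \<inter> osimplex t} \<omega>"
        using w chi_pos[of "Lv t \<omega>" t] by (auto simp: indicator_def ennreal_mult'[symmetric])
    qed
    also have "\<dots> = emeasure (M k) {\<omega> \<in> space (M k). X t \<omega> = l \<and> Lv t \<omega> \<in> B \<inter> osimplex t}"
    proof (rule nn_integral_indicator)
      have "X t -` {l} \<inter> space (M k) \<in> sets (M k)" by (rule measurable_sets[OF meas_X'[OF k t0]]) (use l in simp)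
      moreover have "Lv t -` (B \<inter> osimplex t) \<inter> space (M k) \<in> sets (M k)" by (rule measurable_sets[OF LM]) (use B om in simp)
      moreover have "{\<omega> \<in> space (M k). X t \<omega> = l \<and> Lv t \<omega> \<in> B \<inter> osimplex t} = (X t -` {l} \<inter> space (M k)) \<inter> (Lv t -` (B \<inter> osimplex t) \<inter> space (M k))" by auto
      ultimately show "{\<omega> \<in> space (M k). X t \<omega> = l \<and> Lv t \<omega> \<in> B \<inter> osimplex t} \<in> sets (M k)" by auto
    qed
    finally show ?thesis .
  qed
  moreover have "(\<integral>\<^sup>+x. ?w x \<partial>\<nu>2) = (\<integral>\<^sup>+x\<in>B. ennreal (dens0 t x k l) \<partial>lborel)"
  proof -
    have "(\<integral>\<^sup>+x. ?w x \<partial>\<nu>2) = (\<integral>\<^sup>+x. ennreal (?d2 x) * ?w x \<partial>lborel)"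
      unfolding \<nu>2_def using wm by (subst nn_integral_density) auto
    also have "\<dots> = (\<integral>\<^sup>+x\<in>B. ennreal (dens0 t x k l) \<partial>lborel)"
    proof (rule nn_integral_cong_AE)
      \<comment> \<open>\<open>dens0\<close> lives on the closed simplex and the weighted measure on
        the open one; they differ by a null set.\<close>
      have "AE x in lborel. x \<notin> {x. \<exists>i\<in>I. crd t x i = 0}" by (rule AE_not_in[OF boundary_null])
      then show "AE x in lborel. ennreal (?d2 x) * ?w x = ennreal (dens0 t x k l) * indicator B x"
      proof (rule AE_mp, intro AE_I2 impI)
        fix x assume x: "x \<notin> {x. \<exists>i\<in>I. crd t x i = 0}"
        show "ennreal (?d2 x) * ?w x = ennreal (dens0 t x k l) * indicator B x"
        proof (cases "x \<in> osimplex t")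
          case True
          have "chi t x * raw_dens k l t x * (1 / chi t x) = raw_dens k l t x" using chi_pos[OF True] by simp
          then show ?thesis using True osimplex_subset d2[of x]
            by (auto simp: indicator_def ennreal_mult'[symmetric] dens0_def)
        next
          case False
          have "x \<notin> csimplex t"
          proof
            assume c: "x \<in> csimplex t"
            obtain i where i: "i \<in> I" "\<not> 0 < crd t x i" using False unfolding osimplex_def by blast
            then show False using csimplexD[OF c i(1)] x by force
          qed
          then show ?thesis using False by (simp add: dens0_def)
        qed
      qed
    qed
    finally show ?thesis .
  qed
  ultimately show ?thesis by simp
qed

end

section \<open>The singular part and the conclusion\<close>

lemma norm0_le:
  assumes "1 \<le> N" "\<And>k l. k \<in> {1..N} \<Longrightarrow> l \<in> {1..N} \<Longrightarrow> norm (A k l) \<le> b"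
  shows "norm0 N A \<le> b"
  unfolding norm0_def by (rule Max.boundedI) (use assms in auto)

lemma fourier_translate:
  fixes f :: "'e::euclidean_space \<Rightarrow> real"
  assumes f[measurable]: "f \<in> borel_measurable borel"
  shows "norm (fourier (\<lambda>y. f (y + v)) \<zeta>) = norm (fourier f \<zeta>)"
proof -
  define e where "e y = exp (\<i> * complex_of_real (\<zeta> \<bullet> y))" for y :: 'e
  have em[measurable]: "e \<in> borel_measurable borel"
    unfolding e_def by (intro borel_measurable_continuous_onI continuous_intros)
  have e_add: "e y = e (- v) * e (v + y)" for y
    by (simp add: e_def exp_add[symmetric] inner_add_right algebra_simps)
  have "fourier (\<lambda>y. f (y + v)) \<zeta> = (\<integral>y. e y * complex_of_real (f (v + y)) \<partial>lborel)"
    by (simp add: fourier_def e_def add.commute)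
  also have "\<dots> = (\<integral>y. e (- v) * (e (v + y) * complex_of_real (f (v + y))) \<partial>lborel)"
    by (rule Bochner_Integration.integral_cong[OF refl]) (subst e_add, simp add: mult.assoc)
  also have "\<dots> = e (- v) * (\<integral>y. e (v + y) * complex_of_real (f (v + y)) \<partial>lborel)" by simp
  also have "(\<integral>y. e (v + y) * complex_of_real (f (v + y)) \<partial>lborel) = (\<integral>y. e y * complex_of_real (f y) \<partial>lborel)"
    by (subst (2) lborel_distr_plus[of v, symmetric], subst integral_distr) auto
  also have "\<dots> = fourier f \<zeta>" by (simp add: fourier_def e_def)
  finally show ?thesis by (simp add: norm_mult e_def norm_exp_eq_Re)
qed

context jump_density
begin

text \<open>Off the diagonal G is nonnegative and equals Lam P, so every arc of the graph of G is a
  transition of positive probability.\<close>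

lemma arcs_connected:
  assumes "irreducible_matrix_on {1..N} G" "i \<in> I" "j \<in> I"
  shows "(j, i) \<in> arcs_on\<^sup>*"
proof -
  let ?A = "{(k, l). k \<in> {1..N} \<and> l \<in> {1..N} \<and> k \<noteq> l \<and> G k l \<noteq> 0}"
  let ?H = "with_proj \<lparr>pverts = {1..N}, parcs = ?A\<rparr>"
  have "reachable ?H j i"
    using assms unfolding irreducible_matrix_on_def strongly_connected_def by simp
  then have "(j, i) \<in> rtrancl_on (verts ?H) (arcs_ends ?H)" by (simp add: reachable_def)
  then have "(j, i) \<in> (arcs_ends ?H)\<^sup>*" by (rule rtrancl_on_rtranclI)
  moreover have "arcs_ends ?H \<subseteq> arcs_on"
  proof
    fix e assume "e \<in> arcs_ends ?H"
    then obtain k l where e: "e = (k, l)" "k \<in> I" "l \<in> I" "k \<noteq> l" "G k l \<noteq> 0"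
      by (auto simp: arcs_ends_def arc_to_ends_def)
    then have "0 < G k l" using G_nonneg[of k l] by linarith
    then show "e \<in> arcs_on" using e Lam_pos by (simp add: arcs_on_def P_def)
  qed
  ultimately show ?thesis using rtrancl_mono by blast
qed

section \<open>The Lebesgue decomposition\<close>

definition boundary_event :: "real \<Rightarrow> nat \<Rightarrow> nat \<Rightarrow> 'w set" where
  "boundary_event t k l = {\<omega> \<in> space (M k). X t \<omega> = l \<and> Lv t \<omega> \<notin> osimplex t}"

text \<open>The vector u is the drift per unit time; centring only translates the simplex and the
  density by t u.\<close>

definition dens :: "real ^ 'd \<Rightarrow> real \<Rightarrow> real ^ 'd \<Rightarrow> nat \<Rightarrow> nat \<Rightarrow> real" where
  "dens u t y k l = dens0 t (y + t *\<^sub>R u) k l"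

definition sing :: "real ^ 'd \<Rightarrow> real \<Rightarrow> nat \<Rightarrow> nat \<Rightarrow> (real ^ 'd) measure" where
  "sing u t k l = distr (density (M k) (indicator (boundary_event t k l))) borel (\<lambda>\<omega>. Lv t \<omega> - t *\<^sub>R u)"

lemma boundary_event_sets:
  assumes "k \<in> I" "l \<in> I" "0 \<le> t" shows "boundary_event t k l \<in> sets (M k)"
proof -
  have "X t -` {l} \<inter> space (M k) \<in> sets (M k)" by (rule measurable_sets[OF meas_X'[OF assms(1,3)]]) (use assms in simp)
  moreover have "Lv t -` (- osimplex t) \<inter> space (M k) \<in> sets (M k)"
    by (rule measurable_sets[OF Lv_meas[OF assms(1,3)]]) (use borel_open[OF open_osimplex] in auto)
  moreover have "boundary_event t k l = (X t -` {l} \<inter> space (M k)) \<inter> (Lv t -` (- osimplex t) \<inter> space (M k))"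
    by (auto simp: boundary_event_def)
  ultimately show ?thesis by auto
qed

lemma emeasure_sing:
  assumes k: "k \<in> I" and l: "l \<in> I" and t: "0 \<le> t" and B: "B \<in> sets borel"
  shows "emeasure (sing u t k l) B = emeasure (M k) (boundary_event t k l \<inter> {\<omega>. Lv t \<omega> - t *\<^sub>R u \<in> B})"
proof -
  have m: "(\<lambda>\<omega>. Lv t \<omega> - t *\<^sub>R u) \<in> borel_measurable (M k)" using Lv_meas[OF k t] by simp
  have v: "(\<lambda>\<omega>. Lv t \<omega> - t *\<^sub>R u) -` B \<inter> space (M k) \<in> sets (M k)" by (rule measurable_sets[OF m B])
  have "emeasure (sing u t k l) B = emeasure (density (M k) (indicator (boundary_event t k l))) ((\<lambda>\<omega>. Lv t \<omega> - t *\<^sub>R u) -` B \<inter> space (M k))"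
    unfolding sing_def using m B by (subst emeasure_distr) (auto cong: measurable_cong_sets)
  also have "\<dots> = emeasure (M k) (boundary_event t k l \<inter> ((\<lambda>\<omega>. Lv t \<omega> - t *\<^sub>R u) -` B \<inter> space (M k)))"
    by (rule emeasure_restricted[OF boundary_event_sets[OF k l t] v])
  also have "boundary_event t k l \<inter> ((\<lambda>\<omega>. Lv t \<omega> - t *\<^sub>R u) -` B \<inter> space (M k)) = boundary_event t k l \<inter> {\<omega>. Lv t \<omega> - t *\<^sub>R u \<in> B}"
    by (auto simp: boundary_event_def)
  finally show ?thesis .
qed

lemma dens_meas: "k \<in> I \<Longrightarrow> (\<lambda>y. dens u t y k l) \<in> borel_measurable borel"
  unfolding dens_def by (rule measurable_compose[OF _ dens0_meas]) auto

lemma boundary_event_boundary: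
  assumes "\<omega> \<in> boundary_event t k l" "k \<in> I" "0 \<le> t"
  shows "\<exists>i\<in>I. crd t (Lv t \<omega>) i = 0" "\<exists>i\<in>I. L t i \<omega> = 0"
proof -
  have w: "\<omega> \<in> \<Omega>" using assms space_M by (simp add: boundary_event_def)
  obtain i where i: "i \<in> I" "\<not> 0 < crd t (Lv t \<omega>) i" using assms(1) unfolding boundary_event_def osimplex_def by blast
  then have "crd t (Lv t \<omega>) i = 0" using csimplexD[OF Lv_simplex[OF w assms(3)] i(1)] by simp
  then show "\<exists>i\<in>I. crd t (Lv t \<omega>) i = 0" "\<exists>i\<in>I. L t i \<omega> = 0"
    using i(1) crd_Lv[OF w assms(3) i(1)] by auto
qed

text \<open>The law is split according to whether the occupation vector lies in the open simplex.
  Inside it has the density; outside some coordinate is 0, so that part is carried by finitely many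
  hyperplanes.\<close>

lemma decomposition:
  assumes k: "k \<in> I" and l: "l \<in> I" and t: "0 < t"
  shows "lebesgue_decomposition (\<lambda>B. emeasure (M k) {\<omega> \<in> space (M k). X t \<omega> = l \<and> Lv t \<omega> - t *\<^sub>R u \<in> B})
    (\<lambda>y. dens u t y k l) (sing u t k l)"
  unfolding lebesgue_decomposition_def
proof (intro conjI allI ballI)
  have t0: "0 \<le> t" using t by simp
  show "(\<lambda>y. dens u t y k l) \<in> borel_measurable borel" by (rule dens_meas[OF k])
  show "0 \<le> dens u t y k l" for y unfolding dens_def by (rule dens0_bounds(1)[OF k])
  show "sets (sing u t k l) = sets borel" by (simp add: sing_def)
  let ?Z = "{x. \<exists>i\<in>I. crd t x i = 0}"
  let ?S = "(+) (t *\<^sub>R u) -` ?Z"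
  have Z: "?Z \<in> sets borel" "emeasure lborel ?Z = 0" using boundary_null[of t] by (auto simp: null_sets_def)
  have S: "?S \<in> sets borel" using measurable_sets[of "(+) (t *\<^sub>R u)" borel borel ?Z] Z by simp
  show "\<exists>S\<in>sets borel. emeasure lborel S = 0 \<and> emeasure (sing u t k l) (- S) = 0"
  proof (intro bexI[OF _ S] conjI)
    have "emeasure lborel ?S = emeasure (distr lborel borel ((+) (t *\<^sub>R u))) ?Z"
      using Z by (subst emeasure_distr) auto
    then show "emeasure lborel ?S = 0" using Z by (simp add: lborel_distr_plus)
    have mS: "- ?S \<in> sets borel" using S by (simp add: sets.compl_sets[of _ borel, simplified] Compl_eq_Diff_UNIV)
    have "boundary_event t k l \<inter> {\<omega>. Lv t \<omega> - t *\<^sub>R u \<in> - ?S} = {}"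
      using boundary_event_boundary(1)[OF _ k t0] by auto
    then show "emeasure (sing u t k l) (- ?S) = 0" unfolding emeasure_sing[OF k l t0 mS] by (simp only: emeasure_empty)
  qed
  fix B :: "(real ^ 'd) set" assume B: "B \<in> sets borel"
  define B' where "B' = (\<lambda>x. x - t *\<^sub>R u) -` B"
  have B': "B' \<in> sets borel" using measurable_sets[of "\<lambda>x. x - t *\<^sub>R u" borel borel B] B by (simp add: B'_def)
  let ?E = "{\<omega> \<in> space (M k). X t \<omega> = l \<and> Lv t \<omega> \<in> B' \<inter> osimplex t}"
  let ?F = "boundary_event t k l \<inter> {\<omega>. Lv t \<omega> - t *\<^sub>R u \<in> B}"
  have E: "?E \<in> sets (M k)"
  proof -
    have "X t -` {l} \<inter> space (M k) \<in> sets (M k)" by (rule measurable_sets[OF meas_X'[OF k t0]]) (use l in simp)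
    moreover have "Lv t -` (B' \<inter> osimplex t) \<inter> space (M k) \<in> sets (M k)"
      by (rule measurable_sets[OF Lv_meas[OF k t0]]) (use B' borel_open[OF open_osimplex] in simp)
    moreover have "?E = (X t -` {l} \<inter> space (M k)) \<inter> (Lv t -` (B' \<inter> osimplex t) \<inter> space (M k))" by auto
    ultimately show ?thesis by auto
  qed
  have F: "?F \<in> sets (M k)"
  proof -
    have "Lv t -` B' \<inter> space (M k) \<in> sets (M k)" by (rule measurable_sets[OF Lv_meas[OF k t0] B'])
    moreover have "?F = boundary_event t k l \<inter> (Lv t -` B' \<inter> space (M k))" by (auto simp: boundary_event_def B'_def)
    ultimately show ?thesis using boundary_event_sets[OF k l t0] by auto
  qed
  have "{\<omega> \<in> space (M k). X t \<omega> = l \<and> Lv t \<omega> - t *\<^sub>R u \<in> B} = ?E \<union> ?F"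
    by (auto simp: boundary_event_def B'_def)
  moreover have "?E \<inter> ?F = {}" by (auto simp: boundary_event_def)
  ultimately have "emeasure (M k) {\<omega> \<in> space (M k). X t \<omega> = l \<and> Lv t \<omega> - t *\<^sub>R u \<in> B} = emeasure (M k) ?E + emeasure (M k) ?F"
    using plus_emeasure[OF E F] by simp
  also have "emeasure (M k) ?E = (\<integral>\<^sup>+x\<in>B'. ennreal (dens0 t x k l) \<partial>lborel)"
    by (rule interior_density[OF k l t B'])
  also have "\<dots> = (\<integral>\<^sup>+x\<in>B'. ennreal (dens0 t x k l) \<partial>distr lborel borel ((+) (t *\<^sub>R u)))"
    by (simp only: lborel_distr_plus)
  also have "\<dots> = (\<integral>\<^sup>+y. ennreal (dens0 t (t *\<^sub>R u + y) k l) * indicator B' (t *\<^sub>R u + y) \<partial>lborel)"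
    by (rule nn_integral_distr) (use dens0_meas[OF k] B' in auto)
  also have "\<dots> = (\<integral>\<^sup>+y\<in>B. ennreal (dens u t y k l) \<partial>lborel)"
    by (rule nn_integral_cong) (simp add: dens_def B'_def add.commute indicator_def)
  also have "emeasure (M k) ?F = emeasure (sing u t k l) B" by (rule emeasure_sing[OF k l t0 B, symmetric])
  finally show "emeasure (M k) {\<omega> \<in> space (M k). X t \<omega> = l \<and> Lv t \<omega> - t *\<^sub>R u \<in> B}
    = (\<integral>\<^sup>+y\<in>B. ennreal (dens u t y k l) \<partial>lborel) + emeasure (sing u t k l) B" .
qed

lemma sing_decay:
  assumes irr: "irreducible_matrix_on {1..N} G"
  shows "\<exists>C \<eta>. 0 < C \<and> 0 < \<eta> \<and> (\<forall>t>0. norm0 N (\<lambda>k l. measure (sing u t k l) UNIV) \<le> C * exp (- \<eta> * t))"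
proof -
  have "\<forall>i\<in>I. \<exists>C \<eta>. 0 \<le> C \<and> 0 < \<eta> \<and> (\<forall>k\<in>I. \<forall>t>0. measure (M k) {\<omega> \<in> \<Omega>. L t i \<omega> = 0} \<le> C * exp (- \<eta> * t))"
    by (intro ballI unvisited_decay1 arcs_connected[OF irr])
  then obtain C \<eta> where C: "\<And>i. i \<in> I \<Longrightarrow> 0 \<le> C i \<and> 0 < \<eta> i"
    "\<And>i k t. i \<in> I \<Longrightarrow> k \<in> I \<Longrightarrow> 0 < t \<Longrightarrow> measure (M k) {\<omega> \<in> \<Omega>. L t i \<omega> = 0} \<le> C i * exp (- \<eta> i * t)"
    by metis
  define e where "e = Min (\<eta> ` I)"
  have ne: "\<eta> ` I \<noteq> {}" using N1 by auto
  have e0: "0 < e" unfolding e_def using ne C by (subst Min_gr_iff) auto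
  have e: "e \<le> \<eta> i" if "i \<in> I" for i unfolding e_def by (rule Min_le) (use that in auto)
  \<comment> \<open>The summand 1 makes the constant strictly positive, as property (ii) asks of
    c.\<close>
  let ?C = "(\<Sum>i\<in>I. C i) + 1"
  have C0: "0 \<le> (\<Sum>i\<in>I. C i)" using C by (auto intro!: sum_nonneg)
  have "norm0 N (\<lambda>k l. measure (sing u t k l) UNIV) \<le> ?C * exp (- e * t)" if t: "0 < t" for t
  proof (rule norm0_le[OF N1])
    fix k l assume k: "k \<in> I" and l: "l \<in> I"
    interpret prob_space "M k" by (rule prob_M[OF k])
    have t0: "0 \<le> t" using t by simp
    have Ls: "{\<omega> \<in> \<Omega>. L t i \<omega> = 0} \<in> sets (M k)" for i
    proof -
      have "L t i -` {0} \<inter> space (M k) \<in> sets (M k)" by (rule measurable_sets[OF L_meas[OF k t0]]) simp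
      also have "L t i -` {0} \<inter> space (M k) = {\<omega> \<in> \<Omega>. L t i \<omega> = 0}" by (auto simp: space_M[OF k])
      finally show ?thesis .
    qed
    have "measure (sing u t k l) UNIV = measure (M k) (boundary_event t k l)"
      using emeasure_sing[OF k l t0, of UNIV u] by (simp add: measure_def)
    also have "\<dots> \<le> measure (M k) (\<Union>i\<in>I. {\<omega> \<in> \<Omega>. L t i \<omega> = 0})"
    proof (rule finite_measure_mono)
      show "boundary_event t k l \<subseteq> (\<Union>i\<in>I. {\<omega> \<in> \<Omega>. L t i \<omega> = 0})"
        using boundary_event_boundary(2)[OF _ k t0] space_M[OF k] by (fastforce simp: boundary_event_def)
      show "(\<Union>i\<in>I. {\<omega> \<in> \<Omega>. L t i \<omega> = 0}) \<in> sets (M k)" using Ls by (intro sets.finite_UN) auto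
    qed
    also have "\<dots> \<le> (\<Sum>i\<in>I. measure (M k) {\<omega> \<in> \<Omega>. L t i \<omega> = 0})"
      by (rule measure_UNION_le) (use Ls in auto)
    also have "\<dots> \<le> (\<Sum>i\<in>I. C i * exp (- e * t))"
    proof (rule sum_mono)
      fix i assume i: "i \<in> I"
      have "C i * exp (- \<eta> i * t) \<le> C i * exp (- e * t)" using C(1)[OF i] e[OF i] t0 by (intro mult_left_mono) (auto intro: mult_right_mono)
      then show "measure (M k) {\<omega> \<in> \<Omega>. L t i \<omega> = 0} \<le> C i * exp (- e * t)" using C(2)[OF i k t] by linarith
    qed
    also have "\<dots> = (\<Sum>i\<in>I. C i) * exp (- e * t)" by (simp only: sum_distrib_right)
    also have "\<dots> \<le> ?C * exp (- e * t)" by (rule mult_right_mono) auto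
    finally show "norm (measure (sing u t k l) UNIV) \<le> ?C * exp (- e * t)" by simp
  qed
  then show ?thesis using C0 e0 by (intro exI[of _ ?C] exI[of _ e]) auto
qed

section \<open>The translated domains and the estimates on them\<close>

definition Dom :: "real ^ 'd \<Rightarrow> real \<Rightarrow> (real ^ 'd) set" where
  "Dom u t = (+) (- (t *\<^sub>R u)) ` osimplex t"

lemma mem_Dom: "y \<in> Dom u t \<longleftrightarrow> y + t *\<^sub>R u \<in> osimplex t"
  unfolding Dom_def by (auto simp: image_iff intro: bexI[of _ "y + t *\<^sub>R u"])

lemma mem_closure_Dom: "0 < t \<Longrightarrow> y \<in> closure (Dom u t) \<longleftrightarrow> y + t *\<^sub>R u \<in> csimplex t"
  unfolding Dom_def closure_translation using closure_osimplex
  by (auto simp: image_iff intro: bexI[of _ "y + t *\<^sub>R u"])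

lemma dens_derivative:
  assumes k: "k \<in> I" and y: "y \<in> Dom u t"
  shows "((\<lambda>y. dens u t y k l) has_derivative dens_deriv k l t (y + t *\<^sub>R u)) (at y)"
proof -
  have "((\<lambda>y. y + t *\<^sub>R u) has_derivative (\<lambda>h. h)) (at y)"
    by (auto intro!: derivative_eq_intros)
  from has_derivative_compose[OF this dens0_has_derivative[OF k y[unfolded mem_Dom]]]
  show ?thesis unfolding dens_def .
qed

lemma dens_partial:
  assumes k: "k \<in> I" and y: "y \<in> Dom u t"
  shows "\<bar>partial_deriv j (\<lambda>y. dens u t y k l) y\<bar> \<le> 4 * real CARD('d) * Lam ^ N"
proof -
  let ?D = "dens_deriv k l t (y + t *\<^sub>R u)"
  have D: "((\<lambda>y. dens u t y k l) has_derivative ?D) (at (y + 0 *\<^sub>R axis j 1))"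
    using dens_derivative[OF k y] by simp
  have "((\<lambda>h. y + h *\<^sub>R axis j 1) has_derivative (\<lambda>h. h *\<^sub>R axis j 1)) (at (0::real))"
    by (auto intro!: derivative_eq_intros)
  from has_derivative_compose[OF this D]
  have "((\<lambda>h. dens u t (y + h *\<^sub>R axis j 1) k l) has_derivative (\<lambda>h. ?D (h *\<^sub>R axis j 1))) (at 0)" .
  moreover have "(\<lambda>h. ?D (h *\<^sub>R axis j 1)) = (*) (?D (axis j 1))"
    by (simp add: fun_eq_iff linear_scale[OF has_derivative_linear[OF dens_derivative[OF k y]]] mult.commute)
  ultimately have "((\<lambda>h. dens u t (y + h *\<^sub>R axis j 1) k l) has_field_derivative ?D (axis j 1)) (at 0)"
    unfolding has_field_derivative_def by (simp only:)
  then have "partial_deriv j (\<lambda>y. dens u t y k l) y = ?D (axis j 1)"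
    unfolding partial_deriv_def by (rule DERIV_imp_deriv)
  then show ?thesis using dens_deriv_axis_bound[OF k] by simp
qed

text \<open>Centring multiplies the transform by a phase, so the bound for the uncentred density
  applies; it is uniform because all the times w stay below 2 t0.\<close>

lemma dens_fourier_limit:
  assumes t0: "0 < t0"
  shows "((\<lambda>\<zeta>. SUP w\<in>{t0..<2 * t0}. ennreal (norm0 N (\<lambda>k l. fourier (\<lambda>y. dens u w y k l) \<zeta>))) \<longlongrightarrow> 0) at_infinity"
proof -
  let ?T = "2 * t0"
  define K where "K = (2 * (2 * Lam ^ N) * ?T ^ CARD('d) * V + 4 * Lam ^ (N - 1) * V * real CARD('d) * ?T ^ (CARD('d) - 1)) * (pi * real CARD('d))"
  have b: "(SUP w\<in>{t0..<2 * t0}. ennreal (norm0 N (\<lambda>k l. fourier (\<lambda>y. dens u w y k l) \<zeta>))) \<le> ennreal (K / norm \<zeta>)" if "\<zeta> \<noteq> 0" for \<zeta>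
  proof (intro SUP_least ennreal_leI norm0_le[OF N1])
    fix w k l assume w: "w \<in> {t0..<2 * t0}" and k: "k \<in> I" and l: "l \<in> I"
    have "norm (fourier (\<lambda>y. dens u w y k l) \<zeta>) = norm (fourier (\<lambda>y. dens0 w y k l) \<zeta>)"
      unfolding dens_def by (rule fourier_translate[OF dens0_meas[OF k]])
    also have "\<dots> \<le> K / norm \<zeta>"
      unfolding K_def by (rule dens0_fourier[OF k _ _ that]) (use w t0 in auto)
    finally show "norm (fourier (\<lambda>y. dens u w y k l) \<zeta>) \<le> K / norm \<zeta>" .
  qed
  have "((\<lambda>\<zeta>::real ^ 'd. K / norm \<zeta>) \<longlongrightarrow> 0) at_infinity"
    by (rule real_tendsto_divide_at_top[OF tendsto_const filterlim_norm_at_top])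
  then have lim: "((\<lambda>\<zeta>::real ^ 'd. ennreal (K / norm \<zeta>)) \<longlongrightarrow> 0) at_infinity"
    using tendsto_ennrealI[of "\<lambda>\<zeta>::real ^ 'd. K / norm \<zeta>" 0] by simp
  have ev: "\<forall>\<^sub>F \<zeta>::real ^ 'd in at_infinity. \<zeta> \<noteq> 0"
    unfolding eventually_at_infinity by (rule exI[of _ 1]) auto
  show ?thesis
  proof (rule tendsto_sandwich[OF _ _ tendsto_const lim])
    show "\<forall>\<^sub>F \<zeta> in at_infinity. (SUP w\<in>{t0..<2 * t0}. ennreal (norm0 N (\<lambda>k l. fourier (\<lambda>y. dens u w y k l) \<zeta>))) \<le> ennreal (K / norm \<zeta>)"
      using ev by (rule eventually_mono) (rule b)
  qed simp
qed

lemma dens_boundary: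
  assumes irr: "irreducible_matrix_on {1..N} G"
  shows "(\<lambda>t. enn2real (SUP y\<in>closure (Dom u t) - Dom u t. ennreal (norm0 N (dens u t y))))
           \<in> O[at_top](\<lambda>t. t powr (- (real CARD('d) + 1) / 2))"
proof -
  obtain A b where A: "0 \<le> A" "0 < b"
    "\<And>t k l x. k \<in> I \<Longrightarrow> x \<in> csimplex t - osimplex t \<Longrightarrow> \<bar>dens0 t x k l\<bar> \<le> A * exp (- b * t)"
    using dens0_boundary[OF arcs_connected[OF irr]] by blast
  have le: "enn2real (SUP y\<in>closure (Dom u t) - Dom u t. ennreal (norm0 N (dens u t y))) \<le> A * exp (- b * t)" if t: "0 < t" for t
  proof (rule enn2real_leI)
    show "(SUP y\<in>closure (Dom u t) - Dom u t. ennreal (norm0 N (dens u t y))) \<le> ennreal (A * exp (- b * t))"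
    proof (intro SUP_least ennreal_leI norm0_le[OF N1])
      fix y k l assume y: "y \<in> closure (Dom u t) - Dom u t" and k: "k \<in> I"
      then have "y + t *\<^sub>R u \<in> csimplex t - osimplex t" using mem_closure_Dom[OF t] mem_Dom by auto
      then show "norm (dens u t y k l) \<le> A * exp (- b * t)" unfolding dens_def using A(3)[OF k] by simp
    qed
  qed (use A in simp)
  have "(\<lambda>t. enn2real (SUP y\<in>closure (Dom u t) - Dom u t. ennreal (norm0 N (dens u t y)))) \<in> O[at_top](\<lambda>t. exp (- b * t))"
  proof (rule bigoI[of _ A])
    show "\<forall>\<^sub>F t in at_top. norm (enn2real (SUP y\<in>closure (Dom u t) - Dom u t. ennreal (norm0 N (dens u t y)))) \<le> A * norm (exp (- b * t))"
      using eventually_gt_at_top[of 0] by (rule eventually_mono) (use le in simp)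
  qed
  \<comment> \<open>The boundary values decay exponentially, faster than the power required.\<close>
  also have "(\<lambda>t::real. exp (- b * t)) \<in> O[at_top](\<lambda>t. t powr (- (real CARD('d) + 1) / 2))"
    using A(2) by real_asymp
  finally show ?thesis .
qed

end

theorem proposition5p1:
  fixes N :: nat
    and G :: "nat \<Rightarrow> nat \<Rightarrow> real"
    and M :: "nat \<Rightarrow> 'w measure"
    and X :: "real \<Rightarrow> 'w \<Rightarrow> nat"
    and \<pi> :: "nat \<Rightarrow> real"
    and idx :: "'d::finite \<Rightarrow> nat"
    and Y' :: "real \<Rightarrow> 'w \<Rightarrow> real ^ 'd"
  assumes "N \<ge> 2"
    and "bij_betw idx UNIV {1..N - 1}"
    and "markov_jump_process N G M X"
    and "irreducible_matrix_on {1..N} G"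
    and "\<forall>i\<in>{1..N}. irreducible_matrix_on ({1..N} - {i}) G"
    and "invariant_probability N G \<pi>"
    and "Y' = (\<lambda>t \<omega>. \<chi> j. centred_occupation_time N M \<pi> X t (idx j) \<omega>)"
  shows "markov_additive_process N M X Y' \<and>
    \<comment> \<open>(i)\<close>
    (MAX k\<in>{1..N}. SUP v\<in>{0<..1}. \<integral>\<^sup>+\<omega>. ennreal (norm (Y' v \<omega>) ^ 3) \<partial>M k) < \<infinity> \<and>
    (\<exists>(dens :: real \<Rightarrow> real ^ 'd \<Rightarrow> nat \<Rightarrow> nat \<Rightarrow> real) (sing :: real \<Rightarrow> nat \<Rightarrow> nat \<Rightarrow> (real ^ 'd) measure).
      (\<forall>t>0. \<forall>k\<in>{1..N}. \<forall>l\<in>{1..N}.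
         lebesgue_decomposition (\<lambda>B. emeasure (M k) {\<omega> \<in> space (M k). X t \<omega> = l \<and> Y' t \<omega> \<in> B})
           (\<lambda>y. dens t y k l) (sing t k l)) \<and>
      \<comment> \<open>(ii)\<close>
      (\<exists>c>0. \<exists>\<rho>\<in>{0<..<1}.
         (\<forall>t>0. norm0 N (\<lambda>k l. measure (sing t k l) UNIV) \<le> c * \<rho> powr t) \<and>
         (\<exists>t0>0. \<rho> powr t0 * max 2 (c * real N) \<le> 1 / 4 \<and>
            ((\<lambda>\<zeta>. SUP w\<in>{t0..<2 * t0}.
                ennreal (norm0 N (\<lambda>k l. fourier (\<lambda>y. dens w y k l) \<zeta>))) \<longlongrightarrow> 0) at_infinity)) \<and>
      \<comment> \<open>(iii)\<close>
      (\<exists>D :: real \<Rightarrow> (real ^ 'd) set.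
         (\<forall>t>0. open (D t) \<and> convex (D t) \<and>
            (\<forall>k\<in>{1..N}. \<forall>l\<in>{1..N}.
               (\<forall>y. y \<notin> closure (D t) \<longrightarrow> dens t y k l = 0) \<and>
               continuous_on (closure (D t)) (\<lambda>y. dens t y k l) \<and>
               (\<forall>y\<in>D t. (\<lambda>y. dens t y k l) differentiable (at y)))) \<and>
         (SUP t\<in>{0<..}. SUP y\<in>closure (D t). ennreal (norm0 N (dens t y))) < \<infinity> \<and>
         (\<lambda>t. enn2real (SUP y\<in>closure (D t) - D t. ennreal (norm0 N (dens t y))))
           \<in> O[at_top](\<lambda>t. t powr (- (real CARD('d) + 1) / 2)) \<and>
         (\<forall>j. (SUP t\<in>{0<..}. SUP y\<in>D t.
            ennreal (norm0 N (\<lambda>k l. partial_deriv j (\<lambda>y. dens t y k l) y))) < \<infinity>)))"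
proof -
  interpret J: jump_density N G M X idx by standard (use assms(1-3) in auto)
  define c where "c j = mean_occupation N M \<pi> X (idx j)" for j
  interpret C: jump_coords N G M X idx c by standard
  define u :: "real ^ 'd" where "u = (\<chi> j. c j)"
  have Y1: "Y' = C.Y"
    unfolding assms(7) C.Y_def[abs_def] c_def centred_occupation_time_def by simp
  have Y2: "Y' t \<omega> = J.Lv t \<omega> - t *\<^sub>R u" for t \<omega>
    unfolding assms(7) J.Lv_def centred_occupation_time_def u_def c_def by (simp add: vec_eq_iff)
  have map: "markov_additive_process N M X Y'" unfolding Y1 by (rule C.map_property)
  \<comment> \<open>For v \<le> 1 an occupation time lies in [0, 1] and its centring term is at most
    |c(j)|, so Y' is bounded and so are its third moments.\<close>
  define b where "b = (\<Sum>j\<in>(UNIV :: 'd set). 1 + \<bar>c j\<bar>)"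
  have b0: "0 \<le> b" unfolding b_def by (intro sum_nonneg) auto
  have m3: "(SUP v\<in>{0<..1}. \<integral>\<^sup>+\<omega>. ennreal (norm (Y' v \<omega>) ^ 3) \<partial>M k) \<le> ennreal (b ^ 3)" if k: "k \<in> {1..N}" for k
  proof (rule SUP_least)
    fix v :: real assume v: "v \<in> {0<..1}"
    interpret prob_space "M k" by (rule J.prob_M[OF k])
    have "(\<integral>\<^sup>+\<omega>. ennreal (norm (Y' v \<omega>) ^ 3) \<partial>M k) \<le> (\<integral>\<^sup>+\<omega>. ennreal (b ^ 3) \<partial>M k)"
    proof (rule nn_integral_mono, rule ennreal_leI, rule power_mono)
      fix \<omega> assume "\<omega> \<in> space (M k)"
      then have w: "\<omega> \<in> space J.base" by (simp add: J.space_M[OF k])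
      have v0: "0 \<le> v" using v by simp
      have "norm (Y' v \<omega>) \<le> (\<Sum>j\<in>UNIV. \<bar>Y' v \<omega> $ j\<bar>)" by (rule norm_le_l1_cart)
      also have "\<dots> \<le> b"
        unfolding b_def
      proof (rule sum_mono)
        fix j :: 'd
        have "\<bar>v * c j\<bar> \<le> 1 * \<bar>c j\<bar>" unfolding abs_mult by (rule mult_right_mono) (use v in auto)
        moreover have "0 \<le> occupation_time X v (idx j) \<omega>" by (rule J.L_nonneg[OF w v0])
        moreover have "occupation_time X v (idx j) \<omega> \<le> v" by (rule J.L_le[OF w v0 J.idx_in])
        moreover have "v \<le> 1" using v by simp
        ultimately show "\<bar>Y' v \<omega> $ j\<bar> \<le> 1 + \<bar>c j\<bar>"
          unfolding Y1 C.Y_def by (simp add: abs_le_iff)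
      qed
      finally show "norm (Y' v \<omega>) \<le> b" .
    qed simp
    also have "\<dots> = ennreal (b ^ 3)" by (simp add: emeasure_space_1)
    finally show "(\<integral>\<^sup>+\<omega>. ennreal (norm (Y' v \<omega>) ^ 3) \<partial>M k) \<le> ennreal (b ^ 3)" .
  qed
  have i: "(MAX k\<in>{1..N}. SUP v\<in>{0<..1}. \<integral>\<^sup>+\<omega>. ennreal (norm (Y' v \<omega>) ^ 3) \<partial>M k) < \<infinity>"
  proof (rule le_less_trans)
    show "(MAX k\<in>{1..N}. SUP v\<in>{0<..1}. \<integral>\<^sup>+\<omega>. ennreal (norm (Y' v \<omega>) ^ 3) \<partial>M k) \<le> ennreal (b ^ 3)"
      by (rule Max.boundedI) (use m3 assms(1) in auto)
  qed simp
  obtain K \<eta> where K: "0 < K" "0 < \<eta>"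
    "\<And>t. 0 < t \<Longrightarrow> norm0 N (\<lambda>k l. measure (J.sing u t k l) UNIV) \<le> K * exp (- \<eta> * t)"
    using J.sing_decay[OF assms(4), of u] by blast
  define \<rho> where "\<rho> = exp (- \<eta>)"
  have \<rho>: "\<rho> \<in> {0<..<1}" using K(2) by (simp add: \<rho>_def)
  have \<rho>t: "\<rho> powr t = exp (- \<eta> * t)" for t by (simp add: \<rho>_def powr_def mult.commute)
  define q where "q = max 2 (K * real N)"
  have q: "2 \<le> q" by (simp add: q_def)
  \<comment> \<open>The solution of exp (- \<eta> t0) q = 1/4; it is positive since q \<ge>
    2.\<close>
  define t0 where "t0 = ln (4 * q) / \<eta>"
  have t0: "0 < t0" unfolding t0_def using q K(2) by (intro divide_pos_pos ln_gt_zero) auto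
  have "\<rho> powr t0 * q = 1 / 4"
    unfolding \<rho>t t0_def using q K(2) by (simp add: exp_minus)
  then have q4: "\<rho> powr t0 * max 2 (K * real N) \<le> 1 / 4" by (simp add: q_def)
  have N1: "1 \<le> N" using assms(1) by simp
  have bound: "(SUP t\<in>{0<..}. SUP y\<in>closure (J.Dom u t). ennreal (norm0 N (J.dens u t y))) < \<infinity>"
  proof (rule le_less_trans)
    show "(SUP t\<in>{0<..}. SUP y\<in>closure (J.Dom u t). ennreal (norm0 N (J.dens u t y))) \<le> ennreal (J.Lam ^ (N - 1))"
      by (intro SUP_least ennreal_leI norm0_le[OF N1]) (use J.dens0_bounds(2) in \<open>simp add: J.dens_def\<close>)
  qed simp
  have deriv: "(SUP t\<in>{0<..}. SUP y\<in>J.Dom u t. ennreal (norm0 N (\<lambda>k l. partial_deriv j (\<lambda>y. J.dens u t y k l) y))) < \<infinity>" for j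
  proof (rule le_less_trans)
    show "(SUP t\<in>{0<..}. SUP y\<in>J.Dom u t. ennreal (norm0 N (\<lambda>k l. partial_deriv j (\<lambda>y. J.dens u t y k l) y)))
        \<le> ennreal (4 * real CARD('d) * J.Lam ^ N)"
      by (intro SUP_least ennreal_leI norm0_le[OF N1]) (use J.dens_partial in simp)
  qed simp
  have regular: "open (J.Dom u t) \<and> convex (J.Dom u t) \<and>
            (\<forall>k\<in>{1..N}. \<forall>l\<in>{1..N}.
               (\<forall>y. y \<notin> closure (J.Dom u t) \<longrightarrow> J.dens u t y k l = 0) \<and>
               continuous_on (closure (J.Dom u t)) (\<lambda>y. J.dens u t y k l) \<and>
               (\<forall>y\<in>J.Dom u t. (\<lambda>y. J.dens u t y k l) differentiable (at y)))" if t: "0 < t" for t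
  proof (intro conjI ballI allI impI)
    show "open (J.Dom u t)" unfolding J.Dom_def by (rule open_translation[OF J.open_osimplex])
    show "convex (J.Dom u t)" unfolding J.Dom_def by (rule convex_translation[OF J.convex_osimplex])
    fix k l assume k: "k \<in> {1..N}"
    show "J.dens u t y k l = 0" if "y \<notin> closure (J.Dom u t)" for y
      using that unfolding J.mem_closure_Dom[OF t] by (simp add: J.dens_def J.dens0_def)
    show "continuous_on (closure (J.Dom u t)) (\<lambda>y. J.dens u t y k l)"
      unfolding J.dens_def
      by (rule continuous_on_compose2[OF J.dens0_continuous[OF k]])
         (use J.mem_closure_Dom[OF t] in \<open>auto intro!: continuous_intros\<close>)
    show "(\<lambda>y. J.dens u t y k l) differentiable (at y)" if "y \<in> J.Dom u t" for y
      using J.dens_derivative[OF k that] unfolding differentiable_def by blast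
  qed
  show ?thesis
  proof (intro conjI map i exI[of _ "J.dens u"] exI[of _ "J.sing u"] exI[of _ "J.Dom u"])
    show "\<forall>t>0. \<forall>k\<in>{1..N}. \<forall>l\<in>{1..N}.
         lebesgue_decomposition (\<lambda>B. emeasure (M k) {\<omega> \<in> space (M k). X t \<omega> = l \<and> Y' t \<omega> \<in> B})
           (\<lambda>y. J.dens u t y k l) (J.sing u t k l)"
      unfolding Y2 using J.decomposition by blast
    show "\<exists>c>0. \<exists>\<rho>\<in>{0<..<1}.
         (\<forall>t>0. norm0 N (\<lambda>k l. measure (J.sing u t k l) UNIV) \<le> c * \<rho> powr t) \<and>
         (\<exists>t0>0. \<rho> powr t0 * max 2 (c * real N) \<le> 1 / 4 \<and>
            ((\<lambda>\<zeta>. SUP w\<in>{t0..<2 * t0}.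
                ennreal (norm0 N (\<lambda>k l. fourier (\<lambda>y. J.dens u w y k l) \<zeta>))) \<longlongrightarrow> 0) at_infinity)"
      using K(1,3) \<rho> t0 q4 J.dens_fourier_limit[OF t0] unfolding \<rho>t[symmetric] by blast
    show "\<forall>t>0. open (J.Dom u t) \<and> convex (J.Dom u t) \<and>
            (\<forall>k\<in>{1..N}. \<forall>l\<in>{1..N}.
               (\<forall>y. y \<notin> closure (J.Dom u t) \<longrightarrow> J.dens u t y k l = 0) \<and>
               continuous_on (closure (J.Dom u t)) (\<lambda>y. J.dens u t y k l) \<and>
               (\<forall>y\<in>J.Dom u t. (\<lambda>y. J.dens u t y k l) differentiable (at y)))"
      using regular by blast
    show "\<forall>j. (SUP t\<in>{0<..}. SUP y\<in>J.Dom u t. ennreal (norm0 N (\<lambda>k l. partial_deriv j (\<lambda>y. J.dens u t y k l) y))) < \<infinity>"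
      using deriv by blast
  qed (rule bound, rule J.dens_boundary[OF assms(4)])
qed

end
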